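(* Let $(P,\le,+,0)$ be a preordered set with a compatible abelian group structure, let $R$ be a unital ring, and let $*$ denote either $\mathbf{sh}$ or $\mathbf{gr}$. Let $A$ be a left persistence module and let $(K,d)$ be a chain complex of $\otimes_*$-flat right persistence modules whose subcomplex of boundaries $B$ also has all terms $\otimes_*$-flat. Then: \begin{itemize} \item[1)] For all $n\in \mathbb{N}$, there is a natural exact sequence $$0\to H_n(K)\otimes_*A\to H_n(K\otimes_* A)\to \mathbf{Tor}_1^*(H_{n-1}(K),A)\to 0.$$ \item[2)] Assuming that $R[U_0]$ is right hereditary (right submodules of right projective modules are projective) and that $(K,d)$ has all terms projective (with no assumptions on $B$ this time), for all $n\in\mathbb{N}$ the natural exact sequence $$0\to H_n(K)\otimes_*A\to H_n(K\otimes_* A)\to \mathbf{Tor}_1^*(H_{n-1}(K),A)\to 0$$ splits (it need not be a natural splitting). \end{itemize}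
   Context: Compatible means: $a\le b$ implies $a+c\le b+c$ for all $a,b,c\in P$. Let $\mathbf{P}$ be the category associated to $(P,\le)$. A left (right) persistence module is a functor from $\mathbf{P}$ to left (right) $R$-modules, with natural transformations as morphisms. Let $U_0=\{x\in P: 0\le x\}$ and let $R[U_0]$ be the monoid ring, $P$-graded with $x^s$ ($s\in U_0$) in degree $s$; a left (right) persistence module $M$ is identified with the $P$-graded left (right) $R[U_0]$-module $\bigoplus_{a\in P}M_a$ where $x^s$ acts as $M_{a\le a+s}$. "Projective" and "hereditary" are meant in this category of persistence modules (graded modules). For a right persistence module $M$ and a left persistence module $N$: \begin{itemize} \item $(M\otimes_{\mathbf{gr}}N)_r=\operatorname{colim}_{s+t\le r}M_s\otimes_R N_t$ (colimit over pairs $(s,t)\in P\times P$ with $s+t\le r$, product preorder), i.e. the tensor product of graded $R[U_0]$-modules; \item $(M\otimes_{\mathbf{sh}}N)_a=M_a\otimes_R N_a$ with the induced maps. \end{itemize} Both are functors $\mathbf{P}\to\mathbf{Ab}$. A right persistence module $M$ is $\otimes_*$-flat if $M\otimes_*-$ is exact. $\mathbf{Tor}^*_i$ is the $i$-th left derived functor of $\otimes_*$. $K\otimes_* A$ is the complex with terms $K_n\otimes_* A$. The subcomplex of boundaries of $K$ has terms $d_n(K_n)$. *)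

theory Defs
  imports "HOL-Algebra.Free_Abelian_Groups"
begin

class preordered_ab_group_add = preorder + ab_group_add +
  assumes compatible_add: "a \<le> b \<Longrightarrow> a + c \<le> b + c"


section \<open>Persistence modules\<close>

text \<open>
  Rings are unital rings, not necessarily commutative and possibly trivial: the sort is
  \<open>{ring, monoid_mult}\<close> because \<open>ring_1\<close> would impose \<open>0 \<noteq> 1\<close>.

  Abelian groups are commutative groups of HOL-Algebra, so addition in a module is written
  multiplicatively.  A functor from the preorder to abelian groups has value \<open>grp M a\<close> at \<open>a\<close>
  and structure map \<open>smap M a b\<close> for \<open>a \<le> b\<close>.  Maps matter only on carriers.
\<close>

record ('p, 'm) pers =
  grp :: "'p \<Rightarrow> 'm monoid"
  smap :: "'p \<Rightarrow> 'p \<Rightarrow> 'm \<Rightarrow> 'm"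

record ('p, 'm, 'r) pmod = "('p, 'm) pers" +
  act :: "'p \<Rightarrow> 'r \<Rightarrow> 'm \<Rightarrow> 'm"

locale persistence_group =
  fixes M :: "('p::preorder, 'm, 'z) pers_scheme"
  assumes grp_comm: "comm_group (grp M a)"
    and smap_hom: "a \<le> b \<Longrightarrow> smap M a b \<in> hom (grp M a) (grp M b)"
    and smap_id: "x \<in> carrier (grp M a) \<Longrightarrow> smap M a a x = x"
    and smap_comp: "\<lbrakk>a \<le> b; b \<le> c; x \<in> carrier (grp M a)\<rbrakk>
      \<Longrightarrow> smap M b c (smap M a b x) = smap M a c x"

datatype side = Left | Right

text \<open>For right modules, \<open>act M a r x\<close> stands for \<open>x \<cdot> r\<close>; this is why the two sides differ
  exactly in the associativity axiom.\<close>

locale persistence_module = persistence_group M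
  for sd :: side and M :: "('p::preorder, 'm, 'r::{ring, monoid_mult}) pmod" +
  assumes act_hom: "act M a r \<in> hom (grp M a) (grp M a)"
    and act_add: "x \<in> carrier (grp M a)
      \<Longrightarrow> act M a (r + r') x = act M a r x \<otimes>\<^bsub>grp M a\<^esub> act M a r' x"
    and act_one: "x \<in> carrier (grp M a) \<Longrightarrow> act M a 1 x = x"
    and act_mult: "x \<in> carrier (grp M a) \<Longrightarrow>
      act M a (r * r') x =
        (case sd of Left \<Rightarrow> act M a r (act M a r' x) | Right \<Rightarrow> act M a r' (act M a r x))"
    and act_smap: "\<lbrakk>a \<le> b; x \<in> carrier (grp M a)\<rbrakk>
      \<Longrightarrow> smap M a b (act M a r x) = act M b r (smap M a b x)"

definition pers_hom ::
  "('p::preorder, 'm, 'y) pers_scheme \<Rightarrow> ('p, 'n, 'z) pers_scheme \<Rightarrow> ('p \<Rightarrow> 'm \<Rightarrow> 'n) \<Rightarrow> bool" where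
  "pers_hom M N f \<longleftrightarrow>
     (\<forall>a. f a \<in> hom (grp M a) (grp N a)) \<and>
     (\<forall>a b. a \<le> b \<longrightarrow> (\<forall>x\<in>carrier (grp M a). f b (smap M a b x) = smap N a b (f a x)))"

definition pmod_hom ::
  "('p::preorder, 'm, 'r) pmod \<Rightarrow> ('p, 'n, 'r) pmod \<Rightarrow> ('p \<Rightarrow> 'm \<Rightarrow> 'n) \<Rightarrow> bool" where
  "pmod_hom M N f \<longleftrightarrow> pers_hom M N f \<and>
     (\<forall>a r. \<forall>x\<in>carrier (grp M a). f a (act M a r x) = act N a r (f a x))"

definition pers_surj ::
  "('p, 'm, 'y) pers_scheme \<Rightarrow> ('p, 'n, 'z) pers_scheme \<Rightarrow> ('p \<Rightarrow> 'm \<Rightarrow> 'n) \<Rightarrow> bool" where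
  "pers_surj M N f \<longleftrightarrow> (\<forall>a. f a ` carrier (grp M a) = carrier (grp N a))"

text \<open>Exactness of \<open>0 \<rightarrow> X \<rightarrow> Y \<rightarrow> W \<rightarrow> 0\<close>; kernels and images of functors are computed pointwise.\<close>

definition short_exact ::
  "('p::preorder, 'x, 'zx) pers_scheme \<Rightarrow> ('p, 'y, 'zy) pers_scheme \<Rightarrow> ('p, 'w, 'zw) pers_scheme
    \<Rightarrow> ('p \<Rightarrow> 'x \<Rightarrow> 'y) \<Rightarrow> ('p \<Rightarrow> 'y \<Rightarrow> 'w) \<Rightarrow> bool" where
  "short_exact X Y W f g \<longleftrightarrow>
     pers_hom X Y f \<and> pers_hom Y W g \<and>
     (\<forall>a. inj_on (f a) (carrier (grp X a))) \<and>
     (\<forall>a. kernel (grp Y a) (grp W a) (g a) = f a ` carrier (grp X a)) \<and>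
     pers_surj Y W g"

definition right_split ::
  "('p::preorder, 'y, 'zy) pers_scheme \<Rightarrow> ('p, 'w, 'zw) pers_scheme \<Rightarrow> ('p \<Rightarrow> 'y \<Rightarrow> 'w) \<Rightarrow> bool" where
  "right_split Y W g \<longleftrightarrow>
     (\<exists>\<sigma>. pers_hom W Y \<sigma> \<and> (\<forall>a. \<forall>w\<in>carrier (grp W a). g a (\<sigma> a w) = w))"

definition restrict_pmod :: "('p, 'm, 'r) pmod \<Rightarrow> ('p \<Rightarrow> 'm set) \<Rightarrow> ('p, 'm, 'r) pmod" where
  "restrict_pmod M S = M\<lparr>grp := \<lambda>a. (grp M a)\<lparr>carrier := S a\<rparr>\<rparr>"

definition subpmodule :: "('p::preorder, 'm, 'r) pmod \<Rightarrow> ('p \<Rightarrow> 'm set) \<Rightarrow> bool" where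
  "subpmodule M S \<longleftrightarrow>
     (\<forall>a. subgroup (S a) (grp M a)) \<and>
     (\<forall>a r. act M a r ` S a \<subseteq> S a) \<and>
     (\<forall>a b. a \<le> b \<longrightarrow> smap M a b ` S a \<subseteq> S b)"


section \<open>Tensor products\<close>

text \<open>The abelian group generated by \<open>S\<close> subject to the relators \<open>Rel\<close>, and the homomorphism
  of such groups induced by a map \<open>h\<close> of generators.\<close>

definition presented_group :: "'a set \<Rightarrow> ('a \<Rightarrow>\<^sub>0 int) set \<Rightarrow> ('a \<Rightarrow>\<^sub>0 int) set monoid" where
  "presented_group S Rel = free_Abelian_group S Mod generate (free_Abelian_group S) Rel"

definition presented_class ::
  "'a set \<Rightarrow> ('a \<Rightarrow>\<^sub>0 int) set \<Rightarrow> ('a \<Rightarrow>\<^sub>0 int) \<Rightarrow> ('a \<Rightarrow>\<^sub>0 int) set" where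
  "presented_class S Rel c =
     generate (free_Abelian_group S) Rel #>\<^bsub>free_Abelian_group S\<^esub> c"

definition presented_map ::
  "'b set \<Rightarrow> ('b \<Rightarrow>\<^sub>0 int) set \<Rightarrow> ('a \<Rightarrow> 'b) \<Rightarrow> ('a \<Rightarrow>\<^sub>0 int) set \<Rightarrow> ('b \<Rightarrow>\<^sub>0 int) set" where
  "presented_map S Rel h C =
     the_elem ((\<lambda>c. presented_class S Rel (frag_extend (frag_of \<circ> h) c)) ` C)"

text \<open>\<open>M\<^sub>i \<otimes>\<^sub>R N\<^sub>j\<close> for a right module \<open>M\<^sub>i\<close> and a left module \<open>N\<^sub>j\<close>, generated by pairs
  \<open>(x, y)\<close> standing for \<open>x \<otimes> y\<close>.\<close>

definition tensor_gens ::
  "('p, 'm, 'r) pmod \<Rightarrow> ('p, 'n, 'r) pmod \<Rightarrow> 'p \<Rightarrow> 'p \<Rightarrow> ('m \<times> 'n) set" where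
  "tensor_gens M N i j = carrier (grp M i) \<times> carrier (grp N j)"

definition tensor_rels ::
  "('p, 'm, 'r) pmod \<Rightarrow> ('p, 'n, 'r) pmod \<Rightarrow> 'p \<Rightarrow> 'p \<Rightarrow> ('m \<times> 'n \<Rightarrow>\<^sub>0 int) set" where
  "tensor_rels M N i j =
     {frag_of (x \<otimes>\<^bsub>grp M i\<^esub> x', y) - frag_of (x, y) - frag_of (x', y) | x x' y.
        x \<in> carrier (grp M i) \<and> x' \<in> carrier (grp M i) \<and> y \<in> carrier (grp N j)} \<union>
     {frag_of (x, y \<otimes>\<^bsub>grp N j\<^esub> y') - frag_of (x, y) - frag_of (x, y') | x y y'.
        x \<in> carrier (grp M i) \<and> y \<in> carrier (grp N j) \<and> y' \<in> carrier (grp N j)} \<union>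
     {frag_of (act M i r x, y) - frag_of (x, act N j r y) | r x y.
        x \<in> carrier (grp M i) \<and> y \<in> carrier (grp N j)}"

definition tensor ::
  "('p, 'm, 'r) pmod \<Rightarrow> ('p, 'n, 'r) pmod \<Rightarrow> 'p \<Rightarrow> 'p \<Rightarrow> ('m \<times> 'n \<Rightarrow>\<^sub>0 int) set monoid" where
  "tensor M N i j = presented_group (tensor_gens M N i j) (tensor_rels M N i j)"

definition tensor_map ::
  "('p, 'm, 'r) pmod \<Rightarrow> ('p, 'n, 'r) pmod \<Rightarrow> 'p \<Rightarrow> 'p \<Rightarrow> ('k \<Rightarrow> 'm) \<Rightarrow> ('l \<Rightarrow> 'n)
    \<Rightarrow> ('k \<times> 'l \<Rightarrow>\<^sub>0 int) set \<Rightarrow> ('m \<times> 'n \<Rightarrow>\<^sub>0 int) set" where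
  "tensor_map M N i j f g =
     presented_map (tensor_gens M N i j) (tensor_rels M N i j) (map_prod f g)"

text \<open>Colimit of the diagram of abelian groups \<open>G\<close> with transition maps \<open>\<phi>\<close> over the preordered
  set \<open>(I, rel)\<close>: the generator \<open>(i, t)\<close> stands for the image of \<open>t \<in> G i\<close>.\<close>

definition colim_gens :: "'i set \<Rightarrow> ('i \<Rightarrow> 't monoid) \<Rightarrow> ('i \<times> 't) set" where
  "colim_gens I G = (SIGMA i:I. carrier (G i))"

definition colim_rels ::
  "'i set \<Rightarrow> ('i \<Rightarrow> 'i \<Rightarrow> bool) \<Rightarrow> ('i \<Rightarrow> 't monoid) \<Rightarrow> ('i \<Rightarrow> 'i \<Rightarrow> 't \<Rightarrow> 't) \<Rightarrow> ('i \<times> 't \<Rightarrow>\<^sub>0 int) set"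
where
  "colim_rels I rel G \<phi> =
     {frag_of (i, t \<otimes>\<^bsub>G i\<^esub> t') - frag_of (i, t) - frag_of (i, t') | i t t'.
        i \<in> I \<and> t \<in> carrier (G i) \<and> t' \<in> carrier (G i)} \<union>
     {frag_of (j, \<phi> i j t) - frag_of (i, t) | i j t.
        i \<in> I \<and> j \<in> I \<and> rel i j \<and> t \<in> carrier (G i)}"

datatype tensor_kind = Sh | Gr

text \<open>Both tensor products are formed as a colimit of \<open>M\<^sub>i \<otimes>\<^sub>R N\<^sub>j\<close>, so that they have a common type.
  For \<open>Sh\<close> the index set at \<open>r\<close> is the single pair \<open>(r, r)\<close>, whose colimit is \<open>M\<^sub>r \<otimes>\<^sub>R N\<^sub>r\<close>
  (see \<open>pten_Sh_iso\<close> below).  For \<open>r \<le> r'\<close> the pair \<open>(r, r)\<close> is sent to \<open>(r', r')\<close>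
  in the case of \<open>Sh\<close>, and the index set of \<open>r\<close> is included into that of \<open>r'\<close> in the case of \<open>Gr\<close>.\<close>

fun ten_index :: "tensor_kind \<Rightarrow> 'p::preordered_ab_group_add \<Rightarrow> ('p \<times> 'p) set" where
  "ten_index Sh r = {(r, r)}"
| "ten_index Gr r = {(i, j). i + j \<le> r}"

fun ten_reindex :: "tensor_kind \<Rightarrow> 'p \<Rightarrow> 'p \<times> 'p \<Rightarrow> 'p \<times> 'p" where
  "ten_reindex Sh r' _ = (r', r')"
| "ten_reindex Gr r' ij = ij"

definition ten_diag ::
  "('p, 'm, 'r) pmod \<Rightarrow> ('p, 'n, 'r) pmod \<Rightarrow> 'p \<times> 'p \<Rightarrow> ('m \<times> 'n \<Rightarrow>\<^sub>0 int) set monoid" where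
  "ten_diag M N = (\<lambda>(i, j). tensor M N i j)"

definition ten_trans ::
  "('p, 'm, 'r) pmod \<Rightarrow> ('p, 'n, 'r) pmod \<Rightarrow> 'p \<times> 'p \<Rightarrow> 'p \<times> 'p
    \<Rightarrow> ('m \<times> 'n \<Rightarrow>\<^sub>0 int) set \<Rightarrow> ('m \<times> 'n \<Rightarrow>\<^sub>0 int) set" where
  "ten_trans M N = (\<lambda>(i, j) (i', j'). tensor_map M N i' j' (smap M i i') (smap N j j'))"

definition ten_gens ::
  "tensor_kind \<Rightarrow> ('p::preordered_ab_group_add, 'm, 'r) pmod \<Rightarrow> ('p, 'n, 'r) pmod \<Rightarrow> 'p
    \<Rightarrow> (('p \<times> 'p) \<times> ('m \<times> 'n \<Rightarrow>\<^sub>0 int) set) set" where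
  "ten_gens s M N r = colim_gens (ten_index s r) (ten_diag M N)"

definition ten_rels ::
  "tensor_kind \<Rightarrow> ('p::preordered_ab_group_add, 'm, 'r) pmod \<Rightarrow> ('p, 'n, 'r) pmod \<Rightarrow> 'p
    \<Rightarrow> (('p \<times> 'p) \<times> ('m \<times> 'n \<Rightarrow>\<^sub>0 int) set \<Rightarrow>\<^sub>0 int) set" where
  "ten_rels s M N r = colim_rels (ten_index s r)
     (\<lambda>(i, j) (i', j'). i \<le> i' \<and> j \<le> j') (ten_diag M N) (ten_trans M N)"

type_synonym ('p, 'm, 'n) ten = "(('p \<times> 'p) \<times> ('m \<times> 'n \<Rightarrow>\<^sub>0 int) set \<Rightarrow>\<^sub>0 int) set"

definition pten ::
  "tensor_kind \<Rightarrow> ('p::preordered_ab_group_add, 'm, 'r) pmod \<Rightarrow> ('p, 'n, 'r) pmod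
    \<Rightarrow> ('p, ('p, 'm, 'n) ten) pers" where
  "pten s M N = \<lparr>
     grp = \<lambda>r. presented_group (ten_gens s M N r) (ten_rels s M N r),
     smap = \<lambda>r r'. presented_map (ten_gens s M N r') (ten_rels s M N r')
       (\<lambda>(ij, t). (ten_reindex s r' ij, ten_trans M N ij (ten_reindex s r' ij) t))\<rparr>"

lemma presented_normal:
  assumes "Rel \<subseteq> carrier (free_Abelian_group S)"
  shows "generate (free_Abelian_group S) Rel \<lhd> free_Abelian_group S"
proof -
  interpret F: comm_group "free_Abelian_group S" by (rule abelian_free_Abelian_group)
  show ?thesis
    by (rule F.subgroup_imp_normal[OF F.generate_is_subgroup[OF assms]])
qed

lemma presented_map_id:
  assumes Rel: "Rel \<subseteq> carrier (free_Abelian_group S)"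
    and h: "\<And>x. x \<in> S \<Longrightarrow> h x = x"
    and C: "C \<in> carrier (presented_group S Rel)"
  shows "presented_map S Rel h C = C"
proof -
  let ?F = "free_Abelian_group S" and ?N = "generate (free_Abelian_group S) Rel"
  interpret N: normal ?N ?F by (rule presented_normal[OF Rel])
  obtain c where c: "c \<in> carrier ?F" "C = ?N #>\<^bsub>?F\<^esub> c"
    using C by (auto simp: presented_group_def FactGroup_def RCOSETS_def)
  have 1: "presented_class S Rel (frag_extend (frag_of \<circ> h) c') = C" if "c' \<in> C" for c'
  proof -
    have c': "c' \<in> carrier ?F"
      using that c N.r_coset_subset_G N.subset by blast
    then have "frag_extend (frag_of \<circ> h) c' = frag_extend frag_of c'"
      by (intro frag_extend_eq) (auto simp: h)
    then have "frag_extend (frag_of \<circ> h) c' = c'"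
      using frag_expansion[of c'] by simp
    moreover have "?N #>\<^bsub>?F\<^esub> c' = C"
      using N.repr_independence[of c' ?N c] that c N.subgroup_axioms by auto
    ultimately show ?thesis by (simp add: presented_class_def)
  qed
  moreover have "C \<noteq> {}"
    using c N.rcos_self[OF _ N.subgroup_axioms] by blast
  ultimately have "(\<lambda>c. presented_class S Rel (frag_extend (frag_of \<circ> h) c)) ` C = {C}"
    by (auto simp: image_iff)
  then show ?thesis by (simp add: presented_map_def)
qed

lemma colim_point_iso:
  assumes "comm_group (G i)" and \<phi>: "\<And>t. t \<in> carrier (G i) \<Longrightarrow> \<phi> i i t = t"
  shows "presented_group (colim_gens {i} G) (colim_rels {i} rel G \<phi>) \<cong> G i"
proof -
  interpret G: comm_group "G i" by fact
  let ?S = "colim_gens {i} G" and ?R = "colim_rels {i} rel G \<phi>"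
  let ?F = "free_Abelian_group ?S"
  let ?N = "generate ?F ?R"
  have S: "(j, t) \<in> ?S \<longleftrightarrow> j = i \<and> t \<in> carrier (G i)" for j t
    by (auto simp: colim_gens_def)
  interpret F: comm_group ?F by (rule abelian_free_Abelian_group)
  have R: "?R \<subseteq> carrier ?F"
    by (auto simp: colim_rels_def \<phi> S dest!: subsetD[OF keys_diff])
  interpret N: normal ?N ?F by (rule presented_normal[OF R])
  obtain h where h: "h \<in> hom ?F (G i)" and h_of: "\<And>x. x \<in> ?S \<Longrightarrow> h (frag_of x) = snd x"
  proof (rule G.free_Abelian_group_universal[of snd ?S])
    show "snd ` ?S \<subseteq> carrier (G i)" by (auto simp: colim_gens_def)
  qed auto
  interpret h: group_hom ?F "G i" h
    using h by unfold_locales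
  have Fm: "x - y \<in> carrier ?F" if "x \<in> carrier ?F" "y \<in> carrier ?F" for x y
    using that keys_diff[of x y] by auto
  have h_diff: "h (x - y) = h x \<otimes>\<^bsub>G i\<^esub> inv\<^bsub>G i\<^esub> h y"
    if "x \<in> carrier ?F" "y \<in> carrier ?F" for x y
    using h.hom_mult[of x "inv\<^bsub>?F\<^esub> y"] that h.hom_inv[of y] F.inv_closed[of y] by simp
  have N_diff: "x - y \<in> ?N" if "x \<in> ?N" "y \<in> ?N" for x y
  proof -
    have "Poly_Mapping.keys y \<subseteq> ?S" using N.mem_carrier[OF that(2)] by simp
    then have "inv\<^bsub>?F\<^esub> y = - y" by (rule inv_free_Abelian_group)
    then show ?thesis using N.m_closed[OF that(1) N.m_inv_closed[OF that(2)]] by simp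
  qed
  have N_add: "x + y \<in> ?N" if "x \<in> ?N" "y \<in> ?N" for x y
    using N.m_closed[OF that] by simp
  have rel_add: "frag_of (i, t \<otimes>\<^bsub>G i\<^esub> t') - frag_of (i, t) - frag_of (i, t') \<in> ?N"
    if "t \<in> carrier (G i)" "t' \<in> carrier (G i)" for t t'
    by (rule generate.incl) (use that in \<open>auto simp: colim_rels_def\<close>)
  have one: "frag_of (i, \<one>\<^bsub>G i\<^esub>) \<in> ?N"
    using N_diff[OF N.one_closed rel_add[of "\<one>\<^bsub>G i\<^esub>" "\<one>\<^bsub>G i\<^esub>"]] by simp
  have "?R \<subseteq> kernel ?F (G i) h"
  proof
    fix x assume x: "x \<in> ?R"
    have fr: "frag_of (i, t) \<in> carrier ?F" "h (frag_of (i, t)) = t" if "t \<in> carrier (G i)" for t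
      using that h_of[of "(i, t)"] by (auto simp: S)
    consider (add) t t' where "t \<in> carrier (G i)" "t' \<in> carrier (G i)"
        "x = frag_of (i, t \<otimes>\<^bsub>G i\<^esub> t') - frag_of (i, t) - frag_of (i, t')"
      | (trans) t where "t \<in> carrier (G i)" "x = frag_of (i, t) - frag_of (i, t)"
      using x by (force simp: colim_rels_def \<phi>)
    then have "h x = \<one>\<^bsub>G i\<^esub>"
    proof cases
      case add
      have "h x = (t \<otimes>\<^bsub>G i\<^esub> t') \<otimes>\<^bsub>G i\<^esub> inv\<^bsub>G i\<^esub> t \<otimes>\<^bsub>G i\<^esub> inv\<^bsub>G i\<^esub> t'"
        unfolding add(3) using add(1,2) by (simp add: h_diff Fm fr S del: carrier_free_Abelian_group_iff)
      also have "\<dots> = \<one>\<^bsub>G i\<^esub>"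
        using add(1,2) by (metis G.inv_closed G.m_assoc G.m_closed G.m_comm G.r_inv G.r_one)
      finally show ?thesis .
    next
      case trans
      then show ?thesis using h.hom_one by simp
    qed
    then show "x \<in> kernel ?F (G i) h"
      using subsetD[OF R x] unfolding kernel_def by blast
  qed
  then have 1: "?N \<subseteq> kernel ?F (G i) h"
    by (rule F.generate_subgroup_incl) (rule h.subgroup_kernel)
  have 2: "c - frag_of (i, h c) \<in> ?N" if "Poly_Mapping.keys c \<subseteq> ?S" for c
    using that
  proof (induction c rule: free_Abelian_group_induct[consumes 1, case_names zero diff single])
    case zero
    show ?case using N_diff[OF N.one_closed one] h.hom_one by simp
  next
    case (diff x y)
    let ?t = "h x" and ?t' = "h y"
    have t: "?t \<in> carrier (G i)" "?t' \<in> carrier (G i)"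
      using diff by (auto intro!: h.hom_closed)
    let ?u = "?t \<otimes>\<^bsub>G i\<^esub> inv\<^bsub>G i\<^esub> ?t'"
    have "frag_of (i, ?t) - frag_of (i, ?u) - frag_of (i, ?t') \<in> ?N"
      using rel_add[of ?u ?t'] t by (simp add: G.m_assoc)
    with N_diff[OF diff(3,4)]
    have "x - frag_of (i, ?t) - (y - frag_of (i, ?t')) +
        (frag_of (i, ?t) - frag_of (i, ?u) - frag_of (i, ?t')) \<in> ?N"
      by (rule N_add)
    moreover have "h (x - y) = ?u"
      using diff by (intro h_diff) auto
    ultimately show ?case by (simp add: algebra_simps)
  next
    case (single a)
    then show ?case using N.one_closed by (cases a) (simp add: h_of S)
  qed
  have "kernel ?F (G i) h \<subseteq> ?N"
  proof
    fix c assume "c \<in> kernel ?F (G i) h"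
    then have "c - frag_of (i, \<one>\<^bsub>G i\<^esub>) \<in> ?N" using 2[of c] by (auto simp: kernel_def)
    from N_add[OF this one] show "c \<in> ?N" by simp
  qed
  with 1 have "kernel ?F (G i) h = ?N" by blast
  moreover have "h ` carrier ?F = carrier (G i)"
  proof
    show "carrier (G i) \<subseteq> h ` carrier ?F"
    proof
      fix t assume "t \<in> carrier (G i)"
      then show "t \<in> h ` carrier ?F"
        using h_of[of "(i, t)"] by (intro image_eqI[of _ _ "frag_of (i, t)"]) (auto simp: S)
    qed
  qed auto
  ultimately show ?thesis
    using h.FactGroup_iso by (simp add: presented_group_def)
qed

lemma tensor_rels_subset:
  assumes "persistence_module Right M" and "persistence_module Left N"
  shows "tensor_rels M N i j \<subseteq> carrier (free_Abelian_group (tensor_gens M N i j))"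
proof -
  interpret M: persistence_module Right M by fact
  interpret N: persistence_module Left N by fact
  interpret Mi: comm_group "grp M i" by (rule M.grp_comm)
  interpret Nj: comm_group "grp N j" by (rule N.grp_comm)
  show ?thesis
    using hom_in_carrier[OF M.act_hom] hom_in_carrier[OF N.act_hom]
    by (auto simp: tensor_rels_def tensor_gens_def dest!: subsetD[OF keys_diff])
qed

lemma comm_group_tensor:
  assumes "persistence_module Right M" and "persistence_module Left N"
  shows "comm_group (tensor M N i j)"
proof -
  interpret F: comm_group "free_Abelian_group (tensor_gens M N i j)"
    by (rule abelian_free_Abelian_group)
  show ?thesis
    unfolding tensor_def presented_group_def
    by (rule F.abelian_FactGroup[OF F.generate_is_subgroup[OF tensor_rels_subset[OF assms]]])
qed

lemma pten_Sh_iso: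
  fixes M :: "('p::preordered_ab_group_add, 'm, 'r::{ring, monoid_mult}) pmod"
  assumes "persistence_module Right M" and "persistence_module Left N"
  shows "grp (pten Sh M N) r \<cong> tensor M N r r"
proof -
  interpret M: persistence_module Right M by fact
  interpret N: persistence_module Left N by fact
  have "ten_trans M N (r, r) (r, r) t = t" if "t \<in> carrier (ten_diag M N (r, r))" for t
    using that unfolding ten_trans_def tensor_map_def ten_diag_def tensor_def prod.case
    by (intro presented_map_id[OF tensor_rels_subset[OF assms]])
      (auto simp: tensor_gens_def M.smap_id N.smap_id)
  then have "presented_group (ten_gens Sh M N r) (ten_rels Sh M N r) \<cong> ten_diag M N (r, r)"
    unfolding ten_gens_def ten_rels_def ten_index.simps
    by (intro colim_point_iso) (auto simp: ten_diag_def comm_group_tensor[OF assms])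
  then show ?thesis by (simp add: pten_def ten_diag_def)
qed

text \<open>\<open>f \<otimes> g\<close>, where \<open>M\<close> and \<open>N\<close> are the targets of \<open>f\<close> and \<open>g\<close>.\<close>

definition pten_map ::
  "tensor_kind \<Rightarrow> ('p::preordered_ab_group_add, 'm, 'r) pmod \<Rightarrow> ('p, 'n, 'r) pmod
    \<Rightarrow> ('p \<Rightarrow> 'k \<Rightarrow> 'm) \<Rightarrow> ('p \<Rightarrow> 'l \<Rightarrow> 'n) \<Rightarrow> 'p \<Rightarrow> ('p, 'k, 'l) ten \<Rightarrow> ('p, 'm, 'n) ten" where
  "pten_map s M N f g r = presented_map (ten_gens s M N r) (ten_rels s M N r)
     (\<lambda>((i, j), t). ((i, j), tensor_map M N i j (f i) (g j) t))"


section \<open>Chain complexes and homology\<close>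

text \<open>Degrees are integers, so that \<open>H\<^bsub>n-1\<^esub>\<close> makes sense for \<open>n = 0\<close>; a complex indexed by the
  natural numbers is one that vanishes in negative degrees.\<close>

record ('p, 'm, 'z) complex =
  obj :: "int \<Rightarrow> ('p, 'm, 'z) pers_scheme"
  dif :: "int \<Rightarrow> 'p \<Rightarrow> 'm \<Rightarrow> 'm"

type_synonym ('p, 'm) pers_complex = "('p, 'm, unit) complex"
type_synonym ('p, 'm, 'r) pmod_complex = "('p, 'm, ('p, 'm, 'r, unit) pmod_ext) complex"

definition is_pmod_complex ::
  "side \<Rightarrow> ('p::preorder, 'm, 'r::{ring, monoid_mult}) pmod_complex \<Rightarrow> bool" where
  "is_pmod_complex sd K \<longleftrightarrow>
     (\<forall>n. persistence_module sd (obj K n)) \<and>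
     (\<forall>n. pmod_hom (obj K n) (obj K (n - 1)) (dif K n)) \<and>
     (\<forall>n a. \<forall>x\<in>carrier (grp (obj K n) a).
        dif K (n - 1) a (dif K n a x) = \<one>\<^bsub>grp (obj K (n - 2)) a\<^esub>)"

definition chain_map ::
  "('p::preorder, 'm, 'r) pmod_complex \<Rightarrow> ('p, 'n, 'r) pmod_complex
    \<Rightarrow> (int \<Rightarrow> 'p \<Rightarrow> 'm \<Rightarrow> 'n) \<Rightarrow> bool" where
  "chain_map K L f \<longleftrightarrow>
     (\<forall>n. pmod_hom (obj K n) (obj L n) (f n)) \<and>
     (\<forall>n a. \<forall>x\<in>carrier (grp (obj K n) a). f (n - 1) a (dif K n a x) = dif L n a (f n a x))"

definition cycles :: "('p, 'm, 'z) complex \<Rightarrow> int \<Rightarrow> 'p \<Rightarrow> 'm set" where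
  "cycles K n a = kernel (grp (obj K n) a) (grp (obj K (n - 1)) a) (dif K n a)"

definition boundaries :: "('p, 'm, 'z) complex \<Rightarrow> int \<Rightarrow> 'p \<Rightarrow> 'm set" where
  "boundaries K n a = dif K (n + 1) a ` carrier (grp (obj K (n + 1)) a)"

definition boundary_pmod :: "('p, 'm, 'r) pmod_complex \<Rightarrow> int \<Rightarrow> ('p, 'm, 'r) pmod" where
  "boundary_pmod K n = restrict_pmod (obj K n) (boundaries K n)"

text \<open>Homology classes are cosets of boundaries; \<open>homology_ind L n a h\<close> is the map of cosets
  induced by \<open>h\<close>, with values in \<open>H\<^sub>n(L)\<^sub>a\<close>.\<close>

definition homology_ind ::
  "('p, 'n, 'z) complex \<Rightarrow> int \<Rightarrow> 'p \<Rightarrow> ('m \<Rightarrow> 'n) \<Rightarrow> 'm set \<Rightarrow> 'n set" where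
  "homology_ind L n a h C = the_elem ((\<lambda>x. boundaries L n a #>\<^bsub>grp (obj L n) a\<^esub> h x) ` C)"

definition homology :: "('p, 'm, 'z) complex \<Rightarrow> int \<Rightarrow> ('p, 'm set) pers" where
  "homology K n = \<lparr>
     grp = \<lambda>a. (grp (obj K n) a)\<lparr>carrier := cycles K n a\<rparr> Mod boundaries K n a,
     smap = \<lambda>a b. homology_ind K n b (smap (obj K n) a b)\<rparr>"

definition homology_pmod :: "('p, 'm, 'r) pmod_complex \<Rightarrow> int \<Rightarrow> ('p, 'm set, 'r) pmod" where
  "homology_pmod K n = \<lparr>
     grp = grp (homology K n),
     smap = smap (homology K n),
     act = \<lambda>a r. homology_ind K n a (act (obj K n) a r)\<rparr>"

definition homology_map ::
  "('p, 'n, 'z) complex \<Rightarrow> int \<Rightarrow> (int \<Rightarrow> 'p \<Rightarrow> 'm \<Rightarrow> 'n) \<Rightarrow> 'p \<Rightarrow> 'm set \<Rightarrow> 'n set" where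
  "homology_map L n f a = homology_ind L n a (f n a)"

text \<open>The complexes \<open>K \<otimes> A\<close> and \<open>M \<otimes> Q\<close>.\<close>

definition complex_pten ::
  "tensor_kind \<Rightarrow> ('p::preordered_ab_group_add, 'm, 'r) pmod_complex \<Rightarrow> ('p, 'n, 'r) pmod
    \<Rightarrow> ('p, ('p, 'm, 'n) ten) pers_complex" where
  "complex_pten s K A = \<lparr>
     obj = \<lambda>n. pten s (obj K n) A,
     dif = \<lambda>n. pten_map s (obj K (n - 1)) A (dif K n) (\<lambda>_ x. x)\<rparr>"

definition pten_complex ::
  "tensor_kind \<Rightarrow> ('p::preordered_ab_group_add, 'm, 'r) pmod \<Rightarrow> ('p, 'n, 'r) pmod_complex
    \<Rightarrow> ('p, ('p, 'm, 'n) ten) pers_complex" where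
  "pten_complex s M Q = \<lparr>
     obj = \<lambda>n. pten s M (obj Q n),
     dif = \<lambda>n. pten_map s M (obj Q (n - 1)) (\<lambda>_ x. x) (dif Q n)\<rparr>"


section \<open>Flat and projective persistence modules, \<open>Tor\<close>\<close>

text \<open>
  Flatness, projectivity and heredity quantify over all persistence modules.  HOL cannot quantify
  over types inside a formula, so these notions refer to the persistence modules whose values are
  carried by subsets of a type \<open>'u\<close>.  The type used is the one below.  It is infinite, contains
  \<open>'p\<close>, \<open>'r\<close> and the carrier types \<open>'k\<close>, \<open>'a\<close> of the modules under consideration, and so has
  room (up to isomorphism) for submodules and quotients of free persistence modules on at most
  \<open>|'u|\<close> generators.  Testing against those is equivalent to testing against all persistence
  modules, and every persistence module over \<open>'k\<close>, \<open>'a\<close> or \<open>'u\<close> has a projective resolution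
  over \<open>'u\<close>.
\<close>

type_synonym ('p, 'r, 'k, 'a) universe = "('p + 'r + 'k + 'a) list"

definition flat ::
  "'u itself \<Rightarrow> tensor_kind \<Rightarrow> ('p::preordered_ab_group_add, 'm, 'r::{ring, monoid_mult}) pmod \<Rightarrow> bool"
where
  "flat _ s M \<longleftrightarrow>
     (\<forall>(X :: ('p, 'u, 'r) pmod) (Y :: ('p, 'u, 'r) pmod) (W :: ('p, 'u, 'r) pmod) f g.
        persistence_module Left X \<and> persistence_module Left Y \<and> persistence_module Left W \<and>
        pmod_hom X Y f \<and> pmod_hom Y W g \<and> short_exact X Y W f g \<longrightarrow>
        short_exact (pten s M X) (pten s M Y) (pten s M W)
          (pten_map s M Y (\<lambda>_ x. x) f) (pten_map s M W (\<lambda>_ x. x) g))"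

definition projective ::
  "'u itself \<Rightarrow> side \<Rightarrow> ('p::preorder, 'm, 'r::{ring, monoid_mult}) pmod \<Rightarrow> bool" where
  "projective _ sd M \<longleftrightarrow>
     persistence_module sd M \<and>
     (\<forall>(Y :: ('p, 'u, 'r) pmod) (W :: ('p, 'u, 'r) pmod) g f.
        persistence_module sd Y \<and> persistence_module sd W \<and>
        pmod_hom Y W g \<and> pers_surj Y W g \<and> pmod_hom M W f \<longrightarrow>
        (\<exists>h. pmod_hom M Y h \<and> (\<forall>a. \<forall>x\<in>carrier (grp M a). g a (h a x) = f a x)))"

text \<open>Hereditary refers to graded modules over \<open>R[U\<^sub>0]\<close>, that is, to persistence modules.\<close>

definition right_hereditary ::
  "'u itself \<Rightarrow> 'p::preorder itself \<Rightarrow> 'r::{ring, monoid_mult} itself \<Rightarrow> bool" where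
  "right_hereditary u _ _ \<longleftrightarrow>
     (\<forall>(M :: ('p, 'u, 'r) pmod) S.
        projective u Right M \<and> subpmodule M S \<longrightarrow> projective u Right (restrict_pmod M S))"

definition projective_resolution ::
  "('p::preorder, 'u, 'r::{ring, monoid_mult}) pmod_complex \<Rightarrow> ('p \<Rightarrow> 'u \<Rightarrow> 'a)
    \<Rightarrow> ('p, 'a, 'r) pmod \<Rightarrow> bool" where
  "projective_resolution Q e A \<longleftrightarrow>
     is_pmod_complex Left Q \<and>
     (\<forall>n. projective TYPE('u) Left (obj Q n)) \<and>
     (\<forall>n<0. \<forall>a. carrier (grp (obj Q n) a) = {\<one>\<^bsub>grp (obj Q n) a\<^esub>}) \<and>
     (\<forall>n>0. \<forall>a. cycles Q n a = boundaries Q n a) \<and>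
     pmod_hom (obj Q 0) A e \<and> pers_surj (obj Q 0) A e \<and>
     (\<forall>a. kernel (grp (obj Q 0) a) (grp A a) (e a) = boundaries Q 0 a)"

definition resolution ::
  "('p::preorder, 'a, 'r::{ring, monoid_mult}) pmod
    \<Rightarrow> ('p, 'u, 'r) pmod_complex \<times> ('p \<Rightarrow> 'u \<Rightarrow> 'a)" where
  "resolution A = (SOME (Q, e). projective_resolution Q e A)"

definition resolution_lift ::
  "'u itself \<Rightarrow> ('p::preorder, 'a, 'r::{ring, monoid_mult}) pmod \<Rightarrow> ('p, 'b, 'r) pmod
    \<Rightarrow> ('p \<Rightarrow> 'a \<Rightarrow> 'b) \<Rightarrow> int \<Rightarrow> 'p \<Rightarrow> 'u \<Rightarrow> 'u" where
  "resolution_lift _ A A' g =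
     (let (Q, e) = resolution A; (Q', e') = resolution A' in
      SOME \<phi>. chain_map Q Q' \<phi> \<and>
        (\<forall>a. \<forall>x\<in>carrier (grp (obj Q 0) a). e' a (\<phi> 0 a x) = g a (e a x)))"

text \<open>\<open>Tor\<^sub>i(M, -)\<close> is the \<open>i\<close>-th left derived functor of \<open>M \<otimes> -\<close>; \<open>Tor_map\<close> gives its
  functoriality in both arguments, for \<open>f\<close> with target \<open>M'\<close> and \<open>g : A \<rightarrow> A'\<close>.\<close>

definition Tor ::
  "'u itself \<Rightarrow> tensor_kind \<Rightarrow> nat \<Rightarrow> ('p::preordered_ab_group_add, 'm, 'r::{ring, monoid_mult}) pmod
    \<Rightarrow> ('p, 'a, 'r) pmod \<Rightarrow> ('p, ('p, 'm, 'u) ten set) pers" where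
  "Tor _ s i M A = homology (pten_complex s M (fst (resolution A))) (int i)"

definition Tor_map ::
  "'u itself \<Rightarrow> tensor_kind \<Rightarrow> nat \<Rightarrow> ('p::preordered_ab_group_add, 'm, 'r::{ring, monoid_mult}) pmod
    \<Rightarrow> ('p, 'a, 'r) pmod \<Rightarrow> ('p, 'b, 'r) pmod \<Rightarrow> ('p \<Rightarrow> 'l \<Rightarrow> 'm) \<Rightarrow> ('p \<Rightarrow> 'a \<Rightarrow> 'b)
    \<Rightarrow> 'p \<Rightarrow> ('p, 'l, 'u) ten set \<Rightarrow> ('p, 'm, 'u) ten set" where
  "Tor_map u s i M' A A' f g =
     (let Q' = fst (resolution A') in
      homology_map (pten_complex s M' Q') (int i)
        (\<lambda>n. pten_map s M' (obj Q' n) f (resolution_lift u A A' g n)))"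


section \<open>The sequence\<close>

definition kunneth_exact ::
  "'u itself \<Rightarrow> tensor_kind \<Rightarrow> int \<Rightarrow> ('p::preordered_ab_group_add, 'k, 'r::{ring, monoid_mult}) pmod_complex
    \<Rightarrow> ('p, 'a, 'r) pmod
    \<Rightarrow> ('p \<Rightarrow> ('p, 'k set, 'a) ten \<Rightarrow> ('p, 'k, 'a) ten set)
    \<Rightarrow> ('p \<Rightarrow> ('p, 'k, 'a) ten set \<Rightarrow> ('p, 'k set, 'u) ten set) \<Rightarrow> bool" where
  "kunneth_exact u s n K A \<alpha> \<beta> \<longleftrightarrow>
     short_exact (pten s (homology_pmod K n) A)
       (homology (complex_pten s K A) n)
       (Tor u s 1 (homology_pmod K (n - 1)) A) \<alpha> \<beta>"

definition kunneth_split ::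
  "'u itself \<Rightarrow> tensor_kind \<Rightarrow> int \<Rightarrow> ('p::preordered_ab_group_add, 'k, 'r::{ring, monoid_mult}) pmod_complex
    \<Rightarrow> ('p, 'a, 'r) pmod
    \<Rightarrow> ('p \<Rightarrow> ('p, 'k, 'a) ten set \<Rightarrow> ('p, 'k set, 'u) ten set) \<Rightarrow> bool" where
  "kunneth_split u s n K A \<beta> \<longleftrightarrow>
     right_split (homology (complex_pten s K A) n) (Tor u s 1 (homology_pmod K (n - 1)) A) \<beta>"

text \<open>The two squares induced by a chain map \<open>f : K \<rightarrow> K'\<close> and a morphism \<open>g : A \<rightarrow> A'\<close>.\<close>

definition kunneth_squares ::
  "'u itself \<Rightarrow> tensor_kind \<Rightarrow> int \<Rightarrow> ('p::preordered_ab_group_add, 'k, 'r::{ring, monoid_mult}) pmod_complex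
    \<Rightarrow> ('p, 'k, 'r) pmod_complex \<Rightarrow> ('p, 'a, 'r) pmod \<Rightarrow> ('p, 'a, 'r) pmod
    \<Rightarrow> (int \<Rightarrow> 'p \<Rightarrow> 'k \<Rightarrow> 'k) \<Rightarrow> ('p \<Rightarrow> 'a \<Rightarrow> 'a)
    \<Rightarrow> ('p \<Rightarrow> ('p, 'k set, 'a) ten \<Rightarrow> ('p, 'k, 'a) ten set)
    \<Rightarrow> ('p \<Rightarrow> ('p, 'k, 'a) ten set \<Rightarrow> ('p, 'k set, 'u) ten set)
    \<Rightarrow> ('p \<Rightarrow> ('p, 'k set, 'a) ten \<Rightarrow> ('p, 'k, 'a) ten set)
    \<Rightarrow> ('p \<Rightarrow> ('p, 'k, 'a) ten set \<Rightarrow> ('p, 'k set, 'u) ten set) \<Rightarrow> bool" where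
  "kunneth_squares u s n K K' A A' f g \<alpha> \<beta> \<alpha>' \<beta>' \<longleftrightarrow>
     (let Hfg = homology_map (complex_pten s K' A') n (\<lambda>m. pten_map s (obj K' m) A' (f m) g) in
      (\<forall>a. \<forall>x\<in>carrier (grp (pten s (homology_pmod K n) A) a).
         Hfg a (\<alpha> a x) = \<alpha>' a (pten_map s (homology_pmod K' n) A' (homology_map K' n f) g a x)) \<and>
      (\<forall>a. \<forall>y\<in>carrier (grp (homology (complex_pten s K A) n) a).
         Tor_map u s 1 (homology_pmod K' (n - 1)) A A' (homology_map K' (n - 1) f) g a (\<beta> a y) =
         \<beta>' a (Hfg a y)))"

definition kunneth_natural ::
  "'u itself \<Rightarrow> tensor_kind \<Rightarrow> int \<Rightarrow> ('p::preordered_ab_group_add, 'k, 'r::{ring, monoid_mult}) pmod_complex set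
    \<Rightarrow> (('p, 'k, 'r) pmod_complex \<Rightarrow> ('p, 'a, 'r) pmod
          \<Rightarrow> 'p \<Rightarrow> ('p, 'k set, 'a) ten \<Rightarrow> ('p, 'k, 'a) ten set)
    \<Rightarrow> (('p, 'k, 'r) pmod_complex \<Rightarrow> ('p, 'a, 'r) pmod
          \<Rightarrow> 'p \<Rightarrow> ('p, 'k, 'a) ten set \<Rightarrow> ('p, 'k set, 'u) ten set) \<Rightarrow> bool" where
  "kunneth_natural u s n \<K> \<alpha> \<beta> \<longleftrightarrow>
     (\<forall>K\<in>\<K>. \<forall>K'\<in>\<K>. \<forall>A A' f g.
        persistence_module Left A \<and> persistence_module Left A' \<and>
        chain_map K K' f \<and> pmod_hom A A' g \<longrightarrow>
        kunneth_squares u s n K K' A A' f g (\<alpha> K A) (\<beta> K A) (\<alpha> K' A') (\<beta> K' A'))"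

definition flat_complexes ::
  "'u itself \<Rightarrow> tensor_kind
    \<Rightarrow> ('p::preordered_ab_group_add, 'k, 'r::{ring, monoid_mult}) pmod_complex set" where
  "flat_complexes u s =
     {K. is_pmod_complex Right K \<and> (\<forall>n. flat u s (obj K n)) \<and> (\<forall>n. flat u s (boundary_pmod K n))}"

definition projective_complexes ::
  "'u itself \<Rightarrow> ('p::preorder, 'k, 'r::{ring, monoid_mult}) pmod_complex set" where
  "projective_complexes u =
     {K. is_pmod_complex Right K \<and> (\<forall>n. projective u Right (obj K n))}"

end

theory Submission
  imports Defs
begin

text \<open>
  Write \<open>Z\<close>, \<open>B\<close>, \<open>H\<close> for the cycles, boundaries and homology of \<open>K\<close>, and let \<open>Q \<rightarrow> A\<close> be the
  projective resolution that defines \<open>Tor\<close>.  An element of \<open>M \<otimes> N\<close>, where \<open>N\<close> has a dual basis, is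
  determined by its coordinates in \<open>M\<close>; hence \<open>- \<otimes> Q\<^sub>i\<close> is exact.  Since \<open>B\<close> is flat, a snake argument
  along \<open>Q\<^sub>0 \<rightarrow> A\<close> shows that \<open>Z \<otimes> A \<rightarrow> K \<otimes> A\<close> is injective, and since \<open>K\<close> is flat as well,
  \<open>Z \<otimes> Q\<^sub>2 \<rightarrow> Z \<otimes> Q\<^sub>1 \<rightarrow> Z \<otimes> Q\<^sub>0\<close> is exact.  Together with right exactness this gives the sequence by
  chasing elements: the first map sends \<open>[z] \<otimes> a\<close> to \<open>[z \<otimes> a]\<close>; the second lifts a cycle of \<open>K\<^sub>n \<otimes> A\<close>
  to \<open>K\<^sub>n \<otimes> Q\<^sub>0\<close>, writes its boundary as \<open>\<partial>w\<close> with \<open>w \<in> Z\<^sub>n\<^sub>-\<^sub>1 \<otimes> Q\<^sub>1\<close>, and takes the class of \<open>w\<close> in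
  \<open>H\<^sub>n\<^sub>-\<^sub>1 \<otimes> Q\<^sub>1\<close>.  Both maps are relations between a class and its lifts which chain maps visibly
  preserve, so naturality needs no uniqueness of lifted chain maps up to homotopy.

  If \<open>K\<close> is projective and submodules of projectives are projective, then \<open>B\<close> is projective, hence
  flat, and a section of \<open>K\<^sub>n \<rightarrow> B\<^sub>n\<^sub>-\<^sub>1\<close> extends \<open>Z\<^sub>n \<rightarrow> H\<^sub>n\<close> to \<open>K\<^sub>n\<close>; tensoring with \<open>A\<close> gives a left
  inverse of the first map.
\<close>

section \<open>Quotients and presented groups\<close>

text \<open>Flatness, projectivity and heredity are tested on modules over one type
  \<open>'u\<close>, while the proof meets modules over \<open>'k\<close>, \<open>'a\<close>,
  \<open>'k set\<close> and finitely supported functions. Modules are therefore moved into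
  \<open>'u\<close> along injections, and \<open>'u\<close> must absorb free modules on generators
  labelled by \<open>'u\<close> itself. Lists over a type with two distinct letters can do this.

  The predicate \<open>flat\<close> concerns right modules only, so it cannot express that tensoring
  with the left module \<open>obj Q m\<close> is exact. Coordinates give this for both tensor
  products at once. Apart from index sets and reindexing, the two products differ in the degree of
  \<open>M\<close> that holds a coordinate: \<open>r\<close> for \<open>Sh\<close>, and
  \<open>r - d\<close> for \<open>Gr\<close>, where inverses in the group of degrees enter.

  Choices of lifts are avoided by working with relations: a total additive relation that relates the
  unit only to the unit is the graph of a homomorphism. The same device turns a left inverse of the
  first map into a section of the second, which is the form of splitting that
  \<open>right_split\<close> demands. It also yields compatibility with structure maps, since all
  lifts may be pushed forward.\<close>

abbreviation el :: "('p, 'm, 'z) pers_scheme \<Rightarrow> 'p \<Rightarrow> 'm set" where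
  "el M a \<equiv> carrier (grp M a)"

lemma hom_inverse:
  assumes "h \<in> hom G H" "group G" "group H" "x \<in> carrier G"
  shows "h (inv\<^bsub>G\<^esub> x) = inv\<^bsub>H\<^esub> h x"
  using assms by (simp add: group_hom.hom_inv group_hom_axioms_def group_hom_def)

lemma (in group) diff_eq_one:
  assumes "x \<in> carrier G" "y \<in> carrier G"
  shows "x \<otimes> inv y = \<one> \<longleftrightarrow> x = y"
  using assms by (metis inv_closed inv_equality inv_inv r_inv)

lemma comm_group_group: "comm_group G \<Longrightarrow> group G"
  by (simp add: comm_group_def)

lemma quotient_hom:
  assumes "comm_group G" "subgroup N G"
  shows "(\<lambda>x. N #>\<^bsub>G\<^esub> x) \<in> hom G (G Mod N)"
  using normal.r_coset_hom_Mod[OF comm_group.subgroup_imp_normal[OF assms]] .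

lemma coset_eq_one_iff:
  assumes "comm_group G" "subgroup N G" "x \<in> carrier G"
  shows "N #>\<^bsub>G\<^esub> x = N \<longleftrightarrow> x \<in> N"
  using assms by (metis comm_group_group group.coset_join1 group.coset_join2 subgroup.subset)

lemma coset_eq:
  assumes "comm_group G" "subgroup N G" "x \<in> carrier G" "n \<in> N"
  shows "N #>\<^bsub>G\<^esub> (n \<otimes>\<^bsub>G\<^esub> x) = N #>\<^bsub>G\<^esub> x"
proof -
  interpret G: comm_group G by fact
  interpret N: subgroup N G by fact
  have "N #>\<^bsub>G\<^esub> (n \<otimes>\<^bsub>G\<^esub> x) = (N #>\<^bsub>G\<^esub> n) #>\<^bsub>G\<^esub> x"
    using assms by (simp add: G.coset_mult_assoc N.subset)
  then show ?thesis using assms G.coset_join2[of n N] by simp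
qed

text \<open>The induced maps of the definitions, \<open>presented_map\<close> and
  \<open>homology_ind\<close>, are \<open>the_elem\<close> of the image of a coset. A function that
  is constant on the coset has a singleton image, so these maps can be evaluated on any
  representative.\<close>

lemma the_elem_coset:
  assumes "comm_group G" "subgroup N G" "x \<in> carrier G"
    and f: "\<And>n. n \<in> N \<Longrightarrow> f (n \<otimes>\<^bsub>G\<^esub> x) = f x"
  shows "the_elem (f ` (N #>\<^bsub>G\<^esub> x)) = f x"
proof -
  interpret G: comm_group G by fact
  interpret N: subgroup N G by fact
  have "f ` (N #>\<^bsub>G\<^esub> x) = {f x}"
    unfolding r_coset_def using f N.one_closed assms(3) by (auto intro!: image_eqI[of _ _ x] bexI[of _ "\<one>\<^bsub>G\<^esub>"])
  then show ?thesis by simp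
qed

lemma quotient_universal:
  assumes G: "comm_group G" and N: "subgroup N G" and H: "group H" and h: "h \<in> hom G H"
    and 1: "\<And>n. n \<in> N \<Longrightarrow> h n = \<one>\<^bsub>H\<^esub>"
  shows "\<exists>g\<in>hom (G Mod N) H. \<forall>x\<in>carrier G. g (N #>\<^bsub>G\<^esub> x) = h x"
proof -
  have nor: "N \<lhd> G" using comm_group.subgroup_imp_normal[OF G N] .
  have hx: "h x = h y" if "x \<in> carrier G" "y \<in> carrier G" "N #>\<^bsub>G\<^esub> x = N #>\<^bsub>G\<^esub> y" for x y
  proof -
    interpret G: comm_group G by fact
    interpret N: subgroup N G by fact
    interpret H: group H by fact
    have "x \<in> N #>\<^bsub>G\<^esub> y" using that N G.rcos_self by blast
    then obtain n where n: "n \<in> N" "x = n \<otimes>\<^bsub>G\<^esub> y" unfolding r_coset_def by auto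
    then show ?thesis using h that(2) 1 by (simp add: hom_mult hom_in_carrier)
  qed
  have "group_hom G H h"
    using G H h by (simp add: comm_group_group group_hom_axioms_def group_hom_def)
  then obtain g where "g \<in> hom (G Mod N) H" "\<And>x. x \<in> carrier G \<Longrightarrow> g (N #>\<^bsub>G\<^esub> x) = h x"
    using FactGroup_universal[OF h nor hx] by metis
  then show ?thesis by blast
qed

lemma hom_frag_minus_group:
  assumes "h \<in> hom (free_Abelian_group S) H" "group H"
    "Poly_Mapping.keys a \<subseteq> S" "Poly_Mapping.keys b \<subseteq> S"
  shows "h (a - b) = h a \<otimes>\<^bsub>H\<^esub> inv\<^bsub>H\<^esub> h b"
proof -
  have "h (a \<otimes>\<^bsub>free_Abelian_group S\<^esub> inv\<^bsub>free_Abelian_group S\<^esub> b) = h a \<otimes>\<^bsub>H\<^esub> inv\<^bsub>H\<^esub> h b"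
    using assms hom_inverse[OF assms(1) group_free_Abelian_group assms(2), of b]
    by (subst hom_mult[OF assms(1)]) (auto simp: group.inv_closed)
  then show ?thesis using assms by simp
qed

lemma presented_class_surj:
  "t \<in> carrier (presented_group S Rel) \<Longrightarrow>
    \<exists>c. Poly_Mapping.keys c \<subseteq> S \<and> t = presented_class S Rel c"
  unfolding presented_group_def presented_class_def carrier_FactGroup image_iff
    carrier_free_Abelian_group_iff Bex_def .

context
  fixes S :: "'a set" and Rel
  assumes Rel: "Rel \<subseteq> carrier (free_Abelian_group S)"
begin

lemma generate_subgroup: "subgroup (generate (free_Abelian_group S) Rel) (free_Abelian_group S)"
  using group.generate_is_subgroup[OF group_free_Abelian_group Rel] .

lemma presented_comm_group: "comm_group (presented_group S Rel)"
  unfolding presented_group_def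
  by (rule comm_group.abelian_FactGroup[OF abelian_free_Abelian_group generate_subgroup])

lemma presented_class_hom:
  "presented_class S Rel \<in> hom (free_Abelian_group S) (presented_group S Rel)"
  unfolding presented_group_def presented_class_def[abs_def]
  by (rule quotient_hom[OF abelian_free_Abelian_group generate_subgroup])

lemma presented_class_closed:
  "x \<in> S \<Longrightarrow> presented_class S Rel (frag_of x) \<in> carrier (presented_group S Rel)"
  by (rule hom_in_carrier[OF presented_class_hom]) simp

lemma presented_class_one_iff:
  assumes "Poly_Mapping.keys c \<subseteq> S"
  shows "presented_class S Rel c = \<one>\<^bsub>presented_group S Rel\<^esub>
    \<longleftrightarrow> c \<in> generate (free_Abelian_group S) Rel"
  unfolding presented_class_def presented_group_def
  using coset_eq_one_iff[OF abelian_free_Abelian_group generate_subgroup] assms by simp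

lemma presented_class_diff:
  assumes "Poly_Mapping.keys a \<subseteq> S" "Poly_Mapping.keys b \<subseteq> S"
  shows "presented_class S Rel (a - b) = presented_class S Rel a \<otimes>\<^bsub>presented_group S Rel\<^esub>
    inv\<^bsub>presented_group S Rel\<^esub> presented_class S Rel b"
  by (rule hom_frag_minus_group[OF presented_class_hom comm_group_group[OF presented_comm_group] assms])

text \<open>Relators \<open>a - b\<close> encode balancing over R and transition maps; relators
  \<open>a - b - c\<close> encode additivity in one variable. This lemma and
  \<open>presented_relator3\<close> turn the two shapes into equations between classes.\<close>

lemma presented_relator:
  assumes "frag_of a - frag_of b \<in> Rel" "a \<in> S" "b \<in> S"
  shows "presented_class S Rel (frag_of a) = presented_class S Rel (frag_of b)"
proof -
  interpret P: comm_group "presented_group S Rel" by (rule presented_comm_group)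
  have "presented_class S Rel (frag_of a - frag_of b) = \<one>\<^bsub>presented_group S Rel\<^esub>"
    using assms by (subst presented_class_one_iff) (auto intro: generate.incl dest!: subsetD[OF keys_diff])
  then have "presented_class S Rel (frag_of a) \<otimes>\<^bsub>presented_group S Rel\<^esub>
    inv\<^bsub>presented_group S Rel\<^esub> presented_class S Rel (frag_of b) = \<one>\<^bsub>presented_group S Rel\<^esub>"
    using assms by (simp add: presented_class_diff)
  then show ?thesis
    using P.diff_eq_one presented_class_closed assms(2,3) by blast
qed

lemma presented_relator3:
  assumes "frag_of a - frag_of b - frag_of c \<in> Rel" "a \<in> S" "b \<in> S" "c \<in> S"
  shows "presented_class S Rel (frag_of a) =
    presented_class S Rel (frag_of b) \<otimes>\<^bsub>presented_group S Rel\<^esub> presented_class S Rel (frag_of c)"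
proof -
  interpret P: comm_group "presented_group S Rel" by (rule presented_comm_group)
  have k: "Poly_Mapping.keys (frag_of a - frag_of b) \<subseteq> S"
    using assms by (auto dest!: subsetD[OF keys_diff])
  have "presented_class S Rel (frag_of a - frag_of b - frag_of c) = \<one>\<^bsub>presented_group S Rel\<^esub>"
    using assms k by (subst presented_class_one_iff) (auto intro: generate.incl dest!: subsetD[OF keys_diff])
  then have eq: "presented_class S Rel (frag_of a) \<otimes>\<^bsub>presented_group S Rel\<^esub>
      inv\<^bsub>presented_group S Rel\<^esub> presented_class S Rel (frag_of b) \<otimes>\<^bsub>presented_group S Rel\<^esub>
      inv\<^bsub>presented_group S Rel\<^esub> presented_class S Rel (frag_of c) = \<one>\<^bsub>presented_group S Rel\<^esub>"
    using assms k by (simp add: presented_class_diff)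
  show ?thesis
    using eq presented_class_closed[OF assms(2)] presented_class_closed[OF assms(3)] presented_class_closed[OF assms(4)]
    by (simp add: P.m_assoc P.inv_mult[symmetric] P.diff_eq_one)
qed

text \<open>The induction over formal sums is done here once. Later statements about elements of
  tensor products are checked on generators by exhibiting a subgroup that contains them: an
  equalizer, a preimage or an image.\<close>

lemma presented_generated:
  assumes T: "subgroup T (presented_group S Rel)"
    and gen: "\<And>x. x \<in> S \<Longrightarrow> presented_class S Rel (frag_of x) \<in> T"
  shows "carrier (presented_group S Rel) \<subseteq> T"
proof
  interpret P: comm_group "presented_group S Rel" by (rule presented_comm_group)
  interpret T: subgroup T "presented_group S Rel" by fact
  have *: "presented_class S Rel c \<in> T" if "Poly_Mapping.keys c \<subseteq> S" for c
    using that
  proof (induction c rule: free_Abelian_group_induct[consumes 1, case_names zero diff single])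
    case zero
    have "presented_class S Rel 0 = \<one>\<^bsub>presented_group S Rel\<^esub>"
      using hom_one[OF presented_class_hom] P.group_axioms by simp
    then show ?case using T.one_closed by simp
  next
    case (diff x y)
    then show ?case by (simp add: presented_class_diff)
  next
    case (single a)
    then show ?case by (simp add: gen)
  qed
  fix x assume "x \<in> carrier (presented_group S Rel)"
  then obtain c where "Poly_Mapping.keys c \<subseteq> S" "x = presented_class S Rel c"
    using presented_class_surj by blast
  then show "x \<in> T" using * by simp
qed

text \<open>The kernel of \<open>h\<close> is a subgroup containing the relators, hence contains
  everything they generate. The second conclusion supplies the independence of representatives in
  \<open>presented_map_hom\<close>.\<close>

lemma presented_universal_aux:
  assumes H: "group H" and h: "h \<in> hom (free_Abelian_group S) H"
    and rel: "\<And>\<rho>. \<rho> \<in> Rel \<Longrightarrow> h \<rho> = \<one>\<^bsub>H\<^esub>"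
  shows "\<exists>g\<in>hom (presented_group S Rel) H.
      \<forall>c. Poly_Mapping.keys c \<subseteq> S \<longrightarrow> g (presented_class S Rel c) = h c" (is ?A)
    and "n \<in> generate (free_Abelian_group S) Rel \<Longrightarrow> h n = \<one>\<^bsub>H\<^esub>"
proof -
  interpret h: group_hom "free_Abelian_group S" H h
    using H h by (simp add: group_hom_axioms_def group_hom_def)
  have "generate (free_Abelian_group S) Rel \<subseteq> kernel (free_Abelian_group S) H h"
    using rel Rel by (intro h.G.generate_subgroup_incl h.subgroup_kernel)
      (unfold kernel_def, blast)
  then show n: "h n = \<one>\<^bsub>H\<^esub>" if "n \<in> generate (free_Abelian_group S) Rel" for n
    using that by (auto simp: kernel_def)
  show ?A
    using quotient_universal[OF abelian_free_Abelian_group generate_subgroup H h n]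
    unfolding presented_group_def presented_class_def carrier_free_Abelian_group_iff Ball_def .
qed

text \<open>The extension of \<open>f\<close> to the free group is found inside the proof, so the
  condition on relators is imposed on every homomorphism \<open>h\<close> with the prescribed
  values. A user evaluates \<open>h\<close> on each shape of relator by \<open>hom_relator\<close>
  or \<open>hom_relator3\<close>.\<close>

lemma presented_universal:
  assumes H: "comm_group H" and f: "\<And>x. x \<in> S \<Longrightarrow> f x \<in> carrier H"
    and rel: "\<And>h \<rho>. \<lbrakk>h \<in> hom (free_Abelian_group S) H; \<And>x. x \<in> S \<Longrightarrow> h (frag_of x) = f x; \<rho> \<in> Rel\<rbrakk>
      \<Longrightarrow> h \<rho> = \<one>\<^bsub>H\<^esub>"
  shows "\<exists>g\<in>hom (presented_group S Rel) H.
    \<forall>x\<in>S. g (presented_class S Rel (frag_of x)) = f x"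
proof -
  obtain h where h: "h \<in> hom (free_Abelian_group S) H" "\<And>x. x \<in> S \<Longrightarrow> h (frag_of x) = f x"
  proof (rule comm_group.free_Abelian_group_universal[OF H, of f S])
    show "f ` S \<subseteq> carrier H" using f by auto
  qed (rule that)
  obtain g where "g \<in> hom (presented_group S Rel) H"
    "\<And>c. Poly_Mapping.keys c \<subseteq> S \<Longrightarrow> g (presented_class S Rel c) = h c"
    using presented_universal_aux(1)[OF comm_group_group[OF H] h(1) rel[OF h]] by blast
  then show ?thesis using h(2) by (intro bexI[of _ g]) auto
qed

end

lemma presented_map_hom:
  fixes S' :: "'b set"
  assumes Rel: "Rel \<subseteq> carrier (free_Abelian_group S)" and Rel': "Rel' \<subseteq> carrier (free_Abelian_group S')" and h: "\<And>x. x \<in> S \<Longrightarrow> h x \<in> S'"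
    and rel: "\<And>\<rho>. \<rho> \<in> Rel \<Longrightarrow>
      presented_class S' Rel' (frag_extend (frag_of \<circ> h) \<rho>) = \<one>\<^bsub>presented_group S' Rel'\<^esub>"
  shows "presented_map S' Rel' h \<in> hom (presented_group S Rel) (presented_group S' Rel')" (is ?A)
    and "x \<in> S \<Longrightarrow> presented_map S' Rel' h (presented_class S Rel (frag_of x)) =
      presented_class S' Rel' (frag_of (h x))"
proof -
  let ?P' = "presented_group S' Rel'"
  interpret P': comm_group ?P'
    by (rule presented_comm_group[OF Rel'])
  \<comment> \<open>This is the function that \<open>presented_map\<close> applies to
    representatives. It is a homomorphism killing the relators, hence constant on cosets.\<close>
  define k where "k = (\<lambda>c. presented_class S' Rel' (frag_extend (frag_of \<circ> h) c))"
  have p': "presented_class S' Rel' \<in> hom (free_Abelian_group S') ?P'"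
    by (rule presented_class_hom[OF Rel'])
  have ex: "frag_extend (frag_of \<circ> h) c \<in> carrier (free_Abelian_group S')"
    if "Poly_Mapping.keys c \<subseteq> S" for c
  proof -
    have "Poly_Mapping.keys (frag_extend (frag_of \<circ> h) c) \<subseteq> (\<Union>x\<in>Poly_Mapping.keys c. {h x})"
      using keys_frag_extend[of "frag_of \<circ> h" c] by simp
    with that h show ?thesis unfolding carrier_free_Abelian_group_iff by blast
  qed
  have k: "k \<in> hom (free_Abelian_group S) ?P'"
  proof (rule homI)
    fix x y assume "x \<in> carrier (free_Abelian_group S)" "y \<in> carrier (free_Abelian_group S)"
    then show "k (x \<otimes>\<^bsub>free_Abelian_group S\<^esub> y) = k x \<otimes>\<^bsub>?P'\<^esub> k y"
      using hom_mult[OF p' ex ex, of x y] by (simp add: k_def frag_extend_add)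
  qed (use hom_in_carrier[OF p' ex] in \<open>auto simp: k_def\<close>)
  have k1: "k \<rho> = \<one>\<^bsub>?P'\<^esub>" if "\<rho> \<in> Rel" for \<rho>
    using rel[OF that] by (simp add: k_def)
  have kn: "k n = \<one>\<^bsub>?P'\<^esub>" if "n \<in> generate (free_Abelian_group S) Rel" for n
    using presented_universal_aux(2)[OF Rel P'.group_axioms k k1 that] by simp
  obtain g where g: "g \<in> hom (presented_group S Rel) ?P'"
    "\<And>c. Poly_Mapping.keys c \<subseteq> S \<Longrightarrow> g (presented_class S Rel c) = k c"
    using presented_universal_aux(1)[OF Rel P'.group_axioms k k1] by blast
  have eq: "presented_map S' Rel' h (presented_class S Rel c) = k c" if "Poly_Mapping.keys c \<subseteq> S" for c
    unfolding presented_map_def k_def[symmetric] presented_class_def[of S]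
  proof (rule the_elem_coset[OF abelian_free_Abelian_group generate_subgroup[OF Rel]])
    show "c \<in> carrier (free_Abelian_group S)" using that by simp
    fix n assume n: "n \<in> generate (free_Abelian_group S) Rel"
    then have "n \<in> carrier (free_Abelian_group S)" using subgroup.mem_carrier[OF generate_subgroup[OF Rel]] by blast
    with n show "k (n \<otimes>\<^bsub>free_Abelian_group S\<^esub> c) = k c"
      using hom_mult[OF k] that kn hom_in_carrier[OF k, of c] by simp
  qed
  have "presented_map S' Rel' h t = g t" if "t \<in> carrier (presented_group S Rel)" for t
  proof -
    obtain c where "Poly_Mapping.keys c \<subseteq> S" "t = presented_class S Rel c"
      using presented_class_surj[OF \<open>t \<in> _\<close>] by blast
    then show ?thesis using eq g(2) by simp
  qed
  then show ?A using g(1) comm_group_group[OF presented_comm_group[OF Rel]]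
    by (simp add: hom_def Pi_def group.is_monoid monoid.m_closed)
  show "presented_map S' Rel' h (presented_class S Rel (frag_of x)) =
      presented_class S' Rel' (frag_of (h x))" if "x \<in> S"
    using eq[of "frag_of x"] that by (simp add: k_def)
qed

section \<open>The universal property of the tensor products\<close>

abbreviation "rmod M \<equiv> persistence_module Right M"
abbreviation "lmod M \<equiv> persistence_module Left M"

lemma pmod_comm_group: "persistence_module sd M \<Longrightarrow> comm_group (grp M a)"
  by (simp add: persistence_module_def persistence_group.grp_comm)

lemma pmod_group: "persistence_module sd M \<Longrightarrow> group (grp M a)"
  by (simp add: pmod_comm_group comm_group_group)

lemma pmod_smap_hom: "\<lbrakk>persistence_module sd M; a \<le> b\<rbrakk> \<Longrightarrow> smap M a b \<in> hom (grp M a) (grp M b)"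
  by (simp add: persistence_module_def persistence_group.smap_hom)

lemma pmod_smap_closed: "\<lbrakk>persistence_module sd M; a \<le> b; x \<in> el M a\<rbrakk> \<Longrightarrow> smap M a b x \<in> el M b"
  using hom_in_carrier[OF pmod_smap_hom] .

lemma pmod_act_hom: "persistence_module sd M \<Longrightarrow> act M a r \<in> hom (grp M a) (grp M a)"
  by (rule persistence_module.act_hom)

lemma pmod_act_closed: "\<lbrakk>persistence_module sd M; x \<in> el M a\<rbrakk> \<Longrightarrow> act M a r x \<in> el M a"
  using hom_in_carrier[OF pmod_act_hom] .

lemma pmod_smap_id: "\<lbrakk>persistence_module sd M; x \<in> el M a\<rbrakk> \<Longrightarrow> smap M a a x = x"
  by (simp add: persistence_module_def persistence_group.smap_id)

lemma pmod_smap_comp: "\<lbrakk>persistence_module sd M; a \<le> b; b \<le> c; x \<in> el M a\<rbrakk>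
  \<Longrightarrow> smap M b c (smap M a b x) = smap M a c x"
  by (simp add: persistence_module_def persistence_group.smap_comp)

lemma pmod_act_smap: "\<lbrakk>persistence_module sd M; a \<le> b; x \<in> el M a\<rbrakk>
  \<Longrightarrow> smap M a b (act M a r x) = act M b r (smap M a b x)"
  by (rule persistence_module.act_smap)

lemma pmod_mult_closed:
  "\<lbrakk>persistence_module sd M; x \<in> el M a; y \<in> el M a\<rbrakk> \<Longrightarrow> x \<otimes>\<^bsub>grp M a\<^esub> y \<in> el M a"
  by (simp add: group.is_monoid monoid.m_closed pmod_group)

lemma pmod_one_closed: "persistence_module sd M \<Longrightarrow> \<one>\<^bsub>grp M a\<^esub> \<in> el M a"
  by (simp add: group.is_monoid pmod_group)

lemma presented_relator_one:
  assumes "Rel \<subseteq> carrier (free_Abelian_group S)" "\<rho> \<in> Rel"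
  shows "presented_class S Rel \<rho> = \<one>\<^bsub>presented_group S Rel\<^esub>"
proof -
  have "Poly_Mapping.keys \<rho> \<subseteq> S" using assms unfolding carrier_free_Abelian_group_iff[symmetric] by blast
  then show ?thesis using presented_class_one_iff[OF assms(1)] generate.incl[OF assms(2)] by blast
qed

text \<open>Reduces equality of homomorphisms to generators: an equalizer that contains the
  generators is everything. This is the content of \<open>tensor_hom_eq\<close>,
  \<open>pten_hom_eq\<close> and \<open>tensor_at_hom_eq\<close>.\<close>

lemma equalizer_subgroup:
  assumes "group G" "group H" "h \<in> hom G H" "k \<in> hom G H"
  shows "subgroup {x \<in> carrier G. h x = k x} G"
proof -
  interpret h: group_hom G H h using assms by (simp add: group_hom_axioms_def group_hom_def)
  interpret k: group_hom G H k using assms by (simp add: group_hom_axioms_def group_hom_def)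
  show ?thesis by unfold_locales auto
qed

lemma preimage_subgroup:
  assumes "group G" "group H" "h \<in> hom G H" "subgroup T H"
  shows "subgroup {x \<in> carrier G. h x \<in> T} G"
proof -
  interpret h: group_hom G H h using assms by (simp add: group_hom_axioms_def group_hom_def)
  interpret T: subgroup T H by fact
  show ?thesis by unfold_locales auto
qed

section \<open>Tensor products over R of two values\<close>

definition tcl where
  "tcl M N i j x y = presented_class (tensor_gens M N i j) (tensor_rels M N i j) (frag_of (x, y))"

lemma tensor_rels_cases:
  assumes "\<rho> \<in> tensor_rels M N i j"
  obtains (left) x x' y where "\<rho> = frag_of (x \<otimes>\<^bsub>grp M i\<^esub> x', y) - frag_of (x, y) - frag_of (x', y)"
      "x \<in> el M i" "x' \<in> el M i" "y \<in> el N j"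
    | (right) x y y' where "\<rho> = frag_of (x, y \<otimes>\<^bsub>grp N j\<^esub> y') - frag_of (x, y) - frag_of (x, y')"
      "x \<in> el M i" "y \<in> el N j" "y' \<in> el N j"
    | (act) a x y where "\<rho> = frag_of (act M i a x, y) - frag_of (x, act N j a y)"
      "x \<in> el M i" "y \<in> el N j"
  using assms unfolding tensor_rels_def by blast

lemma tensor_relsI:
  "\<lbrakk>x \<in> el M i; x' \<in> el M i; y \<in> el N j\<rbrakk> \<Longrightarrow>
    frag_of (x \<otimes>\<^bsub>grp M i\<^esub> x', y) - frag_of (x, y) - frag_of (x', y) \<in> tensor_rels M N i j"
  "\<lbrakk>x \<in> el M i; y \<in> el N j; y' \<in> el N j\<rbrakk> \<Longrightarrow>
    frag_of (x, y \<otimes>\<^bsub>grp N j\<^esub> y') - frag_of (x, y) - frag_of (x, y') \<in> tensor_rels M N i j"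
  "\<lbrakk>x \<in> el M i; y \<in> el N j\<rbrakk> \<Longrightarrow>
    frag_of (act M i a x, y) - frag_of (x, act N j a y) \<in> tensor_rels M N i j"
  unfolding tensor_rels_def by blast+

lemma hom_relator:
  assumes h: "h \<in> hom (free_Abelian_group S) H" and H: "comm_group H" and S: "a \<in> S" "b \<in> S"
    and eq: "h (frag_of a) = h (frag_of b)"
  shows "h (frag_of a - frag_of b) = \<one>\<^bsub>H\<^esub>"
proof -
  interpret H: comm_group H by fact
  have "h (frag_of b) \<in> carrier H" using S by (intro hom_in_carrier[OF h]) simp
  then show ?thesis
    using S eq by (subst hom_frag_minus_group[OF h H.group_axioms]) auto
qed

lemma hom_relator3:
  assumes h: "h \<in> hom (free_Abelian_group S) H" and H: "comm_group H" and S: "a \<in> S" "b \<in> S" "c \<in> S"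
    and eq: "h (frag_of a) = h (frag_of b) \<otimes>\<^bsub>H\<^esub> h (frag_of c)"
  shows "h (frag_of a - frag_of b - frag_of c) = \<one>\<^bsub>H\<^esub>"
proof -
  interpret H: comm_group H by fact
  have cl: "h (frag_of x) \<in> carrier H" if "x \<in> S" for x using that by (intro hom_in_carrier[OF h]) simp
  have k: "Poly_Mapping.keys (frag_of a - frag_of b) \<subseteq> S"
    using S by (auto dest!: subsetD[OF keys_diff])
  have "h (frag_of a - frag_of b - frag_of c) =
      h (frag_of a) \<otimes>\<^bsub>H\<^esub> inv\<^bsub>H\<^esub> h (frag_of b) \<otimes>\<^bsub>H\<^esub> inv\<^bsub>H\<^esub> h (frag_of c)"
    using S k by (simp add: hom_frag_minus_group[OF h H.group_axioms])
  also have "\<dots> = h (frag_of a) \<otimes>\<^bsub>H\<^esub> inv\<^bsub>H\<^esub> (h (frag_of b) \<otimes>\<^bsub>H\<^esub> h (frag_of c))"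
    using cl S by (simp add: H.m_assoc H.inv_mult[symmetric])
  also have "\<dots> = \<one>\<^bsub>H\<^esub>"
    using cl S eq by simp
  finally show ?thesis .
qed

context
  fixes M :: "('p::preordered_ab_group_add, 'm, 'r::{ring, monoid_mult}) pmod"
    and N :: "('p, 'n, 'r) pmod"
  assumes M: "rmod M" and N: "lmod N"
begin

lemmas tensor_rels = tensor_rels_subset[OF M N]

lemma tcl_closed: "\<lbrakk>x \<in> el M i; y \<in> el N j\<rbrakk> \<Longrightarrow> tcl M N i j x y \<in> carrier (tensor M N i j)"
  unfolding tcl_def tensor_def by (rule presented_class_closed[OF tensor_rels]) (simp add: tensor_gens_def)

lemma tcl_left: "\<lbrakk>x \<in> el M i; x' \<in> el M i; y \<in> el N j\<rbrakk> \<Longrightarrow>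
  tcl M N i j (x \<otimes>\<^bsub>grp M i\<^esub> x') y = tcl M N i j x y \<otimes>\<^bsub>tensor M N i j\<^esub> tcl M N i j x' y"
  unfolding tcl_def tensor_def
  by (rule presented_relator3[OF tensor_rels])
    (auto simp: tensor_gens_def tensor_rels_def intro: pmod_mult_closed[OF M])

lemma tcl_right: "\<lbrakk>x \<in> el M i; y \<in> el N j; y' \<in> el N j\<rbrakk> \<Longrightarrow>
  tcl M N i j x (y \<otimes>\<^bsub>grp N j\<^esub> y') = tcl M N i j x y \<otimes>\<^bsub>tensor M N i j\<^esub> tcl M N i j x y'"
  unfolding tcl_def tensor_def
  by (rule presented_relator3[OF tensor_rels])
    (auto simp: tensor_gens_def tensor_rels_def intro: pmod_mult_closed[OF N])

lemma tcl_act: "\<lbrakk>x \<in> el M i; y \<in> el N j\<rbrakk> \<Longrightarrow>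
  tcl M N i j (act M i a x) y = tcl M N i j x (act N j a y)"
  unfolding tcl_def tensor_def
  by (rule presented_relator[OF tensor_rels])
    (auto simp: tensor_gens_def tensor_rels_def intro: pmod_act_closed[OF M] pmod_act_closed[OF N])

lemma tensor_generated:
  assumes "subgroup T (tensor M N i j)"
    "\<And>x y. \<lbrakk>x \<in> el M i; y \<in> el N j\<rbrakk> \<Longrightarrow> tcl M N i j x y \<in> T"
  shows "carrier (tensor M N i j) \<subseteq> T"
  using assms unfolding tensor_def
  by (intro presented_generated[OF tensor_rels]) (auto simp: tcl_def tensor_gens_def)

lemma tensor_hom_eq:
  assumes "comm_group H" "h \<in> hom (tensor M N i j) H" "k \<in> hom (tensor M N i j) H"
    "\<And>x y. \<lbrakk>x \<in> el M i; y \<in> el N j\<rbrakk> \<Longrightarrow> h (tcl M N i j x y) = k (tcl M N i j x y)"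
    "t \<in> carrier (tensor M N i j)"
  shows "h t = k t"
  using tensor_generated[OF equalizer_subgroup[OF _ _ assms(2,3)]] assms
    comm_group_tensor[OF M N] tcl_closed by (auto simp: comm_group_group)

lemma tensor_universal:
  assumes H: "comm_group H"
    and closed: "\<And>x y. \<lbrakk>x \<in> el M i; y \<in> el N j\<rbrakk> \<Longrightarrow> b x y \<in> carrier H"
    and left: "\<And>x x' y. \<lbrakk>x \<in> el M i; x' \<in> el M i; y \<in> el N j\<rbrakk> \<Longrightarrow>
      b (x \<otimes>\<^bsub>grp M i\<^esub> x') y = b x y \<otimes>\<^bsub>H\<^esub> b x' y"
    and right: "\<And>x y y'. \<lbrakk>x \<in> el M i; y \<in> el N j; y' \<in> el N j\<rbrakk> \<Longrightarrow>
      b x (y \<otimes>\<^bsub>grp N j\<^esub> y') = b x y \<otimes>\<^bsub>H\<^esub> b x y'"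
    and act: "\<And>a x y. \<lbrakk>x \<in> el M i; y \<in> el N j\<rbrakk> \<Longrightarrow> b (act M i a x) y = b x (act N j a y)"
  shows "\<exists>g\<in>hom (tensor M N i j) H. \<forall>x\<in>el M i. \<forall>y\<in>el N j. g (tcl M N i j x y) = b x y"
proof -
  have "\<exists>g\<in>hom (tensor M N i j) H. \<forall>p\<in>tensor_gens M N i j.
      g (presented_class (tensor_gens M N i j) (tensor_rels M N i j) (frag_of p)) = (\<lambda>(x, y). b x y) p"
    unfolding tensor_def
  proof (rule presented_universal[OF tensor_rels H])
    show "(\<lambda>(x, y). b x y) p \<in> carrier H" if "p \<in> tensor_gens M N i j" for p
      using that closed by (auto simp: tensor_gens_def)
    fix h \<rho>
    assume h: "h \<in> hom (free_Abelian_group (tensor_gens M N i j)) H"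
      and hb: "\<And>p. p \<in> tensor_gens M N i j \<Longrightarrow> h (frag_of p) = (\<lambda>(x, y). b x y) p"
      and "\<rho> \<in> tensor_rels M N i j"
    from this(3) show "h \<rho> = \<one>\<^bsub>H\<^esub>"
    proof (cases rule: tensor_rels_cases)
      case (left x x' y)
      have "(x \<otimes>\<^bsub>grp M i\<^esub> x', y) \<in> tensor_gens M N i j" "(x, y) \<in> tensor_gens M N i j"
          "(x', y) \<in> tensor_gens M N i j"
        using left(2-) pmod_mult_closed[OF M] by (auto simp: tensor_gens_def)
      then show ?thesis
        unfolding left(1) using assms(3)[OF left(2-)] by (intro hom_relator3[OF h H]) (simp_all add: hb)
    next
      case (right x y y')
      have "(x, y \<otimes>\<^bsub>grp N j\<^esub> y') \<in> tensor_gens M N i j" "(x, y) \<in> tensor_gens M N i j"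
          "(x, y') \<in> tensor_gens M N i j"
        using right(2-) pmod_mult_closed[OF N] by (auto simp: tensor_gens_def)
      then show ?thesis
        unfolding right(1) using assms(4)[OF right(2-)] by (intro hom_relator3[OF h H]) (simp_all add: hb)
    next
      case (act a x y)
      have "(act M i a x, y) \<in> tensor_gens M N i j" "(x, act N j a y) \<in> tensor_gens M N i j"
        using act(2-) pmod_act_closed[OF M] pmod_act_closed[OF N] by (auto simp: tensor_gens_def)
      then show ?thesis
        unfolding act(1) using assms(5)[OF act(2-)] by (intro hom_relator[OF h H]) (simp_all add: hb)
    qed
  qed
  then show ?thesis by (force simp: tcl_def tensor_gens_def)
qed

end

text \<open>Relators go to relators of the same kind, so the map on formal sums descends. Source and
  target degrees may differ, which lets the lemma serve structure maps as well as morphisms.\<close>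

lemma tensor_map_hom:
  fixes M :: "('p::preordered_ab_group_add, 'm, 'r::{ring, monoid_mult}) pmod"
  assumes M: "rmod M" and N: "lmod N" and M': "rmod M'" and N': "lmod N'"
    and f: "f \<in> hom (grp M i) (grp M' i')" and g: "g \<in> hom (grp N j) (grp N' j')"
    and fa: "\<And>a x. x \<in> el M i \<Longrightarrow> f (act M i a x) = act M' i' a (f x)"
    and ga: "\<And>a y. y \<in> el N j \<Longrightarrow> g (act N j a y) = act N' j' a (g y)"
  shows "tensor_map M' N' i' j' f g \<in> hom (tensor M N i j) (tensor M' N' i' j')" (is ?A)
    and "\<lbrakk>x \<in> el M i; y \<in> el N j\<rbrakk> \<Longrightarrow>
      tensor_map M' N' i' j' f g (tcl M N i j x y) = tcl M' N' i' j' (f x) (g y)"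
proof -
  have c: "map_prod f g p \<in> tensor_gens M' N' i' j'" if "p \<in> tensor_gens M N i j" for p
    using that hom_in_carrier[OF f] hom_in_carrier[OF g] by (auto simp: tensor_gens_def)
  have r: "presented_class (tensor_gens M' N' i' j') (tensor_rels M' N' i' j')
      (frag_extend (frag_of \<circ> map_prod f g) \<rho>) = \<one>\<^bsub>presented_group (tensor_gens M' N' i' j') (tensor_rels M' N' i' j')\<^esub>"
    if "\<rho> \<in> tensor_rels M N i j" for \<rho>
  proof -
    have "frag_extend (frag_of \<circ> map_prod f g) \<rho> \<in> tensor_rels M' N' i' j'"
      using that
    proof (cases rule: tensor_rels_cases)
      case (left x x' y)
      have "frag_extend (frag_of \<circ> map_prod f g) \<rho> =
          frag_of (f x \<otimes>\<^bsub>grp M' i'\<^esub> f x', g y) - frag_of (f x, g y) - frag_of (f x', g y)"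
        unfolding left(1) using left(2-) by (simp add: frag_extend_diff hom_mult[OF f])
      then show ?thesis
        using tensor_relsI(1)[of "f x" M' i' "f x'" "g y" N' j'] left(2-) hom_in_carrier[OF f] hom_in_carrier[OF g] by metis
    next
      case (right x y y')
      have "frag_extend (frag_of \<circ> map_prod f g) \<rho> =
          frag_of (f x, g y \<otimes>\<^bsub>grp N' j'\<^esub> g y') - frag_of (f x, g y) - frag_of (f x, g y')"
        unfolding right(1) using right(2-) by (simp add: frag_extend_diff hom_mult[OF g])
      then show ?thesis
        using tensor_relsI(2)[of "f x" M' i' "g y" N' j' "g y'"] right(2-) hom_in_carrier[OF f] hom_in_carrier[OF g] by metis
    next
      case (act a x y)
      have "frag_extend (frag_of \<circ> map_prod f g) \<rho> =
          frag_of (act M' i' a (f x), g y) - frag_of (f x, act N' j' a (g y))"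
        unfolding act(1) using act(2-) by (simp add: frag_extend_diff fa ga)
      then show ?thesis
        using tensor_relsI(3)[of "f x" M' i' "g y" N' j' a] act(2-) hom_in_carrier[OF f] hom_in_carrier[OF g] by metis
    qed
    then show ?thesis
      by (rule presented_relator_one[OF tensor_rels_subset[OF M' N']])
  qed
  note * = presented_map_hom[OF tensor_rels_subset[OF M N] tensor_rels_subset[OF M' N'], OF c r]
  show ?A using *(1) by (simp add: tensor_map_def tensor_def)
  show "tensor_map M' N' i' j' f g (tcl M N i j x y) = tcl M' N' i' j' (f x) (g y)"
    if "x \<in> el M i" "y \<in> el N j"
    using *(2)[where x = "(x, y)"] that by (simp add: tensor_map_def tensor_def tcl_def tensor_gens_def)
qed

section \<open>Morphisms, balanced families and the universal property\<close>

lemma pers_hom_hom: "pers_hom M N f \<Longrightarrow> f a \<in> hom (grp M a) (grp N a)"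
  by (simp add: pers_hom_def)

lemma pers_hom_smap: "\<lbrakk>pers_hom M N f; a \<le> b; x \<in> el M a\<rbrakk> \<Longrightarrow> f b (smap M a b x) = smap N a b (f a x)"
  by (simp add: pers_hom_def)

lemma pmod_hom_pers: "pmod_hom M N f \<Longrightarrow> pers_hom M N f"
  by (simp add: pmod_hom_def)

lemma pmod_hom_hom: "pmod_hom M N f \<Longrightarrow> f a \<in> hom (grp M a) (grp N a)"
  by (simp add: pmod_hom_def pers_hom_def)

lemma pmod_hom_closed: "\<lbrakk>pmod_hom M N f; x \<in> el M a\<rbrakk> \<Longrightarrow> f a x \<in> el N a"
  using hom_in_carrier[OF pmod_hom_hom] .

lemma pmod_hom_smap: "\<lbrakk>pmod_hom M N f; a \<le> b; x \<in> el M a\<rbrakk> \<Longrightarrow> f b (smap M a b x) = smap N a b (f a x)"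
  by (simp add: pmod_hom_def pers_hom_def)

lemma pmod_hom_act: "\<lbrakk>pmod_hom M N f; x \<in> el M a\<rbrakk> \<Longrightarrow> f a (act M a r x) = act N a r (f a x)"
  by (simp add: pmod_hom_def)

text \<open>A cocone of balanced biadditive maps on the diagram of pairs of degrees. The conditions
  \<open>left\<close>, \<open>right\<close> and \<open>act\<close> make each \<open>b i j\<close>
  factor through the tensor product over R; \<open>trans\<close> makes the factors compatible with
  the colimit. No side is fixed for \<open>M\<close> and \<open>N\<close>, so that the notion is
  symmetric, see \<open>balanced_swap\<close>.\<close>

locale balanced =
  fixes s :: tensor_kind and r :: "'p::preordered_ab_group_add"
    and M :: "('p, 'm, 'r::{ring, monoid_mult}) pmod" and N :: "('p, 'n, 'r) pmod"
    and H :: "('c, 'z) monoid_scheme" and b :: "'p \<Rightarrow> 'p \<Rightarrow> 'm \<Rightarrow> 'n \<Rightarrow> 'c"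
  assumes closed: "\<lbrakk>(i, j) \<in> ten_index s r; x \<in> el M i; y \<in> el N j\<rbrakk> \<Longrightarrow> b i j x y \<in> carrier H"
    and left: "\<lbrakk>(i, j) \<in> ten_index s r; x \<in> el M i; x' \<in> el M i; y \<in> el N j\<rbrakk> \<Longrightarrow>
      b i j (x \<otimes>\<^bsub>grp M i\<^esub> x') y = b i j x y \<otimes>\<^bsub>H\<^esub> b i j x' y"
    and right: "\<lbrakk>(i, j) \<in> ten_index s r; x \<in> el M i; y \<in> el N j; y' \<in> el N j\<rbrakk> \<Longrightarrow>
      b i j x (y \<otimes>\<^bsub>grp N j\<^esub> y') = b i j x y \<otimes>\<^bsub>H\<^esub> b i j x y'"
    and act: "\<lbrakk>(i, j) \<in> ten_index s r; x \<in> el M i; y \<in> el N j\<rbrakk> \<Longrightarrow>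
      b i j (act M i a x) y = b i j x (act N j a y)"
    and trans: "\<lbrakk>(i, j) \<in> ten_index s r; (i', j') \<in> ten_index s r; i \<le> i'; j \<le> j';
      x \<in> el M i; y \<in> el N j\<rbrakk> \<Longrightarrow> b i' j' (smap M i i' x) (smap N j j' y) = b i j x y"

definition pcl where
  "pcl s M N r i j t = presented_class (ten_gens s M N r) (ten_rels s M N r) (frag_of ((i, j), t))"

text \<open>A pure tensor with factors in degrees \<open>i\<close> and \<open>j\<close>, viewed in
  degree \<open>r\<close> of the tensor product.\<close>

definition ptau where
  "ptau s M N r i j x y = pcl s M N r i j (tcl M N i j x y)"

lemma grp_pten: "grp (pten s M N) r = presented_group (ten_gens s M N r) (ten_rels s M N r)"
  by (simp add: pten_def)

lemma ten_gens_iff: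
  "((i, j), t) \<in> ten_gens s M N r \<longleftrightarrow> (i, j) \<in> ten_index s r \<and> t \<in> carrier (tensor M N i j)"
  by (auto simp: ten_gens_def colim_gens_def ten_diag_def)

lemma ten_relsI1:
  "\<lbrakk>(i, j) \<in> ten_index s r; t \<in> carrier (tensor M N i j); t' \<in> carrier (tensor M N i j)\<rbrakk> \<Longrightarrow>
    frag_of ((i, j), t \<otimes>\<^bsub>tensor M N i j\<^esub> t') - frag_of ((i, j), t) - frag_of ((i, j), t')
      \<in> ten_rels s M N r"
  unfolding ten_rels_def colim_rels_def ten_diag_def by force

lemma ten_relsI2:
  "\<lbrakk>(i, j) \<in> ten_index s r; (i', j') \<in> ten_index s r; i \<le> i'; j \<le> j'; t \<in> carrier (tensor M N i j)\<rbrakk> \<Longrightarrow>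
    frag_of ((i', j'), ten_trans M N (i, j) (i', j') t) - frag_of ((i, j), t) \<in> ten_rels s M N r"
  unfolding ten_rels_def colim_rels_def ten_diag_def by force

lemma ten_rels_cases:
  assumes "\<rho> \<in> ten_rels s M N r"
  obtains (add) i j t t' where
      "\<rho> = frag_of ((i, j), t \<otimes>\<^bsub>tensor M N i j\<^esub> t') - frag_of ((i, j), t) - frag_of ((i, j), t')"
      "(i, j) \<in> ten_index s r" "t \<in> carrier (tensor M N i j)" "t' \<in> carrier (tensor M N i j)"
    | (trans) i j i' j' t where
      "\<rho> = frag_of ((i', j'), ten_trans M N (i, j) (i', j') t) - frag_of ((i, j), t)"
      "(i, j) \<in> ten_index s r" "(i', j') \<in> ten_index s r" "i \<le> i'" "j \<le> j'"
      "t \<in> carrier (tensor M N i j)"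
  using assms unfolding ten_rels_def colim_rels_def ten_diag_def Un_iff mem_Collect_eq
  by (elim disjE exE conjE) (metis (mono_tags, lifting) case_prod_conv surj_pair)+

context
  fixes M :: "('p::preordered_ab_group_add, 'm, 'r::{ring, monoid_mult}) pmod"
    and N :: "('p, 'n, 'r) pmod"
  assumes M: "rmod M" and N: "lmod N"
begin

lemma tensor_comm_group: "comm_group (tensor M N i j)"
  by (rule comm_group_tensor[OF M N])

lemma tensor_mult_closed:
  "\<lbrakk>t \<in> carrier (tensor M N i j); t' \<in> carrier (tensor M N i j)\<rbrakk> \<Longrightarrow>
    t \<otimes>\<^bsub>tensor M N i j\<^esub> t' \<in> carrier (tensor M N i j)"
  using tensor_comm_group[of i j] by (simp add: comm_group_def group.is_monoid monoid.m_closed)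

lemma ten_trans_hom:
  assumes "i \<le> i'" "j \<le> j'"
  shows "ten_trans M N (i, j) (i', j') \<in> hom (tensor M N i j) (tensor M N i' j')"
    and "\<lbrakk>x \<in> el M i; y \<in> el N j\<rbrakk> \<Longrightarrow>
      ten_trans M N (i, j) (i', j') (tcl M N i j x y) = tcl M N i' j' (smap M i i' x) (smap N j j' y)"
  unfolding ten_trans_def prod.case
  using tensor_map_hom[OF M N M N pmod_smap_hom[OF M assms(1)] pmod_smap_hom[OF N assms(2)]]
    pmod_act_smap[OF M assms(1)] pmod_act_smap[OF N assms(2)] by auto

lemma ten_rels_subset: "ten_rels s M N r \<subseteq> carrier (free_Abelian_group (ten_gens s M N r))"
proof
  fix \<rho> assume "\<rho> \<in> ten_rels s M N r"
  then show "\<rho> \<in> carrier (free_Abelian_group (ten_gens s M N r))"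
  proof (cases rule: ten_rels_cases)
    case (add i j t t')
    then show ?thesis
      using tensor_mult_closed[of t i j t']
      by (auto simp: ten_gens_iff dest!: subsetD[OF keys_diff])
  next
    case (trans i j i' j' t)
    then show ?thesis
      using hom_in_carrier[OF ten_trans_hom(1), of i i' j j' t]
      by (auto simp: ten_gens_iff dest!: subsetD[OF keys_diff])
  qed
qed

lemma pten_comm_group: "comm_group (grp (pten s M N) r)"
  unfolding grp_pten by (rule presented_comm_group[OF ten_rels_subset])

lemma pcl_hom: "(i, j) \<in> ten_index s r \<Longrightarrow> pcl s M N r i j \<in> hom (tensor M N i j) (grp (pten s M N) r)"
  unfolding grp_pten
proof (rule homI)
  assume ij: "(i, j) \<in> ten_index s r"
  show "pcl s M N r i j t \<in> carrier (presented_group (ten_gens s M N r) (ten_rels s M N r))"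
    if "t \<in> carrier (tensor M N i j)" for t
    unfolding pcl_def using that ij
    by (intro presented_class_closed[OF ten_rels_subset]) (simp add: ten_gens_iff)
  show "pcl s M N r i j (t \<otimes>\<^bsub>tensor M N i j\<^esub> t') = pcl s M N r i j t
      \<otimes>\<^bsub>presented_group (ten_gens s M N r) (ten_rels s M N r)\<^esub> pcl s M N r i j t'"
    if "t \<in> carrier (tensor M N i j)" "t' \<in> carrier (tensor M N i j)" for t t'
    unfolding pcl_def using that ij tensor_mult_closed[OF that]
    by (intro presented_relator3[OF ten_rels_subset] ten_relsI1) (simp_all add: ten_gens_iff)
qed

lemma pcl_trans:
  assumes "(i, j) \<in> ten_index s r" "(i', j') \<in> ten_index s r" "i \<le> i'" "j \<le> j'"
    "t \<in> carrier (tensor M N i j)"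
  shows "pcl s M N r i' j' (ten_trans M N (i, j) (i', j') t) = pcl s M N r i j t"
  unfolding pcl_def using assms hom_in_carrier[OF ten_trans_hom(1)[OF assms(3,4)] assms(5)]
  by (intro presented_relator[OF ten_rels_subset] ten_relsI2) (simp_all add: ten_gens_iff)

lemma ptau_balanced: "balanced s r M N (grp (pten s M N) r) (ptau s M N r)"
proof
  fix i j x y assume ij: "(i, j) \<in> ten_index s r" and x: "x \<in> el M i" and y: "y \<in> el N j"
  show "ptau s M N r i j x y \<in> el (pten s M N) r"
    unfolding ptau_def by (rule hom_in_carrier[OF pcl_hom[OF ij] tcl_closed[OF M N x y]])
  show "ptau s M N r i j (x \<otimes>\<^bsub>grp M i\<^esub> x') y =
      ptau s M N r i j x y \<otimes>\<^bsub>grp (pten s M N) r\<^esub> ptau s M N r i j x' y" if "x' \<in> el M i" for x'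
    unfolding ptau_def using hom_mult[OF pcl_hom[OF ij]] tcl_closed[OF M N] tcl_left[OF M N] x that y by simp
  show "ptau s M N r i j x (y \<otimes>\<^bsub>grp N j\<^esub> y') =
      ptau s M N r i j x y \<otimes>\<^bsub>grp (pten s M N) r\<^esub> ptau s M N r i j x y'" if "y' \<in> el N j" for y'
    unfolding ptau_def using hom_mult[OF pcl_hom[OF ij]] tcl_closed[OF M N] tcl_right[OF M N] x that y by simp
  show "ptau s M N r i j (act M i a x) y = ptau s M N r i j x (act N j a y)" for a
    unfolding ptau_def using tcl_act[OF M N x y] by simp
  show "ptau s M N r i' j' (smap M i i' x) (smap N j j' y) = ptau s M N r i j x y"
    if "(i', j') \<in> ten_index s r" "i \<le> i'" "j \<le> j'" for i' j'
    unfolding ptau_def using pcl_trans[OF ij that tcl_closed[OF M N x y]] ten_trans_hom(2)[OF that(2,3) x y] by simp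
qed

lemmas ptau_closed = balanced.closed[OF ptau_balanced]
lemmas ptau_left = balanced.left[OF ptau_balanced]
lemmas ptau_right = balanced.right[OF ptau_balanced]

lemma pten_generated:
  assumes T: "subgroup T (grp (pten s M N) r)"
    and gen: "\<And>i j x y. \<lbrakk>(i, j) \<in> ten_index s r; x \<in> el M i; y \<in> el N j\<rbrakk> \<Longrightarrow> ptau s M N r i j x y \<in> T"
  shows "el (pten s M N) r \<subseteq> T"
  unfolding grp_pten
proof (rule presented_generated[OF ten_rels_subset T[unfolded grp_pten]])
  fix p assume "p \<in> ten_gens s M N r"
  moreover obtain i j t where p: "p = ((i, j), t)" by (metis surj_pair)
  ultimately have ij: "(i, j) \<in> ten_index s r" and t: "t \<in> carrier (tensor M N i j)"
    by (simp_all add: ten_gens_iff)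
  have "carrier (tensor M N i j) \<subseteq> {t \<in> carrier (tensor M N i j). pcl s M N r i j t \<in> T}"
  proof (rule tensor_generated[OF M N preimage_subgroup[OF _ _ pcl_hom[OF ij] T]])
    show "tcl M N i j x y \<in> {t \<in> carrier (tensor M N i j). pcl s M N r i j t \<in> T}"
      if "x \<in> el M i" "y \<in> el N j" for x y
      using tcl_closed[OF M N that] gen[OF ij that] by (simp add: ptau_def)
  qed (simp_all add: comm_group_group tensor_comm_group pten_comm_group)
  then show "presented_class (ten_gens s M N r) (ten_rels s M N r) (frag_of p) \<in> T"
    using t by (auto simp: pcl_def p)
qed

lemma pten_hom_eq:
  assumes "group H" "h \<in> hom (grp (pten s M N) r) H" "k \<in> hom (grp (pten s M N) r) H"
    and eq: "\<And>i j x y. \<lbrakk>(i, j) \<in> ten_index s r; x \<in> el M i; y \<in> el N j\<rbrakk> \<Longrightarrow>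
      h (ptau s M N r i j x y) = k (ptau s M N r i j x y)"
    and t: "t \<in> el (pten s M N) r"
  shows "h t = k t"
proof -
  have "el (pten s M N) r \<subseteq> {t \<in> el (pten s M N) r. h t = k t}"
    using eq ptau_closed
    by (intro pten_generated equalizer_subgroup[OF _ assms(1-3)]) (auto simp: comm_group_group pten_comm_group)
  then show ?thesis using t by blast
qed

text \<open>Two universal properties in a row: each \<open>b i j\<close> factors through a tensor
  product over R, and the factors are glued on the colimit. That they respect the transition maps
  holds on pure tensors by \<open>balanced.trans\<close> and extends by
  \<open>tensor_hom_eq\<close>.\<close>

lemma pten_universal:
  fixes H :: "'c monoid"
  assumes H: "comm_group H" and b: "balanced s r M N H b"
  shows "\<exists>h\<in>hom (grp (pten s M N) r) H. \<forall>i j x y. (i, j) \<in> ten_index s r \<longrightarrow> x \<in> el M i \<longrightarrow> y \<in> el N j \<longrightarrow>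
    h (ptau s M N r i j x y) = b i j x y"
proof -
  interpret balanced s r M N H b by fact
  have "\<exists>g\<in>hom (tensor M N i j) H. \<forall>x\<in>el M i. \<forall>y\<in>el N j. g (tcl M N i j x y) = b i j x y"
    if ij: "(i, j) \<in> ten_index s r" for i j
    using closed[OF ij] left[OF ij] right[OF ij] act[OF ij] by (intro tensor_universal[OF M N H])
  then obtain g where g: "\<And>i j. (i, j) \<in> ten_index s r \<Longrightarrow> g i j \<in> hom (tensor M N i j) H"
    "\<And>i j x y. \<lbrakk>(i, j) \<in> ten_index s r; x \<in> el M i; y \<in> el N j\<rbrakk> \<Longrightarrow> g i j (tcl M N i j x y) = b i j x y"
    by metis
  define f where "f = (\<lambda>((i, j), t). g i j t)"
  have "\<exists>h\<in>hom (presented_group (ten_gens s M N r) (ten_rels s M N r)) H. \<forall>p\<in>ten_gens s M N r.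
      h (presented_class (ten_gens s M N r) (ten_rels s M N r) (frag_of p)) = f p"
  proof (rule presented_universal[OF ten_rels_subset H])
    show "f p \<in> carrier H" if "p \<in> ten_gens s M N r" for p
      using that hom_in_carrier[OF g(1)] by (cases p rule: prod.exhaust[case_product prod.exhaust])
       (auto simp: f_def ten_gens_iff)
    fix h \<rho>
    assume h: "h \<in> hom (free_Abelian_group (ten_gens s M N r)) H"
      and hf: "\<And>p. p \<in> ten_gens s M N r \<Longrightarrow> h (frag_of p) = f p"
      and "\<rho> \<in> ten_rels s M N r"
    from this(3) show "h \<rho> = \<one>\<^bsub>H\<^esub>"
    proof (cases rule: ten_rels_cases)
      case (add i j t t')
      have "((i, j), t \<otimes>\<^bsub>tensor M N i j\<^esub> t') \<in> ten_gens s M N r" "((i, j), t) \<in> ten_gens s M N r"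
        "((i, j), t') \<in> ten_gens s M N r"
        using add(2-) tensor_mult_closed[of t i j t'] by (simp_all add: ten_gens_iff)
      then show ?thesis
        unfolding add(1) using hom_mult[OF g(1)[OF add(2)] add(3,4)]
        by (intro hom_relator3[OF h H]) (simp_all add: hf, simp add: f_def)
    next
      case (trans i j i' j' t)
      have tr: "ten_trans M N (i, j) (i', j') \<in> hom (tensor M N i j) (tensor M N i' j')"
        using trans(4,5) by (rule ten_trans_hom(1))
      have "(\<lambda>t. g i' j' (ten_trans M N (i, j) (i', j') t)) t = g i j t"
      proof (rule tensor_hom_eq[OF M N H _ g(1)[OF trans(2)] _ trans(6)])
        show "(\<lambda>t. g i' j' (ten_trans M N (i, j) (i', j') t)) \<in> hom (tensor M N i j) H"
          using hom_compose[OF tr g(1)[OF trans(3)]] by (simp add: o_def)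
        show "g i' j' (ten_trans M N (i, j) (i', j') (tcl M N i j x y)) = g i j (tcl M N i j x y)"
          if "x \<in> el M i" "y \<in> el N j" for x y
          using that trans(2-5) balanced.trans[OF b trans(2-5) that]
          by (simp add: ten_trans_hom(2) g(2) pmod_smap_closed[OF M] pmod_smap_closed[OF N])
      qed
      moreover have "((i', j'), ten_trans M N (i, j) (i', j') t) \<in> ten_gens s M N r"
        "((i, j), t) \<in> ten_gens s M N r"
        using trans(2-) hom_in_carrier[OF tr] by (simp_all add: ten_gens_iff)
      ultimately show ?thesis
        unfolding trans(1) by (intro hom_relator[OF h H]) (simp_all add: hf, simp add: f_def)
    qed
  qed
  then obtain h where h: "h \<in> hom (presented_group (ten_gens s M N r) (ten_rels s M N r)) H"
    "\<And>p. p \<in> ten_gens s M N r \<Longrightarrow>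
      h (presented_class (ten_gens s M N r) (ten_rels s M N r) (frag_of p)) = f p" by blast
  show ?thesis
    unfolding grp_pten
  proof (intro bexI[OF _ h(1)] allI impI)
    fix i j x y assume ij: "(i, j) \<in> ten_index s r" and x: "x \<in> el M i" and y: "y \<in> el N j"
    have "((i, j), tcl M N i j x y) \<in> ten_gens s M N r"
      using ij tcl_closed[OF M N x y] by (simp add: ten_gens_iff)
    then show "h (ptau s M N r i j x y) = b i j x y"
      using h(2) g(2)[OF ij x y] by (simp add: ptau_def pcl_def f_def)
  qed
qed

end

text \<open>Covers two kinds of maps at once: structure maps, with
  \<open>\<rho> = ten_reindex s r'\<close>, and maps induced by morphisms, with
  \<open>\<rho> = id\<close>. For structure maps the two factors depend on the pair of degrees,
  hence the index argument of \<open>f\<close> and \<open>g\<close>.\<close>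

lemma presented_map_pten:
  fixes M :: "('p::preordered_ab_group_add, 'm, 'r::{ring, monoid_mult}) pmod"
    and \<rho> :: "'p \<times> 'p \<Rightarrow> 'p \<times> 'p"
  assumes M: "rmod M" and N: "lmod N" and M': "rmod M'" and N': "lmod N'"
    and idx: "\<And>i j. (i, j) \<in> ten_index s r \<Longrightarrow> \<rho> (i, j) \<in> ten_index s r'"
    and mono: "\<And>i j i' j'. \<lbrakk>(i, j) \<in> ten_index s r; (i', j') \<in> ten_index s r; i \<le> i'; j \<le> j'\<rbrakk> \<Longrightarrow>
      fst (\<rho> (i, j)) \<le> fst (\<rho> (i', j')) \<and> snd (\<rho> (i, j)) \<le> snd (\<rho> (i', j'))"
    and f: "\<And>i j. (i, j) \<in> ten_index s r \<Longrightarrow> f (i, j) \<in> hom (grp M i) (grp M' (fst (\<rho> (i, j))))"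
    and g: "\<And>i j. (i, j) \<in> ten_index s r \<Longrightarrow> g (i, j) \<in> hom (grp N j) (grp N' (snd (\<rho> (i, j))))"
    and fa: "\<And>i j a x. \<lbrakk>(i, j) \<in> ten_index s r; x \<in> el M i\<rbrakk> \<Longrightarrow>
      f (i, j) (act M i a x) = act M' (fst (\<rho> (i, j))) a (f (i, j) x)"
    and ga: "\<And>i j a x. \<lbrakk>(i, j) \<in> ten_index s r; x \<in> el N j\<rbrakk> \<Longrightarrow>
      g (i, j) (act N j a x) = act N' (snd (\<rho> (i, j))) a (g (i, j) x)"
    and fs: "\<And>i j i' j' x. \<lbrakk>(i, j) \<in> ten_index s r; (i', j') \<in> ten_index s r; i \<le> i'; j \<le> j'; x \<in> el M i\<rbrakk> \<Longrightarrow>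
      f (i', j') (smap M i i' x) = smap M' (fst (\<rho> (i, j))) (fst (\<rho> (i', j'))) (f (i, j) x)"
    and gs: "\<And>i j i' j' x. \<lbrakk>(i, j) \<in> ten_index s r; (i', j') \<in> ten_index s r; i \<le> i'; j \<le> j'; x \<in> el N j\<rbrakk> \<Longrightarrow>
      g (i', j') (smap N j j' x) = smap N' (snd (\<rho> (i, j))) (snd (\<rho> (i', j'))) (g (i, j) x)"
    and h: "h = presented_map (ten_gens s M' N' r') (ten_rels s M' N' r')
      (\<lambda>(ij, t). (\<rho> ij, tensor_map M' N' (fst (\<rho> ij)) (snd (\<rho> ij)) (f ij) (g ij) t))"
  shows "h \<in> hom (grp (pten s M N) r) (grp (pten s M' N') r')"
    and "\<lbrakk>(i, j) \<in> ten_index s r; x \<in> el M i; y \<in> el N j\<rbrakk> \<Longrightarrow> h (ptau s M N r i j x y) =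
      ptau s M' N' r' (fst (\<rho> (i, j))) (snd (\<rho> (i, j))) (f (i, j) x) (g (i, j) y)"
proof -
  define F where "F ij = tensor_map M' N' (fst (\<rho> ij)) (snd (\<rho> ij)) (f ij) (g ij)" for ij
  let ?k = "\<lambda>(ij, t). (\<rho> ij, F ij t)"
  have h: "h = presented_map (ten_gens s M' N' r') (ten_rels s M' N' r') ?k"
    using h unfolding F_def .
  have F: "F (i, j) \<in> hom (tensor M N i j) (tensor M' N' (fst (\<rho> (i, j))) (snd (\<rho> (i, j))))"
    and F_tcl: "\<And>x y. \<lbrakk>x \<in> el M i; y \<in> el N j\<rbrakk> \<Longrightarrow>
      F (i, j) (tcl M N i j x y) = tcl M' N' (fst (\<rho> (i, j))) (snd (\<rho> (i, j))) (f (i, j) x) (g (i, j) y)"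
    if ij: "(i, j) \<in> ten_index s r" for i j
    unfolding F_def
    using tensor_map_hom[OF M N M' N' f[OF ij] g[OF ij] fa[OF ij] ga[OF ij]] by blast+
  note fc = hom_in_carrier[OF f] and gc = hom_in_carrier[OF g] and Fc = hom_in_carrier[OF F]
  \<comment> \<open>\<open>F\<close> commutes with the transition maps. This is what carries a
    colimit relator to a colimit relator; both sides are additive, so pure tensors suffice.\<close>
  have F_trans: "F (i', j') (ten_trans M N (i, j) (i', j') t) = ten_trans M' N' (\<rho> (i, j)) (\<rho> (i', j')) (F (i, j) t)"
    if ij: "(i, j) \<in> ten_index s r" and ij': "(i', j') \<in> ten_index s r" and le: "i \<le> i'" "j \<le> j'"
      and t: "t \<in> carrier (tensor M N i j)" for i j i' j' t
  proof -
    note tr = ten_trans_hom[OF M N le]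
    have le': "fst (\<rho> (i, j)) \<le> fst (\<rho> (i', j'))" "snd (\<rho> (i, j)) \<le> snd (\<rho> (i', j'))"
      using mono[OF ij ij' le] by auto
    note tr' = ten_trans_hom[OF M' N' le']
    have "(\<lambda>t. F (i', j') (ten_trans M N (i, j) (i', j') t)) t =
      (\<lambda>t. ten_trans M' N' (fst (\<rho> (i, j)), snd (\<rho> (i, j))) (fst (\<rho> (i', j')), snd (\<rho> (i', j'))) (F (i, j) t)) t"
    proof (rule tensor_hom_eq[OF M N tensor_comm_group[OF M' N'] _ _ _ t])
      show "(\<lambda>t. F (i', j') (ten_trans M N (i, j) (i', j') t))
          \<in> hom (tensor M N i j) (tensor M' N' (fst (\<rho> (i', j'))) (snd (\<rho> (i', j'))))"
        using hom_compose[OF tr(1) F[OF ij']] by (simp add: o_def)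
      show "(\<lambda>t. ten_trans M' N' (fst (\<rho> (i, j)), snd (\<rho> (i, j))) (fst (\<rho> (i', j')), snd (\<rho> (i', j'))) (F (i, j) t))
          \<in> hom (tensor M N i j) (tensor M' N' (fst (\<rho> (i', j'))) (snd (\<rho> (i', j'))))"
        using hom_compose[OF F[OF ij] tr'(1)] by (simp add: o_def)
      fix x y assume xy: "x \<in> el M i" "y \<in> el N j"
      show "F (i', j') (ten_trans M N (i, j) (i', j') (tcl M N i j x y)) =
        ten_trans M' N' (fst (\<rho> (i, j)), snd (\<rho> (i, j))) (fst (\<rho> (i', j')), snd (\<rho> (i', j'))) (F (i, j) (tcl M N i j x y))"
        unfolding tr(2)[OF xy] F_tcl[OF ij xy] tr'(2)[OF fc[OF ij xy(1)] gc[OF ij xy(2)]]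
          F_tcl[OF ij' pmod_smap_closed[OF M le(1) xy(1)] pmod_smap_closed[OF N le(2) xy(2)]]
          fs[OF ij ij' le xy(1)] gs[OF ij ij' le xy(2)] ..
    qed
    then show ?thesis by simp
  qed
  note R = ten_rels_subset[OF M N, of s r] and R' = ten_rels_subset[OF M' N', of s r']
  have c: "?k p \<in> ten_gens s M' N' r'" if "p \<in> ten_gens s M N r" for p
  proof -
    obtain i j t where p: "p = ((i, j), t)" by (metis surj_pair)
    then have ij: "(i, j) \<in> ten_index s r" "t \<in> carrier (tensor M N i j)" using that by (simp_all add: ten_gens_iff)
    have "((fst (\<rho> (i, j)), snd (\<rho> (i, j))), F (i, j) t) \<in> ten_gens s M' N' r'"
      unfolding ten_gens_iff using idx[OF ij(1)] Fc[OF ij] by simp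
    then show ?thesis by (simp add: p)
  qed
  have rel: "presented_class (ten_gens s M' N' r') (ten_rels s M' N' r') (frag_extend (frag_of \<circ> ?k) \<sigma>) =
      \<one>\<^bsub>presented_group (ten_gens s M' N' r') (ten_rels s M' N' r')\<^esub>"
    if "\<sigma> \<in> ten_rels s M N r" for \<sigma>
  proof (rule presented_relator_one[OF R'])
    show "frag_extend (frag_of \<circ> ?k) \<sigma> \<in> ten_rels s M' N' r'"
      using that
    proof (cases rule: ten_rels_cases)
      case (add i j t t')
      have "frag_extend (frag_of \<circ> ?k) \<sigma> =
        frag_of ((fst (\<rho> (i, j)), snd (\<rho> (i, j))),
          F (i, j) t \<otimes>\<^bsub>tensor M' N' (fst (\<rho> (i, j))) (snd (\<rho> (i, j)))\<^esub> F (i, j) t')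
        - frag_of ((fst (\<rho> (i, j)), snd (\<rho> (i, j))), F (i, j) t)
        - frag_of ((fst (\<rho> (i, j)), snd (\<rho> (i, j))), F (i, j) t')"
        unfolding add(1) by (simp add: frag_extend_diff hom_mult[OF F[OF add(2)] add(3,4)])
      then show ?thesis
        using ten_relsI1[of "fst (\<rho> (i, j))" "snd (\<rho> (i, j))" s r' "F (i, j) t" M' N' "F (i, j) t'"]
          idx[OF add(2)] Fc[OF add(2,3)] Fc[OF add(2,4)] by simp
    next
      case (trans i j i' j' t)
      have "frag_extend (frag_of \<circ> ?k) \<sigma> =
        frag_of ((fst (\<rho> (i', j')), snd (\<rho> (i', j'))),
          ten_trans M' N' (fst (\<rho> (i, j)), snd (\<rho> (i, j))) (fst (\<rho> (i', j')), snd (\<rho> (i', j'))) (F (i, j) t))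
        - frag_of ((fst (\<rho> (i, j)), snd (\<rho> (i, j))), F (i, j) t)"
        unfolding trans(1) by (simp add: frag_extend_diff F_trans[OF trans(2-6)])
      then show ?thesis
        using ten_relsI2[of "fst (\<rho> (i, j))" "snd (\<rho> (i, j))" s r' "fst (\<rho> (i', j'))" "snd (\<rho> (i', j'))" "F (i, j) t" M' N']
          idx[OF trans(2)] idx[OF trans(3)] Fc[OF trans(2,6)] mono[OF trans(2-5)] by simp
    qed
  qed
  show "h \<in> hom (grp (pten s M N) r) (grp (pten s M' N') r')"
    unfolding h grp_pten
    by (rule presented_map_hom(1)[OF R R']) (fact c, fact rel)
  assume ij: "(i, j) \<in> ten_index s r" and xy: "x \<in> el M i" "y \<in> el N j"
  have mem: "((i, j), tcl M N i j x y) \<in> ten_gens s M N r"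
    using ij tcl_closed[OF M N xy] by (simp add: ten_gens_iff)
  have "presented_map (ten_gens s M' N' r') (ten_rels s M' N' r') ?k
      (presented_class (ten_gens s M N r) (ten_rels s M N r) (frag_of ((i, j), tcl M N i j x y))) =
    presented_class (ten_gens s M' N' r') (ten_rels s M' N' r') (frag_of (?k ((i, j), tcl M N i j x y)))"
    by (rule presented_map_hom(2)[OF R R']) (fact c, fact rel, fact mem)
  then show "h (ptau s M N r i j x y) =
      ptau s M' N' r' (fst (\<rho> (i, j))) (snd (\<rho> (i, j))) (f (i, j) x) (g (i, j) y)"
    unfolding h ptau_def pcl_def by (simp add: F_tcl[OF ij xy])
qed

lemma pten_map_hom:
  fixes M :: "('p::preordered_ab_group_add, 'm, 'r::{ring, monoid_mult}) pmod"
  assumes M: "rmod M" and N: "lmod N" and M': "rmod M'" and N': "lmod N'"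
    and f: "pmod_hom M M' f" and g: "pmod_hom N N' g"
  shows "pten_map s M' N' f g r \<in> hom (grp (pten s M N) r) (grp (pten s M' N') r)"
    and "\<lbrakk>(i, j) \<in> ten_index s r; x \<in> el M i; y \<in> el N j\<rbrakk> \<Longrightarrow>
      pten_map s M' N' f g r (ptau s M N r i j x y) = ptau s M' N' r i j (f i x) (g j y)"
proof -
  have h: "pten_map s M' N' f g r = presented_map (ten_gens s M' N' r) (ten_rels s M' N' r)
      (\<lambda>(ij, t). (id ij, tensor_map M' N' (fst (id ij)) (snd (id ij)) ((f \<circ> fst) ij) ((g \<circ> snd) ij) t))"
    unfolding pten_map_def by (rule arg_cong[where f = "presented_map _ _"]) (auto simp: fun_eq_iff)
  note * = presented_map_pten[OF M N M' N' _ _ _ _ _ _ _ _ h, of r]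
  show "pten_map s M' N' f g r \<in> hom (grp (pten s M N) r) (grp (pten s M' N') r)"
    by (rule *(1)) (simp_all add: pmod_hom_hom[OF f] pmod_hom_hom[OF g] pmod_hom_act[OF f] pmod_hom_act[OF g]
      pmod_hom_smap[OF f] pmod_hom_smap[OF g])
  assume "(i, j) \<in> ten_index s r" "x \<in> el M i" "y \<in> el N j"
  then have "pten_map s M' N' f g r (ptau s M N r i j x y) =
      ptau s M' N' r (fst (id (i, j))) (snd (id (i, j))) ((f \<circ> fst) (i, j) x) ((g \<circ> snd) (i, j) y)"
    by (intro *(2)) (simp_all add: pmod_hom_hom[OF f] pmod_hom_hom[OF g] pmod_hom_act[OF f] pmod_hom_act[OF g]
      pmod_hom_smap[OF f] pmod_hom_smap[OF g])
  then show "pten_map s M' N' f g r (ptau s M N r i j x y) = ptau s M' N' r i j (f i x) (g j y)"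
    by simp
qed

lemma ten_reindex_index:
  fixes r :: "'p::preordered_ab_group_add"
  assumes "r \<le> r'" "(i, j) \<in> ten_index s r"
  shows "ten_reindex s r' (i, j) \<in> ten_index s r'"
    and "i \<le> fst (ten_reindex s r' (i, j))" and "j \<le> snd (ten_reindex s r' (i, j))"
  using assms by (cases s; auto intro: order_trans)+

lemma ten_reindex_mono:
  fixes i :: "'p::preordered_ab_group_add"
  assumes "i \<le> i'" "j \<le> j'"
  shows "fst (ten_reindex s r (i, j)) \<le> fst (ten_reindex s r (i', j'))
    \<and> snd (ten_reindex s r (i, j)) \<le> snd (ten_reindex s r (i', j'))"
  using assms by (cases s) auto

lemma pten_smap_hom:
  fixes M :: "('p::preordered_ab_group_add, 'm, 'r::{ring, monoid_mult}) pmod"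
  assumes M: "rmod M" and N: "lmod N" and le: "r \<le> r'"
  shows "smap (pten s M N) r r' \<in> hom (grp (pten s M N) r) (grp (pten s M N) r')"
    and "\<lbrakk>(i, j) \<in> ten_index s r; x \<in> el M i; y \<in> el N j\<rbrakk> \<Longrightarrow>
      smap (pten s M N) r r' (ptau s M N r i j x y) =
      ptau s M N r' (fst (ten_reindex s r' (i, j))) (snd (ten_reindex s r' (i, j)))
        (smap M i (fst (ten_reindex s r' (i, j))) x) (smap N j (snd (ten_reindex s r' (i, j))) y)"
proof -
  let ?\<rho> = "ten_reindex s r'"
  let ?f = "\<lambda>ij. smap M (fst ij) (fst (?\<rho> ij))" and ?g = "\<lambda>ij. smap N (snd ij) (snd (?\<rho> ij))"
  have h: "smap (pten s M N) r r' = presented_map (ten_gens s M N r') (ten_rels s M N r')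
      (\<lambda>(ij, t). (?\<rho> ij, tensor_map M N (fst (?\<rho> ij)) (snd (?\<rho> ij)) (?f ij) (?g ij) t))"
    unfolding pten_def ten_trans_def pers.simps
    by (rule arg_cong[where f = "presented_map _ _"]) (auto simp: fun_eq_iff split: prod.split)
  note idx = ten_reindex_index[OF le]
  note * = presented_map_pten[OF M N M N idx(1) ten_reindex_mono _ _ _ _ _ _ h]
  have fs: "smap M i' (fst (?\<rho> (i', j'))) (smap M i i' x) =
      smap M (fst (?\<rho> (i, j))) (fst (?\<rho> (i', j'))) (smap M i (fst (?\<rho> (i, j))) x)"
    if "(i, j) \<in> ten_index s r" "(i', j') \<in> ten_index s r" "i \<le> i'" "j \<le> j'" "x \<in> el M i" for i j i' j' x
    using that idx(2)[OF that(1)] idx(2)[OF that(2)] ten_reindex_mono[OF that(3,4), of s r']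
    by (simp add: pmod_smap_comp[OF M])
  have gs: "smap N j' (snd (?\<rho> (i', j'))) (smap N j j' x) =
      smap N (snd (?\<rho> (i, j))) (snd (?\<rho> (i', j'))) (smap N j (snd (?\<rho> (i, j))) x)"
    if "(i, j) \<in> ten_index s r" "(i', j') \<in> ten_index s r" "i \<le> i'" "j \<le> j'" "x \<in> el N j" for i j i' j' x
    using that idx(3)[OF that(1)] idx(3)[OF that(2)] ten_reindex_mono[OF that(3,4), of s r']
    by (simp add: pmod_smap_comp[OF N])
  show "smap (pten s M N) r r' \<in> hom (grp (pten s M N) r) (grp (pten s M N) r')"
    by (rule *(1)) (simp_all add: pmod_smap_hom[OF M] pmod_smap_hom[OF N] idx(2,3)
      pmod_act_smap[OF M] pmod_act_smap[OF N] fs gs)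
  assume "(i, j) \<in> ten_index s r" "x \<in> el M i" "y \<in> el N j"
  then have "smap (pten s M N) r r' (ptau s M N r i j x y) =
      ptau s M N r' (fst (?\<rho> (i, j))) (snd (?\<rho> (i, j))) (?f (i, j) x) (?g (i, j) y)"
    by (intro *(2)) (simp_all add: pmod_smap_hom[OF M] pmod_smap_hom[OF N] idx(2,3)
      pmod_act_smap[OF M] pmod_act_smap[OF N] fs gs)
  then show "smap (pten s M N) r r' (ptau s M N r i j x y) =
      ptau s M N r' (fst (?\<rho> (i, j))) (snd (?\<rho> (i, j)))
        (smap M i (fst (?\<rho> (i, j))) x) (smap N j (snd (?\<rho> (i, j))) y)" by simp
qed

lemma hom_compose': "\<lbrakk>h \<in> hom G H; k \<in> hom H K\<rbrakk> \<Longrightarrow> (\<lambda>x. k (h x)) \<in> hom G K"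
  using hom_compose[of h G H k K] by (simp add: o_def)

lemma id_hom: "(\<lambda>x. x) \<in> hom G G"
  by (simp add: hom_def)

lemma pten_persistence_group:
  fixes M :: "('p::preordered_ab_group_add, 'm, 'r::{ring, monoid_mult}) pmod"
  assumes M: "rmod M" and N: "lmod N"
  shows "persistence_group (pten s M N)"
proof (rule persistence_group.intro)
  note grp = comm_group_group[OF pten_comm_group[OF M N]]
  show "comm_group (grp (pten s M N) a)" for a by (rule pten_comm_group[OF M N])
  show "smap (pten s M N) a b \<in> hom (grp (pten s M N) a) (grp (pten s M N) b)" if "a \<le> b" for a b
    by (rule pten_smap_hom(1)[OF M N that])
  show "smap (pten s M N) a a t = t" if "t \<in> el (pten s M N) a" for t a
  proof (rule pten_hom_eq[OF M N grp pten_smap_hom(1)[OF M N order_refl] id_hom _ that])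
    fix i j x y assume ij: "(i, j) \<in> ten_index s a" "x \<in> el M i" "y \<in> el N j"
    have "ten_reindex s a (i, j) = (i, j)" using ij(1) by (cases s) auto
    then show "smap (pten s M N) a a (ptau s M N a i j x y) = ptau s M N a i j x y"
      using pten_smap_hom(2)[OF M N order_refl ij] pmod_smap_id[OF M ij(2)] pmod_smap_id[OF N ij(3)] by simp
  qed
  show "smap (pten s M N) b c (smap (pten s M N) a b t) = smap (pten s M N) a c t"
    if ab: "a \<le> b" and bc: "b \<le> c" and t: "t \<in> el (pten s M N) a" for a b c t
  proof (rule pten_hom_eq[OF M N grp _ _ _ t])
    note ac = order_trans[OF ab bc]
    show "(\<lambda>t. smap (pten s M N) b c (smap (pten s M N) a b t)) \<in> hom (grp (pten s M N) a) (grp (pten s M N) c)"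
      by (rule hom_compose'[OF pten_smap_hom(1)[OF M N ab] pten_smap_hom(1)[OF M N bc]])
    show "smap (pten s M N) a c \<in> hom (grp (pten s M N) a) (grp (pten s M N) c)"
      by (rule pten_smap_hom(1)[OF M N ac])
    fix i j x y assume ij: "(i, j) \<in> ten_index s a" "x \<in> el M i" "y \<in> el N j"
    obtain k l where kl: "ten_reindex s b (i, j) = (k, l)" by (metis surj_pair)
    have kl': "(k, l) \<in> ten_index s b" "i \<le> k" "j \<le> l"
      using ten_reindex_index[OF ab ij(1)] kl by auto
    \<comment> \<open>\<open>Sh\<close> reindexes to a pair that depends on the final degree only,
      and \<open>Gr\<close> leaves pairs unchanged, so reindexing in two steps agrees with
      reindexing in one.\<close>
    have re: "ten_reindex s c (k, l) = ten_reindex s c (i, j)" using kl by (cases s) auto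
    have "k \<le> fst (ten_reindex s c (i, j))" "l \<le> snd (ten_reindex s c (i, j))"
      using ten_reindex_index[OF bc kl'(1)] re by auto
    then show "smap (pten s M N) b c (smap (pten s M N) a b (ptau s M N a i j x y)) =
        smap (pten s M N) a c (ptau s M N a i j x y)"
      using pten_smap_hom(2)[OF M N ab ij] kl kl' ij re
      by (simp add: pten_smap_hom(2)[OF M N bc] pten_smap_hom(2)[OF M N ac] pmod_smap_closed[OF M]
        pmod_smap_closed[OF N] pmod_smap_comp[OF M] pmod_smap_comp[OF N])
  qed
qed

lemma pten_map_pers_hom:
  fixes M :: "('p::preordered_ab_group_add, 'm, 'r::{ring, monoid_mult}) pmod"
  assumes M: "rmod M" and N: "lmod N" and M': "rmod M'" and N': "lmod N'"
    and f: "pmod_hom M M' f" and g: "pmod_hom N N' g"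
  shows "pers_hom (pten s M N) (pten s M' N') (pten_map s M' N' f g)"
  unfolding pers_hom_def
proof (intro conjI allI impI ballI)
  note mh = pten_map_hom[OF M N M' N' f g]
  show "pten_map s M' N' f g a \<in> hom (grp (pten s M N) a) (grp (pten s M' N') a)" for a by (rule mh(1))
  fix a b t assume ab: "a \<le> b" and t: "t \<in> el (pten s M N) a"
  show "pten_map s M' N' f g b (smap (pten s M N) a b t) = smap (pten s M' N') a b (pten_map s M' N' f g a t)"
  proof (rule pten_hom_eq[OF M N comm_group_group[OF pten_comm_group[OF M' N']] _ _ _ t])
    show "(\<lambda>t. pten_map s M' N' f g b (smap (pten s M N) a b t)) \<in> hom (grp (pten s M N) a) (grp (pten s M' N') b)"
      by (rule hom_compose'[OF pten_smap_hom(1)[OF M N ab] mh(1)])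
    show "(\<lambda>t. smap (pten s M' N') a b (pten_map s M' N' f g a t)) \<in> hom (grp (pten s M N) a) (grp (pten s M' N') b)"
      by (rule hom_compose'[OF mh(1) pten_smap_hom(1)[OF M' N' ab]])
    fix i j x y assume ij: "(i, j) \<in> ten_index s a" "x \<in> el M i" "y \<in> el N j"
    obtain k l where kl: "ten_reindex s b (i, j) = (k, l)" by (metis surj_pair)
    have kl': "(k, l) \<in> ten_index s b" "i \<le> k" "j \<le> l"
      using ten_reindex_index[OF ab ij(1)] kl by auto
    show "pten_map s M' N' f g b (smap (pten s M N) a b (ptau s M N a i j x y)) =
        smap (pten s M' N') a b (pten_map s M' N' f g a (ptau s M N a i j x y))"
      using ij kl kl' by (simp add: pten_smap_hom(2)[OF M N ab] pten_smap_hom(2)[OF M' N' ab] mh(2)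
        pmod_smap_closed[OF M] pmod_smap_closed[OF N] pmod_hom_closed[OF f] pmod_hom_closed[OF g]
        pmod_hom_smap[OF f] pmod_hom_smap[OF g])
  qed
qed

text \<open>The source of all commuting diagrams in the chases. The two factors are compared
  separately and only on carriers; pure tensors do the rest.\<close>

lemma pten_map_square:
  fixes M :: "('p::preordered_ab_group_add, 'm, 'r::{ring, monoid_mult}) pmod"
  assumes M: "rmod M" and N: "lmod N" and M1: "rmod M1" and N1: "lmod N1"
    and M2: "rmod M2" and N2: "lmod N2" and M': "rmod M'" and N': "lmod N'"
    and f1: "pmod_hom M M1 f1" and g1: "pmod_hom N N1 g1" and f2: "pmod_hom M M2 f2" and g2: "pmod_hom N N2 g2"
    and f1': "pmod_hom M1 M' f1'" and g1': "pmod_hom N1 N' g1'"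
    and f2': "pmod_hom M2 M' f2'" and g2': "pmod_hom N2 N' g2'"
    and f: "\<And>a x. x \<in> el M a \<Longrightarrow> f1' a (f1 a x) = f2' a (f2 a x)"
    and g: "\<And>a x. x \<in> el N a \<Longrightarrow> g1' a (g1 a x) = g2' a (g2 a x)"
    and t: "t \<in> el (pten s M N) r"
  shows "pten_map s M' N' f1' g1' r (pten_map s M1 N1 f1 g1 r t) =
    pten_map s M' N' f2' g2' r (pten_map s M2 N2 f2 g2 r t)"
proof (rule pten_hom_eq[OF M N comm_group_group[OF pten_comm_group[OF M' N']] _ _ _ t])
  note m1 = pten_map_hom[OF M N M1 N1 f1 g1] and m1' = pten_map_hom[OF M1 N1 M' N' f1' g1']
    and m2 = pten_map_hom[OF M N M2 N2 f2 g2] and m2' = pten_map_hom[OF M2 N2 M' N' f2' g2']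
  show "(\<lambda>t. pten_map s M' N' f1' g1' r (pten_map s M1 N1 f1 g1 r t)) \<in> hom (grp (pten s M N) r) (grp (pten s M' N') r)"
    by (rule hom_compose'[OF m1(1) m1'(1)])
  show "(\<lambda>t. pten_map s M' N' f2' g2' r (pten_map s M2 N2 f2 g2 r t)) \<in> hom (grp (pten s M N) r) (grp (pten s M' N') r)"
    by (rule hom_compose'[OF m2(1) m2'(1)])
qed (simp add: pten_map_hom(2)[OF M N M1 N1 f1 g1] pten_map_hom(2)[OF M1 N1 M' N' f1' g1']
   pten_map_hom(2)[OF M N M2 N2 f2 g2] pten_map_hom(2)[OF M2 N2 M' N' f2' g2'] f g
   pmod_hom_closed[OF f1] pmod_hom_closed[OF g1] pmod_hom_closed[OF f2] pmod_hom_closed[OF g2])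

lemma pmod_hom_id: "pmod_hom M M (\<lambda>_ x. x)"
  by (simp add: pmod_hom_def pers_hom_def id_hom)

lemma pten_map_id:
  assumes M: "rmod M" and N: "lmod N" and t: "t \<in> el (pten s M N) r"
  shows "pten_map s M N (\<lambda>_ x. x) (\<lambda>_ x. x) r t = t"
  by (rule pten_hom_eq[OF M N comm_group_group[OF pten_comm_group[OF M N]] pten_map_hom(1)[OF M N M N pmod_hom_id pmod_hom_id] id_hom _ t])
    (simp add: pten_map_hom(2)[OF M N M N pmod_hom_id pmod_hom_id])

text \<open>A triangle is a square with an identity as one of its edges.\<close>

lemma pten_map_comp:
  fixes M :: "('p::preordered_ab_group_add, 'm, 'r::{ring, monoid_mult}) pmod"
  assumes M: "rmod M" and N: "lmod N" and M1: "rmod M1" and N1: "lmod N1" and M': "rmod M'" and N': "lmod N'"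
    and f1: "pmod_hom M M1 f1" and g1: "pmod_hom N N1 g1"
    and f1': "pmod_hom M1 M' f1'" and g1': "pmod_hom N1 N' g1'"
    and f2: "pmod_hom M M' f2" and g2: "pmod_hom N N' g2"
    and f: "\<And>a x. x \<in> el M a \<Longrightarrow> f1' a (f1 a x) = f2 a x"
    and g: "\<And>a x. x \<in> el N a \<Longrightarrow> g1' a (g1 a x) = g2 a x"
    and t: "t \<in> el (pten s M N) r"
  shows "pten_map s M' N' f1' g1' r (pten_map s M1 N1 f1 g1 r t) = pten_map s M' N' f2 g2 r t"
  using pten_map_square[OF M N M1 N1 M' N' M' N' f1 g1 f2 g2 f1' g1' pmod_hom_id pmod_hom_id f g t]
    pten_map_id[OF M' N' hom_in_carrier[OF pten_map_hom(1)[OF M N M' N' f2 g2] t]] by simp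

section \<open>Right exactness\<close>

text \<open>The functor of two variables is symmetric up to exchanging left and right modules.  The
  universal property is therefore recorded without mentioning sides, so that each statement about
  one variable also gives the one about the other.  The first argument is the type in which
  targets are allowed to live.\<close>

definition tensor_at ::
  "'c itself \<Rightarrow> tensor_kind \<Rightarrow> 'p::preordered_ab_group_add \<Rightarrow> ('p, 'm, 'r::{ring, monoid_mult}) pmod
    \<Rightarrow> ('p, 'n, 'r) pmod \<Rightarrow> 'g monoid \<Rightarrow> ('p \<Rightarrow> 'p \<Rightarrow> 'm \<Rightarrow> 'n \<Rightarrow> 'g) \<Rightarrow> bool" where
  "tensor_at _ s r M N G \<tau> \<longleftrightarrow> comm_group G \<and> balanced s r M N G \<tau> \<and>
    (\<forall>T. subgroup T G \<longrightarrow>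
      (\<forall>i j x y. (i, j) \<in> ten_index s r \<longrightarrow> x \<in> el M i \<longrightarrow> y \<in> el N j \<longrightarrow> \<tau> i j x y \<in> T) \<longrightarrow>
      carrier G \<subseteq> T) \<and>
    (\<forall>(H :: 'c monoid) b. comm_group H \<longrightarrow> balanced s r M N H b \<longrightarrow>
      (\<exists>h\<in>hom G H. \<forall>i j x y. (i, j) \<in> ten_index s r \<longrightarrow> x \<in> el M i \<longrightarrow> y \<in> el N j \<longrightarrow>
        h (\<tau> i j x y) = b i j x y))"

lemma pten_tensor_at:
  assumes "rmod M" "lmod N"
  shows "tensor_at TYPE('c) s r M N (grp (pten s M N) r) (ptau s M N r)"
  unfolding tensor_at_def
proof (intro conjI allI impI)
  show "el (pten s M N) r \<subseteq> T" if "subgroup T (grp (pten s M N) r)"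
    "\<forall>i j x y. (i, j) \<in> ten_index s r \<longrightarrow> x \<in> el M i \<longrightarrow> y \<in> el N j \<longrightarrow> ptau s M N r i j x y \<in> T" for T
    by (rule pten_generated[OF assms that(1)]) (use that(2) in blast)
qed (fact pten_comm_group[OF assms] ptau_balanced[OF assms] pten_universal[OF assms])+

context
  fixes c :: "'c itself" and s r and M :: "('p::preordered_ab_group_add, 'm, 'r::{ring, monoid_mult}) pmod"
    and N :: "('p, 'n, 'r) pmod" and G :: "'g monoid" and \<tau>
  assumes at: "tensor_at c s r M N G \<tau>"
begin

lemma tensor_at_comm_group: "comm_group G"
  by (rule conjunct1[OF at[unfolded tensor_at_def]])

lemma tensor_at_balanced: "balanced s r M N G \<tau>"
  by (rule conjunct1[OF conjunct2[OF at[unfolded tensor_at_def]]])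

lemma tensor_at_generated:
  assumes T: "subgroup T G"
    and gen: "\<And>i j x y. \<lbrakk>(i, j) \<in> ten_index s r; x \<in> el M i; y \<in> el N j\<rbrakk> \<Longrightarrow> \<tau> i j x y \<in> T"
  shows "carrier G \<subseteq> T"
  by (rule conjunct1[OF conjunct2[OF conjunct2[OF at[unfolded tensor_at_def]]], rule_format])
    (fact T, fact gen)

lemma tensor_at_universal:
  fixes H :: "'c monoid"
  assumes H: "comm_group H" and b: "balanced s r M N H b"
  shows "\<exists>h\<in>hom G H. \<forall>i j x y. (i, j) \<in> ten_index s r \<longrightarrow> x \<in> el M i \<longrightarrow> y \<in> el N j \<longrightarrow>
        h (\<tau> i j x y) = b i j x y"
  by (rule conjunct2[OF conjunct2[OF conjunct2[OF at[unfolded tensor_at_def]]], rule_format])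
    (fact H, fact b)

end

lemma ten_index_swap: "(i, j) \<in> ten_index s r \<longleftrightarrow> (j, i) \<in> ten_index s r"
  by (cases s) (auto simp: add.commute)

lemma balanced_swap:
  assumes "balanced s r M N H b"
  shows "balanced s r N M H (\<lambda>i j x y. b j i y x)"
proof -
  interpret balanced s r M N H b by fact
  show ?thesis
  proof (rule balanced.intro)
    fix i j x y assume "(i, j) \<in> ten_index s r" and x: "x \<in> el N i" and y: "y \<in> el M j"
    then have ji: "(j, i) \<in> ten_index s r" using ten_index_swap by blast
    show "b j i y x \<in> carrier H" by (rule closed[OF ji y x])
    show "b j i y (x \<otimes>\<^bsub>grp N i\<^esub> x') = b j i y x \<otimes>\<^bsub>H\<^esub> b j i y x'" if "x' \<in> el N i" for x'
      by (rule right[OF ji y x that])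
    show "b j i (y \<otimes>\<^bsub>grp M j\<^esub> y') x = b j i y x \<otimes>\<^bsub>H\<^esub> b j i y' x" if "y' \<in> el M j" for y'
      by (rule left[OF ji y that x])
    show "b j i y (act N i a x) = b j i (act M j a y) x" for a
      by (rule act[OF ji y x, symmetric])
    show "b j' i' (smap M j j' y) (smap N i i' x) = b j i y x"
      if "(i', j') \<in> ten_index s r" "i \<le> i'" "j \<le> j'" for i' j'
      using trans[OF ji _ that(3,2) y x] that(1) ten_index_swap by blast
  qed
qed

lemma tensor_at_swap:
  assumes "tensor_at TYPE('c) s r M N G \<tau>"
  shows "tensor_at TYPE('c) s r N M G (\<lambda>i j x y. \<tau> j i y x)"
  unfolding tensor_at_def
proof (intro conjI allI impI)
  show "comm_group G" by (rule tensor_at_comm_group[OF assms])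
  show "balanced s r N M G (\<lambda>i j x y. \<tau> j i y x)" by (rule balanced_swap[OF tensor_at_balanced[OF assms]])
  show "carrier G \<subseteq> T" if "subgroup T G"
    and gen: "\<forall>i j x y. (i, j) \<in> ten_index s r \<longrightarrow> x \<in> el N i \<longrightarrow> y \<in> el M j \<longrightarrow> \<tau> j i y x \<in> T" for T
  proof (rule tensor_at_generated[OF assms that(1)])
    fix i j x y assume ij: "(i, j) \<in> ten_index s r" and "x \<in> el M i" "y \<in> el N j"
    then show "\<tau> i j x y \<in> T"
      using gen[rule_format, OF ten_index_swap[THEN iffD1, OF ij]] by blast
  qed
  show "\<exists>h\<in>hom G H. \<forall>i j x y. (i, j) \<in> ten_index s r \<longrightarrow> x \<in> el N i \<longrightarrow> y \<in> el M j \<longrightarrow>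
        h (\<tau> j i y x) = b i j x y"
    if H: "comm_group H" and b: "balanced s r N M H b" for H :: "'c monoid" and b
  proof -
    obtain h where h: "h \<in> hom G H"
      "\<forall>i j x y. (i, j) \<in> ten_index s r \<longrightarrow> x \<in> el M i \<longrightarrow> y \<in> el N j \<longrightarrow> h (\<tau> i j x y) = b j i y x"
      using tensor_at_universal[OF assms H balanced_swap[OF b]] by (rule bexE)
    show ?thesis
    proof (rule bexI[OF _ h(1)], intro allI impI)
      fix i j x y assume ij: "(i, j) \<in> ten_index s r" and "x \<in> el N i" "y \<in> el M j"
      then show "h (\<tau> j i y x) = b i j x y"
        using h(2)[rule_format, OF ten_index_swap[THEN iffD1, OF ij]] by blast
    qed
  qed
qed

lemma tensor_at_hom_eq:
  assumes at: "tensor_at c s r M N G \<tau>" and "group H" "h \<in> hom G H" "k \<in> hom G H"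
    and eq: "\<And>i j x y. \<lbrakk>(i, j) \<in> ten_index s r; x \<in> el M i; y \<in> el N j\<rbrakk> \<Longrightarrow> h (\<tau> i j x y) = k (\<tau> i j x y)"
    and t: "t \<in> carrier G"
  shows "h t = k t"
proof -
  have "carrier G \<subseteq> {t \<in> carrier G. h t = k t}"
    using eq balanced.closed[OF tensor_at_balanced[OF at]]
    by (intro tensor_at_generated[OF at]
        equalizer_subgroup[OF comm_group_group[OF tensor_at_comm_group[OF at]] assms(2-4)]) auto
  then show ?thesis using t by blast
qed

text \<open>Elements of \<open>W\<close> are lifted to \<open>Y\<close>. Two lifts differ by an
  element killed by \<open>g\<close>, whose pure tensors lie in \<open>T\<close>, so lifting defines
  a balanced family with values in \<open>GY Mod T\<close>. The resulting \<open>k\<close> on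
  \<open>GW\<close> satisfies: \<open>k\<close> after \<open>h\<close> is the quotient map, hence
  \<open>h t\<close> trivial forces \<open>t\<close> into \<open>T\<close>. The target type of
  \<open>atW\<close> is \<open>'g set\<close> because cosets of \<open>T\<close> live there.\<close>

lemma tensor_at_right_exact:
  fixes GY :: "'g monoid" and GW :: "'h monoid"
  assumes M: "persistence_module sdM M" and Y: "persistence_module sd Y" and W: "persistence_module sd W"
    and atY: "tensor_at (c :: 'd itself) s r M Y GY \<tau>Y" and atW: "tensor_at TYPE('g set) s r M W GW \<tau>W"
    and g: "pmod_hom Y W g" and surj: "pers_surj Y W g"
    and h: "h \<in> hom GY GW"
    and h\<tau>: "\<And>i j x y. \<lbrakk>(i, j) \<in> ten_index s r; x \<in> el M i; y \<in> el Y j\<rbrakk> \<Longrightarrow> h (\<tau>Y i j x y) = \<tau>W i j x (g j y)"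
    and T: "subgroup T GY"
    and ker: "\<And>i j x y. \<lbrakk>(i, j) \<in> ten_index s r; x \<in> el M i; y \<in> el Y j; g j y = \<one>\<^bsub>grp W j\<^esub>\<rbrakk> \<Longrightarrow> \<tau>Y i j x y \<in> T"
    and t: "t \<in> carrier GY" and ht: "h t = \<one>\<^bsub>GW\<^esub>"
  shows "t \<in> T"
proof -
  note GY = tensor_at_comm_group[OF atY] and bY = tensor_at_balanced[OF atY]
    and GW = tensor_at_comm_group[OF atW]
  interpret bY: balanced s r M Y GY \<tau>Y by fact
  let ?H = "GY Mod T"
  note H = comm_group.abelian_FactGroup[OF GY T] and q = quotient_hom[OF GY T]
  \<comment> \<open>\<open>inv_into\<close> picks one lift; \<open>star\<close> shows that every
    other lift gives the same coset.\<close>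
  define b where "b i j x w = T #>\<^bsub>GY\<^esub> \<tau>Y i j x (inv_into (el Y j) (g j) w)" for i j x w
  have star: "b i j x (g j y) = T #>\<^bsub>GY\<^esub> \<tau>Y i j x y"
    if ij: "(i, j) \<in> ten_index s r" and x: "x \<in> el M i" and y: "y \<in> el Y j" for i j x y
  proof -
    interpret Yj: comm_group "grp Y j" using Y by (rule pmod_comm_group)
    interpret Wj: comm_group "grp W j" using W by (rule pmod_comm_group)
    let ?y = "inv_into (el Y j) (g j) (g j y)"
    let ?z = "y \<otimes>\<^bsub>grp Y j\<^esub> inv\<^bsub>grp Y j\<^esub> ?y"
    have y': "?y \<in> el Y j" "g j ?y = g j y"
      using y by (auto intro: inv_into_into f_inv_into_f)
    have z: "?z \<in> el Y j" using y y' by simp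
    have "g j ?z = \<one>\<^bsub>grp W j\<^esub>"
      using y y' pmod_hom_closed[OF g y]
      by (simp add: hom_mult[OF pmod_hom_hom[OF g]] hom_inverse[OF pmod_hom_hom[OF g] Yj.group_axioms Wj.group_axioms])
    then have zT: "\<tau>Y i j x ?z \<in> T" using ker[OF ij x z] by simp
    have "?z \<otimes>\<^bsub>grp Y j\<^esub> ?y = y" using y y' by (simp add: Yj.m_assoc)
    with bY.right[OF ij x z y'(1)] have "\<tau>Y i j x y = \<tau>Y i j x ?z \<otimes>\<^bsub>GY\<^esub> \<tau>Y i j x ?y"
      by metis
    then show ?thesis
      unfolding b_def using coset_eq[OF GY T bY.closed[OF ij x y'(1)] zT] by simp
  qed
  have ex: "\<exists>y\<in>el Y j. w = g j y" if "w \<in> el W j" for j w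
    using surj that unfolding pers_surj_def by blast
  have qc: "T #>\<^bsub>GY\<^esub> t \<in> carrier ?H" if "t \<in> carrier GY" for t
    using hom_in_carrier[OF q that] by simp
  have qm: "T #>\<^bsub>GY\<^esub> (t \<otimes>\<^bsub>GY\<^esub> t') = (T #>\<^bsub>GY\<^esub> t) \<otimes>\<^bsub>?H\<^esub> (T #>\<^bsub>GY\<^esub> t')"
    if "t \<in> carrier GY" "t' \<in> carrier GY" for t t'
    using hom_mult[OF q that] by simp
  have bal: "balanced s r M W ?H b"
  proof (rule balanced.intro)
    fix i j x w assume ij: "(i, j) \<in> ten_index s r" and x: "x \<in> el M i" and "w \<in> el W j"
    then obtain y where y: "y \<in> el Y j" and w: "w = g j y" using ex by blast
    show "b i j x w \<in> carrier ?H" unfolding w star[OF ij x y] by (rule qc[OF bY.closed[OF ij x y]])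
    show "b i j (x \<otimes>\<^bsub>grp M i\<^esub> x') w = b i j x w \<otimes>\<^bsub>?H\<^esub> b i j x' w" if "x' \<in> el M i" for x'
      unfolding w star[OF ij x y] star[OF ij that y] star[OF ij pmod_mult_closed[OF M x that] y]
      by (simp add: bY.left[OF ij x that y] qm bY.closed[OF ij _ y] x that del: mult_FactGroup)
    show "b i j x (w \<otimes>\<^bsub>grp W j\<^esub> w') = b i j x w \<otimes>\<^bsub>?H\<^esub> b i j x w'" if w'j: "w' \<in> el W j" for w'
    proof -
      obtain y' where y': "y' \<in> el Y j" and w': "w' = g j y'" using ex[OF w'j] by blast
      have "b i j x (w \<otimes>\<^bsub>grp W j\<^esub> w') = T #>\<^bsub>GY\<^esub> \<tau>Y i j x (y \<otimes>\<^bsub>grp Y j\<^esub> y')"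
        unfolding w w' hom_mult[OF pmod_hom_hom[OF g] y y', symmetric]
        by (rule star[OF ij x pmod_mult_closed[OF Y y y']])
      then show ?thesis
        unfolding w w' star[OF ij x y] star[OF ij x y'] bY.right[OF ij x y y']
        by (simp add: qm bY.closed[OF ij x] y y' del: mult_FactGroup)
    qed
    show "b i j (act M i a x) w = b i j x (act W j a w)" for a
      unfolding w pmod_hom_act[OF g y, symmetric] star[OF ij x pmod_act_closed[OF Y y]]
        star[OF ij pmod_act_closed[OF M x] y] bY.act[OF ij x y] ..
    show "b i' j' (smap M i i' x) (smap W j j' w) = b i j x w"
      if ij': "(i', j') \<in> ten_index s r" and le: "i \<le> i'" "j \<le> j'" for i' j'
      unfolding w pmod_hom_smap[OF g le(2) y, symmetric] star[OF ij x y]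
        star[OF ij' pmod_smap_closed[OF M le(1) x] pmod_smap_closed[OF Y le(2) y]] bY.trans[OF ij ij' le x y] ..
  qed
  obtain k where k: "k \<in> hom GW ?H"
    "\<forall>i j x w. (i, j) \<in> ten_index s r \<longrightarrow> x \<in> el M i \<longrightarrow> w \<in> el W j \<longrightarrow> k (\<tau>W i j x w) = b i j x w"
    using tensor_at_universal[OF atW H bal] by (rule bexE)
  have "k (h t) = T #>\<^bsub>GY\<^esub> t"
  proof (rule tensor_at_hom_eq[OF atY comm_group_group[OF H] hom_compose'[OF h k(1)] q _ t])
    fix i j x y assume *: "(i, j) \<in> ten_index s r" "x \<in> el M i" "y \<in> el Y j"
    then show "k (h (\<tau>Y i j x y)) = T #>\<^bsub>GY\<^esub> \<tau>Y i j x y"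
      using h\<tau>[OF *] k(2)[rule_format, OF *(1,2) pmod_hom_closed[OF g *(3)]] star[OF *] by simp
  qed
  moreover have "k (h t) = T"
    using hom_one[OF k(1)] ht GW H by (simp add: comm_group_group)
  ultimately show ?thesis using coset_eq_one_iff[OF GY T t] by simp
qed

context
  fixes M :: "('p::preordered_ab_group_add, 'm, 'r::{ring, monoid_mult}) pmod"
    and M' :: "('p, 'm1, 'r) pmod" and N :: "('p, 'n, 'r) pmod" and N' :: "('p, 'n1, 'r) pmod" and f g
  assumes M: "rmod M" and N: "lmod N" and M': "rmod M'" and N': "lmod N'"
    and f: "pmod_hom M M' f" and g: "pmod_hom N N' g"
begin

lemma pten_map_image_subgroup: "subgroup (pten_map s M' N' f g r ` el (pten s M N) r) (grp (pten s M' N') r)"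
  using group_hom.img_is_subgroup[of "grp (pten s M N) r" "grp (pten s M' N') r"]
    pten_map_hom(1)[OF M N M' N' f g] pten_comm_group[OF M N] pten_comm_group[OF M' N']
  by (simp add: group_hom_def group_hom_axioms_def comm_group_group)

lemma pten_map_image_ptau:
  assumes "(i, j) \<in> ten_index s r" "x \<in> el M i" "y \<in> el N j"
  shows "ptau s M' N' r i j (f i x) (g j y) \<in> pten_map s M' N' f g r ` el (pten s M N) r"
  using pten_map_hom(2)[OF M N M' N' f g assms] ptau_closed[OF M N assms] by force

lemma pten_map_closed: "t \<in> el (pten s M N) r \<Longrightarrow> pten_map s M' N' f g r t \<in> el (pten s M' N') r"
  using hom_in_carrier[OF pten_map_hom(1)[OF M N M' N' f g]] .

lemma pten_map_surj:
  assumes "pers_surj M M' f" "pers_surj N N' g" "t \<in> el (pten s M' N') r"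
  shows "\<exists>v\<in>el (pten s M N) r. pten_map s M' N' f g r v = t"
proof -
  have "el (pten s M' N') r \<subseteq> pten_map s M' N' f g r ` el (pten s M N) r"
  proof (rule pten_generated[OF M' N' pten_map_image_subgroup])
    fix i j x y assume ij: "(i, j) \<in> ten_index s r" and "x \<in> el M' i" "y \<in> el N' j"
    then obtain x0 y0 where "x0 \<in> el M i" "y0 \<in> el N j" "x = f i x0" "y = g j y0"
      using assms unfolding pers_surj_def by blast
    then show "ptau s M' N' r i j x y \<in> pten_map s M' N' f g r ` el (pten s M N) r"
      using pten_map_image_ptau ij by simp
  qed
  then show ?thesis using assms(3) by blast
qed

end

text \<open>Here \<open>T\<close> is the image of the map induced by \<open>f\<close>; exactness at
  \<open>Y\<close> puts the pure tensors in question into it.\<close>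

lemma pten_exact_second:
  assumes M: "rmod M" and X: "lmod X" and Y: "lmod Y" and W: "lmod W"
    and f: "pmod_hom X Y f" and g: "pmod_hom Y W g" and surj: "pers_surj Y W g"
    and ex: "\<And>a y. \<lbrakk>y \<in> el Y a; g a y = \<one>\<^bsub>grp W a\<^esub>\<rbrakk> \<Longrightarrow> y \<in> f a ` el X a"
    and t: "t \<in> el (pten s M Y) r"
    and 1: "pten_map s M W (\<lambda>_ x. x) g r t = \<one>\<^bsub>grp (pten s M W) r\<^esub>"
  shows "\<exists>v\<in>el (pten s M X) r. pten_map s M Y (\<lambda>_ x. x) f r v = t"
proof -
  have "t \<in> pten_map s M Y (\<lambda>_ x. x) f r ` el (pten s M X) r"
  proof (rule tensor_at_right_exact[OF M Y W pten_tensor_at[OF M Y] pten_tensor_at[OF M W] g surj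
        pten_map_hom[OF M Y M W pmod_hom_id g] pten_map_image_subgroup[OF M X M Y pmod_hom_id f] _ t 1])
    fix i j x y assume *: "(i, j) \<in> ten_index s r" "x \<in> el M i" "y \<in> el Y j" "g j y = \<one>\<^bsub>grp W j\<^esub>"
    then obtain z where "z \<in> el X j" "y = f j z" using ex by blast
    then show "ptau s M Y r i j x y \<in> pten_map s M Y (\<lambda>_ x. x) f r ` el (pten s M X) r"
      using pten_map_image_ptau[OF M X M Y pmod_hom_id f *(1,2)] by simp
  qed
  then show ?thesis by blast
qed

text \<open>The same argument after exchanging the variables by
  \<open>tensor_at_swap\<close>.\<close>

lemma pten_exact_first:
  assumes N: "lmod N" and X: "rmod X" and Y: "rmod Y" and W: "rmod W"
    and f: "pmod_hom X Y f" and g: "pmod_hom Y W g" and surj: "pers_surj Y W g"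
    and ex: "\<And>a y. \<lbrakk>y \<in> el Y a; g a y = \<one>\<^bsub>grp W a\<^esub>\<rbrakk> \<Longrightarrow> y \<in> f a ` el X a"
    and t: "t \<in> el (pten s Y N) r"
    and 1: "pten_map s W N g (\<lambda>_ x. x) r t = \<one>\<^bsub>grp (pten s W N) r\<^esub>"
  shows "\<exists>v\<in>el (pten s X N) r. pten_map s Y N f (\<lambda>_ x. x) r v = t"
proof -
  have "t \<in> pten_map s Y N f (\<lambda>_ x. x) r ` el (pten s X N) r"
  proof (rule tensor_at_right_exact[OF N Y W tensor_at_swap[OF pten_tensor_at[OF Y N]]
        tensor_at_swap[OF pten_tensor_at[OF W N]] g surj
        pten_map_hom(1)[OF Y N W N g pmod_hom_id] _ pten_map_image_subgroup[OF X N Y N f pmod_hom_id] _ t 1])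
    fix i j x y assume *: "(i, j) \<in> ten_index s r" "x \<in> el N i" "y \<in> el Y j"
    then have ji: "(j, i) \<in> ten_index s r" using ten_index_swap by blast
    show "pten_map s W N g (\<lambda>_ x. x) r (ptau s Y N r j i y x) = ptau s W N r j i (g j y) x"
      by (rule pten_map_hom(2)[OF Y N W N g pmod_hom_id ji *(3,2)])
    assume "g j y = \<one>\<^bsub>grp W j\<^esub>"
    then obtain z where "z \<in> el X j" "y = f j z" using ex * by blast
    then show "ptau s Y N r j i y x \<in> pten_map s Y N f (\<lambda>_ x. x) r ` el (pten s X N) r"
      using pten_map_image_ptau[OF X N Y N f pmod_hom_id ji _ *(2)] by simp
  qed
  then show ?thesis by blast
qed

section \<open>Dual bases and flatness\<close>

lemma finprod_hom:
  assumes G: "comm_group G" and H: "comm_group H" and h: "h \<in> hom G H"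
    and f: "\<And>k. k \<in> D \<Longrightarrow> f k \<in> carrier G"
  shows "h (finprod G f D) = finprod H (\<lambda>k. h (f k)) D"
proof -
  interpret G: comm_group G by fact
  interpret H: comm_group H by fact
  show ?thesis
    using f
  proof (induction D rule: infinite_finite_induct)
    case (infinite A)
    then show ?case using hom_one[OF h] by simp
  next
    case empty
    then show ?case using hom_one[OF h] by simp
  next
    case (insert k D)
    then have "(\<lambda>k. h (f k)) \<in> D \<rightarrow> carrier H" "f \<in> D \<rightarrow> carrier G"
      using hom_in_carrier[OF h] by auto
    then show ?case using insert hom_in_carrier[OF h] by (simp add: hom_mult[OF h])
  qed
qed

lemma finprod_subgroup:
  assumes G: "comm_group G" and T: "subgroup T G" and f: "\<And>k. k \<in> D \<Longrightarrow> f k \<in> T"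
  shows "finprod G f D \<in> T"
proof -
  interpret G: comm_group G by fact
  interpret T: subgroup T G by fact
  show ?thesis
    using f
  proof (induction D rule: infinite_finite_induct)
    case (insert k D)
    then have "f \<in> D \<rightarrow> carrier G" by auto
    then show ?case using insert by simp
  qed simp_all
qed

lemma pmod_act_zero:
  assumes M: "persistence_module sd M" and x: "x \<in> el M a"
  shows "act M a 0 x = \<one>\<^bsub>grp M a\<^esub>"
proof -
  interpret group "grp M a" using M by (rule pmod_group)
  have "act M a 0 x \<otimes>\<^bsub>grp M a\<^esub> act M a 0 x = act M a 0 x"
    using persistence_module.act_add[OF M x, of 0 0] by simp
  then show ?thesis using pmod_act_closed[OF M x, of 0] by (metis l_cancel_one')
qed

text \<open>Elements \<open>e k\<close> in degree \<open>d k\<close> with coordinate functions \<open>\<phi> k\<close>, as in the dual basis lemma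
  for projective modules.\<close>

locale dual_basis = persistence_module sd N
  for sd :: side and N :: "('p::preordered_ab_group_add, 'n, 'r::{ring, monoid_mult}) pmod" +
  fixes d :: "'k \<Rightarrow> 'p" and e :: "'k \<Rightarrow> 'n" and \<phi> :: "'k \<Rightarrow> 'p \<Rightarrow> 'n \<Rightarrow> 'r"
  assumes e_closed: "e k \<in> el N (d k)"
    and \<phi>_add: "\<lbrakk>x \<in> el N a; y \<in> el N a\<rbrakk> \<Longrightarrow> \<phi> k a (x \<otimes>\<^bsub>grp N a\<^esub> y) = \<phi> k a x + \<phi> k a y"
    and \<phi>_act: "x \<in> el N a \<Longrightarrow> \<phi> k a (act N a c x) = (case sd of Left \<Rightarrow> c * \<phi> k a x | Right \<Rightarrow> \<phi> k a x * c)"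
    and \<phi>_smap: "\<lbrakk>a \<le> b; x \<in> el N a\<rbrakk> \<Longrightarrow> \<phi> k b (smap N a b x) = \<phi> k a x"
    and \<phi>_support: "\<lbrakk>x \<in> el N a; \<phi> k a x \<noteq> 0\<rbrakk> \<Longrightarrow> d k \<le> a"
    and \<phi>_finite: "x \<in> el N a \<Longrightarrow> finite {k. \<phi> k a x \<noteq> 0}"
    and expand: "x \<in> el N a \<Longrightarrow>
      x = finprod (grp N a) (\<lambda>k. smap N (d k) a (act N (d k) (\<phi> k a x) (e k))) {k. \<phi> k a x \<noteq> 0}"

text \<open>The \<open>k\<close>-th coordinate of an element of \<open>(M \<otimes> N)\<^sub>r\<close> lies in \<open>M\<close> at the first component of
  \<open>coord_degree s r (d k)\<close>.\<close>

fun coord_degree :: "tensor_kind \<Rightarrow> 'p::preordered_ab_group_add \<Rightarrow> 'p \<Rightarrow> 'p \<times> 'p" where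
  "coord_degree Sh r d = (r, r)"
| "coord_degree Gr r d = (r - d, d)"

text \<open>For \<open>Gr\<close>, the inequalities \<open>d \<le> j\<close> and
  \<open>i + j \<le> r\<close> give \<open>i \<le> r - d\<close>: once a generator sits in its own
  degree \<open>d\<close>, the other factor can be moved up to degree \<open>r - d\<close>. For
  \<open>Sh\<close> both factors are already in degree \<open>r\<close>.\<close>

lemma coord_degree:
  fixes r :: "'p::preordered_ab_group_add"
  assumes "(i, j) \<in> ten_index s r" "d \<le> j"
  shows "i \<le> fst (coord_degree s r d)" and "d \<le> snd (coord_degree s r d)"
    and "coord_degree s r d \<in> ten_index s r"
proof -
  have "i \<le> r - d" if "s = Gr"
  proof -
    have "d + i \<le> j + i" using compatible_add[OF assms(2)] .
    also have "\<dots> \<le> r" using assms(1) that by (simp add: add.commute)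
    finally have "d + i + - d \<le> r + - d" by (rule compatible_add)
    then show ?thesis by simp
  qed
  then show "i \<le> fst (coord_degree s r d)" "d \<le> snd (coord_degree s r d)"
    "coord_degree s r d \<in> ten_index s r"
    using assms by (cases s; simp)+
qed

text \<open>The map sending a pure tensor of \<open>x\<close> and \<open>y\<close> to
  \<open>x\<close> times the k-th coordinate of \<open>y\<close>. If \<open>d k \<le> j\<close>
  fails, the coordinate of \<open>y\<close> is zero by \<open>\<phi>_support\<close>; the unit is
  then given explicitly, because for \<open>Gr\<close> the degree \<open>i\<close> need not lie
  below the target degree and \<open>smap\<close> has no properties there.\<close>

definition coord where
  "coord s r M d \<phi> k i j x y = (if d k \<le> j
    then smap M i (fst (coord_degree s r (d k))) (act M i (\<phi> k j y) x)
    else \<one>\<^bsub>grp M (fst (coord_degree s r (d k)))\<^esub>)"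

text \<open>Coordinate functions are R-linear, and \<open>M\<close> is a module on the side opposite
  to \<open>N\<close>; this makes the product with a coordinate balanced.\<close>

lemma (in dual_basis) coord_balanced:
  assumes M: "persistence_module sd' M" and sd: "sd' \<noteq> sd"
  shows "balanced s r M N (grp M (fst (coord_degree s r (d k)))) (coord s r M d \<phi> k)"
proof (rule balanced.intro)
  let ?t = "fst (coord_degree s r (d k))"
  interpret Mt: comm_group "grp M ?t" using M by (rule pmod_comm_group)
  fix i j x y assume ij: "(i, j) \<in> ten_index s r" and x: "x \<in> el M i" and y: "y \<in> el N j"
  note it = coord_degree(1)[OF ij, of "d k"]
  have ax: "act M i c x \<in> el M i" if "x \<in> el M i" for c x using that by (rule pmod_act_closed[OF M])
  show "coord s r M d \<phi> k i j x y \<in> el M ?t"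
    using it ax[OF x] by (simp add: coord_def pmod_smap_closed[OF M])
  show "coord s r M d \<phi> k i j (x \<otimes>\<^bsub>grp M i\<^esub> x') y =
      coord s r M d \<phi> k i j x y \<otimes>\<^bsub>grp M ?t\<^esub> coord s r M d \<phi> k i j x' y" if x': "x' \<in> el M i" for x'
    using it ax x x' by (simp add: coord_def hom_mult[OF pmod_act_hom[OF M]] hom_mult[OF pmod_smap_hom[OF M]])
  show "coord s r M d \<phi> k i j x (y \<otimes>\<^bsub>grp N j\<^esub> y') =
      coord s r M d \<phi> k i j x y \<otimes>\<^bsub>grp M ?t\<^esub> coord s r M d \<phi> k i j x y'" if y': "y' \<in> el N j" for y'
    using it ax x y y'
    by (simp add: coord_def \<phi>_add persistence_module.act_add[OF M] hom_mult[OF pmod_smap_hom[OF M]])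
  show "coord s r M d \<phi> k i j (act M i a x) y = coord s r M d \<phi> k i j x (act N j a y)" for a
    using x y sd by (cases sd; cases sd') (simp_all add: coord_def \<phi>_act persistence_module.act_mult[OF M])
  show "coord s r M d \<phi> k i' j' (smap M i i' x) (smap N j j' y) = coord s r M d \<phi> k i j x y"
    if ij': "(i', j') \<in> ten_index s r" and le: "i \<le> i'" "j \<le> j'" for i' j'
  proof (cases "d k \<le> j")
    case True
    then have "d k \<le> j'" using le(2) by (rule order_trans)
    then show ?thesis
      using True le coord_degree(1)[OF ij' \<open>d k \<le> j'\<close>] x y ax
      by (simp add: coord_def \<phi>_smap pmod_act_smap[OF M, symmetric] pmod_smap_comp[OF M])
  next
    case False
    \<comment> \<open>The coordinate vanishes in degree \<open>j\<close>, and by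
      \<open>\<phi>_smap\<close> also after moving to \<open>j'\<close>. Hence both branches of
      \<open>coord\<close> give the unit, even if the generator becomes available only at
      \<open>j'\<close>.\<close>
    then have 0: "\<phi> k j y = 0" using \<phi>_support[OF y] by blast
    show ?thesis
    proof (cases "d k \<le> j'")
      case True
      interpret Mi: comm_group "grp M i'" using M by (rule pmod_comm_group)
      have "smap M i' ?t \<one>\<^bsub>grp M i'\<^esub> = \<one>\<^bsub>grp M ?t\<^esub>"
        using hom_one[OF pmod_smap_hom[OF M coord_degree(1)[OF ij' True]]] by (simp add: Mi.group_axioms Mt.group_axioms)
      then show ?thesis
        using False True 0 le x y
        by (simp add: coord_def \<phi>_smap pmod_act_zero[OF M] pmod_smap_closed[OF M])
    qed (simp add: coord_def False)
  qed
qed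

text \<open>The maps \<open>ins k\<close> reinsert the k-th coordinate next to the k-th generator,
  and the product over \<open>k\<close> of \<open>ins k\<close> after \<open>c k\<close> is the
  identity. The unit branch of \<open>ins\<close> makes it a homomorphism for every
  \<open>k\<close>; for \<open>Sh\<close> the generator need not reach degree
  \<open>r\<close>.\<close>

lemma (in dual_basis) tensor_expand:
  assumes M: "persistence_module sd' M" and at: "tensor_at w s r M N G \<tau>"
    and c: "\<And>k. c k \<in> hom G (grp M (fst (coord_degree s r (d k))))"
    and c\<tau>: "\<And>k i j x y. \<lbrakk>(i, j) \<in> ten_index s r; x \<in> el M i; y \<in> el N j\<rbrakk> \<Longrightarrow>
      c k (\<tau> i j x y) = coord s r M d \<phi> k i j x y"
    and ins: "ins = (\<lambda>k m. if coord_degree s r (d k) \<in> ten_index s r \<and> d k \<le> snd (coord_degree s r (d k))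
      then \<tau> (fst (coord_degree s r (d k))) (snd (coord_degree s r (d k))) m
        (smap N (d k) (snd (coord_degree s r (d k))) (e k)) else \<one>\<^bsub>G\<^esub>)"
    and t: "t \<in> carrier G"
  shows "\<exists>D. finite D \<and> t = finprod G (\<lambda>k. ins k (c k t)) D"
proof -
  let ?i = "\<lambda>k. fst (coord_degree s r (d k))" and ?j = "\<lambda>k. snd (coord_degree s r (d k))"
  interpret G: comm_group G by (rule tensor_at_comm_group[OF at])
  interpret b: balanced s r M N G \<tau> by (rule tensor_at_balanced[OF at])
  have Nmod: "persistence_module sd N" by (rule persistence_module_axioms)
  have ins_hom: "ins k \<in> hom (grp M (?i k)) G" for k
    unfolding ins
  proof (rule homI)
    have ek: "smap N (d k) (?j k) (e k) \<in> el N (?j k)" if "d k \<le> ?j k"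
      using that by (rule pmod_smap_closed[OF Nmod _ e_closed])
    have idx: "(?i k, ?j k) \<in> ten_index s r" if "coord_degree s r (d k) \<in> ten_index s r"
      using that by simp
    show "(if coord_degree s r (d k) \<in> ten_index s r \<and> d k \<le> ?j k
      then \<tau> (?i k) (?j k) m (smap N (d k) (?j k) (e k)) else \<one>\<^bsub>G\<^esub>) \<in> carrier G" if "m \<in> el M (?i k)" for m
      using that ek idx by (auto intro: b.closed)
    show "(if coord_degree s r (d k) \<in> ten_index s r \<and> d k \<le> ?j k
        then \<tau> (?i k) (?j k) (m \<otimes>\<^bsub>grp M (?i k)\<^esub> m') (smap N (d k) (?j k) (e k)) else \<one>\<^bsub>G\<^esub>) =
      (if coord_degree s r (d k) \<in> ten_index s r \<and> d k \<le> ?j k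
        then \<tau> (?i k) (?j k) m (smap N (d k) (?j k) (e k)) else \<one>\<^bsub>G\<^esub>) \<otimes>\<^bsub>G\<^esub>
      (if coord_degree s r (d k) \<in> ten_index s r \<and> d k \<le> ?j k
        then \<tau> (?i k) (?j k) m' (smap N (d k) (?j k) (e k)) else \<one>\<^bsub>G\<^esub>)"
      if "m \<in> el M (?i k)" "m' \<in> el M (?i k)" for m m'
      using b.left[OF idx that ek] by auto
  qed
  define p where "p k t = ins k (c k t)" for k t
  have p: "p k \<in> hom G G" for k
    unfolding p_def by (rule hom_compose'[OF c ins_hom])
  note pc = hom_in_carrier[OF p]
  have pF: "(\<lambda>k. p k t) \<in> A \<rightarrow> carrier G" if "t \<in> carrier G" for t A
    using pc that by auto
  \<comment> \<open>Different elements use different finite sets of indices. Asking for the formula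
    on all finite supersets allows two such sets to be united, so \<open>T\<close> is a
    subgroup.\<close>
  define T where "T = {t \<in> carrier G. \<exists>D. finite D \<and> (\<forall>D'. finite D' \<longrightarrow> D \<subseteq> D' \<longrightarrow> t = finprod G (\<lambda>k. p k t) D')}"
  have "carrier G \<subseteq> T"
  proof (rule tensor_at_generated[OF at])
    show "subgroup T G"
    proof (rule G.subgroupI)
      show "T \<subseteq> carrier G" by (auto simp: T_def)
      have "\<one>\<^bsub>G\<^esub> \<in> T"
        unfolding T_def using hom_one[OF p G.group_axioms G.group_axioms]
        by (auto intro!: exI[of _ "{}"] G.finprod_one_eqI[symmetric])
      then show "T \<noteq> {}" by blast
      fix x assume "x \<in> T"
      then obtain D where x: "x \<in> carrier G" and D: "finite D"
        "\<And>D'. \<lbrakk>finite D'; D \<subseteq> D'\<rbrakk> \<Longrightarrow> x = finprod G (\<lambda>k. p k x) D'" unfolding T_def by blast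
      show "inv\<^bsub>G\<^esub> x \<in> T"
        unfolding T_def
      proof (intro CollectI conjI exI[of _ D] allI impI)
        show "inv\<^bsub>G\<^esub> x \<in> carrier G" using x by simp
        show "finite D" by fact
        fix D' assume D': "finite D'" "D \<subseteq> D'"
        have "finprod G (\<lambda>k. p k (inv\<^bsub>G\<^esub> x)) D' \<otimes>\<^bsub>G\<^esub> finprod G (\<lambda>k. p k x) D' =
            finprod G (\<lambda>k. p k (inv\<^bsub>G\<^esub> x) \<otimes>\<^bsub>G\<^esub> p k x) D'"
          using x pF by (intro G.finprod_multf[symmetric]) auto
        also have "\<dots> = \<one>\<^bsub>G\<^esub>"
          using x pc by (intro G.finprod_one_eqI) (simp add: hom_inverse[OF p G.group_axioms G.group_axioms])
        finally have "finprod G (\<lambda>k. p k (inv\<^bsub>G\<^esub> x)) D' \<otimes>\<^bsub>G\<^esub> x = \<one>\<^bsub>G\<^esub>" using D(2)[OF D'] by simp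
        then show "inv\<^bsub>G\<^esub> x = finprod G (\<lambda>k. p k (inv\<^bsub>G\<^esub> x)) D'"
          using x pF[of "inv\<^bsub>G\<^esub> x"] by (intro G.inv_equality G.finprod_closed) auto
      qed
      fix y assume "y \<in> T"
      then obtain E where y: "y \<in> carrier G" and E: "finite E"
        "\<And>D'. \<lbrakk>finite D'; E \<subseteq> D'\<rbrakk> \<Longrightarrow> y = finprod G (\<lambda>k. p k y) D'" unfolding T_def by blast
      show "x \<otimes>\<^bsub>G\<^esub> y \<in> T"
        unfolding T_def
      proof (intro CollectI conjI exI[of _ "D \<union> E"] allI impI)
        show "x \<otimes>\<^bsub>G\<^esub> y \<in> carrier G" using x y by simp
        show "finite (D \<union> E)" using D E by simp
        fix D' assume D': "finite D'" "D \<union> E \<subseteq> D'"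
        have "finprod G (\<lambda>k. p k (x \<otimes>\<^bsub>G\<^esub> y)) D' = finprod G (\<lambda>k. p k x \<otimes>\<^bsub>G\<^esub> p k y) D'"
          by (simp add: hom_mult[OF p x y])
        also have "\<dots> = finprod G (\<lambda>k. p k x) D' \<otimes>\<^bsub>G\<^esub> finprod G (\<lambda>k. p k y) D'"
          using x y pF by (intro G.finprod_multf) auto
        also have "\<dots> = x \<otimes>\<^bsub>G\<^esub> y"
          using D(2)[of D'] E(2)[of D'] D' by simp
        finally show "x \<otimes>\<^bsub>G\<^esub> y = finprod G (\<lambda>k. p k (x \<otimes>\<^bsub>G\<^esub> y)) D'" by simp
      qed
    qed
    fix i j x y assume ij: "(i, j) \<in> ten_index s r" and x: "x \<in> el M i" and y: "y \<in> el N j"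
    let ?D = "{k. \<phi> k j y \<noteq> 0}"
    interpret Nj: comm_group "grp N j" by (rule grp_comm)
    have \<tau>h: "\<tau> i j x \<in> hom (grp N j) G"
      by (rule homI) (simp_all add: b.closed[OF ij x] b.right[OF ij x])
    have ys: "smap N (d k) j (act N (d k) (\<phi> k j y) (e k)) \<in> el N j" if "k \<in> ?D" for k
      using that \<phi>_support[OF y] e_closed by (simp add: pmod_smap_closed[OF Nmod] pmod_act_closed[OF Nmod])
    have summand: "\<tau> i j x (smap N (d k) j (act N (d k) (\<phi> k j y) (e k))) = p k (\<tau> i j x y)"
      if "k \<in> ?D" for k
    proof -
      have dj: "d k \<le> j" using that \<phi>_support[OF y] by simp
      note cd = coord_degree[OF ij dj]
      let ?x = "act M i (\<phi> k j y) x"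
      have x': "?x \<in> el M i" by (rule pmod_act_closed[OF M x])
      have se: "smap N (d k) j (e k) \<in> el N j" by (rule pmod_smap_closed[OF Nmod dj e_closed])
      have "\<tau> i j x (smap N (d k) j (act N (d k) (\<phi> k j y) (e k))) = \<tau> i j ?x (smap N (d k) j (e k))"
        unfolding pmod_act_smap[OF Nmod dj e_closed] by (rule b.act[OF ij x se, symmetric])
      also have "\<dots> = \<tau> (?i k) (?j k) (smap M i (?i k) ?x) (smap N (d k) (?j k) (e k))"
      proof (cases s)
        case Sh
        then show ?thesis using ij pmod_smap_id[OF M x'] by simp
      next
        case Gr
        \<comment> \<open>Both tensors come from the one at \<open>(i, d k)\<close>, with the
          generator in its own degree: one transition leads to \<open>(i, j)\<close>, another to
          \<open>(r - d k, d k)\<close>.\<close>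
        have idk: "(i, d k) \<in> ten_index s r"
        proof -
          have "d k + i \<le> j + i" by (rule compatible_add[OF dj])
          also have "\<dots> \<le> r" using ij Gr by (simp add: add.commute)
          finally show ?thesis using Gr by (simp add: add.commute)
        qed
        have "\<tau> i j ?x (smap N (d k) j (e k)) = \<tau> i (d k) ?x (e k)"
          using b.trans[OF idk ij order_refl dj x' e_closed] pmod_smap_id[OF M x'] by simp
        moreover have "\<tau> (?i k) (?j k) (smap M i (?i k) ?x) (smap N (d k) (?j k) (e k)) = \<tau> i (d k) ?x (e k)"
          using b.trans[OF idk _ cd(1,2) x' e_closed] cd(3) by simp
        ultimately show ?thesis by simp
      qed
      also have "\<dots> = p k (\<tau> i j x y)"
        using cd dj by (simp add: p_def c\<tau>[OF ij x y] coord_def ins)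
      finally show ?thesis .
    qed
    have p1: "p k (\<tau> i j x y) = \<one>\<^bsub>G\<^esub>" if "k \<notin> ?D" for k
    proof -
      interpret Mi: comm_group "grp M i" using M by (rule pmod_comm_group)
      interpret Mt: comm_group "grp M (?i k)" using M by (rule pmod_comm_group)
      have "c k (\<tau> i j x y) = \<one>\<^bsub>grp M (?i k)\<^esub>"
        using that hom_one[OF pmod_smap_hom[OF M coord_degree(1)[OF ij]] Mi.group_axioms Mt.group_axioms]
        by (simp add: c\<tau>[OF ij x y] coord_def pmod_act_zero[OF M x])
      then show ?thesis
        using hom_one[OF ins_hom Mt.group_axioms G.group_axioms] by (simp add: p_def)
    qed
    show "\<tau> i j x y \<in> T"
      unfolding T_def
    proof (intro CollectI conjI exI[of _ ?D] allI impI)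
      show cl: "\<tau> i j x y \<in> carrier G" by (rule b.closed[OF ij x y])
      show "finite ?D" by (rule \<phi>_finite[OF y])
      fix D' assume D': "finite D'" "?D \<subseteq> D'"
      have "\<tau> i j x y = \<tau> i j x (finprod (grp N j) (\<lambda>k. smap N (d k) j (act N (d k) (\<phi> k j y) (e k))) ?D)"
        using expand[OF y] by (rule arg_cong)
      also have "\<dots> = finprod G (\<lambda>k. \<tau> i j x (smap N (d k) j (act N (d k) (\<phi> k j y) (e k)))) ?D"
        by (rule finprod_hom[OF Nj.comm_group_axioms G.comm_group_axioms \<tau>h ys])
      also have "\<dots> = finprod G (\<lambda>k. p k (\<tau> i j x y)) ?D"
        by (rule G.finprod_cong') (use summand pF[OF cl] in auto)
      also have "\<dots> = finprod G (\<lambda>k. p k (\<tau> i j x y)) D'"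
        by (rule G.finprod_mono_neutral_cong_left[OF D']) (use p1 pF[OF cl] in auto)
      finally show "\<tau> i j x y = finprod G (\<lambda>k. p k (\<tau> i j x y)) D'" .
    qed
  qed
  then show ?thesis using t unfolding T_def p_def by blast
qed

text \<open>Coordinates commute with \<open>g\<close>, so if \<open>h t\<close> is trivial then
  \<open>g\<close> kills every coordinate of \<open>t\<close>. Each reinserted coordinate is then in
  \<open>T\<close> by \<open>ker\<close>, and so is their product \<open>t\<close>. Taking an image
  for \<open>T\<close> gives exactness; taking the trivial subgroup gives injectivity.\<close>

lemma (in dual_basis) tensor_at_exact:
  fixes M :: "('p, 'm, 'r) pmod" and M' :: "('p, 'm1, 'r) pmod"
  assumes M: "persistence_module sd' M" and M': "persistence_module sd' M'" and sd: "sd' \<noteq> sd"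
    and g: "pmod_hom M M' g"
    and at: "tensor_at TYPE('m) s r M N G \<tau>" and at': "tensor_at TYPE('m1) s r M' N G' \<tau>'"
    and h: "h \<in> hom G G'"
    and h\<tau>: "\<And>i j x y. \<lbrakk>(i, j) \<in> ten_index s r; x \<in> el M i; y \<in> el N j\<rbrakk> \<Longrightarrow> h (\<tau> i j x y) = \<tau>' i j (g i x) y"
    and T: "subgroup T G"
    and ker: "\<And>i j x y. \<lbrakk>(i, j) \<in> ten_index s r; x \<in> el M i; y \<in> el N j; g i x = \<one>\<^bsub>grp M' i\<^esub>\<rbrakk> \<Longrightarrow> \<tau> i j x y \<in> T"
    and t: "t \<in> carrier G" and ht: "h t = \<one>\<^bsub>G'\<^esub>"
  shows "t \<in> T"
proof -
  let ?i = "\<lambda>k. fst (coord_degree s r (d k))" and ?j = "\<lambda>k. snd (coord_degree s r (d k))"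
  have Nmod: "persistence_module sd N" by (rule persistence_module_axioms)
  note G = tensor_at_comm_group[OF at] and G' = tensor_at_comm_group[OF at']
  have ex: "\<forall>k. \<exists>c. c \<in> hom G (grp M (?i k)) \<and> (\<forall>i j x y. (i, j) \<in> ten_index s r \<longrightarrow> x \<in> el M i \<longrightarrow> y \<in> el N j \<longrightarrow>
      c (\<tau> i j x y) = coord s r M d \<phi> k i j x y)"
    using tensor_at_universal[OF at pmod_comm_group[OF M] coord_balanced[OF M sd]] unfolding Bex_def
    by (rule allI)
  obtain c where "\<forall>k. c k \<in> hom G (grp M (?i k)) \<and> (\<forall>i j x y. (i, j) \<in> ten_index s r \<longrightarrow> x \<in> el M i \<longrightarrow> y \<in> el N j \<longrightarrow>
      c k (\<tau> i j x y) = coord s r M d \<phi> k i j x y)"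
    using choice[OF ex] by (rule exE)
  then have c: "\<And>k. c k \<in> hom G (grp M (?i k))"
    and c\<tau>': "\<forall>k i j x y. (i, j) \<in> ten_index s r \<longrightarrow> x \<in> el M i \<longrightarrow> y \<in> el N j \<longrightarrow>
      c k (\<tau> i j x y) = coord s r M d \<phi> k i j x y"
    by simp_all
  note c\<tau> = c\<tau>'[rule_format]
  have ex': "\<forall>k. \<exists>c. c \<in> hom G' (grp M' (?i k)) \<and> (\<forall>i j x y. (i, j) \<in> ten_index s r \<longrightarrow> x \<in> el M' i \<longrightarrow> y \<in> el N j \<longrightarrow>
      c (\<tau>' i j x y) = coord s r M' d \<phi> k i j x y)"
    using tensor_at_universal[OF at' pmod_comm_group[OF M'] coord_balanced[OF M' sd]] unfolding Bex_def
    by (rule allI)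
  obtain c' where "\<forall>k. c' k \<in> hom G' (grp M' (?i k)) \<and> (\<forall>i j x y. (i, j) \<in> ten_index s r \<longrightarrow> x \<in> el M' i \<longrightarrow> y \<in> el N j \<longrightarrow>
      c' k (\<tau>' i j x y) = coord s r M' d \<phi> k i j x y)"
    using choice[OF ex'] by (rule exE)
  then have c': "\<And>k. c' k \<in> hom G' (grp M' (?i k))"
    and c\<tau>'': "\<forall>k i j x y. (i, j) \<in> ten_index s r \<longrightarrow> x \<in> el M' i \<longrightarrow> y \<in> el N j \<longrightarrow>
      c' k (\<tau>' i j x y) = coord s r M' d \<phi> k i j x y"
    by simp_all
  define ins where "ins = (\<lambda>k m. if coord_degree s r (d k) \<in> ten_index s r \<and> d k \<le> ?j k
      then \<tau> (?i k) (?j k) m (smap N (d k) (?j k) (e k)) else \<one>\<^bsub>G\<^esub>)"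
  obtain D where "finite D" and D: "t = finprod G (\<lambda>k. ins k (c k t)) D"
    using tensor_expand[OF M at c c\<tau> ins_def t] by blast
  \<comment> \<open>\<open>g\<close> after \<open>c k\<close> and \<open>c' k\<close> after
    \<open>h\<close> are homomorphisms agreeing on pure tensors, hence equal.\<close>
  have gc: "g (?i k) (c k t) = \<one>\<^bsub>grp M' (?i k)\<^esub>" for k
  proof -
    have "g (?i k) (c k t) = c' k (h t)"
    proof (rule tensor_at_hom_eq[OF at pmod_group[OF M'] hom_compose'[OF c pmod_hom_hom[OF g]] hom_compose'[OF h c'] _ t])
      fix i j x y assume *: "(i, j) \<in> ten_index s r" "x \<in> el M i" "y \<in> el N j"
      have "g (?i k) (coord s r M d \<phi> k i j x y) = coord s r M' d \<phi> k i j (g i x) y"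
        using * coord_degree(1)[OF *(1), of "d k"]
          hom_one[OF pmod_hom_hom[OF g] pmod_group[OF M] pmod_group[OF M']]
        by (simp add: coord_def pmod_hom_smap[OF g] pmod_act_closed[OF M] pmod_hom_act[OF g])
      then show "g (?i k) (c k (\<tau> i j x y)) = c' k (h (\<tau> i j x y))"
        using c\<tau>[OF *] h\<tau>[OF *] c\<tau>''[rule_format, OF *(1) pmod_hom_closed[OF g *(2)] *(3)] by simp
    qed
    then show ?thesis
      using ht hom_one[OF c' comm_group_group[OF G'] pmod_group[OF M']] by simp
  qed
  have "ins k (c k t) \<in> T" for k
    using subgroup.one_closed[OF T] hom_in_carrier[OF c t] gc[of k]
      pmod_smap_closed[OF Nmod _ e_closed]
    by (auto simp: ins_def intro: ker)
  then show ?thesis by (subst D) (rule finprod_subgroup[OF G T])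
qed

lemma pers_injD:
  assumes "pmod_hom X Y f" "persistence_module sd X" "persistence_module sd Y" "inj_on (f a) (el X a)"
    "x \<in> el X a" "f a x = \<one>\<^bsub>grp Y a\<^esub>"
  shows "x = \<one>\<^bsub>grp X a\<^esub>"
proof (rule inj_onD[OF assms(4) _ assms(5) pmod_one_closed[OF assms(2)]])
  show "f a x = f a \<one>\<^bsub>grp X a\<^esub>"
    using hom_one[OF pmod_hom_hom[OF assms(1)] pmod_group[OF assms(2)] pmod_group[OF assms(3)]] assms(6) by simp
qed

context
  fixes M :: "('p::preordered_ab_group_add, 'm, 'r::{ring, monoid_mult}) pmod"
    and N :: "('p, 'n, 'r) pmod"
  assumes M: "rmod M" and N: "lmod N"
begin

lemma ptau_one_left:
  assumes "(i, j) \<in> ten_index s r" "y \<in> el N j"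
  shows "ptau s M N r i j \<one>\<^bsub>grp M i\<^esub> y = \<one>\<^bsub>grp (pten s M N) r\<^esub>"
proof (rule hom_one)
  show "(\<lambda>x. ptau s M N r i j x y) \<in> hom (grp M i) (grp (pten s M N) r)"
    by (rule homI) (simp_all add: ptau_closed[OF M N assms(1)] ptau_left[OF M N assms(1)] assms)
qed (rule pmod_group[OF M] comm_group_group[OF pten_comm_group[OF M N]])+

lemma ptau_one_right:
  assumes "(i, j) \<in> ten_index s r" "x \<in> el M i"
  shows "ptau s M N r i j x \<one>\<^bsub>grp N j\<^esub> = \<one>\<^bsub>grp (pten s M N) r\<^esub>"
proof (rule hom_one)
  show "ptau s M N r i j x \<in> hom (grp N j) (grp (pten s M N) r)"
    by (rule homI) (simp_all add: ptau_closed[OF M N assms(1)] ptau_right[OF M N assms(1)] assms)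
qed (rule pmod_group[OF N] comm_group_group[OF pten_comm_group[OF M N]])+

end

lemma pten_map_trivial_left:
  assumes M: "rmod M" and N: "lmod N" and M': "rmod M'" and N': "lmod N'"
    and f: "pmod_hom M M' f" and g: "pmod_hom N N' g"
    and f1: "\<And>a x. x \<in> el M a \<Longrightarrow> f a x = \<one>\<^bsub>grp M' a\<^esub>"
    and t: "t \<in> el (pten s M N) r"
  shows "pten_map s M' N' f g r t = \<one>\<^bsub>grp (pten s M' N') r\<^esub>"
proof (rule pten_hom_eq[OF M N _ pten_map_hom(1)[OF M N M' N' f g] _ _ t])
  interpret P: comm_group "grp (pten s M' N') r" by (rule pten_comm_group[OF M' N'])
  show "group (grp (pten s M' N') r)" by (rule P.group_axioms)
  show "(\<lambda>_. \<one>\<^bsub>grp (pten s M' N') r\<^esub>) \<in> hom (grp (pten s M N) r) (grp (pten s M' N') r)"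
    by (simp add: hom_def)
  show "pten_map s M' N' f g r (ptau s M N r i j x y) = \<one>\<^bsub>grp (pten s M' N') r\<^esub>"
    if "(i, j) \<in> ten_index s r" "x \<in> el M i" "y \<in> el N j" for i j x y
    using ptau_one_left[OF M' N' that(1) pmod_hom_closed[OF g that(3)]]
    by (simp add: pten_map_hom(2)[OF M N M' N' f g that] f1[OF that(2)])
qed

lemma dual_basis_exact_second:
  assumes db: "dual_basis Left N d e \<phi>" and X: "rmod X" and Y: "rmod Y" and W: "rmod W"
    and f: "pmod_hom X Y f" and g: "pmod_hom Y W g"
    and ex: "\<And>a y. \<lbrakk>y \<in> el Y a; g a y = \<one>\<^bsub>grp W a\<^esub>\<rbrakk> \<Longrightarrow> y \<in> f a ` el X a"
    and t: "t \<in> el (pten s Y N) r"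
    and 1: "pten_map s W N g (\<lambda>_ x. x) r t = \<one>\<^bsub>grp (pten s W N) r\<^esub>"
  shows "\<exists>v\<in>el (pten s X N) r. pten_map s Y N f (\<lambda>_ x. x) r v = t"
proof -
  have N: "lmod N" using db by (simp add: dual_basis_def)
  have "t \<in> pten_map s Y N f (\<lambda>_ x. x) r ` el (pten s X N) r"
  proof (rule dual_basis.tensor_at_exact[OF db Y W _ g pten_tensor_at[OF Y N] pten_tensor_at[OF W N]
        pten_map_hom(1)[OF Y N W N g pmod_hom_id] pten_map_hom(2)[OF Y N W N g pmod_hom_id]
        pten_map_image_subgroup[OF X N Y N f pmod_hom_id] _ t 1])
    fix i j x y assume *: "(i, j) \<in> ten_index s r" "x \<in> el Y i" "y \<in> el N j" "g i x = \<one>\<^bsub>grp W i\<^esub>"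
    then obtain z where "z \<in> el X i" "x = f i z" using ex by blast
    then show "ptau s Y N r i j x y \<in> pten_map s Y N f (\<lambda>_ x. x) r ` el (pten s X N) r"
      using pten_map_image_ptau[OF X N Y N f pmod_hom_id *(1) _ *(3)] by simp
  qed simp
  then show ?thesis by blast
qed

lemma dual_basis_inj_second:
  assumes db: "dual_basis Left N d e \<phi>" and Y: "rmod Y" and W: "rmod W"
    and g: "pmod_hom Y W g" and inj: "\<And>a. inj_on (g a) (el Y a)"
    and t: "t \<in> el (pten s Y N) r"
    and 1: "pten_map s W N g (\<lambda>_ x. x) r t = \<one>\<^bsub>grp (pten s W N) r\<^esub>"
  shows "t = \<one>\<^bsub>grp (pten s Y N) r\<^esub>"
proof -
  have N: "lmod N" using db by (simp add: dual_basis_def)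
  have "t \<in> {\<one>\<^bsub>grp (pten s Y N) r\<^esub>}"
  proof (rule dual_basis.tensor_at_exact[OF db Y W _ g pten_tensor_at[OF Y N] pten_tensor_at[OF W N]
        pten_map_hom(1)[OF Y N W N g pmod_hom_id] pten_map_hom(2)[OF Y N W N g pmod_hom_id] _ _ t 1])
    show "subgroup {\<one>\<^bsub>grp (pten s Y N) r\<^esub>} (grp (pten s Y N) r)"
      by (rule group.triv_subgroup[OF comm_group_group[OF pten_comm_group[OF Y N]]])
    fix i j x y assume *: "(i, j) \<in> ten_index s r" "x \<in> el Y i" "y \<in> el N j" "g i x = \<one>\<^bsub>grp W i\<^esub>"
    then show "ptau s Y N r i j x y \<in> {\<one>\<^bsub>grp (pten s Y N) r\<^esub>}"
      using pers_injD[OF g Y W inj *(2,4)] ptau_one_left[OF Y N *(1,3)] by simp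
  qed simp
  then show ?thesis by blast
qed

text \<open>The mirror image of \<open>dual_basis_inj_second\<close>, with the dual basis on the
  right module. It is the injectivity half of the flatness of projective right modules.\<close>

lemma dual_basis_inj_first:
  assumes db: "dual_basis Right N d e \<phi>" and Y: "lmod Y" and W: "lmod W"
    and g: "pmod_hom Y W g" and inj: "\<And>a. inj_on (g a) (el Y a)"
    and t: "t \<in> el (pten s N Y) r"
    and 1: "pten_map s N W (\<lambda>_ x. x) g r t = \<one>\<^bsub>grp (pten s N W) r\<^esub>"
  shows "t = \<one>\<^bsub>grp (pten s N Y) r\<^esub>"
proof -
  have N: "rmod N" using db by (simp add: dual_basis_def)
  have "t \<in> {\<one>\<^bsub>grp (pten s N Y) r\<^esub>}"
  proof (rule dual_basis.tensor_at_exact[OF db Y W _ g tensor_at_swap[OF pten_tensor_at[OF N Y]]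
        tensor_at_swap[OF pten_tensor_at[OF N W]] pten_map_hom(1)[OF N Y N W pmod_hom_id g] _ _ _ t 1])
    show "subgroup {\<one>\<^bsub>grp (pten s N Y) r\<^esub>} (grp (pten s N Y) r)"
      by (rule group.triv_subgroup[OF comm_group_group[OF pten_comm_group[OF N Y]]])
    fix i j x y assume *: "(i, j) \<in> ten_index s r" "x \<in> el Y i" "y \<in> el N j"
    then have ji: "(j, i) \<in> ten_index s r" using ten_index_swap by blast
    show "pten_map s N W (\<lambda>_ x. x) g r (ptau s N Y r j i y x) = ptau s N W r j i y (g i x)"
      by (rule pten_map_hom(2)[OF N Y N W pmod_hom_id g ji *(3,2)])
    assume "g i x = \<one>\<^bsub>grp W i\<^esub>"
    then show "ptau s N Y r j i y x \<in> {\<one>\<^bsub>grp (pten s N Y) r\<^esub>}"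
      using pers_injD[OF g Y W inj *(2)] ptau_one_right[OF N Y ji *(3)] by simp
  qed simp
  then show ?thesis by blast
qed

section \<open>Submodules and transport of structure\<close>

lemma pmod_hom_comp:
  assumes "pmod_hom M N f" "pmod_hom N L g"
  shows "pmod_hom M L (\<lambda>a x. g a (f a x))"
  unfolding pmod_hom_def pers_hom_def
  using hom_compose'[OF pmod_hom_hom[OF assms(1)] pmod_hom_hom[OF assms(2)]]
  by (simp add: pmod_hom_smap[OF assms(1)] pmod_hom_smap[OF assms(2)] pmod_hom_act[OF assms(1)]
    pmod_hom_act[OF assms(2)] pmod_hom_closed[OF assms(1)])

lemma pmod_homI:
  assumes "\<And>a. f a \<in> hom (grp M a) (grp N a)"
    "\<And>a b x. \<lbrakk>a \<le> b; x \<in> el M a\<rbrakk> \<Longrightarrow> f b (smap M a b x) = smap N a b (f a x)"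
    "\<And>a r x. x \<in> el M a \<Longrightarrow> f a (act M a r x) = act N a r (f a x)"
  shows "pmod_hom M N f"
  using assms by (simp add: pmod_hom_def pers_hom_def)

lemma restrict_simps:
  "grp (restrict_pmod M S) a = (grp M a)\<lparr>carrier := S a\<rparr>"
  "smap (restrict_pmod M S) = smap M" "act (restrict_pmod M S) = act M"
  by (simp_all add: restrict_pmod_def)

lemma subpmoduleD:
  assumes "subpmodule M S"
  shows "subgroup (S a) (grp M a)" "x \<in> S a \<Longrightarrow> x \<in> el M a" "x \<in> S a \<Longrightarrow> act M a r x \<in> S a"
    "\<lbrakk>a \<le> b; x \<in> S a\<rbrakk> \<Longrightarrow> smap M a b x \<in> S b"
proof -
  show s: "subgroup (S a) (grp M a)" using assms by (simp add: subpmodule_def)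
  then show "x \<in> S a \<Longrightarrow> x \<in> el M a" by (rule subgroup.mem_carrier)
  show "x \<in> S a \<Longrightarrow> act M a r x \<in> S a" "\<lbrakk>a \<le> b; x \<in> S a\<rbrakk> \<Longrightarrow> smap M a b x \<in> S b"
    using assms unfolding subpmodule_def by blast+
qed

lemma restrict_pmod_module:
  assumes M: "persistence_module sd M" and S: "subpmodule M S"
  shows "persistence_module sd (restrict_pmod M S)"
proof -
  note sub = subpmoduleD[OF S]
  have sc: "comm_group ((grp M a)\<lparr>carrier := S a\<rparr>)" for a
    by (rule group.group_comm_groupI[OF subgroup.subgroup_is_group[OF sub(1) pmod_group[OF M]]])
      (use sub(2) comm_groupE(4)[OF pmod_comm_group[OF M]] in auto)
  show ?thesis
  proof (intro persistence_module.intro persistence_group.intro persistence_module_axioms.intro,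
      unfold restrict_simps)
    show "smap M a b \<in> hom ((grp M a)\<lparr>carrier := S a\<rparr>) ((grp M b)\<lparr>carrier := S b\<rparr>)" if "a \<le> b" for a b
      by (rule homI) (use sub that in \<open>auto simp: hom_mult[OF pmod_smap_hom[OF M]]\<close>)
    show "act M a r \<in> hom ((grp M a)\<lparr>carrier := S a\<rparr>) ((grp M a)\<lparr>carrier := S a\<rparr>)" for a r
      by (rule homI) (use sub in \<open>auto simp: hom_mult[OF pmod_act_hom[OF M]]\<close>)
  qed (use sub sc in \<open>simp_all add: pmod_smap_id[OF M] pmod_smap_comp[OF M] pmod_act_smap[OF M]
     persistence_module.act_add[OF M] persistence_module.act_one[OF M] persistence_module.act_mult[OF M]\<close>)
qed

lemma restrict_into:
  assumes "pmod_hom X M f" "\<And>a x. x \<in> el X a \<Longrightarrow> f a x \<in> S a"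
  shows "pmod_hom X (restrict_pmod M S) f"
  using assms pmod_hom_hom[OF assms(1)]
  by (intro pmod_homI) (auto simp: restrict_simps hom_def pmod_hom_smap pmod_hom_act)

lemma restrict_from:
  assumes "pmod_hom M N f" "subpmodule M S"
  shows "pmod_hom (restrict_pmod M S) N f"
  using pmod_hom_hom[OF assms(1)] subpmoduleD[OF assms(2)]
  by (intro pmod_homI) (auto simp: restrict_simps hom_def Pi_def pmod_hom_smap[OF assms(1)] pmod_hom_act[OF assms(1)])

lemma restrict_incl: "subpmodule M S \<Longrightarrow> pmod_hom (restrict_pmod M S) M (\<lambda>_ x. x)"
  by (rule restrict_from[OF pmod_hom_id])

lemma pmod_group_hom:
  assumes "pmod_hom M N f" "persistence_module sd M" "persistence_module sd N"
  shows "group_hom (grp M a) (grp N a) (f a)"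
  using assms by (simp add: group_hom_def group_hom_axioms_def pmod_group pmod_hom_hom)

lemma kernel_subpmodule:
  assumes f: "pmod_hom M N f" and M: "persistence_module sd M" and N: "persistence_module sd N"
  shows "subpmodule M (\<lambda>a. kernel (grp M a) (grp N a) (f a))"
  unfolding subpmodule_def
proof (intro conjI allI impI subsetI)
  show "subgroup (kernel (grp M a) (grp N a) (f a)) (grp M a)" for a
    by (rule group_hom.subgroup_kernel[OF pmod_group_hom[OF f M N]])
  show "x \<in> kernel (grp M a) (grp N a) (f a)" if "x \<in> act M a r ` kernel (grp M a) (grp N a) (f a)" for a r x
    using that hom_one[OF pmod_act_hom[OF N] pmod_group[OF N] pmod_group[OF N]]
    by (auto simp: kernel_def pmod_act_closed[OF M] pmod_hom_act[OF f])
  show "x \<in> kernel (grp M b) (grp N b) (f b)" if "a \<le> b" "x \<in> smap M a b ` kernel (grp M a) (grp N a) (f a)" for a b x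
    using that hom_one[OF pmod_smap_hom[OF N that(1)] pmod_group[OF N] pmod_group[OF N]]
    by (auto simp: kernel_def pmod_smap_closed[OF M] pmod_hom_smap[OF f])
qed

lemma image_subpmodule:
  assumes f: "pmod_hom M N f" and M: "persistence_module sd M" and N: "persistence_module sd N"
  shows "subpmodule N (\<lambda>a. f a ` el M a)"
  unfolding subpmodule_def
proof (intro conjI allI impI subsetI)
  show "subgroup (f a ` el M a) (grp N a)" for a
    by (rule group_hom.img_is_subgroup[OF pmod_group_hom[OF f M N]])
  show "x \<in> f a ` el M a" if "x \<in> act N a r ` f a ` el M a" for a r x
    using that by (auto simp: pmod_hom_act[OF f, symmetric] pmod_act_closed[OF M])
  show "x \<in> f b ` el M b" if "a \<le> b" "x \<in> smap N a b ` f a ` el M a" for a b x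
    using that by (auto simp: pmod_hom_smap[OF f, symmetric] pmod_smap_closed[OF M])
qed

text \<open>Copies a module along an injection, mainly into the type over which flatness and
  projectivity are tested. For injective \<open>h\<close>, \<open>inv_into UNIV h\<close> undoes
  \<open>h\<close> on its image.\<close>

definition transport :: "('m \<Rightarrow> 'n) \<Rightarrow> ('p, 'm, 'r) pmod \<Rightarrow> ('p, 'n, 'r) pmod" where
  "transport h M = \<lparr>
    grp = \<lambda>a. \<lparr>carrier = h ` el M a,
      mult = \<lambda>x y. h (inv_into UNIV h x \<otimes>\<^bsub>grp M a\<^esub> inv_into UNIV h y), one = h \<one>\<^bsub>grp M a\<^esub>\<rparr>,
    smap = \<lambda>a b x. h (smap M a b (inv_into UNIV h x)),
    act = \<lambda>a r x. h (act M a r (inv_into UNIV h x))\<rparr>"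

context
  fixes h :: "'m \<Rightarrow> 'n" and M :: "('p::preorder, 'm, 'r::{ring, monoid_mult}) pmod" and sd
  assumes h: "inj h" and M: "persistence_module sd M"
begin

lemma transport_simps:
  "carrier (grp (transport h M) a) = h ` el M a"
  "h x \<otimes>\<^bsub>grp (transport h M) a\<^esub> h y = h (x \<otimes>\<^bsub>grp M a\<^esub> y)"
  "\<one>\<^bsub>grp (transport h M) a\<^esub> = h \<one>\<^bsub>grp M a\<^esub>"
  "smap (transport h M) a b (h x) = h (smap M a b x)"
  "act (transport h M) a r (h x) = h (act M a r x)"
  by (simp_all add: transport_def h)

lemma transport_module: "persistence_module sd (transport h M)"
proof -
  have c: "comm_group (grp (transport h M) a)" for a
  proof -
    interpret comm_group "grp M a" using M by (rule pmod_comm_group)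
    show ?thesis
    proof (rule comm_groupI)
      fix x assume "x \<in> el (transport h M) a"
      then obtain x' where "x' \<in> el M a" "x = h x'" by (auto simp: transport_simps)
      then show "\<exists>y\<in>el (transport h M) a. y \<otimes>\<^bsub>grp (transport h M) a\<^esub> x = \<one>\<^bsub>grp (transport h M) a\<^esub>"
        by (intro bexI[of _ "h (inv\<^bsub>grp M a\<^esub> x')"]) (simp_all add: transport_simps)
    qed (auto simp: transport_simps m_assoc intro!: arg_cong[where f = h] m_comm)
  qed
  show ?thesis
  proof (intro persistence_module.intro persistence_group.intro persistence_module_axioms.intro)
    show "smap (transport h M) a b \<in> hom (grp (transport h M) a) (grp (transport h M) b)" if "a \<le> b" for a b
      by (rule homI) (use that in \<open>auto simp: transport_simps pmod_smap_closed[OF M] hom_mult[OF pmod_smap_hom[OF M]]\<close>)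
    show "act (transport h M) a r \<in> hom (grp (transport h M) a) (grp (transport h M) a)" for a r
      by (rule homI) (auto simp: transport_simps pmod_act_closed[OF M] hom_mult[OF pmod_act_hom[OF M]])
    fix a r r' x
    show "act (transport h M) a (r * r') x = (case sd of
        Left \<Rightarrow> act (transport h M) a r (act (transport h M) a r' x)
        | Right \<Rightarrow> act (transport h M) a r' (act (transport h M) a r x))" if "x \<in> el (transport h M) a"
      using that by (cases sd) (auto simp: transport_simps persistence_module.act_mult[OF M])
  qed (use c in \<open>auto simp: transport_simps pmod_smap_id[OF M] pmod_smap_comp[OF M] pmod_act_smap[OF M]
     persistence_module.act_add[OF M] persistence_module.act_one[OF M]\<close>)
qed

lemma transport_to: "pmod_hom M (transport h M) (\<lambda>_. h)"
  by (rule pmod_homI) (auto simp: transport_simps intro!: homI)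

lemma transport_from: "pmod_hom (transport h M) M (\<lambda>_. inv_into UNIV h)"
  by (rule pmod_homI) (auto simp: transport_simps h intro!: homI)

end

section \<open>Projective modules\<close>

lemma projective_module: "projective u sd M \<Longrightarrow> persistence_module sd M"
  by (simp add: projective_def)

text \<open>Frees the lifting property from the type \<open>'u\<close> and from surjectivity.
  \<open>W\<close> is cut down to the image of \<open>g\<close>, which contains the values of
  \<open>f\<close>; then \<open>Y\<close> and this image are copied into \<open>'u\<close>, and the
  lift is carried back.\<close>

lemma projective_lift:
  fixes u :: "'u itself" and Y :: "('p::preorder, 'y, 'r::{ring, monoid_mult}) pmod"
    and W :: "('p, 'w, 'r) pmod" and iy :: "'y \<Rightarrow> 'u" and iw :: "'w \<Rightarrow> 'u"
  assumes P: "projective u sd P" and iy: "inj iy" and iw: "inj iw"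
    and Y: "persistence_module sd Y" and W: "persistence_module sd W"
    and g: "pmod_hom Y W g" and f: "pmod_hom P W f"
    and fg: "\<And>a x. x \<in> el P a \<Longrightarrow> f a x \<in> g a ` el Y a"
  shows "\<exists>h. pmod_hom P Y h \<and> (\<forall>a. \<forall>x\<in>el P a. g a (h a x) = f a x)"
proof -
  let ?S = "\<lambda>a. g a ` el Y a"
  have S: "subpmodule W ?S" by (rule image_subpmodule[OF g Y W])
  note W1 = restrict_pmod_module[OF W S]
  have g1: "pmod_hom Y (restrict_pmod W ?S) g" by (rule restrict_into[OF g]) simp
  have f1: "pmod_hom P (restrict_pmod W ?S) f" by (rule restrict_into[OF f]) (rule fg)
  let ?Y = "transport iy Y" and ?W = "transport iw (restrict_pmod W ?S)"
  let ?g = "\<lambda>a x. iw (g a (inv_into UNIV iy x))"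
  have gu: "pmod_hom ?Y ?W ?g"
    using pmod_hom_comp[OF pmod_hom_comp[OF transport_from[OF iy Y] g1] transport_to[OF iw W1]] .
  have fu: "pmod_hom P ?W (\<lambda>a x. iw (f a x))"
    using pmod_hom_comp[OF f1 transport_to[OF iw W1]] .
  have surj: "pers_surj ?Y ?W ?g"
    by (auto simp: pers_surj_def transport_simps[OF iy Y] transport_simps[OF iw W1] restrict_simps iy)
      (metis (no_types, lifting) image_iff inv_f_f iy)
  obtain h where h: "pmod_hom P ?Y h" "\<And>a x. x \<in> el P a \<Longrightarrow> ?g a (h a x) = iw (f a x)"
    using P transport_module[OF iy Y] transport_module[OF iw W1] gu surj fu
    unfolding projective_def by blast
  show ?thesis
    using pmod_hom_comp[OF h(1) transport_from[OF iy Y]] h(2) iw by (auto simp: inj_eq)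
qed

text \<open>Lift \<open>f\<close> after \<open>p\<close> and precompose with \<open>i\<close>.
  Besides direct summands this covers isomorphic copies, so projectivity survives a change of
  type.\<close>

lemma projective_retract:
  fixes u :: "'u itself" and P :: "('p::preorder, 'm, 'r::{ring, monoid_mult}) pmod"
    and N :: "('p, 'n, 'r) pmod"
  assumes P: "projective u sd P" and N: "persistence_module sd N"
    and i: "pmod_hom N P i" and p: "pmod_hom P N p" and pi: "\<And>a x. x \<in> el N a \<Longrightarrow> p a (i a x) = x"
  shows "projective u sd N"
  unfolding projective_def
proof (intro conjI allI impI)
  show "persistence_module sd N" by fact
  fix Y W :: "('p, 'u, 'r) pmod" and g f
  assume *: "persistence_module sd Y \<and> persistence_module sd W \<and> pmod_hom Y W g \<and> pers_surj Y W g \<and> pmod_hom N W f"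
  then obtain h where "pmod_hom P Y h" "\<And>a x. x \<in> el P a \<Longrightarrow> g a (h a x) = f a (p a x)"
    using P pmod_hom_comp[OF p, of W f] unfolding projective_def by blast
  then show "\<exists>h. pmod_hom N Y h \<and> (\<forall>a. \<forall>x\<in>el N a. g a (h a x) = f a x)"
    using pmod_hom_comp[OF i] pmod_hom_closed[OF i] pi by (intro exI[of _ "\<lambda>a x. h a (i a x)"]) simp
qed

section \<open>Free persistence modules\<close>

text \<open>A generator \<open>x \<in> S a\<close> of degree \<open>a\<close> is represented by the monomial at \<open>(a, x)\<close>.\<close>

definition free_pmod ::
  "side \<Rightarrow> ('p::preorder \<Rightarrow> 'x set) \<Rightarrow> ('p, 'p \<times> 'x \<Rightarrow>\<^sub>0 'r, 'r::{ring, monoid_mult}) pmod" where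
  "free_pmod sd S = \<lparr>
    grp = \<lambda>a. \<lparr>carrier = {\<phi>. \<forall>k\<in>Poly_Mapping.keys \<phi>. fst k \<le> a \<and> snd k \<in> S (fst k)}, mult = (+), one = 0\<rparr>,
    smap = \<lambda>a b \<phi>. \<phi>,
    act = \<lambda>a c. Poly_Mapping.map (case sd of Left \<Rightarrow> (*) c | Right \<Rightarrow> (\<lambda>r. r * c))\<rparr>"

lemma free_simps:
  "\<phi> \<in> el (free_pmod sd S) a \<longleftrightarrow> (\<forall>k\<in>Poly_Mapping.keys \<phi>. fst k \<le> a \<and> snd k \<in> S (fst k))"
  "\<phi> \<otimes>\<^bsub>grp (free_pmod sd S) a\<^esub> \<psi> = \<phi> + \<psi>"
  "\<one>\<^bsub>grp (free_pmod sd S) a\<^esub> = 0"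
  "smap (free_pmod sd S) a b \<phi> = \<phi>"
  by (simp_all add: free_pmod_def)

lemma lookup_free_act:
  "Poly_Mapping.lookup (act (free_pmod sd S) a c \<phi>) k = (case sd of Left \<Rightarrow> c * Poly_Mapping.lookup \<phi> k | Right \<Rightarrow> Poly_Mapping.lookup \<phi> k * c)"
  by (cases sd) (simp_all add: free_pmod_def map.rep_eq when_def)

lemma keys_free_act: "Poly_Mapping.keys (act (free_pmod sd S) a c \<phi>) \<subseteq> Poly_Mapping.keys \<phi>"
proof
  fix k assume "k \<in> Poly_Mapping.keys (act (free_pmod sd S) a c \<phi>)"
  then have "Poly_Mapping.lookup (act (free_pmod sd S) a c \<phi>) k \<noteq> 0" by (simp add: in_keys_iff)
  then show "k \<in> Poly_Mapping.keys \<phi>"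
    by (cases sd) (auto simp: lookup_free_act in_keys_iff)
qed

lemma free_comm_group: "comm_group (grp (free_pmod sd S) a)"
proof (rule comm_groupI)
  fix \<phi> \<psi> :: "'a \<times> 'b \<Rightarrow>\<^sub>0 'c"
  assume \<phi>: "\<phi> \<in> el (free_pmod sd S) a"
  then show "\<exists>\<chi>\<in>el (free_pmod sd S) a. \<chi> \<otimes>\<^bsub>grp (free_pmod sd S) a\<^esub> \<phi> = \<one>\<^bsub>grp (free_pmod sd S) a\<^esub>"
    by (intro bexI[of _ "- \<phi>"]) (auto simp: free_simps keys_def)
  assume "\<psi> \<in> el (free_pmod sd S) a"
  with \<phi> show "\<phi> \<otimes>\<^bsub>grp (free_pmod sd S) a\<^esub> \<psi> \<in> el (free_pmod sd S) a"
    using keys_add[of \<phi> \<psi>] by (auto simp: free_simps)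
qed (auto simp: free_simps algebra_simps)

lemma free_module:
  "persistence_module sd (free_pmod sd S :: ('p::preorder, 'p \<times> 'x \<Rightarrow>\<^sub>0 'r, 'r::{ring, monoid_mult}) pmod)"
proof (intro persistence_module.intro persistence_group.intro persistence_module_axioms.intro)
  let ?F = "free_pmod sd S :: ('p, 'p \<times> 'x \<Rightarrow>\<^sub>0 'r, 'r) pmod"
  show "comm_group (grp ?F a)" for a by (rule free_comm_group)
  show "smap ?F a b \<in> hom (grp ?F a) (grp ?F b)" if "a \<le> b" for a b
    by (rule homI) (use that in \<open>auto simp: free_simps intro: order_trans\<close>)
  show "act ?F a c \<in> hom (grp ?F a) (grp ?F a)" for a c
  proof (rule homI)
    show "act ?F a c x \<in> el ?F a" if "x \<in> el ?F a" for x
      using that keys_free_act[of sd S a c x] by (auto simp: free_simps)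
    show "act ?F a c (x \<otimes>\<^bsub>grp ?F a\<^esub> y) = act ?F a c x \<otimes>\<^bsub>grp ?F a\<^esub> act ?F a c y" for x y
      by (rule poly_mapping_eqI) (cases sd; simp add: free_simps lookup_free_act lookup_add algebra_simps)
  qed
  fix a c c' x
  show "act ?F a (c + c') x = act ?F a c x \<otimes>\<^bsub>grp ?F a\<^esub> act ?F a c' x"
    by (rule poly_mapping_eqI) (cases sd; simp add: free_simps lookup_free_act lookup_add algebra_simps)
  show "act ?F a 1 x = x"
    by (rule poly_mapping_eqI) (cases sd; simp add: lookup_free_act)
  show "act ?F a (c * c') x = (case sd of Left \<Rightarrow> act ?F a c (act ?F a c' x) | Right \<Rightarrow> act ?F a c' (act ?F a c x))"
    by (rule poly_mapping_eqI) (cases sd; simp add: lookup_free_act algebra_simps)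
  show "smap ?F a b (act ?F a c x) = act ?F b c (smap ?F a b x)" for b
    by (simp add: free_simps) (simp add: free_pmod_def)
qed (auto simp: free_simps)

definition free_lift where
  "free_lift Y y b \<phi> = finprod (grp Y b)
    (\<lambda>k. smap Y (fst k) b (act Y (fst k) (Poly_Mapping.lookup \<phi> k) (y k))) (Poly_Mapping.keys \<phi>)"

context
  fixes Y :: "('p::preorder, 'y, 'r::{ring, monoid_mult}) pmod" and sd S and y :: "'p \<times> 'x \<Rightarrow> 'y"
  assumes Y: "persistence_module sd Y" and y: "\<And>k. snd k \<in> S (fst k) \<Longrightarrow> y k \<in> el Y (fst k)"
begin

lemma free_lift_summand:
  "\<lbrakk>fst k \<le> b; snd k \<in> S (fst k)\<rbrakk> \<Longrightarrow> smap Y (fst k) b (act Y (fst k) c (y k)) \<in> el Y b"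
  by (intro pmod_smap_closed[OF Y] pmod_act_closed[OF Y] y)

text \<open>Allows sums over different supports to be compared over a common finite set; additivity
  of \<open>free_lift\<close> needs this because supports of sums can shrink.\<close>

lemma free_lift_superset:
  assumes "finite D" "Poly_Mapping.keys \<phi> \<subseteq> D" "\<And>k. k \<in> D \<Longrightarrow> fst k \<le> b \<and> snd k \<in> S (fst k)"
  shows "free_lift Y y b \<phi> = finprod (grp Y b) (\<lambda>k. smap Y (fst k) b (act Y (fst k) (Poly_Mapping.lookup \<phi> k) (y k))) D"
proof -
  interpret Yb: comm_group "grp Y b" using Y by (rule pmod_comm_group)
  show ?thesis
    unfolding free_lift_def
  proof (rule Yb.finprod_mono_neutral_cong_left[OF assms(1,2)])
    show "smap Y (fst k) b (act Y (fst k) (Poly_Mapping.lookup \<phi> k) (y k)) = \<one>\<^bsub>grp Y b\<^esub>" if "k \<in> D - Poly_Mapping.keys \<phi>" for k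
      using that assms(3)[of k] hom_one[OF pmod_smap_hom[OF Y] pmod_group[OF Y] pmod_group[OF Y], of "fst k" b]
      by (simp add: in_keys_iff pmod_act_zero[OF Y] y)
  qed (use assms(3) free_lift_summand in auto)
qed

lemma free_lift_hom: "pmod_hom (free_pmod sd S) Y (free_lift Y y)"
proof (rule pmod_homI)
  let ?F = "free_pmod sd S :: ('p, 'p \<times> 'x \<Rightarrow>\<^sub>0 'r, 'r) pmod"
  let ?s = "\<lambda>b \<phi> k. smap Y (fst k) b (act Y (fst k) (Poly_Mapping.lookup \<phi> k) (y k))"
  have s: "?s b \<phi> \<in> Poly_Mapping.keys \<phi> \<rightarrow> el Y b" if "\<phi> \<in> el ?F b" for \<phi> b
    using that free_lift_summand by (auto simp: free_simps)
  show "free_lift Y y a \<in> hom (grp ?F a) (grp Y a)" for a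
  proof (rule homI)
    interpret Ya: comm_group "grp Y a" using Y by (rule pmod_comm_group)
    show "free_lift Y y a \<phi> \<in> el Y a" if "\<phi> \<in> el ?F a" for \<phi>
      unfolding free_lift_def by (rule Ya.finprod_closed[OF s[OF that]])
    fix \<phi> \<psi> assume \<phi>: "\<phi> \<in> el ?F a" and \<psi>: "\<psi> \<in> el ?F a"
    let ?D = "Poly_Mapping.keys \<phi> \<union> Poly_Mapping.keys \<psi>"
    have D: "finite ?D" "\<And>k. k \<in> ?D \<Longrightarrow> fst k \<le> a \<and> snd k \<in> S (fst k)"
      using \<phi> \<psi> by (auto simp: free_simps)
    have sD: "?s a \<chi> \<in> ?D \<rightarrow> el Y a" for \<chi> using D free_lift_summand by auto
    have "free_lift Y y a (\<phi> + \<psi>) = finprod (grp Y a) (?s a (\<phi> + \<psi>)) ?D"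
      using D keys_add[of \<phi> \<psi>] by (intro free_lift_superset) auto
    also have "\<dots> = finprod (grp Y a) (\<lambda>k. ?s a \<phi> k \<otimes>\<^bsub>grp Y a\<^esub> ?s a \<psi> k) ?D"
    proof (rule Ya.finprod_cong')
      fix k assume "k \<in> ?D"
      then have k: "fst k \<le> a" "y k \<in> el Y (fst k)" using D(2) y by auto
      then show "?s a (\<phi> + \<psi>) k = ?s a \<phi> k \<otimes>\<^bsub>grp Y a\<^esub> ?s a \<psi> k"
        by (simp add: lookup_add persistence_module.act_add[OF Y] hom_mult[OF pmod_smap_hom[OF Y]] pmod_act_closed[OF Y])
    qed (use sD in auto)
    also have "\<dots> = finprod (grp Y a) (?s a \<phi>) ?D \<otimes>\<^bsub>grp Y a\<^esub> finprod (grp Y a) (?s a \<psi>) ?D"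
      by (rule Ya.finprod_multf[OF sD sD])
    also have "\<dots> = free_lift Y y a \<phi> \<otimes>\<^bsub>grp Y a\<^esub> free_lift Y y a \<psi>"
      using free_lift_superset[OF D(1) _ D(2), of \<phi>] free_lift_superset[OF D(1) _ D(2), of \<psi>] by simp
    finally show "free_lift Y y a (\<phi> \<otimes>\<^bsub>grp ?F a\<^esub> \<psi>) = free_lift Y y a \<phi> \<otimes>\<^bsub>grp Y a\<^esub> free_lift Y y a \<psi>"
      by (simp add: free_simps)
  qed
  fix a \<phi> assume \<phi>: "\<phi> \<in> el ?F a"
  note c = pmod_comm_group[OF Y]
  have k: "fst k \<le> a" "snd k \<in> S (fst k)" "y k \<in> el Y (fst k)" if "k \<in> Poly_Mapping.keys \<phi>" for k
    using \<phi> that y by (auto simp: free_simps)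
  show "free_lift Y y b (smap ?F a b \<phi>) = smap Y a b (free_lift Y y a \<phi>)" if ab: "a \<le> b" for b
  proof -
    have "smap Y a b (free_lift Y y a \<phi>) = finprod (grp Y b) (\<lambda>k. smap Y a b (?s a \<phi> k)) (Poly_Mapping.keys \<phi>)"
      unfolding free_lift_def by (rule finprod_hom[OF c c pmod_smap_hom[OF Y ab]]) (rule free_lift_summand[OF k(1,2)])
    also have "\<dots> = free_lift Y y b \<phi>"
      unfolding free_lift_def
    proof (rule comm_monoid.finprod_cong')
      show "comm_monoid (grp Y b)" using c by (simp add: comm_group_def)
      show "smap Y a b (?s a \<phi> k) = ?s b \<phi> k" if "k \<in> Poly_Mapping.keys \<phi>" for k
        using pmod_smap_comp[OF Y k(1)[OF that] ab pmod_act_closed[OF Y k(3)[OF that]]] .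
    qed (use k ab in \<open>auto intro!: free_lift_summand intro: order_trans\<close>)
    finally show ?thesis by (simp add: free_simps)
  qed
  show "free_lift Y y a (act ?F a c \<phi>) = act Y a c (free_lift Y y a \<phi>)" for c
  proof -
    have "act Y a c (free_lift Y y a \<phi>) = finprod (grp Y a) (\<lambda>k. act Y a c (?s a \<phi> k)) (Poly_Mapping.keys \<phi>)"
      unfolding free_lift_def
      by (rule finprod_hom[OF pmod_comm_group[OF Y] pmod_comm_group[OF Y] pmod_act_hom[OF Y]])
        (rule free_lift_summand[OF k(1,2)])
    also have "\<dots> = finprod (grp Y a) (?s a (act ?F a c \<phi>)) (Poly_Mapping.keys \<phi>)"
    proof (rule comm_monoid.finprod_cong')
      show "comm_monoid (grp Y a)" using pmod_comm_group[OF Y] by (simp add: comm_group_def)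
      show "act Y a c (?s a \<phi> k) = ?s a (act ?F a c \<phi>) k" if "k \<in> Poly_Mapping.keys \<phi>" for k
        unfolding pmod_act_smap[OF Y k(1)[OF that] pmod_act_closed[OF Y k(3)[OF that]], symmetric] lookup_free_act
        using persistence_module.act_mult[OF Y k(3)[OF that]] by (cases sd) simp_all
    qed (use k in \<open>auto intro!: free_lift_summand\<close>)
    also have "\<dots> = free_lift Y y a (act ?F a c \<phi>)"
      using k by (intro free_lift_superset[symmetric] keys_free_act) auto
    finally show ?thesis by simp
  qed
qed

lemma free_lift_single:
  assumes "fst k \<le> a" "snd k \<in> S (fst k)"
  shows "free_lift Y y a (Poly_Mapping.single k 1) = smap Y (fst k) a (y k)"
proof -
  interpret Ya: comm_group "grp Y a" using Y by (rule pmod_comm_group)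
  have "free_lift Y y a (Poly_Mapping.single k 1) =
      finprod (grp Y a) (\<lambda>k'. smap Y (fst k') a (act Y (fst k') (Poly_Mapping.lookup (Poly_Mapping.single k 1) k') (y k'))) {k}"
    using assms by (intro free_lift_superset) auto
  also have "\<dots> = smap Y (fst k) a (act Y (fst k) (Poly_Mapping.lookup (Poly_Mapping.single k 1) k) (y k))"
    using assms free_lift_summand[OF assms] by (subst Ya.finprod_insert) auto
  finally show ?thesis using persistence_module.act_one[OF Y y[OF assms(2)]] by simp
qed

end

lemma free_finprod:
  assumes "\<And>k. k \<in> D \<Longrightarrow> f k \<in> el (free_pmod sd S) a"
  shows "finprod (grp (free_pmod sd S) a) f D = sum f D"
proof -
  interpret comm_group "grp (free_pmod sd S) a" by (rule free_comm_group)
  show ?thesis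
    using assms
  proof (induction D rule: infinite_finite_induct)
    case (insert k D)
    then have "f \<in> D \<rightarrow> el (free_pmod sd S) a" by auto
    then show ?case using insert by (simp add: free_simps(2))
  qed (simp_all add: free_simps)
qed

lemma single_in_free: "\<lbrakk>fst k \<le> a; snd k \<in> S (fst k)\<rbrakk> \<Longrightarrow> Poly_Mapping.single k c \<in> el (free_pmod sd S) a"
  by (auto simp: free_simps split: if_splits)

lemma free_expand:
  fixes \<phi> :: "'p::preorder \<times> 'x \<Rightarrow>\<^sub>0 'r::{ring, monoid_mult}"
  assumes \<phi>: "\<phi> \<in> el (free_pmod sd S) a"
  shows "\<phi> = free_lift (free_pmod sd S) (\<lambda>k. Poly_Mapping.single k 1) a \<phi>"
proof -
  let ?F = "free_pmod sd S :: ('p, 'p \<times> 'x \<Rightarrow>\<^sub>0 'r, 'r) pmod"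
  have k: "fst k \<le> a" "snd k \<in> S (fst k)" if "k \<in> Poly_Mapping.keys \<phi>" for k
    using that \<phi> by (auto simp: free_simps)
  have act: "act ?F b c (Poly_Mapping.single k 1) = Poly_Mapping.single k c" for b c k
    by (rule poly_mapping_eqI) (cases sd; simp add: lookup_free_act lookup_single when_def)
  have "free_lift ?F (\<lambda>k. Poly_Mapping.single k 1) a \<phi> =
      (\<Sum>k\<in>Poly_Mapping.keys \<phi>. smap ?F (fst k) a (act ?F (fst k) (Poly_Mapping.lookup \<phi> k) (Poly_Mapping.single k 1)))"
    unfolding free_lift_def free_simps(4) act by (rule free_finprod) (rule single_in_free[where S = S, OF k])
  also have "\<dots> = (\<Sum>k\<in>Poly_Mapping.keys \<phi>. Poly_Mapping.single k (Poly_Mapping.lookup \<phi> k))"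
    by (simp add: free_simps(4) act)
  also have "\<dots> = \<phi>"
  proof (rule poly_mapping_eqI)
    fix k
    have "Poly_Mapping.lookup (\<Sum>k\<in>Poly_Mapping.keys \<phi>. Poly_Mapping.single k (Poly_Mapping.lookup \<phi> k)) k =
        (\<Sum>k'\<in>Poly_Mapping.keys \<phi>. if k' = k then Poly_Mapping.lookup \<phi> k' else 0)"
      by (simp add: lookup_sum lookup_single when_def)
    also have "\<dots> = Poly_Mapping.lookup \<phi> k" by (simp add: in_keys_iff)
    finally show "Poly_Mapping.lookup (\<Sum>k\<in>Poly_Mapping.keys \<phi>. Poly_Mapping.single k (Poly_Mapping.lookup \<phi> k)) k = Poly_Mapping.lookup \<phi> k" .
  qed
  finally show ?thesis by simp
qed

lemma pmod_hom_free_lift: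
  assumes g: "pmod_hom Y W g" and Y: "persistence_module sd Y" and W: "persistence_module sd W"
    and y: "\<And>k. snd k \<in> S (fst k) \<Longrightarrow> y k \<in> el Y (fst k)"
    and \<phi>: "\<phi> \<in> el (free_pmod sd S) a"
  shows "g a (free_lift Y y a \<phi>) = free_lift W (\<lambda>k. g (fst k) (y k)) a \<phi>"
proof -
  have k: "fst k \<le> a" "snd k \<in> S (fst k)" "y k \<in> el Y (fst k)" if "k \<in> Poly_Mapping.keys \<phi>" for k
    using that \<phi> y by (auto simp: free_simps)
  have s: "smap Y (fst k) a (act Y (fst k) c (y k)) \<in> el Y a" if "k \<in> Poly_Mapping.keys \<phi>" for k c
    using k[OF that] by (intro pmod_smap_closed[OF Y] pmod_act_closed[OF Y])
  have "g a (free_lift Y y a \<phi>) =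
      finprod (grp W a) (\<lambda>k. g a (smap Y (fst k) a (act Y (fst k) (Poly_Mapping.lookup \<phi> k) (y k)))) (Poly_Mapping.keys \<phi>)"
    unfolding free_lift_def
    by (rule finprod_hom[OF pmod_comm_group[OF Y] pmod_comm_group[OF W] pmod_hom_hom[OF g] s])
  also have "\<dots> = free_lift W (\<lambda>k. g (fst k) (y k)) a \<phi>"
    unfolding free_lift_def
  proof (rule comm_monoid.finprod_cong')
    show "comm_monoid (grp W a)" using pmod_comm_group[OF W] by (simp add: comm_group_def)
    show "g a (smap Y (fst k) a (act Y (fst k) (Poly_Mapping.lookup \<phi> k) (y k))) =
        smap W (fst k) a (act W (fst k) (Poly_Mapping.lookup \<phi> k) (g (fst k) (y k)))" if "k \<in> Poly_Mapping.keys \<phi>" for k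
      using k[OF that] by (simp add: pmod_hom_smap[OF g] pmod_hom_act[OF g] pmod_act_closed[OF Y])
    show "(\<lambda>k. smap W (fst k) a (act W (fst k) (Poly_Mapping.lookup \<phi> k) (g (fst k) (y k)))) \<in> Poly_Mapping.keys \<phi> \<rightarrow> el W a"
      using k by (auto intro!: pmod_smap_closed[OF W] pmod_act_closed[OF W] pmod_hom_closed[OF g])
  qed simp
  finally show ?thesis .
qed

text \<open>A morphism from a free module is fixed by its values on the monomials with coefficient
  1. Preimages of these values are chosen and extended by \<open>free_lift\<close>;
  \<open>free_expand\<close> and \<open>pmod_hom_free_lift\<close> then show that the extension is a
  lift.\<close>

lemma free_projective:
  fixes u :: "'u itself" and S :: "'p::preorder \<Rightarrow> 'x set"
  shows "projective u sd (free_pmod sd S :: ('p, 'p \<times> 'x \<Rightarrow>\<^sub>0 'r, 'r::{ring, monoid_mult}) pmod)"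
  unfolding projective_def
proof (intro conjI allI impI)
  let ?F = "free_pmod sd S :: ('p, 'p \<times> 'x \<Rightarrow>\<^sub>0 'r, 'r) pmod"
  let ?e = "\<lambda>k. Poly_Mapping.single k 1 :: 'p \<times> 'x \<Rightarrow>\<^sub>0 'r"
  show "persistence_module sd ?F" by (rule free_module)
  fix Y W :: "('p, 'u, 'r) pmod" and g f
  assume "persistence_module sd Y \<and> persistence_module sd W \<and> pmod_hom Y W g \<and> pers_surj Y W g \<and> pmod_hom ?F W f"
  then have Y: "persistence_module sd Y" and W: "persistence_module sd W" and g: "pmod_hom Y W g"
    and surj: "pers_surj Y W g" and f: "pmod_hom ?F W f" by auto
  have e: "?e k \<in> el ?F (fst k)" if "snd k \<in> S (fst k)" for k using that by (intro single_in_free) simp_all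
  have "\<exists>y. snd k \<in> S (fst k) \<longrightarrow> y \<in> el Y (fst k) \<and> g (fst k) y = f (fst k) (?e k)" for k
    using surj pmod_hom_closed[OF f e, of k] unfolding pers_surj_def by (metis imageE)
  then have "\<exists>y. \<forall>k. snd k \<in> S (fst k) \<longrightarrow> y k \<in> el Y (fst k) \<and> g (fst k) (y k) = f (fst k) (?e k)"
    by (intro choice allI)
  then obtain y where y: "\<And>k. snd k \<in> S (fst k) \<Longrightarrow> y k \<in> el Y (fst k)"
    "\<And>k. snd k \<in> S (fst k) \<Longrightarrow> g (fst k) (y k) = f (fst k) (?e k)" by blast
  have "g a (free_lift Y y a \<phi>) = f a \<phi>" if \<phi>: "\<phi> \<in> el ?F a" for a \<phi>
  proof -
    have k: "snd k \<in> S (fst k)" if "k \<in> Poly_Mapping.keys \<phi>" for k using that \<phi> by (auto simp: free_simps)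
    have "f a \<phi> = f a (free_lift ?F ?e a \<phi>)" using free_expand[OF \<phi>] by (rule arg_cong)
    also have "\<dots> = free_lift W (\<lambda>k. f (fst k) (?e k)) a \<phi>"
      by (rule pmod_hom_free_lift[OF f free_module W e \<phi>])
    also have "\<dots> = free_lift W (\<lambda>k. g (fst k) (y k)) a \<phi>"
      unfolding free_lift_def
    proof (rule comm_monoid.finprod_cong')
      show "comm_monoid (grp W a)" using pmod_comm_group[OF W] by (simp add: comm_group_def)
      show "(\<lambda>k. smap W (fst k) a (act W (fst k) (Poly_Mapping.lookup \<phi> k) (g (fst k) (y k)))) \<in> Poly_Mapping.keys \<phi> \<rightarrow> el W a"
        using \<phi> y(1) by (auto simp: free_simps intro!: pmod_smap_closed[OF W] pmod_act_closed[OF W] pmod_hom_closed[OF g])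
    qed (simp_all add: y(2) k)
    also have "\<dots> = g a (free_lift Y y a \<phi>)"
      by (rule pmod_hom_free_lift[OF g Y W y(1) \<phi>, symmetric])
    finally show ?thesis by simp
  qed
  then show "\<exists>h. pmod_hom ?F Y h \<and> (\<forall>a. \<forall>\<phi>\<in>el ?F a. g a (h a \<phi>) = f a \<phi>)"
    using free_lift_hom[OF Y y(1)] by (intro exI[of _ "free_lift Y y"]) simp
qed

text \<open>All elements of \<open>N\<close> serve as generators, each in its own degree. The
  injection \<open>i\<close> renames them, so that the type of labels can be chosen to fit the
  available encoding of free modules into the universe.\<close>

lemma free_cover:
  fixes i :: "'n \<Rightarrow> 'x"
  assumes N: "persistence_module sd N" and i: "inj i"
    and S_def: "S = (\<lambda>a. i ` el N a)" and y_def: "y = (\<lambda>k. inv_into UNIV i (snd k))"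
  shows "\<And>k. snd k \<in> S (fst k) \<Longrightarrow> y k \<in> el N (fst k)"
    and "pmod_hom (free_pmod sd S) N (free_lift N y)"
    and "pers_surj (free_pmod sd S) N (free_lift N y)"
proof -
  show y: "y k \<in> el N (fst k)" if "snd k \<in> S (fst k)" for k
    using that i by (auto simp: S_def y_def)
  show h: "pmod_hom (free_pmod sd S) N (free_lift N y)" by (rule free_lift_hom[OF N y])
  show "pers_surj (free_pmod sd S) N (free_lift N y)"
    unfolding pers_surj_def
  proof (intro allI equalityI subsetI)
    fix a x assume x: "x \<in> el N a"
    then have a: "fst (a, i x) \<le> a" "snd (a, i x) \<in> S (fst (a, i x))" by (simp_all add: S_def)
    then have "free_lift N y a (Poly_Mapping.single (a, i x) 1) = x"
      using free_lift_single[where Y = N and y = y and S = S, OF N y a] i x by (simp add: y_def pmod_smap_id[OF N])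
    then show "x \<in> free_lift N y a ` el (free_pmod sd S) a"
      using single_in_free[where S = S, OF a] by (metis image_eqI)
  qed (use pmod_hom_closed[OF h] in blast)
qed

text \<open>The dual basis lemma: a section of the free cover writes each element as a finite
  combination of generators with coefficients linear in the element. The injection
  \<open>enc\<close> brings the free module within reach of \<open>projective_lift\<close>, which
  yields the section.\<close>

lemma projective_dual_basis:
  fixes u :: "'u itself" and N :: "('p::preordered_ab_group_add, 'n, 'r::{ring, monoid_mult}) pmod"
    and i :: "'n \<Rightarrow> 'u" and enc :: "('p \<times> 'u \<Rightarrow>\<^sub>0 'r) \<Rightarrow> 'u"
  assumes P: "projective u sd N" and i: "inj i" and enc: "inj enc"
  shows "\<exists>(d :: 'p \<times> 'u \<Rightarrow> 'p) e \<phi>. dual_basis sd N d e \<phi>"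
proof -
  note N = projective_module[OF P]
  define S where "S = (\<lambda>a. i ` el N a)"
  define y where "y = (\<lambda>k :: 'p \<times> 'u. inv_into UNIV i (snd k))"
  let ?F = "free_pmod sd S :: ('p, 'p \<times> 'u \<Rightarrow>\<^sub>0 'r, 'r) pmod"
  note cover = free_cover[OF N i S_def y_def]
  obtain \<sigma> where \<sigma>: "pmod_hom N ?F \<sigma>" "\<And>a x. x \<in> el N a \<Longrightarrow> free_lift N y a (\<sigma> a x) = x"
    using projective_lift[OF P enc i free_module N cover(2) pmod_hom_id] cover(3)
    unfolding pers_surj_def by blast
  note \<sigma>c = pmod_hom_closed[OF \<sigma>(1)]
  \<comment> \<open>A dual basis is indexed by a whole type, so labels outside \<open>S\<close> need
    a value too. Their coordinates are always zero, and the unit of \<open>N\<close> lies in every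
    degree.\<close>
  define e where "e k = (if snd k \<in> S (fst k) then y k else \<one>\<^bsub>grp N (fst k)\<^esub>)" for k
  have "dual_basis sd N fst e (\<lambda>k a x. Poly_Mapping.lookup (\<sigma> a x) k)"
  proof (intro dual_basis.intro[OF N] dual_basis_axioms.intro)
    show "e k \<in> el N (fst k)" for k
      using cover(1) pmod_one_closed[OF N] by (simp add: e_def)
    fix a k x assume x: "x \<in> el N a"
    show "Poly_Mapping.lookup (\<sigma> a (x \<otimes>\<^bsub>grp N a\<^esub> x')) k = Poly_Mapping.lookup (\<sigma> a x) k + Poly_Mapping.lookup (\<sigma> a x') k" if "x' \<in> el N a" for x'
      by (simp add: hom_mult[OF pmod_hom_hom[OF \<sigma>(1)] x that] free_simps lookup_add)
    show "Poly_Mapping.lookup (\<sigma> a (act N a c x)) k = (case sd of Left \<Rightarrow> c * Poly_Mapping.lookup (\<sigma> a x) k | Right \<Rightarrow> Poly_Mapping.lookup (\<sigma> a x) k * c)" for c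
      by (simp add: pmod_hom_act[OF \<sigma>(1) x] lookup_free_act)
    show "Poly_Mapping.lookup (\<sigma> b (smap N a b x)) k = Poly_Mapping.lookup (\<sigma> a x) k" if "a \<le> b" for b
      by (simp add: pmod_hom_smap[OF \<sigma>(1) that x] free_simps)
    show "fst k \<le> a" if "Poly_Mapping.lookup (\<sigma> a x) k \<noteq> 0"
      using \<sigma>c[OF x] that by (auto simp: free_simps in_keys_iff)
    show "finite {k. Poly_Mapping.lookup (\<sigma> a x) k \<noteq> 0}" by simp
    have "finprod (grp N a) (\<lambda>k. smap N (fst k) a (act N (fst k) (Poly_Mapping.lookup (\<sigma> a x) k) (e k))) {k. Poly_Mapping.lookup (\<sigma> a x) k \<noteq> 0}
        = free_lift N y a (\<sigma> a x)"
      unfolding free_lift_def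
    proof (rule comm_monoid.finprod_cong')
      show "comm_monoid (grp N a)" using pmod_comm_group[OF N] by (simp add: comm_group_def)
      have k: "fst k \<le> a" "snd k \<in> S (fst k)" if "k \<in> Poly_Mapping.keys (\<sigma> a x)" for k
        using \<sigma>c[OF x] that by (auto simp: free_simps)
      show "(\<lambda>k. smap N (fst k) a (act N (fst k) (Poly_Mapping.lookup (\<sigma> a x) k) (y k))) \<in> Poly_Mapping.keys (\<sigma> a x) \<rightarrow> el N a"
        using k cover(1) by (auto intro!: pmod_smap_closed[OF N] pmod_act_closed[OF N])
      show "smap N (fst k) a (act N (fst k) (Poly_Mapping.lookup (\<sigma> a x) k) (e k)) =
          smap N (fst k) a (act N (fst k) (Poly_Mapping.lookup (\<sigma> a x) k) (y k))" if "k \<in> Poly_Mapping.keys (\<sigma> a x)" for k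
        using k[OF that] by (simp add: e_def)
    qed (simp add: keys.rep_eq)
    then show "x = finprod (grp N a) (\<lambda>k. smap N (fst k) a (act N (fst k) (Poly_Mapping.lookup (\<sigma> a x) k) (e k)))
        {k. Poly_Mapping.lookup (\<sigma> a x) k \<noteq> 0}"
      using \<sigma>(2)[OF x] by simp
  qed
  then show ?thesis by blast
qed

lemma projective_cover_exists:
  fixes u :: "'u itself" and Y :: "('p::preorder, 'y, 'r::{ring, monoid_mult}) pmod"
    and enc :: "('p \<times> 'y \<Rightarrow>\<^sub>0 'r) \<Rightarrow> 'u"
  assumes Y: "persistence_module sd Y" and enc: "inj enc"
  shows "\<exists>(F :: ('p, 'u, 'r) pmod) q. projective u sd F \<and> pmod_hom F Y q \<and> pers_surj F Y q"
proof -
  define S where "S = (\<lambda>a. id ` el Y a)"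
  define y where "y = (\<lambda>k :: 'p \<times> 'y. inv_into UNIV id (snd k))"
  note cover = free_cover[OF Y inj_on_id S_def y_def]
  let ?N = "free_pmod sd S :: ('p, 'p \<times> 'y \<Rightarrow>\<^sub>0 'r, 'r) pmod" and ?F = "transport enc (free_pmod sd S)"
  let ?q = "\<lambda>a x. free_lift Y y a (inv_into UNIV enc x)"
  have "projective u sd ?F"
    by (rule projective_retract[OF free_projective transport_module[OF enc free_module]
          transport_from[OF enc free_module] transport_to[OF enc free_module]])
      (auto simp: transport_simps[OF enc free_module] enc)
  moreover have "pmod_hom ?F Y ?q"
    by (rule pmod_hom_comp[OF transport_from[OF enc free_module] cover(2)])
  moreover have "pers_surj ?F Y ?q"
    using cover(3) enc
    by (simp add: pers_surj_def transport_simps[OF enc free_module] image_image)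
  ultimately show ?thesis by blast
qed

section \<open>Projective resolutions\<close>

lemma trivial_submodule: "persistence_module sd M \<Longrightarrow> subpmodule M (\<lambda>a. {\<one>\<^bsub>grp M a\<^esub>})"
  using group.triv_subgroup[OF pmod_group] hom_one[OF pmod_act_hom pmod_group pmod_group]
    hom_one[OF pmod_smap_hom pmod_group pmod_group]
  by (auto simp: subpmodule_def)

lemma pmod_hom_trivial:
  assumes "persistence_module sd N"
  shows "pmod_hom M N (\<lambda>a x. \<one>\<^bsub>grp N a\<^esub>)"
  using pmod_one_closed[OF assms] hom_one[OF pmod_act_hom pmod_group pmod_group, OF assms assms assms]
    hom_one[OF pmod_smap_hom pmod_group pmod_group, OF assms _ assms assms]
    monoid.l_one[OF group.is_monoid[OF pmod_group[OF assms]] pmod_one_closed[OF assms]]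
  by (intro pmod_homI) (simp_all add: hom_def)

lemma pmod_hom_one:
  assumes "pmod_hom M N f" "persistence_module sd M" "persistence_module sd N"
  shows "f a \<one>\<^bsub>grp M a\<^esub> = \<one>\<^bsub>grp N a\<^esub>"
  by (rule hom_one[OF pmod_hom_hom[OF assms(1)] pmod_group[OF assms(2)] pmod_group[OF assms(3)]])

text \<open>Provides the zero module, over the same type as \<open>P\<close>, for the negative
  degrees of a resolution.\<close>

lemma trivial_projective:
  assumes P: "projective u sd P"
  shows "projective u sd (restrict_pmod P (\<lambda>a. {\<one>\<^bsub>grp P a\<^esub>}))"
proof -
  note M = projective_module[OF P]
  note S = trivial_submodule[OF M]
  show ?thesis
    by (rule projective_retract[OF P restrict_pmod_module[OF M S] restrict_incl[OF S]
        restrict_into[OF pmod_hom_trivial[OF M]]]) (simp_all add: restrict_simps)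
qed

text \<open>Iterated free covers of kernels. The type stays \<open>'u\<close> at every stage because
  \<open>enc\<close> brings free modules over \<open>'u\<close> back into \<open>'u\<close>.\<close>

lemma projective_resolution_exists:
  fixes A :: "('p::preorder, 'a, 'r::{ring, monoid_mult}) pmod" and ia :: "'a \<Rightarrow> 'u"
    and enc :: "('p \<times> 'u \<Rightarrow>\<^sub>0 'r) \<Rightarrow> 'u"
  assumes A: "lmod A" and ia: "inj ia" and enc: "inj enc"
  shows "\<exists>(Q :: ('p, 'u, 'r) pmod_complex) e. projective_resolution Q e A"
proof -
  let ?u = "TYPE('u)"
  have "\<forall>Y :: ('p, 'u, 'r) pmod. \<exists>Fq :: ('p, 'u, 'r) pmod \<times> ('p \<Rightarrow> 'u \<Rightarrow> 'u). lmod Y \<longrightarrow>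
      projective ?u Left (fst Fq) \<and> pmod_hom (fst Fq) Y (snd Fq) \<and> pers_surj (fst Fq) Y (snd Fq)"
    using projective_cover_exists[OF _ enc, of Left _ ?u] by fastforce
  from choice[OF this] obtain c :: "('p, 'u, 'r) pmod \<Rightarrow> ('p, 'u, 'r) pmod \<times> ('p \<Rightarrow> 'u \<Rightarrow> 'u)"
    where c: "\<forall>Y :: ('p, 'u, 'r) pmod. lmod Y \<longrightarrow>
      projective ?u Left (fst (c Y)) \<and> pmod_hom (fst (c Y)) Y (snd (c Y)) \<and> pers_surj (fst (c Y)) Y (snd (c Y))"
    by (rule exE)
  define K where "K Y a = kernel (grp (fst (c Y)) a) (grp Y a) (snd (c Y) a)" for Y a
  \<comment> \<open>\<open>Y n\<close> is the n-th syzygy. Starting from the copy of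
    \<open>A\<close> in \<open>'u\<close> rather than from \<open>A\<close> gives all stages one
    type, which the recursion requires.\<close>
  define Y where "Y = rec_nat (transport ia A) (\<lambda>_ Y. restrict_pmod (fst (c Y)) (K Y))"
  define F where "F n = fst (c (Y n))" for n
  define q where "q n = snd (c (Y n))" for n
  have Y0: "Y 0 = transport ia A" and YS: "Y (Suc n) = restrict_pmod (F n) (K (Y n))" for n
    by (simp_all add: Y_def F_def)
  have Ymod: "lmod (Y n)" for n
  proof (induction n)
    case 0
    show ?case unfolding Y0 by (rule transport_module[OF ia A])
  next
    case (Suc n)
    then have "projective ?u Left (F n)" "pmod_hom (F n) (Y n) (q n)" using c by (auto simp: F_def q_def)
    then show ?case
      unfolding YS K_def F_def q_def
      by (intro restrict_pmod_module kernel_subpmodule[OF _ _ Suc]) (auto intro: projective_module)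
  qed
  have P: "projective ?u Left (F n)" and q: "pmod_hom (F n) (Y n) (q n)" and surj: "pers_surj (F n) (Y n) (q n)" for n
    using c Ymod[of n] by (auto simp: F_def q_def)
  note Fmod = projective_module[OF P]
  have sub: "subpmodule (F n) (K (Y n))" for n
    unfolding K_def F_def[symmetric] q_def[symmetric] by (rule kernel_subpmodule[OF q Fmod Ymod])
  have K: "K (Y n) a = kernel (grp (F n) a) (grp (Y n) a) (q n a)" for n a
    by (simp add: K_def F_def q_def)
  have qS: "pmod_hom (F (Suc n)) (F n) (q (Suc n))" for n
    using pmod_hom_comp[OF q[of "Suc n", unfolded YS] restrict_incl[OF sub]] .
  have imq: "q (Suc n) a ` el (F (Suc n)) a = K (Y n) a" for n a
    using surj[of "Suc n"] by (simp add: pers_surj_def YS restrict_simps)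
  have kerq: "kernel (grp (F (Suc n)) a) (grp (F n) a) (q (Suc n) a) = K (Y (Suc n)) a" for n a
    unfolding K by (simp add: kernel_def YS restrict_simps)
  define Z where "Z = restrict_pmod (F 0) (\<lambda>a. {\<one>\<^bsub>grp (F 0) a\<^esub>})"
  have Z: "projective ?u Left Z" unfolding Z_def by (rule trivial_projective[OF P])
  note Zmod = projective_module[OF Z]
  \<comment> \<open>In degrees at most 0 the differential has a negative target degree, where the
    object is the zero module \<open>Z\<close>; the constant unit is then the only possible
    map.\<close>
  define Q :: "('p, 'u, 'r) pmod_complex" where "Q = \<lparr>obj = \<lambda>n. if n < 0 then Z else F (nat n),
    dif = \<lambda>n. if n \<le> 0 then (\<lambda>a x. \<one>\<^bsub>grp Z a\<^esub>) else q (nat n)\<rparr>"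
  define e where "e a x = inv_into UNIV ia (q 0 a x)" for a x
  have oQ: "obj Q n = (if n < 0 then Z else F (nat n))" and dQ: "dif Q n = (if n \<le> 0 then (\<lambda>a x. \<one>\<^bsub>grp Z a\<^esub>) else q (nat n))" for n
    by (simp_all add: Q_def)
  have nS: "\<exists>m. nat n = Suc m \<and> nat (n - 1) = m" if "n > 0" for n :: int
    using that by (intro exI[of _ "nat (n - 1)"]) simp
  have dhom: "pmod_hom (obj Q n) (obj Q (n - 1)) (dif Q n)" for n
  proof (cases "n \<le> 0")
    case True
    then show ?thesis by (auto simp: oQ dQ intro: pmod_hom_trivial[OF Zmod])
  next
    case False
    with nS[of n] obtain m where "nat n = Suc m" "nat (n - 1) = m" by auto
    with False show ?thesis using qS[of m] by (simp add: oQ dQ)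
  qed
  have dd: "dif Q (n - 1) a (dif Q n a x) = \<one>\<^bsub>grp (obj Q (n - 2)) a\<^esub>" if x: "x \<in> el (obj Q n) a" for n a x
  proof (cases "n \<le> 1")
    case True
    then show ?thesis by (simp add: oQ dQ)
  next
    case False
    with nS[of n] nS[of "n - 1"] obtain m where m: "nat n = Suc (Suc m)" "nat (n - 1) = Suc m" "nat (n - 2) = m"
      by fastforce
    have "q (Suc (Suc m)) a x \<in> K (Y (Suc m)) a"
      using imq[of "Suc m" a] x m False by (auto simp: oQ)
    then show ?thesis using m False unfolding kerq[symmetric] by (simp add: oQ dQ kernel_def)
  qed
  have mods: "lmod (obj Q n)" for n by (simp add: oQ Fmod Zmod)
  have e: "pmod_hom (obj Q 0) A e"
    unfolding e_def[abs_def] using pmod_hom_comp[OF q[of 0, unfolded Y0] transport_from[OF ia A]] by (simp add: oQ)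
  have "projective_resolution Q e A"
    unfolding projective_resolution_def
  proof (intro conjI allI impI)
    show "is_pmod_complex Left Q" unfolding is_pmod_complex_def using mods dhom dd by blast
    show "projective ?u Left (obj Q n)" for n by (simp add: oQ P Z)
    show "el (obj Q n) a = {\<one>\<^bsub>grp (obj Q n) a\<^esub>}" if "n < 0" for n a
      using that by (simp add: oQ Z_def restrict_simps)
    show "cycles Q n a = boundaries Q n a" if n: "n > 0" for n a
    proof -
      obtain m where m: "nat n = Suc m" "nat (n - 1) = m" using nS[OF n] by blast
      moreover have "nat (n + 1) = Suc (Suc m)" using n m by simp
      ultimately show ?thesis
        using n imq[of "Suc m" a] kerq[of m a] by (simp add: cycles_def boundaries_def oQ dQ)
    qed
    show "pmod_hom (obj Q 0) A e" by (rule e)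
    show "pers_surj (obj Q 0) A e"
      unfolding pers_surj_def
    proof
      fix a
      have "e a ` el (obj Q 0) a = inv_into UNIV ia ` (q 0 a ` el (F 0) a)"
        by (simp add: oQ e_def image_image)
      also have "q 0 a ` el (F 0) a = ia ` el A a"
        using surj[of 0] by (simp add: pers_surj_def Y0 transport_simps[OF ia A])
      finally show "e a ` el (obj Q 0) a = el A a" by (simp add: image_inv_f_f[OF ia])
    qed
    show "kernel (grp (obj Q 0) a) (grp A a) (e a) = boundaries Q 0 a" for a
    proof -
      have "boundaries Q 0 a = K (Y 0) a" using imq[of 0 a] by (simp add: boundaries_def oQ dQ)
      also have "\<dots> = kernel (grp (obj Q 0) a) (grp A a) (e a)"
      proof -
        have "q 0 a x = \<one>\<^bsub>grp (Y 0) a\<^esub> \<longleftrightarrow> e a x = \<one>\<^bsub>grp A a\<^esub>" if "x \<in> el (F 0) a" for x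
          using pmod_hom_closed[OF q that] ia by (auto simp: Y0 transport_simps[OF ia A] e_def inj_eq)
        then show ?thesis unfolding K kernel_def by (auto simp: oQ)
      qed
      finally show ?thesis ..
    qed
  qed
  then show ?thesis by blast
qed

text \<open>The comparison theorem for resolutions. Only existence of the lift is proved; uniqueness
  up to homotopy is bypassed by the treatment of naturality.\<close>

lemma resolution_lift_exists:
  fixes Q :: "('p::preorder, 'u, 'r::{ring, monoid_mult}) pmod_complex" and Q' :: "('p, 'u, 'r) pmod_complex"
    and A :: "('p, 'a, 'r) pmod" and A' :: "('p, 'b, 'r) pmod" and ib :: "'b \<Rightarrow> 'u"
  assumes Q: "projective_resolution Q e A" and Q': "projective_resolution Q' e' A'"
    and A: "lmod A" and A': "lmod A'" and g: "pmod_hom A A' g" and ib: "inj ib"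
  shows "\<exists>\<phi>. chain_map Q Q' \<phi> \<and> (\<forall>a. \<forall>x\<in>el (obj Q 0) a. e' a (\<phi> 0 a x) = g a (e a x))"
proof -
  have mod: "lmod (obj Q n)" and d: "pmod_hom (obj Q n) (obj Q (n - 1)) (dif Q n)"
    and dd: "x \<in> el (obj Q n) a \<Longrightarrow> dif Q (n - 1) a (dif Q n a x) = \<one>\<^bsub>grp (obj Q (n - 2)) a\<^esub>"
    and P: "projective TYPE('u) Left (obj Q n)" and e: "pmod_hom (obj Q 0) A e"
    and ex0: "kernel (grp (obj Q 0) a) (grp A a) (e a) = boundaries Q 0 a" for n a x
    using Q unfolding projective_resolution_def is_pmod_complex_def by blast+
  have mod': "lmod (obj Q' n)" and d': "pmod_hom (obj Q' n) (obj Q' (n - 1)) (dif Q' n)"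
    and neg': "n < 0 \<Longrightarrow> el (obj Q' n) a = {\<one>\<^bsub>grp (obj Q' n) a\<^esub>}"
    and ex': "n > 0 \<Longrightarrow> cycles Q' n a = boundaries Q' n a" and e': "pmod_hom (obj Q' 0) A' e'"
    and surj': "pers_surj (obj Q' 0) A' e'"
    and ex0': "kernel (grp (obj Q' 0) a) (grp A' a) (e' a) = boundaries Q' 0 a" for n a
    using Q' unfolding projective_resolution_def is_pmod_complex_def by blast+
  \<comment> \<open>Cycles of the augmented complex: in degree 0 the augmentation takes the place of
    the differential, so that the first step of the induction has the same form as the later
    ones.\<close>
  define Zx where "Zx n a x \<longleftrightarrow> (if n = 0 then e a x = \<one>\<^bsub>grp A a\<^esub> else dif Q (int n) a x = \<one>\<^bsub>grp (obj Q (int n - 1)) a\<^esub>)" for n a x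
  define Zx' where "Zx' n a x \<longleftrightarrow> (if n = 0 then e' a x = \<one>\<^bsub>grp A' a\<^esub> else dif Q' (int n) a x = \<one>\<^bsub>grp (obj Q' (int n - 1)) a\<^esub>)" for n a x
  have Zd: "Zx n a (dif Q (int n + 1) a x)" if "x \<in> el (obj Q (int n + 1)) a" for n a x
  proof (cases n)
    case 0
    then have "dif Q 1 a x \<in> kernel (grp (obj Q 0) a) (grp A a) (e a)"
      using that unfolding ex0 by (simp add: boundaries_def)
    then show ?thesis using 0 by (simp add: Zx_def kernel_def)
  next
    case (Suc m)
    then show ?thesis using dd[OF that] by (simp add: Zx_def)
  qed
  have Z': "x \<in> dif Q' (int n + 1) a ` el (obj Q' (int n + 1)) a" if "x \<in> el (obj Q' (int n)) a" "Zx' n a x" for n a x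
  proof (cases n)
    case 0
    then have "x \<in> boundaries Q' 0 a" using that unfolding ex0'[symmetric] by (simp add: Zx'_def kernel_def)
    then show ?thesis using 0 by (simp add: boundaries_def)
  next
    case (Suc m)
    then have "x \<in> boundaries Q' (int n) a" using that ex'[of "int n" a, symmetric]
      by (simp add: Zx'_def kernel_def cycles_def)
    then show ?thesis by (simp add: boundaries_def)
  qed
  \<comment> \<open>The induction carries along that augmented cycles go to augmented cycles. By
    exactness of the second resolution this places the next composite inside the image of the
    differential, as \<open>projective_lift\<close> demands.\<close>
  have "\<exists>\<phi>. \<forall>n. (pmod_hom (obj Q (int n)) (obj Q' (int n)) (\<phi> n) \<and>
        (\<forall>a. \<forall>x\<in>el (obj Q (int n)) a. Zx n a x \<longrightarrow> Zx' n a (\<phi> n a x)) \<and>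
        (n = 0 \<longrightarrow> (\<forall>a. \<forall>x\<in>el (obj Q 0) a. e' a (\<phi> n a x) = g a (e a x)))) \<and>
      (\<forall>a. \<forall>x\<in>el (obj Q (int n + 1)) a.
        dif Q' (int n + 1) a (\<phi> (Suc n) a x) = \<phi> n a (dif Q (int n + 1) a x))"
  proof (rule dependent_nat_choice)
    have "\<exists>h. pmod_hom (obj Q 0) (obj Q' 0) h \<and> (\<forall>a. \<forall>x\<in>el (obj Q 0) a. e' a (h a x) = g a (e a x))"
    proof (rule projective_lift[OF P inj_on_id ib mod' A' e' pmod_hom_comp[OF e g]])
      show "g a (e a x) \<in> e' a ` el (obj Q' 0) a" if "x \<in> el (obj Q 0) a" for a x
        using surj' pmod_hom_closed[OF g pmod_hom_closed[OF e that]] by (simp add: pers_surj_def)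
    qed
    then obtain h where h: "pmod_hom (obj Q 0) (obj Q' 0) h" "\<forall>a. \<forall>x\<in>el (obj Q 0) a. e' a (h a x) = g a (e a x)"
      by blast
    then show "\<exists>h. pmod_hom (obj Q (int 0)) (obj Q' (int 0)) h \<and>
        (\<forall>a. \<forall>x\<in>el (obj Q (int 0)) a. Zx 0 a x \<longrightarrow> Zx' 0 a (h a x)) \<and>
        (0 = (0::nat) \<longrightarrow> (\<forall>a. \<forall>x\<in>el (obj Q 0) a. e' a (h a x) = g a (e a x)))"
      using pmod_hom_one[OF g A A'] by (intro exI[of _ h]) (simp add: Zx_def Zx'_def)
  next
    fix \<phi> n
    assume "pmod_hom (obj Q (int n)) (obj Q' (int n)) \<phi> \<and>
      (\<forall>a. \<forall>x\<in>el (obj Q (int n)) a. Zx n a x \<longrightarrow> Zx' n a (\<phi> a x)) \<and>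
      (n = 0 \<longrightarrow> (\<forall>a. \<forall>x\<in>el (obj Q 0) a. e' a (\<phi> a x) = g a (e a x)))"
    then have \<phi>: "pmod_hom (obj Q (int n)) (obj Q' (int n)) \<phi>"
      and \<phi>Z: "\<And>a x. \<lbrakk>x \<in> el (obj Q (int n)) a; Zx n a x\<rbrakk> \<Longrightarrow> Zx' n a (\<phi> a x)" by blast+
    have d1: "pmod_hom (obj Q (int n + 1)) (obj Q (int n)) (dif Q (int n + 1))" using d[of "int n + 1"] by simp
    have d1': "pmod_hom (obj Q' (int n + 1)) (obj Q' (int n)) (dif Q' (int n + 1))" using d'[of "int n + 1"] by simp
    have "\<exists>h. pmod_hom (obj Q (int n + 1)) (obj Q' (int n + 1)) h \<and>
        (\<forall>a. \<forall>x\<in>el (obj Q (int n + 1)) a. dif Q' (int n + 1) a (h a x) = \<phi> a (dif Q (int n + 1) a x))"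
    proof (rule projective_lift[OF P inj_on_id inj_on_id mod' mod' d1' pmod_hom_comp[OF d1 \<phi>]])
      fix a x assume x: "x \<in> el (obj Q (int n + 1)) a"
      note dx = pmod_hom_closed[OF d1 x]
      show "\<phi> a (dif Q (int n + 1) a x) \<in> dif Q' (int n + 1) a ` el (obj Q' (int n + 1)) a"
        by (rule Z'[OF pmod_hom_closed[OF \<phi> dx] \<phi>Z[OF dx Zd[OF x]]])
    qed
    then obtain h where h: "pmod_hom (obj Q (int n + 1)) (obj Q' (int n + 1)) h"
      "\<And>a x. x \<in> el (obj Q (int n + 1)) a \<Longrightarrow> dif Q' (int n + 1) a (h a x) = \<phi> a (dif Q (int n + 1) a x)" by blast
    then show "\<exists>h. (pmod_hom (obj Q (int (Suc n))) (obj Q' (int (Suc n))) h \<and>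
        (\<forall>a. \<forall>x\<in>el (obj Q (int (Suc n))) a. Zx (Suc n) a x \<longrightarrow> Zx' (Suc n) a (h a x)) \<and>
        (Suc n = 0 \<longrightarrow> (\<forall>a. \<forall>x\<in>el (obj Q 0) a. e' a (h a x) = g a (e a x)))) \<and>
      (\<forall>a. \<forall>x\<in>el (obj Q (int n + 1)) a. dif Q' (int n + 1) a (h a x) = \<phi> a (dif Q (int n + 1) a x))"
      using pmod_hom_one[OF \<phi> mod mod'] by (intro exI[of _ h]) (simp add: Zx_def Zx'_def add.commute)
  qed
  then obtain \<phi> where \<phi>: "\<And>n. pmod_hom (obj Q (int n)) (obj Q' (int n)) (\<phi> n)"
    "\<And>a x. x \<in> el (obj Q 0) a \<Longrightarrow> e' a (\<phi> 0 a x) = g a (e a x)"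
    "\<And>n a x. x \<in> el (obj Q (int n + 1)) a \<Longrightarrow>
        dif Q' (int n + 1) a (\<phi> (Suc n) a x) = \<phi> n a (dif Q (int n + 1) a x)" by metis
  define \<Phi> where "\<Phi> n = (if n < 0 then (\<lambda>a x. \<one>\<^bsub>grp (obj Q' n) a\<^esub>) else \<phi> (nat n))" for n :: int
  have "chain_map Q Q' \<Phi>"
    unfolding chain_map_def
  proof (intro conjI allI ballI)
    show \<Phi>h: "pmod_hom (obj Q n) (obj Q' n) (\<Phi> n)" for n
      using \<phi>(1)[of "nat n"] by (cases "n < 0") (simp_all add: \<Phi>_def pmod_hom_trivial[OF mod'])
    fix n a x assume x: "x \<in> el (obj Q n) a"
    show "\<Phi> (n - 1) a (dif Q n a x) = dif Q' n a (\<Phi> n a x)"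
    proof (cases "n \<le> 0")
      case True
      then have "n - 1 < 0" by simp
      then show ?thesis
        using neg'[of "n - 1" a] pmod_hom_closed[OF \<Phi>h pmod_hom_closed[OF d x]]
          pmod_hom_closed[OF d' pmod_hom_closed[OF \<Phi>h x]] by simp
    next
      case False
      define m where "m = nat (n - 1)"
      have m: "n = int m + 1" "nat (int m + 1) = Suc m" using False by (auto simp: m_def)
      then show ?thesis using \<phi>(3)[of x m a] x by (simp add: \<Phi>_def)
    qed
  qed
  then show ?thesis using \<phi>(2) by (intro exI[of _ \<Phi>]) (simp add: \<Phi>_def)
qed

section \<open>Chase tools, flat modules and injectivity after tensoring\<close>

lemma inj_on_kernel:
  assumes h: "h \<in> hom G H" and G: "group G" and H: "group H"
    and ker: "\<And>x. \<lbrakk>x \<in> carrier G; h x = \<one>\<^bsub>H\<^esub>\<rbrakk> \<Longrightarrow> x = \<one>\<^bsub>G\<^esub>"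
  shows "inj_on h (carrier G)"
proof (rule inj_onI)
  interpret G: group G by fact
  interpret H: group H by fact
  fix x y assume x: "x \<in> carrier G" and y: "y \<in> carrier G" and eq: "h x = h y"
  have "h (x \<otimes>\<^bsub>G\<^esub> inv\<^bsub>G\<^esub> y) = \<one>\<^bsub>H\<^esub>"
    using x y eq hom_in_carrier[OF h y] by (simp add: hom_mult[OF h] hom_inverse[OF h G H])
  then show "x = y" using ker[of "x \<otimes>\<^bsub>G\<^esub> inv\<^bsub>G\<^esub> y"] x y by (simp add: G.diff_eq_one)
qed

text \<open>The recurring move of a chase: subtract an element with the same image and lift the
  difference through exactness.\<close>

lemma exact_lift:
  assumes h: "h \<in> hom G H" and G: "group G" and H: "group H"
    and x: "x \<in> carrier G" and y: "y \<in> carrier G" and eq: "h x = h y"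
    and ker: "\<And>z. \<lbrakk>z \<in> carrier G; h z = \<one>\<^bsub>H\<^esub>\<rbrakk> \<Longrightarrow> \<exists>v\<in>V. k v = z"
  shows "\<exists>v\<in>V. x = k v \<otimes>\<^bsub>G\<^esub> y"
proof -
  interpret G: group G by fact
  interpret H: group H by fact
  have "h (x \<otimes>\<^bsub>G\<^esub> inv\<^bsub>G\<^esub> y) = \<one>\<^bsub>H\<^esub>"
    using x y eq hom_in_carrier[OF h y] by (simp add: hom_mult[OF h] hom_inverse[OF h G H])
  then obtain v where "v \<in> V" "k v = x \<otimes>\<^bsub>G\<^esub> inv\<^bsub>G\<^esub> y" using ker x y by blast
  then show ?thesis using x y by (intro bexI[of _ v]) (simp_all add: G.m_assoc)
qed

lemma pten_map_trivial_right:
  assumes M: "rmod M" and N: "lmod N" and M': "rmod M'" and N': "lmod N'"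
    and f: "pmod_hom M M' f" and g: "pmod_hom N N' g"
    and g1: "\<And>a x. x \<in> el N a \<Longrightarrow> g a x = \<one>\<^bsub>grp N' a\<^esub>"
    and t: "t \<in> el (pten s M N) r"
  shows "pten_map s M' N' f g r t = \<one>\<^bsub>grp (pten s M' N') r\<^esub>"
proof (rule pten_hom_eq[OF M N _ pten_map_hom(1)[OF M N M' N' f g] _ _ t])
  interpret P: comm_group "grp (pten s M' N') r" by (rule pten_comm_group[OF M' N'])
  show "group (grp (pten s M' N') r)" by (rule P.group_axioms)
  show "(\<lambda>_. \<one>\<^bsub>grp (pten s M' N') r\<^esub>) \<in> hom (grp (pten s M N) r) (grp (pten s M' N') r)"
    by (simp add: hom_def)
  show "pten_map s M' N' f g r (ptau s M N r i j x y) = \<one>\<^bsub>grp (pten s M' N') r\<^esub>"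
    if "(i, j) \<in> ten_index s r" "x \<in> el M i" "y \<in> el N j" for i j x y
    using ptau_one_right[OF M' N' that(1) pmod_hom_closed[OF f that(2)]]
    by (simp add: pten_map_hom(2)[OF M N M' N' f g that] g1[OF that(3)])
qed

lemma pten_group: "\<lbrakk>rmod M; lmod N\<rbrakk> \<Longrightarrow> group (grp (pten s M N) r)"
  by (rule comm_group_group[OF pten_comm_group])

lemma short_exactD:
  assumes "short_exact X Y W f g"
  shows "pers_surj Y W g" "inj_on (f a) (el X a)"
    "\<lbrakk>y \<in> el Y a; g a y = \<one>\<^bsub>grp W a\<^esub>\<rbrakk> \<Longrightarrow> y \<in> f a ` el X a"
    "x \<in> el X a \<Longrightarrow> g a (f a x) = \<one>\<^bsub>grp W a\<^esub>"
proof -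
  have k: "kernel (grp Y a) (grp W a) (g a) = f a ` el X a" for a
    using assms unfolding short_exact_def by blast
  show "pers_surj Y W g" "inj_on (f a) (el X a)" using assms unfolding short_exact_def by blast+
  show "\<lbrakk>y \<in> el Y a; g a y = \<one>\<^bsub>grp W a\<^esub>\<rbrakk> \<Longrightarrow> y \<in> f a ` el X a"
    unfolding k[symmetric] by (simp add: kernel_def)
  assume "x \<in> el X a"
  then have "f a x \<in> kernel (grp Y a) (grp W a) (g a)" unfolding k by simp
  then show "g a (f a x) = \<one>\<^bsub>grp W a\<^esub>" by (simp add: kernel_def)
qed

text \<open>Right exactness holds for every module; coordinates contribute the injectivity on the
  left.\<close>

lemma dual_basis_flat:
  fixes u :: "'u itself"
  assumes db: "dual_basis Right M d e \<phi>"
  shows "flat u s M"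
  unfolding flat_def
proof (intro allI impI)
  fix X Y W :: "('a, 'u, 'c) pmod" and f g
  assume "lmod X \<and> lmod Y \<and> lmod W \<and> pmod_hom X Y f \<and> pmod_hom Y W g \<and> short_exact X Y W f g"
  then have X: "lmod X" and Y: "lmod Y" and W: "lmod W" and f: "pmod_hom X Y f" and g: "pmod_hom Y W g"
    and se: "short_exact X Y W f g" by auto
  have M: "rmod M" using db by (simp add: dual_basis_def)
  note sx = short_exactD[OF se]
  note mf = pten_map_hom(1)[OF M X M Y pmod_hom_id f] and mg = pten_map_hom(1)[OF M Y M W pmod_hom_id g]
  show "short_exact (pten s M X) (pten s M Y) (pten s M W) (pten_map s M Y (\<lambda>_ x. x) f) (pten_map s M W (\<lambda>_ x. x) g)"
    unfolding short_exact_def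
  proof (intro conjI allI)
    show "pers_hom (pten s M X) (pten s M Y) (pten_map s M Y (\<lambda>_ x. x) f)"
      by (rule pten_map_pers_hom[OF M X M Y pmod_hom_id f])
    show "pers_hom (pten s M Y) (pten s M W) (pten_map s M W (\<lambda>_ x. x) g)"
      by (rule pten_map_pers_hom[OF M Y M W pmod_hom_id g])
    show "inj_on (pten_map s M Y (\<lambda>_ x. x) f a) (el (pten s M X) a)" for a
      by (rule inj_on_kernel[OF mf pten_group[OF M X] pten_group[OF M Y] dual_basis_inj_first[OF db X Y f sx(2)]])
    show "kernel (grp (pten s M Y) a) (grp (pten s M W) a) (pten_map s M W (\<lambda>_ x. x) g a) =
        pten_map s M Y (\<lambda>_ x. x) f a ` el (pten s M X) a" for a
    proof (intro equalityI subsetI)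
      fix t assume "t \<in> kernel (grp (pten s M Y) a) (grp (pten s M W) a) (pten_map s M W (\<lambda>_ x. x) g a)"
      then show "t \<in> pten_map s M Y (\<lambda>_ x. x) f a ` el (pten s M X) a"
        using pten_exact_second[OF M X Y W f g sx(1) sx(3), of t s a] by (auto simp: kernel_def)
    next
      fix t assume "t \<in> pten_map s M Y (\<lambda>_ x. x) f a ` el (pten s M X) a"
      then obtain v where v: "v \<in> el (pten s M X) a" "t = pten_map s M Y (\<lambda>_ x. x) f a v" by blast
      have "pten_map s M W (\<lambda>_ x. x) g a t = pten_map s M W (\<lambda>_ x. x) (\<lambda>a x. g a (f a x)) a v"
        unfolding v(2)
        by (rule pten_map_comp[OF M X M Y M W pmod_hom_id f pmod_hom_id g pmod_hom_id pmod_hom_comp[OF f g] refl refl v(1)])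
      also have "\<dots> = \<one>\<^bsub>grp (pten s M W) a\<^esub>"
        by (rule pten_map_trivial_right[OF M X M W pmod_hom_id pmod_hom_comp[OF f g] sx(4) v(1)])
      finally show "t \<in> kernel (grp (pten s M Y) a) (grp (pten s M W) a) (pten_map s M W (\<lambda>_ x. x) g a)"
        using pten_map_closed[OF M X M Y pmod_hom_id f v(1)] by (simp add: kernel_def v(2))
    qed
    show "pers_surj (pten s M Y) (pten s M W) (pten_map s M W (\<lambda>_ x. x) g)"
      unfolding pers_surj_def
    proof (intro allI equalityI subsetI)
      fix a t assume "t \<in> el (pten s M W) a"
      then show "t \<in> pten_map s M W (\<lambda>_ x. x) g a ` el (pten s M Y) a"
        using pten_map_surj[OF M Y M W pmod_hom_id g _ sx(1)] by (force simp: pers_surj_def)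
    qed (use pten_map_closed[OF M Y M W pmod_hom_id g] in blast)
  qed
qed

abbreviation ker_pmod where
  "ker_pmod Q A q \<equiv> restrict_pmod Q (\<lambda>a. kernel (grp Q a) (grp A a) (q a))"

text \<open>Flatness is tested on modules over \<open>'u\<close>; the quotient \<open>A\<close> of \<open>Q\<close> may live in another
  type that embeds into \<open>'u\<close>.\<close>

lemma flat_kernel_inj:
  fixes u :: "'u itself" and Q :: "('p::preordered_ab_group_add, 'u, 'r::{ring, monoid_mult}) pmod"
    and A :: "('p, 'a, 'r) pmod" and ia :: "'a \<Rightarrow> 'u"
  assumes fl: "flat u s M" and M: "rmod M" and Q: "lmod Q" and A: "lmod A" and ia: "inj ia"
    and q: "pmod_hom Q A q" and surj: "pers_surj Q A q"
    and t: "t \<in> el (pten s M (ker_pmod Q A q)) r"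
    and 1: "pten_map s M Q (\<lambda>_ x. x) (\<lambda>_ x. x) r t = \<one>\<^bsub>grp (pten s M Q) r\<^esub>"
  shows "t = \<one>\<^bsub>grp (pten s M (ker_pmod Q A q)) r\<^esub>"
proof -
  let ?X = "ker_pmod Q A q"
  note S = kernel_subpmodule[OF q Q A]
  note X = restrict_pmod_module[OF Q S] and inc = restrict_incl[OF S]
  let ?W = "transport ia A" and ?g = "\<lambda>a x. ia (q a x)"
  note W = transport_module[OF ia A]
  have g: "pmod_hom Q ?W ?g" by (rule pmod_hom_comp[OF q transport_to[OF ia A]])
  have "short_exact ?X Q ?W (\<lambda>_ x. x) ?g"
    unfolding short_exact_def
  proof (intro conjI allI)
    show "kernel (grp Q a) (grp ?W a) (?g a) = (\<lambda>x. x) ` el ?X a" for a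
      using ia by (auto simp: kernel_def transport_simps[OF ia A] restrict_simps inj_eq)
    show "pers_surj Q ?W ?g"
      using surj by (simp add: pers_surj_def transport_simps[OF ia A] image_image[symmetric])
  qed (use inc g in \<open>auto simp: pmod_hom_pers\<close>)
  then have "short_exact (pten s M ?X) (pten s M Q) (pten s M ?W) (pten_map s M Q (\<lambda>_ x. x) (\<lambda>_ x. x)) (pten_map s M ?W (\<lambda>_ x. x) ?g)"
    using fl X Q W inc g unfolding flat_def by blast
  from short_exactD(2)[OF this] have inj: "inj_on (pten_map s M Q (\<lambda>_ x. x) (\<lambda>_ x. x) r) (el (pten s M ?X) r)" .
  show ?thesis
  proof (rule inj_onD[OF inj _ t])
    show "pten_map s M Q (\<lambda>_ x. x) (\<lambda>_ x. x) r t = pten_map s M Q (\<lambda>_ x. x) (\<lambda>_ x. x) r \<one>\<^bsub>grp (pten s M ?X) r\<^esub>"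
      using 1 hom_one[OF pten_map_hom(1)[OF M X M Q pmod_hom_id inc] pten_group[OF M X] pten_group[OF M Q]] by simp
    show "\<one>\<^bsub>grp (pten s M ?X) r\<^esub> \<in> el (pten s M ?X) r"
      using pten_group[OF M X] by (simp add: group.is_monoid)
  qed
qed

text \<open>The vanishing of \<open>Tor\<^sub>1(W, A)\<close> for flat \<open>W\<close>, balanced: a snake argument with a
  presentation of \<open>A\<close> by a module \<open>Q\<close> for which \<open>- \<otimes> Q\<close> is exact.\<close>

lemma pten_inj_flat_cokernel:
  fixes u :: "'u itself" and Q :: "('p::preordered_ab_group_add, 'u, 'r::{ring, monoid_mult}) pmod"
    and A :: "('p, 'a, 'r) pmod" and ia :: "'a \<Rightarrow> 'u"
  assumes X: "rmod X" and Y: "rmod Y" and W: "rmod W" and f: "pmod_hom X Y f" and g: "pmod_hom Y W g"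
    and inj: "\<And>a. inj_on (f a) (el X a)" and surj_g: "pers_surj Y W g"
    and ex: "\<And>a y. \<lbrakk>y \<in> el Y a; g a y = \<one>\<^bsub>grp W a\<^esub>\<rbrakk> \<Longrightarrow> y \<in> f a ` el X a"
    and gf: "\<And>a x. x \<in> el X a \<Longrightarrow> g a (f a x) = \<one>\<^bsub>grp W a\<^esub>"
    and fl: "flat u s W" and db: "dual_basis Left Q d e \<phi>" and A: "lmod A" and ia: "inj ia"
    and q: "pmod_hom Q A q" and surj: "pers_surj Q A q"
    and t: "t \<in> el (pten s X A) r" and 1: "pten_map s Y A f (\<lambda>_ x. x) r t = \<one>\<^bsub>grp (pten s Y A) r\<^esub>"
  shows "t = \<one>\<^bsub>grp (pten s X A) r\<^esub>"
proof -
  have Q: "lmod Q" using db by (simp add: dual_basis_def)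
  let ?O = "ker_pmod Q A q" and ?i = "\<lambda>_ x. x"
  note S = kernel_subpmodule[OF q Q A]
  note O = restrict_pmod_module[OF Q S] and inc = restrict_incl[OF S]
  have exO: "y \<in> ?i a ` el ?O a" if "y \<in> el Q a" "q a y = \<one>\<^bsub>grp A a\<^esub>" for a y
    using that by (simp add: restrict_simps kernel_def)
  have surj_id: "pers_surj M M ?i" for M :: "('p, 'v, 'r) pmod" by (simp add: pers_surj_def)
  obtain t' where t': "t' \<in> el (pten s X Q) r" "pten_map s X A ?i q r t' = t"
    using pten_map_surj[OF X Q X A pmod_hom_id q surj_id surj t] by blast
  let ?ft = "pten_map s Y Q f ?i r t'"
  have ft: "?ft \<in> el (pten s Y Q) r" by (rule pten_map_closed[OF X Q Y Q f pmod_hom_id t'(1)])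
  have "pten_map s Y A ?i q r ?ft = pten_map s Y A f ?i r (pten_map s X A ?i q r t')"
    by (rule pten_map_square[OF X Q Y Q X A Y A f pmod_hom_id pmod_hom_id q pmod_hom_id q f pmod_hom_id refl refl t'(1)])
  then have "pten_map s Y A ?i q r ?ft = \<one>\<^bsub>grp (pten s Y A) r\<^esub>" using t'(2) 1 by simp
  then obtain v where v: "v \<in> el (pten s Y ?O) r" "pten_map s Y Q ?i ?i r v = ?ft"
    using pten_exact_second[OF Y O Q A inc q surj exO ft] by blast
  \<comment> \<open>Flatness of \<open>W\<close> enters here. The image of \<open>v\<close> in
    \<open>W \<otimes> Q\<close> is that of \<open>t'\<close> under \<open>g\<close> after
    \<open>f\<close>, hence trivial, and tensoring the inclusion of the kernel with \<open>W\<close>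
    keeps it injective.\<close>
  let ?gv = "pten_map s W ?O g ?i r v"
  have gv: "?gv \<in> el (pten s W ?O) r" by (rule pten_map_closed[OF Y O W O g pmod_hom_id v(1)])
  have "pten_map s W Q ?i ?i r ?gv = pten_map s W Q g ?i r (pten_map s Y Q ?i ?i r v)"
    by (rule pten_map_square[OF Y O W O Y Q W Q g pmod_hom_id pmod_hom_id inc pmod_hom_id inc g pmod_hom_id refl refl v(1)])
  also have "\<dots> = pten_map s W Q (\<lambda>a x. g a (f a x)) ?i r t'"
    unfolding v(2)
    by (rule pten_map_comp[OF X Q Y Q W Q f pmod_hom_id g pmod_hom_id pmod_hom_comp[OF f g] pmod_hom_id refl refl t'(1)])
  also have "\<dots> = \<one>\<^bsub>grp (pten s W Q) r\<^esub>"
    by (rule pten_map_trivial_left[OF X Q W Q pmod_hom_comp[OF f g] pmod_hom_id gf t'(1)])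
  finally have "?gv = \<one>\<^bsub>grp (pten s W ?O) r\<^esub>"
    by (rule flat_kernel_inj[OF fl W Q A ia q surj gv])
  then obtain v' where v': "v' \<in> el (pten s X ?O) r" "pten_map s Y ?O f ?i r v' = v"
    using pten_exact_first[OF O X Y W f g surj_g ex v(1)] by blast
  \<comment> \<open>\<open>?w\<close> and \<open>t'\<close> have the same image in
    \<open>Y \<otimes> Q\<close>. Since tensoring with \<open>Q\<close> preserves the injectivity of
    \<open>f\<close>, they coincide, so \<open>t'\<close> comes from the kernel of \<open>q\<close>
    and dies in \<open>X \<otimes> A\<close>.\<close>
  let ?w = "pten_map s X Q ?i ?i r v'"
  have w: "?w \<in> el (pten s X Q) r" by (rule pten_map_closed[OF X O X Q pmod_hom_id inc v'(1)])
  have "pten_map s Y Q f ?i r ?w = pten_map s Y Q ?i ?i r (pten_map s Y ?O f ?i r v')"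
    by (rule pten_map_square[OF X O X Q Y O Y Q pmod_hom_id inc f pmod_hom_id f pmod_hom_id pmod_hom_id inc refl refl v'(1)])
  then have "pten_map s Y Q f ?i r ?w = ?ft" using v v' by simp
  moreover have "inj_on (pten_map s Y Q f ?i r) (el (pten s X Q) r)"
    by (rule inj_on_kernel[OF pten_map_hom(1)[OF X Q Y Q f pmod_hom_id] pten_group[OF X Q] pten_group[OF Y Q]
        dual_basis_inj_second[OF db X Y f inj]])
  ultimately have "?w = t'" using w t'(1) by (simp add: inj_on_eq_iff)
  then have "t = pten_map s X A ?i q r (pten_map s X Q ?i ?i r v')" using t'(2) by simp
  also have "\<dots> = pten_map s X A ?i q r v'"
    by (rule pten_map_comp[OF X O X Q X A pmod_hom_id inc pmod_hom_id q pmod_hom_id restrict_from[OF q S] refl refl v'(1)])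
  also have "\<dots> = \<one>\<^bsub>grp (pten s X A) r\<^esub>"
    by (rule pten_map_trivial_right[OF X O X A pmod_hom_id restrict_from[OF q S] _ v'(1)])
      (simp add: restrict_simps kernel_def)
  finally show ?thesis .
qed

section \<open>Homology\<close>

text \<open>Tensor products carry no action of R, so homology is developed first for complexes of
  functors to abelian groups.\<close>

definition pers_complex :: "('p::preorder, 'm, 'z) complex \<Rightarrow> bool" where
  "pers_complex L \<longleftrightarrow> (\<forall>n. persistence_group (obj L n)) \<and>
    (\<forall>n. pers_hom (obj L n) (obj L (n - 1)) (dif L n)) \<and>
    (\<forall>n a. \<forall>x\<in>el (obj L n) a. dif L (n - 1) a (dif L n a x) = \<one>\<^bsub>grp (obj L (n - 2)) a\<^esub>)"

abbreviation hcls :: "('p, 'm, 'z) complex \<Rightarrow> int \<Rightarrow> 'p \<Rightarrow> 'm \<Rightarrow> 'm set" where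
  "hcls L n a x \<equiv> boundaries L n a #>\<^bsub>grp (obj L n) a\<^esub> x"

text \<open>Serves structure maps, the action of R and chain maps alike: complex and degree may
  change from source to target, and preservation of boundaries is enough.\<close>

lemma homology_ind_hcls:
  assumes "comm_group (grp (obj L n) a)" "comm_group (grp (obj L' n) b)"
    "subgroup (boundaries L n a) (grp (obj L n) a)" "subgroup (boundaries L' n b) (grp (obj L' n) b)"
    and h: "h \<in> hom (grp (obj L n) a) (grp (obj L' n) b)"
    and hb: "\<And>x. x \<in> boundaries L n a \<Longrightarrow> h x \<in> boundaries L' n b"
    and x: "x \<in> el (obj L n) a"
  shows "homology_ind L' n b h (hcls L n a x) = hcls L' n b (h x)"
  unfolding homology_ind_def
proof (rule the_elem_coset[OF assms(1,3) x])
  fix y assume y: "y \<in> boundaries L n a"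
  have "h (y \<otimes>\<^bsub>grp (obj L n) a\<^esub> x) = h y \<otimes>\<^bsub>grp (obj L' n) b\<^esub> h x"
    using hom_mult[OF h subgroup.mem_carrier[OF assms(3) y] x] .
  then show "hcls L' n b (h (y \<otimes>\<^bsub>grp (obj L n) a\<^esub> x)) = hcls L' n b (h x)"
    using coset_eq[OF assms(2,4) hom_in_carrier[OF h x] hb[OF y]] by simp
qed

context
  fixes L :: "('p::preorder, 'm, 'z) complex"
  assumes L: "pers_complex L"
begin

lemma complex_comm_group: "comm_group (grp (obj L n) a)"
  using L by (simp add: pers_complex_def persistence_group.grp_comm)

lemma complex_group: "group (grp (obj L n) a)"
  by (rule comm_group_group[OF complex_comm_group])

lemma dif_pers_hom: "pers_hom (obj L n) (obj L (n - 1)) (dif L n)"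
  using L by (simp add: pers_complex_def)

lemma dif_hom: "dif L n a \<in> hom (grp (obj L n) a) (grp (obj L (n - 1)) a)"
  by (rule pers_hom_hom[OF dif_pers_hom])

lemma dif_hom': "dif L (n + 1) a \<in> hom (grp (obj L (n + 1)) a) (grp (obj L n) a)"
  using dif_hom[of "n + 1"] by simp

lemma dif_dif: "x \<in> el (obj L n) a \<Longrightarrow> dif L (n - 1) a (dif L n a x) = \<one>\<^bsub>grp (obj L (n - 2)) a\<^esub>"
  using L by (simp add: pers_complex_def)

lemma complex_smap_hom: "a \<le> b \<Longrightarrow> smap (obj L n) a b \<in> hom (grp (obj L n) a) (grp (obj L n) b)"
  using L by (simp add: pers_complex_def persistence_group.smap_hom)

lemma cycles_iff: "x \<in> cycles L n a \<longleftrightarrow> x \<in> el (obj L n) a \<and> dif L n a x = \<one>\<^bsub>grp (obj L (n - 1)) a\<^esub>"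
  by (auto simp: cycles_def kernel_def)

lemma cycles_subgroup: "subgroup (cycles L n a) (grp (obj L n) a)"
  unfolding cycles_def
  by (rule group_hom.subgroup_kernel) (simp add: group_hom_def group_hom_axioms_def complex_group dif_hom)

lemma boundaries_subgroup: "subgroup (boundaries L n a) (grp (obj L n) a)"
  unfolding boundaries_def
  by (rule group_hom.img_is_subgroup) (simp add: group_hom_def group_hom_axioms_def complex_group dif_hom')

lemma boundaries_cycles: "boundaries L n a \<subseteq> cycles L n a"
proof
  fix x assume "x \<in> boundaries L n a"
  then obtain y where y: "y \<in> el (obj L (n + 1)) a" "x = dif L (n + 1) a y" by (auto simp: boundaries_def)
  then show "x \<in> cycles L n a"
    using dif_dif[of y "n + 1" a] hom_in_carrier[OF dif_hom' y(1)] by (simp add: cycles_iff)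
qed

lemma homology_group_eq: "grp (homology L n) a = (grp (obj L n) a)\<lparr>carrier := cycles L n a\<rparr> Mod boundaries L n a"
  by (simp add: homology_def)

lemma cycles_comm_group: "comm_group ((grp (obj L n) a)\<lparr>carrier := cycles L n a\<rparr>)"
  by (rule group.group_comm_groupI[OF subgroup.subgroup_is_group[OF cycles_subgroup complex_group]])
    (use subgroup.mem_carrier[OF cycles_subgroup] comm_groupE(4)[OF complex_comm_group] in auto)

lemma boundaries_subgroup_cycles:
  "subgroup (boundaries L n a) ((grp (obj L n) a)\<lparr>carrier := cycles L n a\<rparr>)"
  by (rule group.subgroup_incl[OF complex_group boundaries_subgroup cycles_subgroup boundaries_cycles])

lemma homology_comm_group: "comm_group (grp (homology L n) a)"
  unfolding homology_group_eq by (rule comm_group.abelian_FactGroup[OF cycles_comm_group boundaries_subgroup_cycles])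

text \<open>A coset depends only on the multiplication, so cosets of the boundaries formed in the
  whole term and in its subgroup of cycles are the same sets. This justifies writing classes with
  the ambient group in \<open>hcls\<close>.\<close>

lemma hcls_hom: "hcls L n a \<in> hom ((grp (obj L n) a)\<lparr>carrier := cycles L n a\<rparr>) (grp (homology L n) a)"
  using quotient_hom[OF cycles_comm_group boundaries_subgroup_cycles, of n a]
  unfolding homology_group_eq by (simp add: r_coset_def[abs_def])

lemma hcls_closed: "x \<in> cycles L n a \<Longrightarrow> hcls L n a x \<in> el (homology L n) a"
  using hom_in_carrier[OF hcls_hom] by simp

lemma hcls_mult: "\<lbrakk>x \<in> cycles L n a; y \<in> cycles L n a\<rbrakk> \<Longrightarrow>
  hcls L n a (x \<otimes>\<^bsub>grp (obj L n) a\<^esub> y) = hcls L n a x \<otimes>\<^bsub>grp (homology L n) a\<^esub> hcls L n a y"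
  using hom_mult[OF hcls_hom, of x n a y] by simp

lemma hcls_surj: "C \<in> el (homology L n) a \<Longrightarrow> \<exists>x\<in>cycles L n a. C = hcls L n a x"
  unfolding homology_group_eq carrier_FactGroup by (auto simp: r_coset_def)

lemma homology_one: "\<one>\<^bsub>grp (homology L n) a\<^esub> = boundaries L n a"
  by (simp add: homology_group_eq)

lemma hcls_one_iff: "x \<in> cycles L n a \<Longrightarrow> hcls L n a x = \<one>\<^bsub>grp (homology L n) a\<^esub> \<longleftrightarrow> x \<in> boundaries L n a"
  unfolding homology_one
  using coset_eq_one_iff[OF complex_comm_group boundaries_subgroup] cycles_iff by blast

lemma smap_boundaries:
  assumes "a \<le> b" "x \<in> boundaries L n a"
  shows "smap (obj L n) a b x \<in> boundaries L n b"
proof -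
  obtain y where y: "y \<in> el (obj L (n + 1)) a" "x = dif L (n + 1) a y" using assms by (auto simp: boundaries_def)
  then have "smap (obj L n) a b x = dif L (n + 1) b (smap (obj L (n + 1)) a b y)"
    using pers_hom_smap[OF dif_pers_hom[of "n + 1"] assms(1) y(1)] by simp
  then show ?thesis using hom_in_carrier[OF complex_smap_hom[OF assms(1)] y(1)] by (simp add: boundaries_def)
qed

lemma smap_cycles:
  assumes "a \<le> b" "x \<in> cycles L n a"
  shows "smap (obj L n) a b x \<in> cycles L n b"
  using assms pers_hom_smap[OF dif_pers_hom assms(1)] hom_in_carrier[OF complex_smap_hom[OF assms(1)]]
    hom_one[OF complex_smap_hom[OF assms(1)] complex_group complex_group]
  by (simp add: cycles_iff)

lemma homology_smap:
  assumes "a \<le> b" "x \<in> cycles L n a"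
  shows "smap (homology L n) a b (hcls L n a x) = hcls L n b (smap (obj L n) a b x)"
  using assms(2)
  unfolding homology_def pers.simps
  by (intro homology_ind_hcls complex_comm_group boundaries_subgroup complex_smap_hom smap_boundaries assms(1))
    (simp_all add: cycles_iff)

end

definition pers_chain_map ::
  "('p::preorder, 'm, 'z) complex \<Rightarrow> ('p, 'n, 'y) complex \<Rightarrow> (int \<Rightarrow> 'p \<Rightarrow> 'm \<Rightarrow> 'n) \<Rightarrow> bool" where
  "pers_chain_map K L f \<longleftrightarrow> (\<forall>n. pers_hom (obj K n) (obj L n) (f n)) \<and>
    (\<forall>n a. \<forall>x\<in>el (obj K n) a. f (n - 1) a (dif K n a x) = dif L n a (f n a x))"

context
  fixes K :: "('p::preorder, 'm, 'z) complex" and L :: "('p, 'n, 'y) complex" and f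
  assumes K: "pers_complex K" and L: "pers_complex L" and f: "pers_chain_map K L f"
begin

lemma chain_map_hom: "f n a \<in> hom (grp (obj K n) a) (grp (obj L n) a)"
  using f by (simp add: pers_chain_map_def pers_hom_def)

lemma chain_map_dif: "x \<in> el (obj K n) a \<Longrightarrow> f (n - 1) a (dif K n a x) = dif L n a (f n a x)"
  using f by (simp add: pers_chain_map_def)

lemma chain_map_cycles: "x \<in> cycles K n a \<Longrightarrow> f n a x \<in> cycles L n a"
  using chain_map_dif[of x n a] hom_in_carrier[OF chain_map_hom, of x n a]
    hom_one[OF chain_map_hom complex_group[OF K] complex_group[OF L]]
  by (simp add: cycles_iff[OF K] cycles_iff[OF L])

lemma chain_map_boundaries:
  assumes "x \<in> boundaries K n a"
  shows "f n a x \<in> boundaries L n a"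
proof -
  obtain y where y: "y \<in> el (obj K (n + 1)) a" "x = dif K (n + 1) a y" using assms by (auto simp: boundaries_def)
  then have "f n a x = dif L (n + 1) a (f (n + 1) a y)"
    using chain_map_dif[OF y(1)] by simp
  then show ?thesis using hom_in_carrier[OF chain_map_hom y(1)] by (simp add: boundaries_def)
qed

lemma homology_map_hcls:
  assumes "x \<in> cycles K n a"
  shows "homology_map L n f a (hcls K n a x) = hcls L n a (f n a x)"
  unfolding homology_map_def
  using assms
  by (intro homology_ind_hcls complex_comm_group[OF K] complex_comm_group[OF L] boundaries_subgroup[OF K]
      boundaries_subgroup[OF L] chain_map_hom chain_map_boundaries) (simp_all add: cycles_iff[OF K])

end

text \<open>If \<open>x\<close> has two values, multiply each by one value of the inverse of
  \<open>x\<close>: both products are values of the unit, hence trivial, so the two values agree.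
  The relation is thus the graph of a homomorphism. Both maps of the sequence and the splitting are
  obtained this way.\<close>

lemma additive_relation:
  assumes G: "group G" and H: "group H"
    and dom: "\<And>x y. R x y \<Longrightarrow> x \<in> carrier G \<and> y \<in> carrier H"
    and total: "\<And>x. x \<in> carrier G \<Longrightarrow> \<exists>y. R x y"
    and mult: "\<And>x y x' y'. \<lbrakk>R x y; R x' y'\<rbrakk> \<Longrightarrow> R (x \<otimes>\<^bsub>G\<^esub> x') (y \<otimes>\<^bsub>H\<^esub> y')"
    and unit: "\<And>y. R \<one>\<^bsub>G\<^esub> y \<Longrightarrow> y = \<one>\<^bsub>H\<^esub>"
  shows "(\<lambda>x. THE y. R x y) \<in> hom G H"
    and "R x y \<Longrightarrow> (THE y. R x y) = y"
    and "x \<in> carrier G \<Longrightarrow> R x (THE y. R x y)"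
proof -
  interpret G: group G by fact
  interpret H: group H by fact
  have uniq: "y = y'" if "R x y" "R x y'" for x y y'
  proof -
    have x: "x \<in> carrier G" and y: "y \<in> carrier H" "y' \<in> carrier H" using that dom by blast+
    obtain z where z: "R (inv\<^bsub>G\<^esub> x) z" using total[of "inv\<^bsub>G\<^esub> x"] x by auto
    have R1: "R \<one>\<^bsub>G\<^esub> (y \<otimes>\<^bsub>H\<^esub> z)" and R2: "R \<one>\<^bsub>G\<^esub> (y' \<otimes>\<^bsub>H\<^esub> z)"
      using mult[OF that(1) z] mult[OF that(2) z] x by simp_all
    have "y \<otimes>\<^bsub>H\<^esub> z = \<one>\<^bsub>H\<^esub>" "y' \<otimes>\<^bsub>H\<^esub> z = \<one>\<^bsub>H\<^esub>" by (rule unit[OF R1], rule unit[OF R2])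
    then show "y = y'" using y dom[OF z] H.inv_equality by metis
  qed
  show the: "(THE y. R x y) = y" if "R x y" for x y
    using that uniq by (intro the_equality) auto
  show R: "R x (THE y. R x y)" if "x \<in> carrier G" for x
    using total[OF that] the by auto
  show "(\<lambda>x. THE y. R x y) \<in> hom G H"
    by (rule homI) (use R dom the[OF mult[OF R R]] in auto)
qed

section \<open>Complexes of modules\<close>

definition cycle_pmod :: "('p, 'm, 'r) pmod_complex \<Rightarrow> int \<Rightarrow> ('p, 'm, 'r) pmod" where
  "cycle_pmod K n = restrict_pmod (obj K n) (cycles K n)"

lemma el_cycle: "el (cycle_pmod K n) a = cycles K n a"
  by (simp add: cycle_pmod_def restrict_simps)

lemma el_boundary: "el (boundary_pmod K n) a = boundaries K n a"
  by (simp add: boundary_pmod_def restrict_simps)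

lemma homology_pmod_simps:
  "grp (homology_pmod K n) = grp (homology K n)" "smap (homology_pmod K n) = smap (homology K n)"
  by (simp_all add: homology_pmod_def)

context
  fixes K :: "('p::preorder, 'm, 'r::{ring, monoid_mult}) pmod_complex" and sd
  assumes K: "is_pmod_complex sd K"
begin

lemma obj_module: "persistence_module sd (obj K n)"
  using K by (simp add: is_pmod_complex_def)

lemma dif_pmod_hom: "pmod_hom (obj K n) (obj K (n - 1)) (dif K n)"
  using K by (simp add: is_pmod_complex_def)

lemma dif_pmod_hom': "pmod_hom (obj K (n + 1)) (obj K n) (dif K (n + 1))"
  using dif_pmod_hom[of "n + 1"] by simp

lemma pmod_complex_pers: "pers_complex K"
  using K by (simp add: is_pmod_complex_def pers_complex_def persistence_module_def pmod_hom_pers)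

lemma cycles_subpmodule: "subpmodule (obj K n) (cycles K n)"
  using kernel_subpmodule[OF dif_pmod_hom obj_module obj_module, of n] by (simp add: cycles_def[abs_def])

lemma boundaries_subpmodule: "subpmodule (obj K n) (boundaries K n)"
  using image_subpmodule[OF dif_pmod_hom' obj_module obj_module, of n] by (simp add: boundaries_def[abs_def])

lemma cycle_module: "persistence_module sd (cycle_pmod K n)"
  unfolding cycle_pmod_def by (rule restrict_pmod_module[OF obj_module cycles_subpmodule])

lemma boundary_module: "persistence_module sd (boundary_pmod K n)"
  unfolding boundary_pmod_def by (rule restrict_pmod_module[OF obj_module boundaries_subpmodule])

lemma cycle_incl: "pmod_hom (cycle_pmod K n) (obj K n) (\<lambda>_ x. x)"
  unfolding cycle_pmod_def by (rule restrict_incl[OF cycles_subpmodule])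

lemma dif_boundaries: "x \<in> el (obj K n) a \<Longrightarrow> dif K n a x \<in> boundaries K (n - 1) a"
  by (simp add: boundaries_def)

lemma dif_cycle: "pmod_hom (obj K n) (cycle_pmod K (n - 1)) (dif K n)"
  unfolding cycle_pmod_def
  by (rule restrict_into[OF dif_pmod_hom]) (use dif_boundaries boundaries_cycles[OF pmod_complex_pers] in blast)

lemma dif_cycle': "pmod_hom (obj K (n + 1)) (cycle_pmod K n) (dif K (n + 1))"
  using dif_cycle[of "n + 1"] by simp

lemma dif_boundary: "pmod_hom (obj K n) (boundary_pmod K (n - 1)) (dif K n)"
  unfolding boundary_pmod_def by (rule restrict_into[OF dif_pmod_hom]) (rule dif_boundaries)

lemma dif_boundary_surj: "pers_surj (obj K n) (boundary_pmod K (n - 1)) (dif K n)"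
  by (simp add: pers_surj_def el_boundary boundaries_def)

lemma act_boundaries: "x \<in> boundaries K n a \<Longrightarrow> act (obj K n) a r x \<in> boundaries K n a"
  by (rule subpmoduleD(3)[OF boundaries_subpmodule])

lemma act_cycles: "x \<in> cycles K n a \<Longrightarrow> act (obj K n) a r x \<in> cycles K n a"
  by (rule subpmoduleD(3)[OF cycles_subpmodule])

lemma homology_act:
  assumes "x \<in> cycles K n a"
  shows "act (homology_pmod K n) a r (hcls K n a x) = hcls K n a (act (obj K n) a r x)"
proof -
  note P = pmod_complex_pers
  have "homology_ind K n a (act (obj K n) a r) (hcls K n a x) = hcls K n a (act (obj K n) a r x)"
    using assms
    by (intro homology_ind_hcls complex_comm_group[OF P] boundaries_subgroup[OF P] pmod_act_hom[OF obj_module] act_boundaries)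
      (simp_all add: cycles_iff[OF P])
  then show ?thesis by (simp add: homology_pmod_def)
qed

lemma homology_module: "persistence_module sd (homology_pmod K n)"
proof -
  note P = pmod_complex_pers
  note H = homology_comm_group[OF P] and surj = hcls_surj[OF P] and cl = hcls_closed[OF P] and m = hcls_mult[OF P]
  note sm = homology_smap[OF P] and sc = smap_cycles[OF P]
  have el: "x \<in> el (obj K n) a" if "x \<in> cycles K n a" for x a using that by (simp add: cycles_iff[OF P])
  have mc: "x \<otimes>\<^bsub>grp (obj K n) a\<^esub> y \<in> cycles K n a" if "x \<in> cycles K n a" "y \<in> cycles K n a" for x y a
    using subgroup.m_closed[OF cycles_subgroup[OF P] that] .
  show ?thesis
  proof (intro persistence_module.intro persistence_group.intro persistence_module_axioms.intro, unfold homology_pmod_simps)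
    show "comm_group (grp (homology K n) a)" for a by (rule H)
    show "smap (homology K n) a b \<in> hom (grp (homology K n) a) (grp (homology K n) b)" if ab: "a \<le> b" for a b
    proof (rule homI)
      show "smap (homology K n) a b C \<in> el (homology K n) b" if "C \<in> el (homology K n) a" for C
        using surj[OF that] sm[OF ab] cl sc[OF ab] by auto
      fix C D assume "C \<in> el (homology K n) a" "D \<in> el (homology K n) a"
      then obtain x y where x: "x \<in> cycles K n a" "C = hcls K n a x" and y: "y \<in> cycles K n a" "D = hcls K n a y"
        using surj by meson
      show "smap (homology K n) a b (C \<otimes>\<^bsub>grp (homology K n) a\<^esub> D) =
          smap (homology K n) a b C \<otimes>\<^bsub>grp (homology K n) b\<^esub> smap (homology K n) a b D"
        unfolding x(2) y(2) m[OF x(1) y(1), symmetric] sm[OF ab mc[OF x(1) y(1)]] sm[OF ab x(1)] sm[OF ab y(1)]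
          m[OF sc[OF ab x(1)] sc[OF ab y(1)], symmetric]
          hom_mult[OF complex_smap_hom[OF P ab] el[OF x(1)] el[OF y(1)]] ..
    qed
    show "act (homology_pmod K n) a r \<in> hom (grp (homology K n) a) (grp (homology K n) a)" for a r
    proof (rule homI)
      show "act (homology_pmod K n) a r C \<in> el (homology K n) a" if "C \<in> el (homology K n) a" for C
        using surj[OF that] homology_act cl act_cycles by auto
      fix C D assume "C \<in> el (homology K n) a" "D \<in> el (homology K n) a"
      then obtain x y where x: "x \<in> cycles K n a" "C = hcls K n a x" and y: "y \<in> cycles K n a" "D = hcls K n a y"
        using surj by meson
      show "act (homology_pmod K n) a r (C \<otimes>\<^bsub>grp (homology K n) a\<^esub> D) =
          act (homology_pmod K n) a r C \<otimes>\<^bsub>grp (homology K n) a\<^esub> act (homology_pmod K n) a r D"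
        unfolding x(2) y(2) m[OF x(1) y(1), symmetric] homology_act[OF mc[OF x(1) y(1)]] homology_act[OF x(1)]
          homology_act[OF y(1)] m[OF act_cycles[OF x(1)] act_cycles[OF y(1)], symmetric]
          hom_mult[OF pmod_act_hom[OF obj_module] el[OF x(1)] el[OF y(1)]] ..
    qed
    fix a C assume "C \<in> el (homology K n) a"
    then obtain x where x: "x \<in> cycles K n a" and C: "C = hcls K n a x" using surj by meson
    show "smap (homology K n) a a C = C"
      unfolding C sm[OF order_refl x] pmod_smap_id[OF obj_module el[OF x]] ..
    show "smap (homology K n) b c (smap (homology K n) a b C) = smap (homology K n) a c C" if "a \<le> b" "b \<le> c" for b c
      unfolding C sm[OF that(1) x] sm[OF that(2) sc[OF that(1) x]] sm[OF order_trans[OF that] x]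
        pmod_smap_comp[OF obj_module that el[OF x]] ..
    show "act (homology_pmod K n) a (r + r') C =
        act (homology_pmod K n) a r C \<otimes>\<^bsub>grp (homology K n) a\<^esub> act (homology_pmod K n) a r' C" for r r'
      unfolding C homology_act[OF x] m[OF act_cycles[OF x] act_cycles[OF x], symmetric]
        persistence_module.act_add[OF obj_module el[OF x]] ..
    show "act (homology_pmod K n) a 1 C = C"
      unfolding C homology_act[OF x] persistence_module.act_one[OF obj_module el[OF x]] ..
    show "act (homology_pmod K n) a (r * r') C = (case sd of
        Left \<Rightarrow> act (homology_pmod K n) a r (act (homology_pmod K n) a r' C)
        | Right \<Rightarrow> act (homology_pmod K n) a r' (act (homology_pmod K n) a r C))" for r r'
      unfolding C homology_act[OF x] homology_act[OF act_cycles[OF x]]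
        persistence_module.act_mult[OF obj_module el[OF x]] by (cases sd) simp_all
    show "smap (homology K n) a b (act (homology_pmod K n) a r C) = act (homology_pmod K n) b r (smap (homology K n) a b C)"
      if "a \<le> b" for b r
      unfolding C homology_act[OF x] sm[OF that x] sm[OF that act_cycles[OF x]] homology_act[OF sc[OF that x]]
        pmod_act_smap[OF obj_module that el[OF x]] ..
  qed
qed

lemma hcls_pmod_hom: "pmod_hom (cycle_pmod K n) (homology_pmod K n) (hcls K n)"
proof (rule pmod_homI)
  note P = pmod_complex_pers
  show "hcls K n a \<in> hom (grp (cycle_pmod K n) a) (grp (homology_pmod K n) a)" for a
    using hcls_hom[OF P] by (simp add: cycle_pmod_def restrict_simps homology_pmod_simps)
qed (simp_all add: el_cycle homology_pmod_simps homology_smap[OF pmod_complex_pers] homology_act cycle_pmod_def restrict_simps)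

lemma hcls_pers_surj: "pers_surj (cycle_pmod K n) (homology_pmod K n) (hcls K n)"
  using hcls_surj[OF pmod_complex_pers] hcls_closed[OF pmod_complex_pers]
  by (fastforce simp: pers_surj_def el_cycle homology_pmod_simps)

text \<open>Together with \<open>hcls_dif\<close> this is exactness of \<open>obj K (n + 1)
  \<rightarrow> cycle_pmod K n \<rightarrow> homology_pmod K n\<close> in the middle, phrased with
  the differential as the left map so that right exactness of the tensor product applies
  directly.\<close>

lemma hcls_kernel:
  "\<lbrakk>z \<in> el (cycle_pmod K n) a; hcls K n a z = \<one>\<^bsub>grp (homology_pmod K n) a\<^esub>\<rbrakk>
    \<Longrightarrow> z \<in> dif K (n + 1) a ` el (obj K (n + 1)) a"
  using hcls_one_iff[OF pmod_complex_pers] by (simp add: el_cycle homology_pmod_simps boundaries_def)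

lemma hcls_dif: "x \<in> el (obj K (n + 1)) a \<Longrightarrow> hcls K n a (dif K (n + 1) a x) = \<one>\<^bsub>grp (homology_pmod K n) a\<^esub>"
  using hcls_one_iff[OF pmod_complex_pers] boundaries_cycles[OF pmod_complex_pers] dif_boundaries[of x "n + 1" a]
  by (simp add: homology_pmod_simps subset_iff)

end

lemma chain_map_pers: "chain_map K L f \<Longrightarrow> pers_chain_map K L f"
  by (simp add: chain_map_def pers_chain_map_def pmod_hom_pers)

context
  fixes K :: "('p::preorder, 'm, 'r::{ring, monoid_mult}) pmod_complex"
    and L :: "('p, 'n, 'r) pmod_complex" and f sd
  assumes K: "is_pmod_complex sd K" and L: "is_pmod_complex sd L" and f: "chain_map K L f"
begin

lemma chain_map_pmod_hom: "pmod_hom (obj K n) (obj L n) (f n)"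
  using f by (simp add: chain_map_def)

lemma chain_map_comm: "x \<in> el (obj K n) a \<Longrightarrow> f (n - 1) a (dif K n a x) = dif L n a (f n a x)"
  using f by (simp add: chain_map_def)

lemma chain_map_cycle_hom: "pmod_hom (cycle_pmod K n) (cycle_pmod L n) (f n)"
  unfolding cycle_pmod_def
  using chain_map_cycles[OF pmod_complex_pers[OF K] pmod_complex_pers[OF L] chain_map_pers[OF f]]
  by (intro restrict_into restrict_from[OF chain_map_pmod_hom cycles_subpmodule[OF K]]) (simp add: restrict_simps)

lemma chain_map_hcls: "x \<in> cycles K n a \<Longrightarrow> homology_map L n f a (hcls K n a x) = hcls L n a (f n a x)"
  by (rule homology_map_hcls[OF pmod_complex_pers[OF K] pmod_complex_pers[OF L] chain_map_pers[OF f]])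

lemma homology_map_pmod_hom: "pmod_hom (homology_pmod K n) (homology_pmod L n) (homology_map L n f)"
proof (rule pmod_homI, unfold homology_pmod_simps)
  note PK = pmod_complex_pers[OF K] and PL = pmod_complex_pers[OF L]
  note cc = chain_map_cycles[OF PK PL chain_map_pers[OF f]]
  have el: "x \<in> el (obj K n) a" if "x \<in> cycles K n a" for x a using that by (simp add: cycles_iff[OF PK])
  have mc: "x \<otimes>\<^bsub>grp (obj K n) a\<^esub> y \<in> cycles K n a" if "x \<in> cycles K n a" "y \<in> cycles K n a" for x y a
    using subgroup.m_closed[OF cycles_subgroup[OF PK] that] .
  show "homology_map L n f a \<in> hom (grp (homology K n) a) (grp (homology L n) a)" for a
  proof (rule homI)
    show "homology_map L n f a C \<in> el (homology L n) a" if "C \<in> el (homology K n) a" for C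
      using hcls_surj[OF PK that] chain_map_hcls cc hcls_closed[OF PL] by auto
    fix C D assume "C \<in> el (homology K n) a" "D \<in> el (homology K n) a"
    then obtain x y where x: "x \<in> cycles K n a" "C = hcls K n a x" and y: "y \<in> cycles K n a" "D = hcls K n a y"
      using hcls_surj[OF PK] by meson
    show "homology_map L n f a (C \<otimes>\<^bsub>grp (homology K n) a\<^esub> D) =
        homology_map L n f a C \<otimes>\<^bsub>grp (homology L n) a\<^esub> homology_map L n f a D"
      unfolding x(2) y(2) hcls_mult[OF PK x(1) y(1), symmetric] chain_map_hcls[OF mc[OF x(1) y(1)]]
        chain_map_hcls[OF x(1)] chain_map_hcls[OF y(1)] hcls_mult[OF PL cc[OF x(1)] cc[OF y(1)], symmetric]
        hom_mult[OF pmod_hom_hom[OF chain_map_pmod_hom] el[OF x(1)] el[OF y(1)]] ..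
  qed
  fix a C assume "C \<in> el (homology K n) a"
  then obtain x where x: "x \<in> cycles K n a" and C: "C = hcls K n a x" using hcls_surj[OF PK] by meson
  show "homology_map L n f b (smap (homology K n) a b C) = smap (homology L n) a b (homology_map L n f a C)" if "a \<le> b" for b
    unfolding C homology_smap[OF PK that x] chain_map_hcls[OF x] chain_map_hcls[OF smap_cycles[OF PK that x]]
      homology_smap[OF PL that cc[OF x]] pmod_hom_smap[OF chain_map_pmod_hom that el[OF x]] ..
  show "homology_map L n f a (act (homology_pmod K n) a r C) = act (homology_pmod L n) a r (homology_map L n f a C)" for r
    unfolding C homology_act[OF K x] chain_map_hcls[OF x] chain_map_hcls[OF act_cycles[OF K x]]
      homology_act[OF L cc[OF x]] pmod_hom_act[OF chain_map_pmod_hom el[OF x]] ..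
qed

end

section \<open>Tensor products of a complex with a module\<close>

lemma complex_pten_simps:
  "obj (complex_pten s K A) n = pten s (obj K n) A"
  "dif (complex_pten s K A) n = pten_map s (obj K (n - 1)) A (dif K n) (\<lambda>_ x. x)"
  by (simp_all add: complex_pten_def)

lemma pten_complex_simps:
  "obj (pten_complex s M Q) n = pten s M (obj Q n)"
  "dif (pten_complex s M Q) n = pten_map s M (obj Q (n - 1)) (\<lambda>_ x. x) (dif Q n)"
  by (simp_all add: pten_complex_def)

lemma complex_pten_complex:
  assumes K: "is_pmod_complex Right K" and A: "lmod A"
  shows "pers_complex (complex_pten s K A)"
  unfolding pers_complex_def complex_pten_simps
proof (intro conjI allI ballI)
  note o = obj_module[OF K] and d = dif_pmod_hom[OF K] and i = pmod_hom_id[of A]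
  have d': "pmod_hom (obj K (n - 1)) (obj K (n - 2)) (dif K (n - 1))" for n using d[of "n - 1"] by simp
  show "persistence_group (pten s (obj K n) A)" for n by (rule pten_persistence_group[OF o A])
  show "pers_hom (pten s (obj K n) A) (pten s (obj K (n - 1)) A) (pten_map s (obj K (n - 1)) A (dif K n) (\<lambda>_ x. x))" for n
    by (rule pten_map_pers_hom[OF o A o A d i])
  fix n a t assume t: "t \<in> el (pten s (obj K n) A) a"
  have "pten_map s (obj K (n - 2)) A (dif K (n - 1)) (\<lambda>_ x. x) a (pten_map s (obj K (n - 1)) A (dif K n) (\<lambda>_ x. x) a t) =
      pten_map s (obj K (n - 2)) A (\<lambda>a x. dif K (n - 1) a (dif K n a x)) (\<lambda>_ x. x) a t"
    by (rule pten_map_comp[OF o A o A o A d i d' i pmod_hom_comp[OF d d'] i refl refl t])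
  also have "\<dots> = \<one>\<^bsub>grp (pten s (obj K (n - 2)) A) a\<^esub>"
    by (rule pten_map_trivial_left[OF o A o A pmod_hom_comp[OF d d'] i dif_dif[OF pmod_complex_pers[OF K]] t])
  finally show "pten_map s (obj K (n - 1 - 1)) A (dif K (n - 1)) (\<lambda>_ x. x) a
      (pten_map s (obj K (n - 1)) A (dif K n) (\<lambda>_ x. x) a t) = \<one>\<^bsub>grp (pten s (obj K (n - 2)) A) a\<^esub>" by simp
qed

lemma pten_complex_complex:
  assumes M: "rmod M" and Q: "is_pmod_complex Left Q"
  shows "pers_complex (pten_complex s M Q)"
  unfolding pers_complex_def pten_complex_simps
proof (intro conjI allI ballI)
  note o = obj_module[OF Q] and d = dif_pmod_hom[OF Q] and i = pmod_hom_id[of M]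
  have d': "pmod_hom (obj Q (n - 1)) (obj Q (n - 2)) (dif Q (n - 1))" for n using d[of "n - 1"] by simp
  show "persistence_group (pten s M (obj Q n))" for n by (rule pten_persistence_group[OF M o])
  show "pers_hom (pten s M (obj Q n)) (pten s M (obj Q (n - 1))) (pten_map s M (obj Q (n - 1)) (\<lambda>_ x. x) (dif Q n))" for n
    by (rule pten_map_pers_hom[OF M o M o i d])
  fix n a t assume t: "t \<in> el (pten s M (obj Q n)) a"
  have "pten_map s M (obj Q (n - 2)) (\<lambda>_ x. x) (dif Q (n - 1)) a (pten_map s M (obj Q (n - 1)) (\<lambda>_ x. x) (dif Q n) a t) =
      pten_map s M (obj Q (n - 2)) (\<lambda>_ x. x) (\<lambda>a x. dif Q (n - 1) a (dif Q n a x)) a t"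
    by (rule pten_map_comp[OF M o M o M o i d i d' i pmod_hom_comp[OF d d'] refl refl t])
  also have "\<dots> = \<one>\<^bsub>grp (pten s M (obj Q (n - 2))) a\<^esub>"
    by (rule pten_map_trivial_right[OF M o M o i pmod_hom_comp[OF d d'] dif_dif[OF pmod_complex_pers[OF Q]] t])
  finally show "pten_map s M (obj Q (n - 1 - 1)) (\<lambda>_ x. x) (dif Q (n - 1)) a
      (pten_map s M (obj Q (n - 1)) (\<lambda>_ x. x) (dif Q n) a t) = \<one>\<^bsub>grp (pten s M (obj Q (n - 2))) a\<^esub>" by simp
qed

lemma complex_pten_chain_map:
  assumes K: "is_pmod_complex Right K" and K': "is_pmod_complex Right K'" and A: "lmod A" and A': "lmod A'"
    and f: "chain_map K K' f" and g: "pmod_hom A A' g"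
  shows "pers_chain_map (complex_pten s K A) (complex_pten s K' A') (\<lambda>m. pten_map s (obj K' m) A' (f m) g)"
  unfolding pers_chain_map_def complex_pten_simps
proof (intro conjI allI ballI)
  note o = obj_module[OF K] and o' = obj_module[OF K'] and fh = chain_map_pmod_hom[OF K K' f]
  show "pers_hom (pten s (obj K n) A) (pten s (obj K' n) A') (pten_map s (obj K' n) A' (f n) g)" for n
    by (rule pten_map_pers_hom[OF o A o' A' fh g])
  show "pten_map s (obj K' (n - 1)) A' (f (n - 1)) g a (pten_map s (obj K (n - 1)) A (dif K n) (\<lambda>_ x. x) a t) =
      pten_map s (obj K' (n - 1)) A' (dif K' n) (\<lambda>_ x. x) a (pten_map s (obj K' n) A' (f n) g a t)"
    if "t \<in> el (pten s (obj K n) A) a" for n a t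
    by (rule pten_map_square[OF o A o A o' A' o' A' dif_pmod_hom[OF K] pmod_hom_id fh g fh g dif_pmod_hom[OF K']
        pmod_hom_id chain_map_comm[OF K K' f] refl that])
qed

lemma pten_complex_chain_map:
  assumes M: "rmod M" and M': "rmod M'" and Q: "is_pmod_complex Left Q" and Q': "is_pmod_complex Left Q'"
    and f: "pmod_hom M M' f" and g: "chain_map Q Q' g"
  shows "pers_chain_map (pten_complex s M Q) (pten_complex s M' Q') (\<lambda>m. pten_map s M' (obj Q' m) f (g m))"
  unfolding pers_chain_map_def pten_complex_simps
proof (intro conjI allI ballI)
  note o = obj_module[OF Q] and o' = obj_module[OF Q'] and gh = chain_map_pmod_hom[OF Q Q' g]
  show "pers_hom (pten s M (obj Q n)) (pten s M' (obj Q' n)) (pten_map s M' (obj Q' n) f (g n))" for n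
    by (rule pten_map_pers_hom[OF M o M' o' f gh])
  show "pten_map s M' (obj Q' (n - 1)) f (g (n - 1)) a (pten_map s M (obj Q (n - 1)) (\<lambda>_ x. x) (dif Q n) a t) =
      pten_map s M' (obj Q' (n - 1)) (\<lambda>_ x. x) (dif Q' n) a (pten_map s M' (obj Q' n) f (g n) a t)"
    if "t \<in> el (pten s M (obj Q n)) a" for n a t
    by (rule pten_map_square[OF M o M o M' o' M' o' pmod_hom_id dif_pmod_hom[OF Q] f gh f gh pmod_hom_id
        dif_pmod_hom[OF Q'] refl chain_map_comm[OF Q Q' g] that])
qed

section \<open>The sequence for one complex\<close>

text \<open>The span \<open>H \<otimes> A \<leftarrow> Z \<otimes> A \<rightarrow> H(K \<otimes>
  A)\<close> read as a relation.\<close>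

definition kalpha_rel where
  "kalpha_rel s n K A r t C \<longleftrightarrow> (\<exists>z\<in>el (pten s (cycle_pmod K n) A) r.
     t = pten_map s (homology_pmod K n) A (hcls K n) (\<lambda>_ x. x) r z \<and>
     C = hcls (complex_pten s K A) n r (pten_map s (obj K n) A (\<lambda>_ x. x) (\<lambda>_ x. x) r z))"

text \<open>The connecting map: lift a cycle of \<open>K \<otimes> A\<close> to \<open>c\<close> in \<open>K \<otimes> Q\<^sub>0\<close>; its boundary comes from
  some \<open>w\<close> in \<open>Z \<otimes> Q\<^sub>1\<close>, whose image in \<open>H \<otimes> Q\<^sub>1\<close> is a cycle.\<close>

definition kbeta_rel where
  "kbeta_rel s n K A Q e r y T \<longleftrightarrow>
    (\<exists>c\<in>el (pten s (obj K n) (obj Q 0)) r. \<exists>w\<in>el (pten s (cycle_pmod K (n - 1)) (obj Q 1)) r.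
      y = hcls (complex_pten s K A) n r (pten_map s (obj K n) A (\<lambda>_ x. x) e r c) \<and>
      pten_map s (cycle_pmod K (n - 1)) (obj Q 0) (dif K n) (\<lambda>_ x. x) r c =
        pten_map s (cycle_pmod K (n - 1)) (obj Q 0) (\<lambda>_ x. x) (dif Q 1) r w \<and>
      T = hcls (pten_complex s (homology_pmod K (n - 1)) Q) 1 r
        (pten_map s (homology_pmod K (n - 1)) (obj Q 1) (hcls K (n - 1)) (\<lambda>_ x. x) r w))"

locale kunneth_setup =
  fixes s :: tensor_kind and n :: int
    and K :: "('p::preordered_ab_group_add, 'k, 'r::{ring, monoid_mult}) pmod_complex"
    and A :: "('p, 'a, 'r) pmod" and Q :: "('p, 'u, 'r) pmod_complex" and e :: "'p \<Rightarrow> 'u \<Rightarrow> 'a"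
  assumes K: "is_pmod_complex Right K" and A: "lmod A" and res: "projective_resolution Q e A"
begin

abbreviation "Kn \<equiv> obj K n"
abbreviation "Zn \<equiv> cycle_pmod K n"
abbreviation "Zp \<equiv> cycle_pmod K (n - 1)"
abbreviation "Hn \<equiv> homology_pmod K n"
abbreviation "Hp \<equiv> homology_pmod K (n - 1)"
abbreviation "KA \<equiv> complex_pten s K A"
abbreviation "HQ \<equiv> pten_complex s Hp Q"
abbreviation "I \<equiv> \<lambda>_ x. x"
abbreviation "Q0 \<equiv> obj Q 0"
abbreviation "Q1 \<equiv> obj Q 1"
abbreviation "Q2 \<equiv> obj Q 2"

lemma Qc: "is_pmod_complex Left Q" using res by (simp add: projective_resolution_def)
lemma e_hom: "pmod_hom Q0 A e" using res by (simp add: projective_resolution_def)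
lemma e_surj: "pers_surj Q0 A e" using res by (simp add: projective_resolution_def)
lemma e_kernel: "kernel (grp Q0 a) (grp A a) (e a) = boundaries Q 0 a"
  using res by (simp add: projective_resolution_def)

lemma Q_mod: "lmod (obj Q m)" by (rule obj_module[OF Qc])
lemma K_mod: "rmod (obj K m)" by (rule obj_module[OF K])
lemma Z_mod: "rmod (cycle_pmod K m)" by (rule cycle_module[OF K])
lemma H_mod: "rmod (homology_pmod K m)" by (rule homology_module[OF K])

lemma d1: "pmod_hom Q1 Q0 (dif Q 1)" using dif_pmod_hom[OF Qc, of 1] by simp
lemma d2: "pmod_hom Q2 Q1 (dif Q 2)" using dif_pmod_hom[OF Qc, of 2] by simp
lemma d1_d2: "x \<in> el Q2 a \<Longrightarrow> dif Q 1 a (dif Q 2 a x) = \<one>\<^bsub>grp Q0 a\<^esub>"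
  using dif_dif[OF pmod_complex_pers[OF Qc], of x 2 a] by simp
lemma e_d1: "x \<in> el Q1 a \<Longrightarrow> e a (dif Q 1 a x) = \<one>\<^bsub>grp A a\<^esub>"
proof -
  assume "x \<in> el Q1 a"
  then have "dif Q 1 a x \<in> kernel (grp Q0 a) (grp A a) (e a)" unfolding e_kernel by (simp add: boundaries_def)
  then show ?thesis by (simp add: kernel_def)
qed
lemma e_exact: "\<lbrakk>y \<in> el Q0 a; e a y = \<one>\<^bsub>grp A a\<^esub>\<rbrakk> \<Longrightarrow> y \<in> dif Q 1 a ` el Q1 a"
proof -
  assume "y \<in> el Q0 a" "e a y = \<one>\<^bsub>grp A a\<^esub>"
  then have "y \<in> kernel (grp Q0 a) (grp A a) (e a)" by (simp add: kernel_def)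
  then show ?thesis unfolding e_kernel by (simp add: boundaries_def)
qed

lemma \<iota>: "pmod_hom (cycle_pmod K m) (obj K m) I" by (rule cycle_incl[OF K])
lemma \<delta>: "pmod_hom Kn Zp (dif K n)" by (rule dif_cycle[OF K])
lemma \<delta>': "pmod_hom (obj K (n + 1)) Zn (dif K (n + 1))" by (rule dif_cycle'[OF K])
lemma d: "pmod_hom Kn (obj K (n - 1)) (dif K n)" by (rule dif_pmod_hom[OF K])
lemma d': "pmod_hom (obj K (n + 1)) Kn (dif K (n + 1))" by (rule dif_pmod_hom'[OF K])
lemma \<pi>: "pmod_hom (cycle_pmod K m) (homology_pmod K m) (hcls K m)" by (rule hcls_pmod_hom[OF K])
lemma \<pi>_surj: "pers_surj (cycle_pmod K m) (homology_pmod K m) (hcls K m)" by (rule hcls_pers_surj[OF K])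
lemma I_surj: "pers_surj M M I" by (simp add: pers_surj_def)
lemmas I = pmod_hom_id

lemma \<pi>_\<delta>: "x \<in> el Kn a \<Longrightarrow> hcls K (n - 1) a (dif K n a x) = \<one>\<^bsub>grp Hp a\<^esub>"
  using hcls_dif[OF K, of x "n - 1" a] by simp
lemma \<pi>_exact: "\<lbrakk>z \<in> el Zp a; hcls K (n - 1) a z = \<one>\<^bsub>grp Hp a\<^esub>\<rbrakk> \<Longrightarrow> z \<in> dif K n a ` el Kn a"
  using hcls_kernel[OF K, of z "n - 1" a] by simp
lemma \<delta>_\<iota>: "x \<in> el Zn a \<Longrightarrow> dif K n a x = \<one>\<^bsub>grp Zp a\<^esub>"
  by (simp add: el_cycle cycles_iff[OF pmod_complex_pers[OF K]] cycle_pmod_def restrict_simps)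
lemma d_\<iota>: "x \<in> el Zn a \<Longrightarrow> dif K n a x = \<one>\<^bsub>grp (obj K (n - 1)) a\<^esub>"
  by (simp add: el_cycle cycles_iff[OF pmod_complex_pers[OF K]])
lemma \<delta>_d: "x \<in> el (obj K (n + 1)) a \<Longrightarrow> dif K n a (dif K (n + 1) a x) = \<one>\<^bsub>grp Zp a\<^esub>"
  using dif_dif[OF pmod_complex_pers[OF K], of x "n + 1" a] by (simp add: cycle_pmod_def restrict_simps)

lemma KA: "pers_complex KA" by (rule complex_pten_complex[OF K A])
lemma HQ: "pers_complex HQ" by (rule pten_complex_complex[OF H_mod Qc])

lemma KA_cycles: "t \<in> cycles KA n r \<longleftrightarrow> t \<in> el (pten s Kn A) r \<and>
    pten_map s (obj K (n - 1)) A (dif K n) I r t = \<one>\<^bsub>grp (pten s (obj K (n - 1)) A) r\<^esub>"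
  by (simp add: cycles_iff[OF KA] complex_pten_simps)

lemma KA_boundaries: "t \<in> boundaries KA n r \<longleftrightarrow>
    (\<exists>k\<in>el (pten s (obj K (n + 1)) A) r. t = pten_map s Kn A (dif K (n + 1)) I r k)"
  by (auto simp: boundaries_def complex_pten_simps)

lemma HQ_cycles: "t \<in> cycles HQ 1 r \<longleftrightarrow> t \<in> el (pten s Hp Q1) r \<and>
    pten_map s Hp Q0 I (dif Q 1) r t = \<one>\<^bsub>grp (pten s Hp Q0) r\<^esub>"
  by (simp add: cycles_iff[OF HQ] pten_complex_simps)

lemma HQ_boundaries: "t \<in> boundaries HQ 1 r \<longleftrightarrow>
    (\<exists>k\<in>el (pten s Hp Q2) r. t = pten_map s Hp Q1 I (dif Q 2) r k)"
  by (auto simp: boundaries_def pten_complex_simps)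

lemma one_closed: "\<lbrakk>rmod M; lmod N\<rbrakk> \<Longrightarrow> \<one>\<^bsub>grp (pten s M N) r\<^esub> \<in> el (pten s M N) r"
  by (rule monoid.one_closed[OF group.is_monoid[OF pten_group]])

lemma mult_closed: "\<lbrakk>rmod M; lmod N; x \<in> el (pten s M N) r; y \<in> el (pten s M N) r\<rbrakk>
    \<Longrightarrow> x \<otimes>\<^bsub>grp (pten s M N) r\<^esub> y \<in> el (pten s M N) r"
  by (rule monoid.m_closed[OF group.is_monoid[OF pten_group]])

lemma \<iota>_closed: "z \<in> el (pten s Zn A) r \<Longrightarrow> pten_map s Kn A I I r z \<in> cycles KA n r"
proof -
  assume z: "z \<in> el (pten s Zn A) r"
  have "pten_map s (obj K (n - 1)) A (dif K n) I r (pten_map s Kn A I I r z) =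
      pten_map s (obj K (n - 1)) A (dif K n) I r z"
    by (rule pten_map_comp[OF Z_mod A K_mod A K_mod A \<iota> I d I pmod_hom_comp[OF \<iota> d] I refl refl z])
  also have "\<dots> = \<one>\<^bsub>grp (pten s (obj K (n - 1)) A) r\<^esub>"
    by (rule pten_map_trivial_left[OF Z_mod A K_mod A pmod_hom_comp[OF \<iota> d] I d_\<iota> z])
  finally show ?thesis using pten_map_closed[OF Z_mod A K_mod A \<iota> I z] by (simp add: KA_cycles)
qed

lemma \<iota>_\<delta>': "k \<in> el (pten s (obj K (n + 1)) A) r \<Longrightarrow>
    pten_map s Kn A I I r (pten_map s Zn A (dif K (n + 1)) I r k) = pten_map s Kn A (dif K (n + 1)) I r k"
  by (rule pten_map_comp[OF K_mod A Z_mod A K_mod A \<delta>' I \<iota> I d' I refl refl])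

end

text \<open>Flatness enters the chases only through these three facts. The first makes
  \<open>Z \<otimes> A\<close> a subobject of \<open>K \<otimes> A\<close>, the second is exactness
  of \<open>Z \<otimes> Q\<close> in degree 1, and the third is exactness of \<open>Z \<otimes> Q0
  \<rightarrow> K \<otimes> Q0 \<rightarrow> Z \<otimes> Q0\<close>, with the degree of the last
  \<open>Z\<close> lowered by one. They are stated for all degrees \<open>m\<close>, so they do not
  depend on \<open>n\<close>.\<close>

locale kunneth = kunneth_setup s n K A Q e
  for s n and K :: "('p::preordered_ab_group_add, 'k, 'r::{ring, monoid_mult}) pmod_complex"
    and A :: "('p, 'a, 'r) pmod" and Q :: "('p, 'u, 'r) pmod_complex" and e +
  assumes cycle_inj: "\<And>m r t. \<lbrakk>t \<in> el (pten s (cycle_pmod K m) A) r;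
        pten_map s (obj K m) A (\<lambda>_ x. x) (\<lambda>_ x. x) r t = \<one>\<^bsub>grp (pten s (obj K m) A) r\<^esub>\<rbrakk>
      \<Longrightarrow> t = \<one>\<^bsub>grp (pten s (cycle_pmod K m) A) r\<^esub>"
    and cycle_Tor1: "\<And>m r t. \<lbrakk>t \<in> el (pten s (cycle_pmod K m) (obj Q 1)) r;
        pten_map s (cycle_pmod K m) (obj Q 0) (\<lambda>_ x. x) (dif Q 1) r t = \<one>\<^bsub>grp (pten s (cycle_pmod K m) (obj Q 0)) r\<^esub>\<rbrakk>
      \<Longrightarrow> \<exists>v\<in>el (pten s (cycle_pmod K m) (obj Q 2)) r.
        pten_map s (cycle_pmod K m) (obj Q 1) (\<lambda>_ x. x) (dif Q 2) r v = t"
    and Q0_exact: "\<And>m r t. \<lbrakk>t \<in> el (pten s (obj K m) (obj Q 0)) r;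
        pten_map s (cycle_pmod K (m - 1)) (obj Q 0) (dif K m) (\<lambda>_ x. x) r t =
          \<one>\<^bsub>grp (pten s (cycle_pmod K (m - 1)) (obj Q 0)) r\<^esub>\<rbrakk>
      \<Longrightarrow> \<exists>v\<in>el (pten s (cycle_pmod K m) (obj Q 0)) r.
        pten_map s (obj K m) (obj Q 0) (\<lambda>_ x. x) (\<lambda>_ x. x) r v = t"
begin

section \<open>The map from homology tensored with the module\<close>

lemma kalphaI: "z \<in> el (pten s Zn A) r \<Longrightarrow> kalpha_rel s n K A r
    (pten_map s Hn A (hcls K n) I r z) (hcls KA n r (pten_map s Kn A I I r z))"
  unfolding kalpha_rel_def by (rule bexI) simp_all

lemma kalphaE:
  assumes "kalpha_rel s n K A r t C"
  obtains z where "z \<in> el (pten s Zn A) r" "t = pten_map s Hn A (hcls K n) I r z"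
    "C = hcls KA n r (pten_map s Kn A I I r z)"
  using assms unfolding kalpha_rel_def by (elim bexE conjE) (rule that)

lemma kalpha_dom: "kalpha_rel s n K A r t C \<Longrightarrow> t \<in> el (pten s Hn A) r \<and> C \<in> el (homology KA n) r"
  by (elim kalphaE) (simp add: pten_map_closed[OF Z_mod A H_mod A \<pi> I] hcls_closed[OF KA \<iota>_closed])

lemma kalpha_total:
  assumes "t \<in> el (pten s Hn A) r"
  shows "\<exists>C. kalpha_rel s n K A r t C"
proof -
  obtain z where "z \<in> el (pten s Zn A) r" "pten_map s Hn A (hcls K n) I r z = t"
    using pten_map_surj[OF Z_mod A H_mod A \<pi> I \<pi>_surj I_surj assms] by (rule bexE)
  then show ?thesis using kalphaI[of z r] by auto
qed

lemma kalpha_mult: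
  assumes "kalpha_rel s n K A r t C" "kalpha_rel s n K A r t' C'"
  shows "kalpha_rel s n K A r (t \<otimes>\<^bsub>grp (pten s Hn A) r\<^esub> t') (C \<otimes>\<^bsub>grp (homology KA n) r\<^esub> C')"
proof -
  obtain z where z: "z \<in> el (pten s Zn A) r" "t = pten_map s Hn A (hcls K n) I r z"
      "C = hcls KA n r (pten_map s Kn A I I r z)"
    using assms(1) by (rule kalphaE)
  obtain z' where z': "z' \<in> el (pten s Zn A) r" "t' = pten_map s Hn A (hcls K n) I r z'"
      "C' = hcls KA n r (pten_map s Kn A I I r z')"
    using assms(2) by (rule kalphaE)
  show ?thesis
    unfolding z(2,3) z'(2,3)
      hom_mult[OF pten_map_hom(1)[OF Z_mod A H_mod A \<pi> I] z(1) z'(1), symmetric]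
      hcls_mult[OF KA \<iota>_closed[OF z(1)] \<iota>_closed[OF z'(1)], symmetric]
    unfolding complex_pten_simps
      hom_mult[OF pten_map_hom(1)[OF Z_mod A K_mod A \<iota> I] z(1) z'(1), symmetric]
    using kalphaI[OF mult_closed[OF Z_mod A z(1) z'(1)]] unfolding complex_pten_simps .
qed

text \<open>By right exactness a lift of the unit comes from \<open>obj K (n + 1)\<close> tensored
  with \<open>A\<close>, so its image in \<open>K \<otimes> A\<close> is a boundary.\<close>

lemma kalpha_unit:
  assumes "kalpha_rel s n K A r \<one>\<^bsub>grp (pten s Hn A) r\<^esub> C"
  shows "C = \<one>\<^bsub>grp (homology KA n) r\<^esub>"
proof -
  obtain z where z: "z \<in> el (pten s Zn A) r" "\<one>\<^bsub>grp (pten s Hn A) r\<^esub> = pten_map s Hn A (hcls K n) I r z"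
      "C = hcls KA n r (pten_map s Kn A I I r z)"
    using assms by (rule kalphaE)
  obtain k where k: "k \<in> el (pten s (obj K (n + 1)) A) r" "pten_map s Zn A (dif K (n + 1)) I r k = z"
    using pten_exact_first[OF A K_mod Z_mod H_mod \<delta>' \<pi> \<pi>_surj hcls_kernel[OF K] z(1) z(2)[symmetric]] by blast
  have "pten_map s Kn A I I r z \<in> boundaries KA n r"
    using \<iota>_\<delta>'[OF k(1)] k by (auto simp: KA_boundaries)
  then show ?thesis unfolding z(3) by (simp add: hcls_one_iff[OF KA \<iota>_closed[OF z(1)]])
qed

text \<open>If the image of \<open>z\<close> in \<open>K \<otimes> A\<close> is the boundary of
  \<open>k\<close>, then \<open>z\<close> and the image of \<open>k\<close> in
  \<open>Z \<otimes> A\<close> agree by \<open>cycle_inj\<close>; boundaries vanish in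
  \<open>H \<otimes> A\<close>.\<close>

lemma kalpha_injective:
  assumes "kalpha_rel s n K A r t \<one>\<^bsub>grp (homology KA n) r\<^esub>"
  shows "t = \<one>\<^bsub>grp (pten s Hn A) r\<^esub>"
proof -
  obtain z where z: "z \<in> el (pten s Zn A) r" "t = pten_map s Hn A (hcls K n) I r z"
      "\<one>\<^bsub>grp (homology KA n) r\<^esub> = hcls KA n r (pten_map s Kn A I I r z)"
    using assms by (rule kalphaE)
  from z(1) z(3)[symmetric] obtain k where k: "k \<in> el (pten s (obj K (n + 1)) A) r"
      "pten_map s Kn A I I r z = pten_map s Kn A (dif K (n + 1)) I r k"
    by (auto simp: hcls_one_iff[OF KA \<iota>_closed[OF z(1)]] KA_boundaries)
  let ?k = "pten_map s Zn A (dif K (n + 1)) I r k"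
  have k': "?k \<in> el (pten s Zn A) r" by (rule pten_map_closed[OF K_mod A Z_mod A \<delta>' I k(1)])
  have inj: "inj_on (pten_map s Kn A I I r) (el (pten s Zn A) r)"
    by (rule inj_on_kernel[OF pten_map_hom(1)[OF Z_mod A K_mod A \<iota> I] pten_group[OF Z_mod A] pten_group[OF K_mod A] cycle_inj])
  have "pten_map s Kn A I I r z = pten_map s Kn A I I r ?k" using k(2) \<iota>_\<delta>'[OF k(1)] by simp
  from inj_onD[OF inj this z(1) k'] have "z = ?k" .
  then have "t = pten_map s Hn A (hcls K n) I r ?k" using z(2) by simp
  also have "\<dots> = pten_map s Hn A (\<lambda>a x. hcls K n a (dif K (n + 1) a x)) I r k"
    by (rule pten_map_comp[OF K_mod A Z_mod A H_mod A \<delta>' I \<pi> I pmod_hom_comp[OF \<delta>' \<pi>] I refl refl k(1)])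
  also have "\<dots> = \<one>\<^bsub>grp (pten s Hn A) r\<^esub>"
    by (rule pten_map_trivial_left[OF K_mod A H_mod A pmod_hom_comp[OF \<delta>' \<pi>] I hcls_dif[OF K] k(1)])
  finally show ?thesis .
qed

lemma kalpha_smap:
  assumes "kalpha_rel s n K A r t C" "r \<le> r'"
  shows "kalpha_rel s n K A r' (smap (pten s Hn A) r r' t) (smap (homology KA n) r r' C)"
proof -
  obtain z where z: "z \<in> el (pten s Zn A) r" "t = pten_map s Hn A (hcls K n) I r z"
      "C = hcls KA n r (pten_map s Kn A I I r z)"
    using assms(1) by (rule kalphaE)
  show ?thesis
    unfolding z(2,3) homology_smap[OF KA assms(2) \<iota>_closed[OF z(1)]]
    unfolding complex_pten_simps
      pers_hom_smap[OF pten_map_pers_hom[OF Z_mod A K_mod A \<iota> I] assms(2) z(1), symmetric]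
      pers_hom_smap[OF pten_map_pers_hom[OF Z_mod A H_mod A \<pi> I] assms(2) z(1), symmetric]
    using kalphaI[OF hom_in_carrier[OF pten_smap_hom(1)[OF Z_mod A assms(2)] z(1)]]
    unfolding complex_pten_simps .
qed

section \<open>The connecting map\<close>

lemma kbeta_cycles:
  assumes c: "c \<in> el (pten s Kn Q0) r" and w: "w \<in> el (pten s Zp Q1) r"
    and eq: "pten_map s Zp Q0 (dif K n) I r c = pten_map s Zp Q0 I (dif Q 1) r w"
  shows "pten_map s Kn A I e r c \<in> cycles KA n r" (is ?C)
    and "pten_map s Hp Q1 (hcls K (n - 1)) I r w \<in> cycles HQ 1 r" (is ?W)
proof -
  have "pten_map s (obj K (n - 1)) A (dif K n) I r (pten_map s Kn A I e r c) =
      pten_map s (obj K (n - 1)) A I e r (pten_map s Zp Q0 (dif K n) I r c)"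
    by (rule pten_map_square[OF K_mod Q_mod K_mod A Z_mod Q_mod K_mod A I e_hom \<delta> I d I \<iota> e_hom refl refl c])
  also have "\<dots> = pten_map s (obj K (n - 1)) A I (\<lambda>a x. e a (dif Q 1 a x)) r w"
    unfolding eq
    by (rule pten_map_comp[OF Z_mod Q_mod Z_mod Q_mod K_mod A I d1 \<iota> e_hom \<iota> pmod_hom_comp[OF d1 e_hom] refl refl w])
  also have "\<dots> = \<one>\<^bsub>grp (pten s (obj K (n - 1)) A) r\<^esub>"
    by (rule pten_map_trivial_right[OF Z_mod Q_mod K_mod A \<iota> pmod_hom_comp[OF d1 e_hom] e_d1 w])
  finally show ?C using pten_map_closed[OF K_mod Q_mod K_mod A I e_hom c] by (simp add: KA_cycles)
  have "pten_map s Hp Q0 I (dif Q 1) r (pten_map s Hp Q1 (hcls K (n - 1)) I r w) =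
      pten_map s Hp Q0 (hcls K (n - 1)) I r (pten_map s Zp Q0 I (dif Q 1) r w)"
    by (rule pten_map_square[OF Z_mod Q_mod H_mod Q_mod Z_mod Q_mod H_mod Q_mod \<pi> I I d1 I d1 \<pi> I refl refl w])
  also have "\<dots> = pten_map s Hp Q0 (\<lambda>a x. hcls K (n - 1) a (dif K n a x)) I r c"
    unfolding eq[symmetric]
    by (rule pten_map_comp[OF K_mod Q_mod Z_mod Q_mod H_mod Q_mod \<delta> I \<pi> I pmod_hom_comp[OF \<delta> \<pi>] I refl refl c])
  also have "\<dots> = \<one>\<^bsub>grp (pten s Hp Q0) r\<^esub>"
    by (rule pten_map_trivial_left[OF K_mod Q_mod H_mod Q_mod pmod_hom_comp[OF \<delta> \<pi>] I \<pi>_\<delta> c])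
  finally show ?W using pten_map_closed[OF Z_mod Q_mod H_mod Q_mod \<pi> I w] by (simp add: HQ_cycles)
qed

lemma kbetaE:
  assumes "kbeta_rel s n K A Q e r y T"
  obtains c w where "c \<in> el (pten s Kn Q0) r" "w \<in> el (pten s Zp Q1) r"
    "y = hcls KA n r (pten_map s Kn A I e r c)"
    "pten_map s Zp Q0 (dif K n) I r c = pten_map s Zp Q0 I (dif Q 1) r w"
    "T = hcls HQ 1 r (pten_map s Hp Q1 (hcls K (n - 1)) I r w)"
  using assms unfolding kbeta_rel_def by (elim bexE conjE) (rule that)

lemma kbetaI:
  assumes "c \<in> el (pten s Kn Q0) r" "w \<in> el (pten s Zp Q1) r"
    "y = hcls KA n r (pten_map s Kn A I e r c)"
    "pten_map s Zp Q0 (dif K n) I r c = pten_map s Zp Q0 I (dif Q 1) r w"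
    "T = hcls HQ 1 r (pten_map s Hp Q1 (hcls K (n - 1)) I r w)"
  shows "kbeta_rel s n K A Q e r y T"
  unfolding kbeta_rel_def by (intro bexI[OF _ assms(1)] bexI[OF _ assms(2)] conjI assms(3-5))

lemma kbeta_dom: "kbeta_rel s n K A Q e r y T \<Longrightarrow> y \<in> el (homology KA n) r \<and> T \<in> el (homology HQ 1) r"
  by (elim kbetaE) (simp add: hcls_closed[OF KA kbeta_cycles(1)] hcls_closed[OF HQ kbeta_cycles(2)])

lemma kbeta_total:
  assumes "y \<in> el (homology KA n) r"
  shows "\<exists>T. kbeta_rel s n K A Q e r y T"
proof -
  obtain x where x: "x \<in> el (pten s Kn A) r"
      "pten_map s (obj K (n - 1)) A (dif K n) I r x = \<one>\<^bsub>grp (pten s (obj K (n - 1)) A) r\<^esub>"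
      "y = hcls KA n r x"
    using hcls_surj[OF KA assms] by (auto simp: KA_cycles)
  obtain c where c: "c \<in> el (pten s Kn Q0) r" "pten_map s Kn A I e r c = x"
    using pten_map_surj[OF K_mod Q_mod K_mod A I e_hom I_surj e_surj x(1)] by blast
  have "pten_map s (obj K (n - 1)) A I I r (pten_map s Zp A (dif K n) I r x) =
      pten_map s (obj K (n - 1)) A (dif K n) I r x"
    by (rule pten_map_comp[OF K_mod A Z_mod A K_mod A \<delta> I \<iota> I d I refl refl x(1)])
  \<comment> \<open>The cycle condition says only that the differential of \<open>x\<close> dies in
    \<open>K \<otimes> A\<close>. By \<open>cycle_inj\<close> it dies already in
    \<open>Z \<otimes> A\<close>, which is what makes the differential of the lift \<open>c\<close>
    come from \<open>Q1\<close>.\<close>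
  with x(2) have 1: "pten_map s Zp A (dif K n) I r x = \<one>\<^bsub>grp (pten s Zp A) r\<^esub>"
    using cycle_inj[OF pten_map_closed[OF K_mod A Z_mod A \<delta> I x(1)]] by simp
  have "pten_map s Zp A I e r (pten_map s Zp Q0 (dif K n) I r c) =
      pten_map s Zp A (dif K n) I r (pten_map s Kn A I e r c)"
    by (rule pten_map_square[OF K_mod Q_mod Z_mod Q_mod K_mod A Z_mod A \<delta> I I e_hom I e_hom \<delta> I refl refl c(1)])
  with 1 c(2) have "pten_map s Zp A I e r (pten_map s Zp Q0 (dif K n) I r c) = \<one>\<^bsub>grp (pten s Zp A) r\<^esub>" by simp
  then obtain w where w: "w \<in> el (pten s Zp Q1) r"
      "pten_map s Zp Q0 I (dif Q 1) r w = pten_map s Zp Q0 (dif K n) I r c"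
    using pten_exact_second[OF Z_mod Q_mod Q_mod A d1 e_hom e_surj e_exact
        pten_map_closed[OF K_mod Q_mod Z_mod Q_mod \<delta> I c(1)]] by blast
  have "y = hcls KA n r (pten_map s Kn A I e r c)" using x(3) c(2) by simp
  from kbetaI[OF c(1) w(1) this w(2)[symmetric] refl] show ?thesis ..
qed

lemma kbeta_mult:
  assumes "kbeta_rel s n K A Q e r y T" "kbeta_rel s n K A Q e r y' T'"
  shows "kbeta_rel s n K A Q e r (y \<otimes>\<^bsub>grp (homology KA n) r\<^esub> y') (T \<otimes>\<^bsub>grp (homology HQ 1) r\<^esub> T')"
  using assms
proof (elim kbetaE)
  fix c w c' w'
  assume c: "c \<in> el (pten s Kn Q0) r" and w: "w \<in> el (pten s Zp Q1) r"
    and y: "y = hcls KA n r (pten_map s Kn A I e r c)"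
    and eq: "pten_map s Zp Q0 (dif K n) I r c = pten_map s Zp Q0 I (dif Q 1) r w"
    and T: "T = hcls HQ 1 r (pten_map s Hp Q1 (hcls K (n - 1)) I r w)"
    and c': "c' \<in> el (pten s Kn Q0) r" and w': "w' \<in> el (pten s Zp Q1) r"
    and y': "y' = hcls KA n r (pten_map s Kn A I e r c')"
    and eq': "pten_map s Zp Q0 (dif K n) I r c' = pten_map s Zp Q0 I (dif Q 1) r w'"
    and T': "T' = hcls HQ 1 r (pten_map s Hp Q1 (hcls K (n - 1)) I r w')"
  show ?thesis
  proof (rule kbetaI[OF mult_closed[OF K_mod Q_mod c c'] mult_closed[OF Z_mod Q_mod w w']])
    show "y \<otimes>\<^bsub>grp (homology KA n) r\<^esub> y' = hcls KA n r (pten_map s Kn A I e r (c \<otimes>\<^bsub>grp (pten s Kn Q0) r\<^esub> c'))"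
      unfolding y y' hcls_mult[OF KA kbeta_cycles(1)[OF c w eq] kbeta_cycles(1)[OF c' w' eq'], symmetric]
      unfolding complex_pten_simps hom_mult[OF pten_map_hom(1)[OF K_mod Q_mod K_mod A I e_hom] c c'] ..
    show "T \<otimes>\<^bsub>grp (homology HQ 1) r\<^esub> T' =
        hcls HQ 1 r (pten_map s Hp Q1 (hcls K (n - 1)) I r (w \<otimes>\<^bsub>grp (pten s Zp Q1) r\<^esub> w'))"
      unfolding T T' hcls_mult[OF HQ kbeta_cycles(2)[OF c w eq] kbeta_cycles(2)[OF c' w' eq'], symmetric]
      unfolding pten_complex_simps hom_mult[OF pten_map_hom(1)[OF Z_mod Q_mod H_mod Q_mod \<pi> I] w w'] ..
    show "pten_map s Zp Q0 (dif K n) I r (c \<otimes>\<^bsub>grp (pten s Kn Q0) r\<^esub> c') =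
        pten_map s Zp Q0 I (dif Q 1) r (w \<otimes>\<^bsub>grp (pten s Zp Q1) r\<^esub> w')"
      unfolding hom_mult[OF pten_map_hom(1)[OF K_mod Q_mod Z_mod Q_mod \<delta> I] c c'] eq eq'
        hom_mult[OF pten_map_hom(1)[OF Z_mod Q_mod Z_mod Q_mod I d1] w w'] ..
  qed
qed

lemma \<pi>_d2: "x \<in> el (pten s Zp Q2) r \<Longrightarrow> pten_map s Hp Q1 (hcls K (n - 1)) I r (pten_map s Zp Q1 I (dif Q 2) r x) =
    pten_map s Hp Q1 I (dif Q 2) r (pten_map s Hp Q2 (hcls K (n - 1)) I r x)"
  by (rule pten_map_square[OF Z_mod Q_mod Z_mod Q_mod H_mod Q_mod H_mod Q_mod I d2 \<pi> I \<pi> I I d2 refl refl])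

lemma \<pi>_\<delta>_pten: "v \<in> el (pten s Kn (obj Q m)) r \<Longrightarrow>
    pten_map s Hp (obj Q m) (hcls K (n - 1)) I r (pten_map s Zp (obj Q m) (dif K n) I r v) = \<one>\<^bsub>grp (pten s Hp (obj Q m)) r\<^esub>"
  using pten_map_comp[OF K_mod Q_mod Z_mod Q_mod H_mod Q_mod \<delta> I \<pi> I pmod_hom_comp[OF \<delta> \<pi>] I refl refl, of v s m r]
    pten_map_trivial_left[OF K_mod Q_mod H_mod Q_mod pmod_hom_comp[OF \<delta> \<pi>] I \<pi>_\<delta>, of v s m r] by simp

lemma \<delta>_d1: "v \<in> el (pten s Kn Q1) r \<Longrightarrow> pten_map s Zp Q0 (dif K n) I r (pten_map s Kn Q0 I (dif Q 1) r v) =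
    pten_map s Zp Q0 I (dif Q 1) r (pten_map s Zp Q1 (dif K n) I r v)"
  by (rule pten_map_square[OF K_mod Q_mod K_mod Q_mod Z_mod Q_mod Z_mod Q_mod I d1 \<delta> I \<delta> I I d1 refl refl])

lemma e_d1_pten: "v \<in> el (pten s Kn Q1) r \<Longrightarrow>
    pten_map s Kn A I e r (pten_map s Kn Q0 I (dif Q 1) r v) = \<one>\<^bsub>grp (pten s Kn A) r\<^esub>"
  using pten_map_comp[OF K_mod Q_mod K_mod Q_mod K_mod A I d1 I e_hom I pmod_hom_comp[OF d1 e_hom] refl refl, of v s n r]
    pten_map_trivial_right[OF K_mod Q_mod K_mod A I pmod_hom_comp[OF d1 e_hom] e_d1, of v s n r] by simp

text \<open>If the class is trivial, \<open>c\<close> is a boundary coming from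
  \<open>K \<otimes> Q1\<close>, given by \<open>v\<close>, times one coming from the differential
  of \<open>K\<close>. The latter is killed by the differential, so \<open>w\<close> and the image
  of \<open>v\<close> agree in \<open>Z \<otimes> Q0\<close>. By \<open>cycle_Tor1\<close> they
  differ by an element from \<open>Q2\<close>; in \<open>H \<otimes> Q1\<close> the contribution of
  \<open>v\<close> vanishes and a boundary remains.\<close>

lemma kbeta_unit:
  assumes "kbeta_rel s n K A Q e r \<one>\<^bsub>grp (homology KA n) r\<^esub> T"
  shows "T = \<one>\<^bsub>grp (homology HQ 1) r\<^esub>"
proof -
  obtain c w where c: "c \<in> el (pten s Kn Q0) r" and w: "w \<in> el (pten s Zp Q1) r"
    and y: "\<one>\<^bsub>grp (homology KA n) r\<^esub> = hcls KA n r (pten_map s Kn A I e r c)"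
    and eq: "pten_map s Zp Q0 (dif K n) I r c = pten_map s Zp Q0 I (dif Q 1) r w"
    and T: "T = hcls HQ 1 r (pten_map s Hp Q1 (hcls K (n - 1)) I r w)"
    using assms by (rule kbetaE)
  note cyc = kbeta_cycles[OF c w eq]
  obtain k where k: "k \<in> el (pten s (obj K (n + 1)) A) r"
      "pten_map s Kn A I e r c = pten_map s Kn A (dif K (n + 1)) I r k"
    using y[symmetric] by (auto simp: hcls_one_iff[OF KA cyc(1)] KA_boundaries)
  obtain k' where k': "k' \<in> el (pten s (obj K (n + 1)) Q0) r" "pten_map s (obj K (n + 1)) A I e r k' = k"
    using pten_map_surj[OF K_mod Q_mod K_mod A I e_hom I_surj e_surj k(1)] by blast
  let ?dk = "pten_map s Kn Q0 (dif K (n + 1)) I r k'"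
  have dk: "?dk \<in> el (pten s Kn Q0) r" by (rule pten_map_closed[OF K_mod Q_mod K_mod Q_mod d' I k'(1)])
  have "pten_map s Kn A I e r ?dk = pten_map s Kn A (dif K (n + 1)) I r (pten_map s (obj K (n + 1)) A I e r k')"
    by (rule pten_map_square[OF K_mod Q_mod K_mod Q_mod K_mod A K_mod A d' I I e_hom I e_hom d' I refl refl k'(1)])
  then have "pten_map s Kn A I e r c = pten_map s Kn A I e r ?dk" using k k' by simp
  from exact_lift[OF pten_map_hom(1)[OF K_mod Q_mod K_mod A I e_hom] pten_group[OF K_mod Q_mod] pten_group[OF K_mod A]
      c dk this pten_exact_second[OF K_mod Q_mod Q_mod A d1 e_hom e_surj e_exact]]
  obtain v where v: "v \<in> el (pten s Kn Q1) r"
      "c = pten_map s Kn Q0 I (dif Q 1) r v \<otimes>\<^bsub>grp (pten s Kn Q0) r\<^esub> ?dk" by blast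
  let ?\<delta>v = "pten_map s Zp Q1 (dif K n) I r v"
  have \<delta>v: "?\<delta>v \<in> el (pten s Zp Q1) r" by (rule pten_map_closed[OF K_mod Q_mod Z_mod Q_mod \<delta> I v(1)])
  have dv: "pten_map s Kn Q0 I (dif Q 1) r v \<in> el (pten s Kn Q0) r"
    by (rule pten_map_closed[OF K_mod Q_mod K_mod Q_mod I d1 v(1)])
  have \<delta>dk: "pten_map s Zp Q0 (dif K n) I r ?dk = \<one>\<^bsub>grp (pten s Zp Q0) r\<^esub>"
    using pten_map_comp[OF K_mod Q_mod K_mod Q_mod Z_mod Q_mod d' I \<delta> I pmod_hom_comp[OF d' \<delta>] I refl refl k'(1)]
      pten_map_trivial_left[OF K_mod Q_mod Z_mod Q_mod pmod_hom_comp[OF d' \<delta>] I \<delta>_d k'(1)] by simp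
  interpret ZQ0: group "grp (pten s Zp Q0) r" by (rule pten_group[OF Z_mod Q_mod])
  have "pten_map s Zp Q0 I (dif Q 1) r w = pten_map s Zp Q0 I (dif Q 1) r ?\<delta>v"
    unfolding eq[symmetric] v(2) hom_mult[OF pten_map_hom(1)[OF K_mod Q_mod Z_mod Q_mod \<delta> I] dv dk] \<delta>dk \<delta>_d1[OF v(1)]
    by (rule ZQ0.r_one[OF pten_map_closed[OF Z_mod Q_mod Z_mod Q_mod I d1 \<delta>v]])
  from exact_lift[OF pten_map_hom(1)[OF Z_mod Q_mod Z_mod Q_mod I d1] pten_group[OF Z_mod Q_mod] ZQ0.group_axioms
      w \<delta>v this cycle_Tor1]
  obtain x where x: "x \<in> el (pten s Zp Q2) r"
      "w = pten_map s Zp Q1 I (dif Q 2) r x \<otimes>\<^bsub>grp (pten s Zp Q1) r\<^esub> ?\<delta>v" by blast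
  interpret HQ1: group "grp (pten s Hp Q1) r" by (rule pten_group[OF H_mod Q_mod])
  have x': "pten_map s Hp Q2 (hcls K (n - 1)) I r x \<in> el (pten s Hp Q2) r"
    by (rule pten_map_closed[OF Z_mod Q_mod H_mod Q_mod \<pi> I x(1)])
  have "pten_map s Hp Q1 (hcls K (n - 1)) I r w =
      pten_map s Hp Q1 I (dif Q 2) r (pten_map s Hp Q2 (hcls K (n - 1)) I r x)"
    unfolding x(2) hom_mult[OF pten_map_hom(1)[OF Z_mod Q_mod H_mod Q_mod \<pi> I] pten_map_closed[OF Z_mod Q_mod Z_mod Q_mod I d2 x(1)] \<delta>v]
      \<pi>_d2[OF x(1)] \<pi>_\<delta>_pten[OF v(1)]
    by (rule HQ1.r_one[OF pten_map_closed[OF H_mod Q_mod H_mod Q_mod I d2 x']])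
  then show ?thesis using x' unfolding T hcls_one_iff[OF HQ cyc(2)] HQ_boundaries by blast
qed

text \<open>A cycle of \<open>H \<otimes> Q1\<close> lifts to \<open>w\<close> in
  \<open>Z \<otimes> Q1\<close>. The boundary of \<open>w\<close> dies in
  \<open>H \<otimes> Q0\<close>, so right exactness lifts it to some \<open>c\<close> in
  \<open>K \<otimes> Q0\<close>.\<close>

lemma kbeta_surj:
  assumes "T \<in> el (homology HQ 1) r"
  shows "\<exists>y. kbeta_rel s n K A Q e r y T"
proof -
  obtain h where h: "h \<in> el (pten s Hp Q1) r" "pten_map s Hp Q0 I (dif Q 1) r h = \<one>\<^bsub>grp (pten s Hp Q0) r\<^esub>"
      "T = hcls HQ 1 r h"
    using hcls_surj[OF HQ assms] by (auto simp: HQ_cycles)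
  obtain w where w: "w \<in> el (pten s Zp Q1) r" "pten_map s Hp Q1 (hcls K (n - 1)) I r w = h"
    using pten_map_surj[OF Z_mod Q_mod H_mod Q_mod \<pi> I \<pi>_surj I_surj h(1)] by blast
  have "pten_map s Hp Q0 (hcls K (n - 1)) I r (pten_map s Zp Q0 I (dif Q 1) r w) =
      pten_map s Hp Q0 I (dif Q 1) r (pten_map s Hp Q1 (hcls K (n - 1)) I r w)"
    by (rule pten_map_square[OF Z_mod Q_mod Z_mod Q_mod H_mod Q_mod H_mod Q_mod I d1 \<pi> I \<pi> I I d1 refl refl w(1)])
  then have "pten_map s Hp Q0 (hcls K (n - 1)) I r (pten_map s Zp Q0 I (dif Q 1) r w) = \<one>\<^bsub>grp (pten s Hp Q0) r\<^esub>"
    using w h by simp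
  then obtain c where c: "c \<in> el (pten s Kn Q0) r" "pten_map s Zp Q0 (dif K n) I r c = pten_map s Zp Q0 I (dif Q 1) r w"
    using pten_exact_first[OF Q_mod K_mod Z_mod H_mod \<delta> \<pi> \<pi>_surj \<pi>_exact
        pten_map_closed[OF Z_mod Q_mod Z_mod Q_mod I d1 w(1)]] by blast
  have "T = hcls HQ 1 r (pten_map s Hp Q1 (hcls K (n - 1)) I r w)" using w(2) h(3) by simp
  from kbetaI[OF c(1) w(1) refl c(2) this] show ?thesis ..
qed

lemma \<iota>_e: "z \<in> el (pten s Zn Q0) r \<Longrightarrow>
    pten_map s Kn A I e r (pten_map s Kn Q0 I I r z) = pten_map s Kn A I I r (pten_map s Zn A I e r z)"
  by (rule pten_map_square[OF Z_mod Q_mod K_mod Q_mod Z_mod A K_mod A \<iota> I I e_hom I e_hom \<iota> I refl refl])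

text \<open>Correcting \<open>w\<close> by a boundary from \<open>Q2\<close> leaves an element
  coming from \<open>v\<close> in \<open>K \<otimes> Q1\<close>. Then \<open>c\<close> and the
  boundary of \<open>v\<close> have the same differential, and by \<open>Q0_exact\<close> they
  differ by an element of \<open>Z \<otimes> Q0\<close>. The boundary of \<open>v\<close> dies in
  \<open>K \<otimes> A\<close>, so the class is represented by that element.\<close>

lemma kbeta_kernel:
  assumes "kbeta_rel s n K A Q e r y \<one>\<^bsub>grp (homology HQ 1) r\<^esub>"
  shows "\<exists>t. kalpha_rel s n K A r t y"
proof -
  obtain c w where c: "c \<in> el (pten s Kn Q0) r" and w: "w \<in> el (pten s Zp Q1) r"
    and y: "y = hcls KA n r (pten_map s Kn A I e r c)"
    and eq: "pten_map s Zp Q0 (dif K n) I r c = pten_map s Zp Q0 I (dif Q 1) r w"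
    and T: "\<one>\<^bsub>grp (homology HQ 1) r\<^esub> = hcls HQ 1 r (pten_map s Hp Q1 (hcls K (n - 1)) I r w)"
    using assms by (rule kbetaE)
  note cyc = kbeta_cycles[OF c w eq]
  obtain h where h: "h \<in> el (pten s Hp Q2) r"
      "pten_map s Hp Q1 (hcls K (n - 1)) I r w = pten_map s Hp Q1 I (dif Q 2) r h"
    using T[symmetric] by (auto simp: hcls_one_iff[OF HQ cyc(2)] HQ_boundaries)
  obtain x where x: "x \<in> el (pten s Zp Q2) r" "pten_map s Hp Q2 (hcls K (n - 1)) I r x = h"
    using pten_map_surj[OF Z_mod Q_mod H_mod Q_mod \<pi> I \<pi>_surj I_surj h(1)] by blast
  let ?dx = "pten_map s Zp Q1 I (dif Q 2) r x"
  have dx: "?dx \<in> el (pten s Zp Q1) r" by (rule pten_map_closed[OF Z_mod Q_mod Z_mod Q_mod I d2 x(1)])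
  have "pten_map s Hp Q1 (hcls K (n - 1)) I r w = pten_map s Hp Q1 (hcls K (n - 1)) I r ?dx"
    using \<pi>_d2[OF x(1)] x h by simp
  from exact_lift[OF pten_map_hom(1)[OF Z_mod Q_mod H_mod Q_mod \<pi> I] pten_group[OF Z_mod Q_mod] pten_group[OF H_mod Q_mod]
      w dx this pten_exact_first[OF Q_mod K_mod Z_mod H_mod \<delta> \<pi> \<pi>_surj \<pi>_exact]]
  obtain v where v: "v \<in> el (pten s Kn Q1) r"
      "w = pten_map s Zp Q1 (dif K n) I r v \<otimes>\<^bsub>grp (pten s Zp Q1) r\<^esub> ?dx" by blast
  let ?\<delta>v = "pten_map s Zp Q1 (dif K n) I r v" and ?dv = "pten_map s Kn Q0 I (dif Q 1) r v"
  have \<delta>v: "?\<delta>v \<in> el (pten s Zp Q1) r" by (rule pten_map_closed[OF K_mod Q_mod Z_mod Q_mod \<delta> I v(1)])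
  have dv: "?dv \<in> el (pten s Kn Q0) r" by (rule pten_map_closed[OF K_mod Q_mod K_mod Q_mod I d1 v(1)])
  have ddx: "pten_map s Zp Q0 I (dif Q 1) r ?dx = \<one>\<^bsub>grp (pten s Zp Q0) r\<^esub>"
    using pten_map_comp[OF Z_mod Q_mod Z_mod Q_mod Z_mod Q_mod I d2 I d1 I pmod_hom_comp[OF d2 d1] refl refl x(1)]
      pten_map_trivial_right[OF Z_mod Q_mod Z_mod Q_mod I pmod_hom_comp[OF d2 d1] d1_d2 x(1)] by simp
  interpret ZQ0: group "grp (pten s Zp Q0) r" by (rule pten_group[OF Z_mod Q_mod])
  interpret K_A: group "grp (pten s Kn A) r" by (rule pten_group[OF K_mod A])
  have "pten_map s Zp Q0 (dif K n) I r c = pten_map s Zp Q0 (dif K n) I r ?dv"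
    unfolding eq v(2) hom_mult[OF pten_map_hom(1)[OF Z_mod Q_mod Z_mod Q_mod I d1] \<delta>v dx] ddx \<delta>_d1[OF v(1)]
    by (rule ZQ0.r_one[OF pten_map_closed[OF Z_mod Q_mod Z_mod Q_mod I d1 \<delta>v]])
  from exact_lift[OF pten_map_hom(1)[OF K_mod Q_mod Z_mod Q_mod \<delta> I] pten_group[OF K_mod Q_mod] ZQ0.group_axioms
      c dv this Q0_exact]
  obtain z where z: "z \<in> el (pten s Zn Q0) r"
      "c = pten_map s Kn Q0 I I r z \<otimes>\<^bsub>grp (pten s Kn Q0) r\<^esub> ?dv" by blast
  have z': "pten_map s Zn A I e r z \<in> el (pten s Zn A) r" by (rule pten_map_closed[OF Z_mod Q_mod Z_mod A I e_hom z(1)])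
  have "pten_map s Kn A I e r c = pten_map s Kn A I I r (pten_map s Zn A I e r z)"
    unfolding z(2) hom_mult[OF pten_map_hom(1)[OF K_mod Q_mod K_mod A I e_hom] pten_map_closed[OF Z_mod Q_mod K_mod Q_mod \<iota> I z(1)] dv]
      e_d1_pten[OF v(1)] \<iota>_e[OF z(1)]
    by (rule K_A.r_one[OF pten_map_closed[OF Z_mod A K_mod A \<iota> I z']])
  then show ?thesis using kalphaI[OF z'] unfolding y by auto
qed

text \<open>A lift taken in \<open>Z \<otimes> Q0\<close> has trivial differential, so the unit is
  an admissible \<open>w\<close>.\<close>

lemma kbeta_kalpha:
  assumes "kalpha_rel s n K A r t y"
  shows "kbeta_rel s n K A Q e r y \<one>\<^bsub>grp (homology HQ 1) r\<^esub>"
proof -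
  obtain z where z: "z \<in> el (pten s Zn A) r" "y = hcls KA n r (pten_map s Kn A I I r z)"
    using assms by (rule kalphaE)
  obtain z' where z': "z' \<in> el (pten s Zn Q0) r" "pten_map s Zn A I e r z' = z"
    using pten_map_surj[OF Z_mod Q_mod Z_mod A I e_hom I_surj e_surj z(1)] by blast
  have c: "pten_map s Kn Q0 I I r z' \<in> el (pten s Kn Q0) r"
    by (rule pten_map_closed[OF Z_mod Q_mod K_mod Q_mod \<iota> I z'(1)])
  show ?thesis
  proof (rule kbetaI[OF c one_closed[OF Z_mod Q_mod]])
    show "y = hcls KA n r (pten_map s Kn A I e r (pten_map s Kn Q0 I I r z'))"
      unfolding z(2) \<iota>_e[OF z'(1)] z'(2) ..
    have "pten_map s Zp Q0 (dif K n) I r (pten_map s Kn Q0 I I r z') = \<one>\<^bsub>grp (pten s Zp Q0) r\<^esub>"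
      using pten_map_comp[OF Z_mod Q_mod K_mod Q_mod Z_mod Q_mod \<iota> I \<delta> I pmod_hom_comp[OF \<iota> \<delta>] I refl refl z'(1)]
        pten_map_trivial_left[OF Z_mod Q_mod Z_mod Q_mod pmod_hom_comp[OF \<iota> \<delta>] I \<delta>_\<iota> z'(1)] by simp
    then show "pten_map s Zp Q0 (dif K n) I r (pten_map s Kn Q0 I I r z') =
        pten_map s Zp Q0 I (dif Q 1) r \<one>\<^bsub>grp (pten s Zp Q1) r\<^esub>"
      using hom_one[OF pten_map_hom(1)[OF Z_mod Q_mod Z_mod Q_mod I d1] pten_group[OF Z_mod Q_mod] pten_group[OF Z_mod Q_mod]]
      by simp
    have 1: "\<one>\<^bsub>grp (pten s Hp Q1) r\<^esub> \<in> boundaries HQ 1 r"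
      using subgroup.one_closed[OF boundaries_subgroup[OF HQ]] by (simp add: pten_complex_simps)
    show "\<one>\<^bsub>grp (homology HQ 1) r\<^esub> = hcls HQ 1 r (pten_map s Hp Q1 (hcls K (n - 1)) I r \<one>\<^bsub>grp (pten s Zp Q1) r\<^esub>)"
      unfolding hom_one[OF pten_map_hom(1)[OF Z_mod Q_mod H_mod Q_mod \<pi> I] pten_group[OF Z_mod Q_mod] pten_group[OF H_mod Q_mod]]
      by (rule iffD2[OF hcls_one_iff[OF HQ subsetD[OF boundaries_cycles[OF HQ] 1]] 1, symmetric])
  qed
qed

lemma kbeta_smap:
  assumes "kbeta_rel s n K A Q e r y T" "r \<le> r'"
  shows "kbeta_rel s n K A Q e r' (smap (homology KA n) r r' y) (smap (homology HQ 1) r r' T)"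
  using assms(1)
proof (rule kbetaE)
  fix c w
  assume c: "c \<in> el (pten s Kn Q0) r" and w: "w \<in> el (pten s Zp Q1) r"
    and y: "y = hcls KA n r (pten_map s Kn A I e r c)"
    and eq: "pten_map s Zp Q0 (dif K n) I r c = pten_map s Zp Q0 I (dif Q 1) r w"
    and T: "T = hcls HQ 1 r (pten_map s Hp Q1 (hcls K (n - 1)) I r w)"
  note cyc = kbeta_cycles[OF c w eq]
  show ?thesis
  proof (rule kbetaI[OF hom_in_carrier[OF pten_smap_hom(1)[OF K_mod Q_mod assms(2)] c]
        hom_in_carrier[OF pten_smap_hom(1)[OF Z_mod Q_mod assms(2)] w]])
    show "smap (homology KA n) r r' y = hcls KA n r' (pten_map s Kn A I e r' (smap (pten s Kn Q0) r r' c))"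
      unfolding y homology_smap[OF KA assms(2) cyc(1)]
      unfolding complex_pten_simps
        pers_hom_smap[OF pten_map_pers_hom[OF K_mod Q_mod K_mod A I e_hom] assms(2) c] ..
    show "smap (homology HQ 1) r r' T = hcls HQ 1 r' (pten_map s Hp Q1 (hcls K (n - 1)) I r' (smap (pten s Zp Q1) r r' w))"
      unfolding T homology_smap[OF HQ assms(2) cyc(2)]
      unfolding pten_complex_simps
        pers_hom_smap[OF pten_map_pers_hom[OF Z_mod Q_mod H_mod Q_mod \<pi> I] assms(2) w] ..
    show "pten_map s Zp Q0 (dif K n) I r' (smap (pten s Kn Q0) r r' c) =
        pten_map s Zp Q0 I (dif Q 1) r' (smap (pten s Zp Q1) r r' w)"
      unfolding pers_hom_smap[OF pten_map_pers_hom[OF K_mod Q_mod Z_mod Q_mod \<delta> I] assms(2) c] eq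
        pers_hom_smap[OF pten_map_pers_hom[OF Z_mod Q_mod Z_mod Q_mod I d1] assms(2) w] ..
  qed
qed

section \<open>The two maps as functions, and exactness\<close>

definition "kalpha r t = (THE C. kalpha_rel s n K A r t C)"
definition "kbeta r y = (THE T. kbeta_rel s n K A Q e r y T)"

lemma kalpha_fun:
  "kalpha r \<in> hom (grp (pten s Hn A) r) (grp (homology KA n) r)"
  "kalpha_rel s n K A r t C \<Longrightarrow> kalpha r t = C"
  "t \<in> el (pten s Hn A) r \<Longrightarrow> kalpha_rel s n K A r t (kalpha r t)"
  using additive_relation[of "grp (pten s Hn A) r" "grp (homology KA n) r" "kalpha_rel s n K A r",
      OF pten_group[OF H_mod A] comm_group_group[OF homology_comm_group[OF KA]] kalpha_dom kalpha_total kalpha_mult kalpha_unit]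
  unfolding kalpha_def[abs_def] by blast+

lemma kbeta_fun:
  "kbeta r \<in> hom (grp (homology KA n) r) (grp (homology HQ 1) r)"
  "kbeta_rel s n K A Q e r y T \<Longrightarrow> kbeta r y = T"
  "y \<in> el (homology KA n) r \<Longrightarrow> kbeta_rel s n K A Q e r y (kbeta r y)"
  using additive_relation[of "grp (homology KA n) r" "grp (homology HQ 1) r" "kbeta_rel s n K A Q e r",
      OF comm_group_group[OF homology_comm_group[OF KA]] comm_group_group[OF homology_comm_group[OF HQ]]
        kbeta_dom kbeta_total kbeta_mult kbeta_unit]
  unfolding kbeta_def[abs_def] by blast+

theorem kunneth_short_exact: "short_exact (pten s Hn A) (homology KA n) (homology HQ 1) kalpha kbeta"
  unfolding short_exact_def pers_hom_def
proof (intro conjI allI impI ballI)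
  show "kalpha a \<in> hom (grp (pten s Hn A) a) (grp (homology KA n) a)" for a by (rule kalpha_fun(1))
  show "kbeta a \<in> hom (grp (homology KA n) a) (grp (homology HQ 1) a)" for a by (rule kbeta_fun(1))
  show "kalpha b (smap (pten s Hn A) a b t) = smap (homology KA n) a b (kalpha a t)"
    if "a \<le> b" "t \<in> el (pten s Hn A) a" for a b t
    by (rule kalpha_fun(2)[OF kalpha_smap[OF kalpha_fun(3)[OF that(2)] that(1)]])
  show "kbeta b (smap (homology KA n) a b y) = smap (homology HQ 1) a b (kbeta a y)"
    if "a \<le> b" "y \<in> el (homology KA n) a" for a b y
    by (rule kbeta_fun(2)[OF kbeta_smap[OF kbeta_fun(3)[OF that(2)] that(1)]])
  show "inj_on (kalpha a) (el (pten s Hn A) a)" for a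
    by (rule inj_on_kernel[OF kalpha_fun(1) pten_group[OF H_mod A] comm_group_group[OF homology_comm_group[OF KA]]])
      (use kalpha_fun(3) kalpha_injective in metis)
  show "kernel (grp (homology KA n) a) (grp (homology HQ 1) a) (kbeta a) = kalpha a ` el (pten s Hn A) a" for a
  proof (intro equalityI subsetI)
    fix y assume "y \<in> kernel (grp (homology KA n) a) (grp (homology HQ 1) a) (kbeta a)"
    then have "y \<in> el (homology KA n) a" "kbeta a y = \<one>\<^bsub>grp (homology HQ 1) a\<^esub>" by (simp_all add: kernel_def)
    then obtain t where t: "kalpha_rel s n K A a t y" using kbeta_kernel kbeta_fun(3) by metis
    then show "y \<in> kalpha a ` el (pten s Hn A) a" using kalpha_fun(2)[OF t] kalpha_dom[OF t] by blast
  next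
    fix y assume "y \<in> kalpha a ` el (pten s Hn A) a"
    then have "\<exists>t. kalpha_rel s n K A a t y" using kalpha_fun(3) by blast
    then show "y \<in> kernel (grp (homology KA n) a) (grp (homology HQ 1) a) (kbeta a)"
      using kbeta_fun(2)[OF kbeta_kalpha] kalpha_dom by (auto simp: kernel_def)
  qed
  show "pers_surj (homology KA n) (homology HQ 1) kbeta"
    unfolding pers_surj_def
  proof (intro allI equalityI subsetI)
    fix a T assume "T \<in> el (homology HQ 1) a"
    then obtain y where y: "kbeta_rel s n K A Q e a y T" using kbeta_surj by blast
    then show "T \<in> kbeta a ` el (homology KA n) a" using kbeta_fun(2)[OF y] kbeta_dom[OF y] by blast
  qed (use hom_in_carrier[OF kbeta_fun(1)] in blast)
qed

end

section \<open>Naturality\<close>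

text \<open>The lifts \<open>z\<close>, \<open>c\<close> and \<open>w\<close> are pushed forward
  along \<open>f\<close>, \<open>g\<close> and \<open>\<phi>\<close>, and each condition in the
  relations becomes a commuting square. Any chain map \<open>\<phi>\<close> over \<open>g\<close>
  qualifies, in particular the one selected by \<open>resolution_lift\<close>.\<close>

lemma kunneth_natural_maps:
  assumes k: "kunneth s K A Q e" and k': "kunneth s K' A' Q' e'"
    and f: "chain_map K K' f" and g: "pmod_hom A A' g" and \<phi>: "chain_map Q Q' \<phi>"
    and \<phi>0: "\<And>a x. x \<in> el (obj Q 0) a \<Longrightarrow> e' a (\<phi> 0 a x) = g a (e a x)"
  shows "kalpha_rel s n K A r t C \<Longrightarrow>
      kalpha_rel s n K' A' r (pten_map s (homology_pmod K' n) A' (homology_map K' n f) g r t)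
        (homology_map (complex_pten s K' A') n (\<lambda>m. pten_map s (obj K' m) A' (f m) g) r C)"
    and "kbeta_rel s n K A Q e r y T \<Longrightarrow>
      kbeta_rel s n K' A' Q' e' r (homology_map (complex_pten s K' A') n (\<lambda>m. pten_map s (obj K' m) A' (f m) g) r y)
        (homology_map (pten_complex s (homology_pmod K' (n - 1)) Q') 1
          (\<lambda>m. pten_map s (homology_pmod K' (n - 1)) (obj Q' m) (homology_map K' (n - 1) f) (\<phi> m)) r T)"
proof -
  interpret k: kunneth s n K A Q e by (rule k)
  interpret k': kunneth s n K' A' Q' e' by (rule k')
  note fh = chain_map_pmod_hom[OF k.K k'.K f] and fz = chain_map_cycle_hom[OF k.K k'.K f]
    and fH = homology_map_pmod_hom[OF k.K k'.K f] and \<phi>h = chain_map_pmod_hom[OF k.Qc k'.Qc \<phi>]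
  have fcls: "homology_map K' m f a (hcls K m a x) = hcls K' m a (f m a x)" if "x \<in> el (cycle_pmod K m) a" for m a x
    using that chain_map_hcls[OF k.K k'.K f] by (simp add: el_cycle)
  have f\<delta>: "dif K' n a (f n a x) = f (n - 1) a (dif K n a x)" if "x \<in> el k.Kn a" for a x
    using chain_map_comm[OF k.K k'.K f that] by simp
  have \<phi>1: "dif Q' 1 a (\<phi> 1 a x) = \<phi> 0 a (dif Q 1 a x)" if "x \<in> el k.Q1 a" for a x
    using chain_map_comm[OF k.Qc k'.Qc \<phi> that] by simp
  note KAmap = homology_map_hcls[OF k.KA k'.KA complex_pten_chain_map[OF k.K k'.K k.A k'.A f g]]
  note HQmap = homology_map_hcls[OF k.HQ k'.HQ pten_complex_chain_map[OF k.H_mod k'.H_mod k.Qc k'.Qc fH \<phi>]]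
  show "kalpha_rel s n K' A' r (pten_map s (homology_pmod K' n) A' (homology_map K' n f) g r t)
        (homology_map (complex_pten s K' A') n (\<lambda>m. pten_map s (obj K' m) A' (f m) g) r C)"
    if "kalpha_rel s n K A r t C"
    using that
  proof (rule k.kalphaE)
    fix z assume z: "z \<in> el (pten s k.Zn A) r" and t: "t = pten_map s k.Hn A (hcls K n) k.I r z"
      and C: "C = hcls k.KA n r (pten_map s k.Kn A k.I k.I r z)"
    let ?z = "pten_map s k'.Zn A' (f n) g r z"
    have z': "?z \<in> el (pten s k'.Zn A') r" by (rule pten_map_closed[OF k.Z_mod k.A k'.Z_mod k'.A fz g z])
    have "pten_map s k'.Hn A' (homology_map K' n f) g r t = pten_map s k'.Hn A' (hcls K' n) k'.I r ?z"
      unfolding t by (rule pten_map_square[OF k.Z_mod k.A k.H_mod k.A k'.Z_mod k'.A k'.H_mod k'.A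
          k.\<pi> k.I fz g fH g k'.\<pi> k'.I fcls refl z])
    moreover have "pten_map s k'.Kn A' (f n) g r (pten_map s k.Kn A k.I k.I r z) = pten_map s k'.Kn A' k'.I k'.I r ?z"
      by (rule pten_map_square[OF k.Z_mod k.A k.K_mod k.A k'.Z_mod k'.A k'.K_mod k'.A
          k.\<iota> k.I fz g fh g k'.\<iota> k'.I refl refl z])
    ultimately show ?thesis
      using k'.kalphaI[OF z'] unfolding C KAmap[OF k.\<iota>_closed[OF z]] by simp
  qed
  show "kbeta_rel s n K' A' Q' e' r (homology_map (complex_pten s K' A') n (\<lambda>m. pten_map s (obj K' m) A' (f m) g) r y)
        (homology_map (pten_complex s (homology_pmod K' (n - 1)) Q') 1
          (\<lambda>m. pten_map s (homology_pmod K' (n - 1)) (obj Q' m) (homology_map K' (n - 1) f) (\<phi> m)) r T)"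
    if "kbeta_rel s n K A Q e r y T"
    using that
  proof (rule k.kbetaE)
    fix c w
    assume c: "c \<in> el (pten s k.Kn k.Q0) r" and w: "w \<in> el (pten s k.Zp k.Q1) r"
      and y: "y = hcls k.KA n r (pten_map s k.Kn A k.I e r c)"
      and eq: "pten_map s k.Zp k.Q0 (dif K n) k.I r c = pten_map s k.Zp k.Q0 k.I (dif Q 1) r w"
      and T: "T = hcls k.HQ 1 r (pten_map s k.Hp k.Q1 (hcls K (n - 1)) k.I r w)"
    note cyc = k.kbeta_cycles[OF c w eq]
    let ?c = "pten_map s k'.Kn k'.Q0 (f n) (\<phi> 0) r c" and ?w = "pten_map s k'.Zp k'.Q1 (f (n - 1)) (\<phi> 1) r w"
    show ?thesis
    proof (rule k'.kbetaI)
      show "?c \<in> el (pten s k'.Kn k'.Q0) r" by (rule pten_map_closed[OF k.K_mod k.Q_mod k'.K_mod k'.Q_mod fh \<phi>h c])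
      show "?w \<in> el (pten s k'.Zp k'.Q1) r" by (rule pten_map_closed[OF k.Z_mod k.Q_mod k'.Z_mod k'.Q_mod fz \<phi>h w])
      have "pten_map s k'.Kn A' (f n) g r (pten_map s k.Kn A k.I e r c) = pten_map s k'.Kn A' k'.I e' r ?c"
        by (rule pten_map_square[OF k.K_mod k.Q_mod k.K_mod k.A k'.K_mod k'.Q_mod k'.K_mod k'.A
            k.I k.e_hom fh \<phi>h fh g k'.I k'.e_hom refl \<phi>0[symmetric] c])
      then show "homology_map (complex_pten s K' A') n (\<lambda>m. pten_map s (obj K' m) A' (f m) g) r y =
          hcls k'.KA n r (pten_map s k'.Kn A' k'.I e' r ?c)"
        unfolding y KAmap[OF cyc(1)] by simp
      have "pten_map s k'.Zp k'.Q0 (dif K' n) k'.I r ?c =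
          pten_map s k'.Zp k'.Q0 (f (n - 1)) (\<phi> 0) r (pten_map s k.Zp k.Q0 (dif K n) k.I r c)"
        by (rule pten_map_square[OF k.K_mod k.Q_mod k'.K_mod k'.Q_mod k.Z_mod k.Q_mod k'.Z_mod k'.Q_mod
            fh \<phi>h k.\<delta> k.I k'.\<delta> k'.I fz \<phi>h f\<delta> refl c])
      also have "\<dots> = pten_map s k'.Zp k'.Q0 k'.I (dif Q' 1) r ?w"
        unfolding eq
        by (rule pten_map_square[OF k.Z_mod k.Q_mod k.Z_mod k.Q_mod k'.Z_mod k'.Q_mod k'.Z_mod k'.Q_mod
            k.I k.d1 fz \<phi>h fz \<phi>h k'.I k'.d1 refl \<phi>1[symmetric] w])
      finally show "pten_map s k'.Zp k'.Q0 (dif K' n) k'.I r ?c = pten_map s k'.Zp k'.Q0 k'.I (dif Q' 1) r ?w" .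
      have "pten_map s k'.Hp k'.Q1 (homology_map K' (n - 1) f) (\<phi> 1) r (pten_map s k.Hp k.Q1 (hcls K (n - 1)) k.I r w) =
          pten_map s k'.Hp k'.Q1 (hcls K' (n - 1)) k'.I r ?w"
        by (rule pten_map_square[OF k.Z_mod k.Q_mod k.H_mod k.Q_mod k'.Z_mod k'.Q_mod k'.H_mod k'.Q_mod
            k.\<pi> k.I fz \<phi>h fH \<phi>h k'.\<pi> k'.I fcls refl w])
      then show "homology_map (pten_complex s (homology_pmod K' (n - 1)) Q') 1
          (\<lambda>m. pten_map s (homology_pmod K' (n - 1)) (obj Q' m) (homology_map K' (n - 1) f) (\<phi> m)) r T =
          hcls k'.HQ 1 r (pten_map s k'.Hp k'.Q1 (hcls K' (n - 1)) k'.I r ?w)"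
        unfolding T HQmap[OF cyc(2)] by simp
    qed
  qed
qed

section \<open>Flat complexes\<close>

lemma kunneth_of_flat:
  fixes u :: "'u itself" and K :: "('p::preordered_ab_group_add, 'k, 'r::{ring, monoid_mult}) pmod_complex"
    and A :: "('p, 'a, 'r) pmod" and Q :: "('p, 'u, 'r) pmod_complex"
    and ia :: "'a \<Rightarrow> 'u" and enc :: "('p \<times> 'u \<Rightarrow>\<^sub>0 'r) \<Rightarrow> 'u"
  assumes K: "K \<in> flat_complexes u s" and A: "lmod A" and res: "projective_resolution Q e A"
    and ia: "inj ia" and enc: "inj enc"
  shows "kunneth s K A Q e"
proof -
  have Kc: "is_pmod_complex Right K" and flK: "flat u s (obj K m)" and flB: "flat u s (boundary_pmod K m)" for m
    using K by (simp_all add: flat_complexes_def)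
  \<comment> \<open>The degree 0 is arbitrary; the facts taken from the locale below concern the
    resolution or hold for every degree \<open>m\<close>.\<close>
  interpret kunneth_setup s 0 K A Q e by (rule kunneth_setup.intro) (fact Kc A res)+
  have P: "projective TYPE('u) Left (obj Q m)" for m
    using res by (simp add: projective_resolution_def)
  note db = projective_dual_basis[OF P inj_on_id enc]
  have incl_inj: "inj_on ((\<lambda>_ x. x) a) X" for a :: 'p and X :: "'k set" by simp
  have B_mod: "rmod (boundary_pmod K m)" for m by (rule boundary_module[OF K])
  have Z_ker: "y \<in> I a ` el (cycle_pmod K m) a" if "y \<in> el (obj K m) a" "dif K m a y = \<one>\<^bsub>grp (boundary_pmod K (m - 1)) a\<^esub>" for y a m
    using that by (simp add: el_cycle cycles_iff[OF pmod_complex_pers[OF Kc]] boundary_pmod_def restrict_simps)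
  have d_Z: "dif K m a x = \<one>\<^bsub>grp (boundary_pmod K (m - 1)) a\<^esub>" if "x \<in> el (cycle_pmod K m) a" for x a m
    using that by (simp add: el_cycle cycles_iff[OF pmod_complex_pers[OF Kc]] boundary_pmod_def restrict_simps)
  \<comment> \<open>Applied twice: to \<open>A\<close> with its cover \<open>Q0\<close>, and to the
    first syzygy \<open>?O\<close> with its cover \<open>Q1\<close>. The flat cokernel of the
    inclusion of cycles is the module of boundaries one degree lower.\<close>
  have inj: "t = \<one>\<^bsub>grp (pten s (cycle_pmod K m) X) r\<^esub>"
    if db: "dual_basis Left F d' e' \<phi>" and X: "lmod X" and i: "inj i" and q: "pmod_hom F X q" "pers_surj F X q"
      and t: "t \<in> el (pten s (cycle_pmod K m) X) r"
        "pten_map s (obj K m) X I I r t = \<one>\<^bsub>grp (pten s (obj K m) X) r\<^esub>"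
    for F :: "('p, 'u, 'r) pmod" and d' :: "'p \<times> 'u \<Rightarrow> 'p" and e' \<phi> and X :: "('p, 'x, 'r) pmod" and i :: "'x \<Rightarrow> 'u" and q t m r
    by (rule pten_inj_flat_cokernel[OF Z_mod K_mod B_mod \<iota> dif_boundary[OF Kc] incl_inj dif_boundary_surj[OF Kc]
        Z_ker d_Z flB db X i q t])
  let ?O = "ker_pmod Q0 A e"
  note S = kernel_subpmodule[OF e_hom Q_mod A]
  note O = restrict_pmod_module[OF Q_mod S] and inc = restrict_incl[OF S]
  have q1: "pmod_hom Q1 ?O (dif Q 1)"
    by (rule restrict_into[OF d1]) (simp add: kernel_def e_d1 pmod_hom_closed[OF d1])
  have q1_surj: "pers_surj Q1 ?O (dif Q 1)"
    unfolding pers_surj_def using e_exact e_d1 pmod_hom_closed[OF d1]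
    by (auto simp: restrict_simps kernel_def)
  have d2_exact: "y \<in> dif Q 2 a ` el Q2 a" if "y \<in> el Q1 a" "dif Q 1 a y = \<one>\<^bsub>grp ?O a\<^esub>" for y a
  proof -
    have "y \<in> cycles Q 1 a" using that by (simp add: cycles_def kernel_def restrict_simps)
    also have "cycles Q 1 a = boundaries Q 1 a" using res by (simp add: projective_resolution_def)
    finally show ?thesis by (simp add: boundaries_def)
  qed
  show ?thesis
  proof (intro kunneth.intro kunneth_axioms.intro)
    show "kunneth_setup K A Q e" by (rule kunneth_setup.intro) (fact Kc A res)+
    obtain d0 e0 \<phi>0 where db0: "dual_basis Left Q0 (d0 :: 'p \<times> 'u \<Rightarrow> 'p) e0 \<phi>0" using db[of 0] by blast
    obtain d1' e1 \<phi>1 where db1: "dual_basis Left Q1 (d1' :: 'p \<times> 'u \<Rightarrow> 'p) e1 \<phi>1" using db[of 1] by blast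
    show "t = \<one>\<^bsub>grp (pten s (cycle_pmod K m) A) r\<^esub>"
      if "t \<in> el (pten s (cycle_pmod K m) A) r" "pten_map s (obj K m) A I I r t = \<one>\<^bsub>grp (pten s (obj K m) A) r\<^esub>" for m r t
      by (rule inj[OF db0 A ia e_hom e_surj that])
    show "\<exists>v\<in>el (pten s (cycle_pmod K m) Q0) r. pten_map s (obj K m) Q0 I I r v = t"
      if "t \<in> el (pten s (obj K m) Q0) r" "pten_map s (cycle_pmod K (m - 1)) Q0 (dif K m) I r t = \<one>\<^bsub>grp (pten s (cycle_pmod K (m - 1)) Q0) r\<^esub>" for m r t
      by (rule dual_basis_exact_second[OF db0 Z_mod K_mod Z_mod \<iota> dif_cycle[OF Kc] _ that])
        (simp add: el_cycle cycles_iff[OF pmod_complex_pers[OF Kc]] cycle_pmod_def restrict_simps)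
    show "\<exists>v\<in>el (pten s (cycle_pmod K m) Q2) r. pten_map s (cycle_pmod K m) Q1 I (dif Q 2) r v = t"
      if t: "t \<in> el (pten s (cycle_pmod K m) Q1) r"
        and 1: "pten_map s (cycle_pmod K m) Q0 I (dif Q 1) r t = \<one>\<^bsub>grp (pten s (cycle_pmod K m) Q0) r\<^esub>" for m r t
    proof -
      \<comment> \<open>\<open>Q1 \<rightarrow> Q0\<close> factors through the syzygy
        \<open>?O\<close>. The image of \<open>t\<close> in \<open>K \<otimes> ?O\<close> dies in
        \<open>K \<otimes> Q0\<close>, hence is trivial because \<open>K\<close> is flat; then
        \<open>inj\<close> makes it trivial in \<open>Z \<otimes> ?O\<close>, and right exactness
        along \<open>Q2 \<rightarrow> Q1 \<rightarrow> ?O\<close> lifts \<open>t\<close>.\<close>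
      let ?Z = "cycle_pmod K m" and ?K = "obj K m"
      let ?t = "pten_map s ?Z ?O I (dif Q 1) r t"
      have t': "?t \<in> el (pten s ?Z ?O) r" by (rule pten_map_closed[OF Z_mod Q_mod Z_mod O pmod_hom_id q1 t])
      let ?v = "pten_map s ?K ?O I I r ?t"
      have v: "?v \<in> el (pten s ?K ?O) r" by (rule pten_map_closed[OF Z_mod O K_mod O \<iota> pmod_hom_id t'])
      have "pten_map s ?Z Q0 I I r ?t = pten_map s ?Z Q0 I (dif Q 1) r t"
        by (rule pten_map_comp[OF Z_mod Q_mod Z_mod O Z_mod Q_mod pmod_hom_id q1 pmod_hom_id inc pmod_hom_id d1 refl refl t])
      moreover have "pten_map s ?K Q0 I I r ?v = pten_map s ?K Q0 I I r (pten_map s ?Z Q0 I I r ?t)"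
        by (rule pten_map_square[OF Z_mod O K_mod O Z_mod Q_mod K_mod Q_mod \<iota> pmod_hom_id pmod_hom_id inc pmod_hom_id inc \<iota> pmod_hom_id refl refl t'])
      ultimately have "pten_map s ?K Q0 I I r ?v = \<one>\<^bsub>grp (pten s ?K Q0) r\<^esub>"
        using 1 hom_one[OF pten_map_hom(1)[OF Z_mod Q_mod K_mod Q_mod \<iota> pmod_hom_id] pten_group[OF Z_mod Q_mod] pten_group[OF K_mod Q_mod]]
        by simp
      from flat_kernel_inj[OF flK K_mod Q_mod A ia e_hom e_surj v this]
      have "?v = \<one>\<^bsub>grp (pten s ?K ?O) r\<^esub>" .
      from inj[OF db1 O inj_on_id q1 q1_surj t' this]
      have "?t = \<one>\<^bsub>grp (pten s ?Z ?O) r\<^esub>" .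
      from pten_exact_second[OF Z_mod Q_mod Q_mod O d2 q1 q1_surj d2_exact t this]
      show ?thesis .
    qed
  qed
qed

section \<open>Projective complexes\<close>

lemma projective_flat:
  fixes u :: "'u itself" and M :: "('p::preordered_ab_group_add, 'k, 'r::{ring, monoid_mult}) pmod"
    and i :: "'k \<Rightarrow> 'u" and enc :: "('p \<times> 'u \<Rightarrow>\<^sub>0 'r) \<Rightarrow> 'u"
  assumes "projective u Right M" "inj i" "inj enc"
  shows "flat u s M"
  using projective_dual_basis[OF assms] dual_basis_flat by blast

text \<open>Heredity speaks of modules over \<open>'u\<close>, so the term of the complex is copied
  there, the boundaries become a submodule of the copy, and projectivity returns along the
  isomorphism.\<close>

lemma boundary_projective:
  fixes u :: "'u itself" and K :: "('p::preordered_ab_group_add, 'k, 'r::{ring, monoid_mult}) pmod_complex"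
    and i :: "'k \<Rightarrow> 'u"
  assumes her: "right_hereditary u TYPE('p) TYPE('r)" and K: "K \<in> projective_complexes u" and i: "inj i"
  shows "projective u Right (boundary_pmod K n)"
proof -
  have Kc: "is_pmod_complex Right K" and P: "projective u Right (obj K n)"
    using K by (simp_all add: projective_complexes_def)
  note K_mod = obj_module[OF Kc]
  let ?M = "transport i (obj K n)"
  note M = transport_module[OF i K_mod]
  have PM: "projective u Right ?M"
    by (rule projective_retract[OF P M transport_from[OF i K_mod] transport_to[OF i K_mod]])
      (auto simp: transport_simps[OF i K_mod] i)
  have d: "pmod_hom (obj K (n + 1)) ?M (\<lambda>a x. i (dif K (n + 1) a x))"
    by (rule pmod_hom_comp[OF dif_pmod_hom'[OF Kc] transport_to[OF i K_mod]])
  note S = image_subpmodule[OF d K_mod M]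
  let ?N = "restrict_pmod ?M (\<lambda>a. (\<lambda>x. i (dif K (n + 1) a x)) ` el (obj K (n + 1)) a)"
  have PN: "projective u Right ?N" using her PM S unfolding right_hereditary_def by blast
  show ?thesis
  proof (rule projective_retract[OF PN boundary_module[OF Kc]])
    show "pmod_hom (boundary_pmod K n) ?N (\<lambda>_. i)"
      unfolding boundary_pmod_def
      by (rule restrict_into[OF restrict_from[OF transport_to[OF i K_mod] boundaries_subpmodule[OF Kc]]])
        (auto simp: restrict_simps boundaries_def)
    show "pmod_hom ?N (boundary_pmod K n) (\<lambda>_. inv_into UNIV i)"
      unfolding boundary_pmod_def
      by (rule restrict_into[OF restrict_from[OF transport_from[OF i K_mod] S]])
        (auto simp: restrict_simps boundaries_def i)
  qed (simp add: i)
qed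

text \<open>Makes the sequence of flat complexes available for projective ones, so that the
  splitting concerns the same two maps.\<close>

lemma projective_complexes_flat:
  fixes u :: "'u itself" and i :: "'k \<Rightarrow> 'u" and enc :: "('p::preordered_ab_group_add \<times> 'u \<Rightarrow>\<^sub>0 'r::{ring, monoid_mult}) \<Rightarrow> 'u"
  assumes her: "right_hereditary u TYPE('p) TYPE('r)" and i: "inj i" and enc: "inj enc"
  shows "(projective_complexes u :: ('p, 'k, 'r) pmod_complex set) \<subseteq> flat_complexes u s"
proof
  fix K :: "('p, 'k, 'r) pmod_complex" assume K: "K \<in> projective_complexes u"
  then show "K \<in> flat_complexes u s"
    using projective_flat[OF boundary_projective[OF her K i] i enc] projective_flat[OF _ i enc]
    by (simp add: flat_complexes_def projective_complexes_def)
qed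

lemma pmod_hom_diff:
  assumes M: "persistence_module sd M" and N: "persistence_module sd N"
    and f: "pmod_hom M N f" and g: "pmod_hom M N g"
  shows "pmod_hom M N (\<lambda>a x. f a x \<otimes>\<^bsub>grp N a\<^esub> inv\<^bsub>grp N a\<^esub> g a x)"
proof (rule pmod_homI)
  note N_grp = pmod_group[OF N] and c = pmod_hom_closed[OF f] pmod_hom_closed[OF g]
  show "(\<lambda>x. f a x \<otimes>\<^bsub>grp N a\<^esub> inv\<^bsub>grp N a\<^esub> g a x) \<in> hom (grp M a) (grp N a)" for a
  proof -
    interpret Na: comm_group "grp N a" using N by (rule pmod_comm_group)
    show ?thesis
      by (rule homI) (simp_all add: c hom_mult[OF pmod_hom_hom[OF f]] hom_mult[OF pmod_hom_hom[OF g]]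
        Na.inv_mult Na.m_ac)
  qed
  show "f b (smap M a b x) \<otimes>\<^bsub>grp N b\<^esub> inv\<^bsub>grp N b\<^esub> g b (smap M a b x) =
      smap N a b (f a x \<otimes>\<^bsub>grp N a\<^esub> inv\<^bsub>grp N a\<^esub> g a x)" if ab: "a \<le> b" and x: "x \<in> el M a" for a b x
    using x c[OF x] group.inv_closed[OF N_grp c(2)[OF x]]
    by (simp add: pmod_hom_smap[OF f ab] pmod_hom_smap[OF g ab] hom_mult[OF pmod_smap_hom[OF N ab]]
      hom_inverse[OF pmod_smap_hom[OF N ab] N_grp N_grp])
  show "f a (act M a r x) \<otimes>\<^bsub>grp N a\<^esub> inv\<^bsub>grp N a\<^esub> g a (act M a r x) =
      act N a r (f a x \<otimes>\<^bsub>grp N a\<^esub> inv\<^bsub>grp N a\<^esub> g a x)" if x: "x \<in> el M a" for a r x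
    using x c[OF x] group.inv_closed[OF N_grp c(2)[OF x]]
    by (simp add: pmod_hom_act[OF f] pmod_hom_act[OF g] hom_mult[OF pmod_act_hom[OF N]]
      hom_inverse[OF pmod_act_hom[OF N] N_grp N_grp])
qed

text \<open>A section of \<open>K\<^sub>n \<rightarrow> B\<^sub>n\<^sub>-\<^sub>1\<close> gives \<open>K\<^sub>n \<rightarrow> Z\<^sub>n \<rightarrow> H\<^sub>n\<close>, a chain map from \<open>K\<close> to its homology
  with zero differential; it induces a left inverse of \<open>kalpha\<close>.\<close>

lemma (in kunneth) retraction_exists:
  fixes v :: "'v itself" and i :: "'k \<Rightarrow> 'v"
  assumes P: "projective v Right (boundary_pmod K (n - 1))" and i: "inj i"
  shows "\<exists>\<rho>. pmod_hom Kn Hn \<rho> \<and> (\<forall>a. \<forall>x\<in>el Zn a. \<rho> a x = hcls K n a x)"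
proof -
  let ?B = "boundary_pmod K (n - 1)"
  note B = boundary_module[OF K, of "n - 1"]
  obtain \<sigma> where \<sigma>: "pmod_hom ?B Kn \<sigma>" "\<And>a x. x \<in> el ?B a \<Longrightarrow> dif K n a (\<sigma> a x) = x"
    using projective_lift[OF P i i K_mod B dif_boundary[OF K] pmod_hom_id] by (auto simp: el_boundary boundaries_def)
  have \<sigma>d: "pmod_hom Kn Kn (\<lambda>a x. \<sigma> a (dif K n a x))" by (rule pmod_hom_comp[OF dif_boundary[OF K] \<sigma>(1)])
  \<comment> \<open>Subtracting the section of the differential projects \<open>Kn\<close> onto the
    cycles: the difference has trivial differential, and a cycle is left unchanged.\<close>
  define \<kappa> where "\<kappa> a x = x \<otimes>\<^bsub>grp Kn a\<^esub> inv\<^bsub>grp Kn a\<^esub> \<sigma> a (dif K n a x)" for a x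
  have \<kappa>: "pmod_hom Kn Kn \<kappa>"
    unfolding \<kappa>_def[abs_def] by (rule pmod_hom_diff[OF K_mod K_mod pmod_hom_id \<sigma>d])
  have "\<kappa> a x \<in> cycles K n a" if x: "x \<in> el Kn a" for a x
  proof -
    interpret k: group "grp Kn a" by (rule pmod_group[OF K_mod])
    interpret k': group "grp (obj K (n - 1)) a" by (rule pmod_group[OF K_mod])
    have dx: "dif K n a x \<in> el ?B a" by (rule pmod_hom_closed[OF dif_boundary[OF K] x])
    have s: "\<sigma> a (dif K n a x) \<in> el Kn a" by (rule pmod_hom_closed[OF \<sigma>(1) dx])
    have "dif K n a (\<kappa> a x) = \<one>\<^bsub>grp (obj K (n - 1)) a\<^esub>"
      unfolding \<kappa>_def using x s \<sigma>(2)[OF dx] pmod_hom_closed[OF d x]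
      by (simp add: hom_mult[OF pmod_hom_hom[OF d]] hom_inverse[OF pmod_hom_hom[OF d] k.group_axioms k'.group_axioms])
    then show ?thesis using pmod_hom_closed[OF \<kappa> x] by (simp add: cycles_iff[OF pmod_complex_pers[OF K]])
  qed
  then have \<kappa>Z: "pmod_hom Kn Zn \<kappa>" unfolding cycle_pmod_def by (rule restrict_into[OF \<kappa>])
  have "\<kappa> a x = x" if x: "x \<in> el Zn a" for a x
  proof -
    interpret k: group "grp Kn a" by (rule pmod_group[OF K_mod])
    have "dif K n a x = \<one>\<^bsub>grp ?B a\<^esub>" using d_\<iota>[OF x] by (simp add: boundary_pmod_def restrict_simps)
    then show ?thesis
      using pmod_hom_closed[OF \<iota> x] pmod_hom_one[OF \<sigma>(1) B K_mod] by (simp add: \<kappa>_def)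
  qed
  then show ?thesis
    using pmod_hom_comp[OF \<kappa>Z \<pi>] by (intro exI[of _ "\<lambda>a x. hcls K n a (\<kappa> a x)"]) simp
qed

text \<open>Tensoring \<open>\<rho>\<close> with \<open>A\<close> gives a map on cycles that kills
  boundaries and inverts the first map of the sequence on the left. The kernel of this left inverse
  is a complement to the image of the first map, so it meets each fibre of \<open>kbeta\<close> in
  exactly one class; that class is the value of the section.\<close>

lemma (in kunneth) kunneth_right_split:
  assumes \<rho>: "pmod_hom Kn Hn \<rho>" and \<rho>Z: "\<And>a x. x \<in> el Zn a \<Longrightarrow> \<rho> a x = hcls K n a x"
  shows "right_split (homology KA n) (homology HQ 1) kbeta"
proof -
  let ?\<rho> = "pten_map s Hn A \<rho> I"
  note \<rho>_hom = pten_map_hom(1)[OF K_mod A H_mod A \<rho> pmod_hom_id[of A]]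
  have \<rho>_boundary: "?\<rho> r b = \<one>\<^bsub>grp (pten s Hn A) r\<^esub>" if b: "b \<in> boundaries KA n r" for r b
  proof -
    obtain k where k: "k \<in> el (pten s (obj K (n + 1)) A) r" "b = pten_map s Kn A (dif K (n + 1)) I r k"
      using b unfolding KA_boundaries by (rule bexE)
    have "\<rho> a (dif K (n + 1) a x) = \<one>\<^bsub>grp Hn a\<^esub>" if "x \<in> el (obj K (n + 1)) a" for a x
      using \<rho>Z[OF pmod_hom_closed[OF \<delta>' that]] hcls_dif[OF K that] by simp
    then show ?thesis
      unfolding k(2)
      using pten_map_comp[OF K_mod A K_mod A H_mod A d' pmod_hom_id \<rho> pmod_hom_id pmod_hom_comp[OF d' \<rho>] pmod_hom_id refl refl k(1)]
        pten_map_trivial_left[OF K_mod A H_mod A pmod_hom_comp[OF d' \<rho>] pmod_hom_id _ k(1)] by simp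
  qed
  have \<rho>_\<iota>: "?\<rho> r (pten_map s Kn A I I r z) = pten_map s Hn A (hcls K n) I r z" if "z \<in> el (pten s Zn A) r" for r z
    by (rule pten_map_comp[OF Z_mod A K_mod A H_mod A \<iota> pmod_hom_id \<rho> pmod_hom_id \<pi> pmod_hom_id \<rho>Z refl that])
  have el: "c \<in> el (pten s Kn A) r" if "c \<in> cycles KA n r" for c r using that by (simp add: KA_cycles)
  have cm: "c \<otimes>\<^bsub>grp (pten s Kn A) r\<^esub> c' \<in> cycles KA n r" if "c \<in> cycles KA n r" "c' \<in> cycles KA n r" for c c' r
    using subgroup.m_closed[OF cycles_subgroup[OF KA] that] by (simp add: complex_pten_simps)
  have ci: "inv\<^bsub>grp (pten s Kn A) r\<^esub> c \<in> cycles KA n r" if "c \<in> cycles KA n r" for c r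
    using subgroup.m_inv_closed[OF cycles_subgroup[OF KA] that] by (simp add: complex_pten_simps)
  note hm = hcls_mult[OF KA, unfolded complex_pten_simps]
  \<comment> \<open>Cycles in one homology class differ by a boundary, which the map kills, so it
    depends on the class only.\<close>
  have \<rho>_class: "?\<rho> r c = ?\<rho> r c'"
    if c: "c \<in> cycles KA n r" and c': "c' \<in> cycles KA n r" and eq: "hcls KA n r c = hcls KA n r c'" for c c' r
  proof -
    interpret G: group "grp (pten s Kn A) r" by (rule pten_group[OF K_mod A])
    interpret H: group "grp (pten s Hn A) r" by (rule pten_group[OF H_mod A])
    have sub: "subgroup (boundaries KA n r) (grp (pten s Kn A) r)"
      using boundaries_subgroup[OF KA, where n = n and a = r] by (simp add: complex_pten_simps)
    have "boundaries KA n r #>\<^bsub>grp (pten s Kn A) r\<^esub> (c \<otimes>\<^bsub>grp (pten s Kn A) r\<^esub> inv\<^bsub>grp (pten s Kn A) r\<^esub> c') =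
        boundaries KA n r #>\<^bsub>grp (pten s Kn A) r\<^esub> (c' \<otimes>\<^bsub>grp (pten s Kn A) r\<^esub> inv\<^bsub>grp (pten s Kn A) r\<^esub> c')"
      using eq hm[OF c ci[OF c']] hm[OF c' ci[OF c']] by (simp add: complex_pten_simps)
    also have "\<dots> = boundaries KA n r"
      using el[OF c'] G.coset_mult_one[OF subgroup.subset[OF sub]] by simp
    finally have "c \<otimes>\<^bsub>grp (pten s Kn A) r\<^esub> inv\<^bsub>grp (pten s Kn A) r\<^esub> c' \<in> boundaries KA n r"
      unfolding coset_eq_one_iff[OF pten_comm_group[OF K_mod A] sub el[OF cm[OF c ci[OF c']]]] .
    from \<rho>_boundary[OF this] show ?thesis
      using hom_in_carrier[OF \<rho>_hom el[OF c]] hom_in_carrier[OF \<rho>_hom el[OF c']]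
      by (simp add: hom_mult[OF \<rho>_hom el[OF c] el[OF ci[OF c']]] hom_inverse[OF \<rho>_hom G.group_axioms H.group_axioms el[OF c']] H.diff_eq_one)
  qed
  \<comment> \<open>\<open>R r T y\<close> says that \<open>y\<close> lies over \<open>T\<close> and
    in the kernel of the left inverse, expressed through a representing cycle.\<close>
  define R where "R r T y \<longleftrightarrow> y \<in> el (homology KA n) r \<and> kbeta r y = T \<and>
    (\<exists>c\<in>cycles KA n r. y = hcls KA n r c \<and> ?\<rho> r c = \<one>\<^bsub>grp (pten s Hn A) r\<^esub>)" for r T y
  have HKA: "group (grp (homology KA n) r)" and HHQ: "group (grp (homology HQ 1) r)" for r
    by (rule comm_group_group[OF homology_comm_group[OF KA]], rule comm_group_group[OF homology_comm_group[OF HQ]])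
  have R_dom: "T \<in> el (homology HQ 1) r \<and> y \<in> el (homology KA n) r" if "R r T y" for r T y
    using that hom_in_carrier[OF kbeta_fun(1)] by (auto simp: R_def)
  have R_total: "\<exists>y. R r T y" if T: "T \<in> el (homology HQ 1) r" for r T
  proof -
    interpret G: group "grp (pten s Kn A) r" by (rule pten_group[OF K_mod A])
    interpret H: group "grp (pten s Hn A) r" by (rule pten_group[OF H_mod A])
    interpret HH: group "grp (homology HQ 1) r" by (rule HHQ)
    obtain y where y: "kbeta_rel s n K A Q e r y T" using kbeta_surj[OF T] by blast
    obtain c where c: "c \<in> cycles KA n r" "y = hcls KA n r c" using hcls_surj[OF KA] kbeta_dom[OF y] by blast
    \<comment> \<open>\<open>z\<close> has the same value in \<open>H \<otimes> A\<close> as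
      \<open>c\<close>. Subtracting its image from \<open>c\<close> moves the class into the kernel
      of the left inverse without changing \<open>kbeta\<close>, which is trivial on the image of
      the first map.\<close>
    obtain z where z: "z \<in> el (pten s Zn A) r" "pten_map s Hn A (hcls K n) I r z = ?\<rho> r c"
      using pten_map_surj[OF Z_mod A H_mod A \<pi> pmod_hom_id \<pi>_surj I_surj hom_in_carrier[OF \<rho>_hom el[OF c(1)]]] by blast
    let ?z = "pten_map s Kn A I I r z"
    let ?c = "c \<otimes>\<^bsub>grp (pten s Kn A) r\<^esub> inv\<^bsub>grp (pten s Kn A) r\<^esub> ?z"
    note zc = \<iota>_closed[OF z(1)]
    have c': "?c \<in> cycles KA n r" by (rule cm[OF c(1) ci[OF zc]])
    have "?\<rho> r ?c = \<one>\<^bsub>grp (pten s Hn A) r\<^esub>"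
      using \<rho>_\<iota>[OF z(1)] z(2) hom_in_carrier[OF \<rho>_hom el[OF c(1)]]
      by (simp add: hom_mult[OF \<rho>_hom el[OF c(1)] el[OF ci[OF zc]]] hom_inverse[OF \<rho>_hom G.group_axioms H.group_axioms el[OF zc]])
    moreover have "kbeta r (hcls KA n r ?c) = T"
    proof -
      have "?c \<otimes>\<^bsub>grp (pten s Kn A) r\<^esub> ?z = c" using el[OF c(1)] el[OF zc] by (simp add: G.m_assoc)
      then have "y = hcls KA n r ?c \<otimes>\<^bsub>grp (homology KA n) r\<^esub> hcls KA n r ?z"
        using c(2) hm[OF c' zc] by (simp add: complex_pten_simps)
      then have "kbeta r y = kbeta r (hcls KA n r ?c) \<otimes>\<^bsub>grp (homology HQ 1) r\<^esub> kbeta r (hcls KA n r ?z)"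
        using hom_mult[OF kbeta_fun(1) hcls_closed[OF KA c'] hcls_closed[OF KA zc]] by simp
      then show ?thesis
        using kbeta_fun(2)[OF kbeta_kalpha[OF kalphaI[OF z(1)]]] kbeta_fun(2)[OF y]
          hom_in_carrier[OF kbeta_fun(1) hcls_closed[OF KA c']] by simp
    qed
    ultimately show ?thesis using c' hcls_closed[OF KA c'] unfolding R_def by blast
  qed
  have R_mult: "R r (T \<otimes>\<^bsub>grp (homology HQ 1) r\<^esub> T') (y \<otimes>\<^bsub>grp (homology KA n) r\<^esub> y')"
    if Rs: "R r T y" "R r T' y'" for r T y T' y'
  proof -
    interpret H: group "grp (pten s Hn A) r" by (rule pten_group[OF H_mod A])
    interpret HH: group "grp (homology KA n) r" by (rule HKA)
    obtain c c' where c: "c \<in> cycles KA n r" "y = hcls KA n r c" "?\<rho> r c = \<one>\<^bsub>grp (pten s Hn A) r\<^esub>"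
      and c': "c' \<in> cycles KA n r" "y' = hcls KA n r c'" "?\<rho> r c' = \<one>\<^bsub>grp (pten s Hn A) r\<^esub>"
      using Rs unfolding R_def by blast
    have y: "y \<in> el (homology KA n) r" "y' \<in> el (homology KA n) r" "kbeta r y = T" "kbeta r y' = T'"
      using Rs unfolding R_def by blast+
    have yy: "y \<otimes>\<^bsub>grp (homology KA n) r\<^esub> y' \<in> el (homology KA n) r"
        "kbeta r (y \<otimes>\<^bsub>grp (homology KA n) r\<^esub> y') = T \<otimes>\<^bsub>grp (homology HQ 1) r\<^esub> T'"
      using y by (simp_all add: hom_mult[OF kbeta_fun(1)])
    have "?\<rho> r (c \<otimes>\<^bsub>grp (pten s Kn A) r\<^esub> c') = \<one>\<^bsub>grp (pten s Hn A) r\<^esub>"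
      by (simp add: hom_mult[OF \<rho>_hom el[OF c(1)] el[OF c'(1)]] c c')
    moreover have "y \<otimes>\<^bsub>grp (homology KA n) r\<^esub> y' = hcls KA n r (c \<otimes>\<^bsub>grp (pten s Kn A) r\<^esub> c')"
      using hm[OF c(1) c'(1)] c(2) c'(2) by (simp add: complex_pten_simps)
    ultimately show ?thesis
      using cm[OF c(1) c'(1)] yy unfolding R_def by blast
  qed
  have R_unit: "y = \<one>\<^bsub>grp (homology KA n) r\<^esub>" if Ry: "R r \<one>\<^bsub>grp (homology HQ 1) r\<^esub> y" for r y
  proof -
    have y: "y \<in> el (homology KA n) r" "kbeta r y = \<one>\<^bsub>grp (homology HQ 1) r\<^esub>" using Ry by (simp_all add: R_def)
    obtain c where c: "c \<in> cycles KA n r" "y = hcls KA n r c" "?\<rho> r c = \<one>\<^bsub>grp (pten s Hn A) r\<^esub>"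
      using Ry unfolding R_def by blast
    \<comment> \<open>A class over the unit comes from some \<open>t\<close> by exactness, and the
      left inverse recovers \<open>t\<close>; being in its kernel, the class comes from the trivial
      \<open>t\<close>.\<close>
    obtain t where t: "kalpha_rel s n K A r t y"
      using kbeta_kernel[of r y] kbeta_fun(3)[OF y(1)] y(2) by auto
    then obtain z where z: "z \<in> el (pten s Zn A) r" "t = pten_map s Hn A (hcls K n) I r z"
        "y = hcls KA n r (pten_map s Kn A I I r z)" by (rule kalphaE)
    have "t = \<one>\<^bsub>grp (pten s Hn A) r\<^esub>"
      using \<rho>_class[OF c(1) \<iota>_closed[OF z(1)]] c(2,3) z(2,3) \<rho>_\<iota>[OF z(1)] by simp
    then show ?thesis using kalpha_unit t by simp
  qed
  have R_smap: "R r' (smap (homology HQ 1) r r' T) (smap (homology KA n) r r' y)"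
    if Ry: "R r T y" and le: "r \<le> r'" for r r' T y
  proof -
    obtain c where c: "c \<in> cycles KA n r" "y = hcls KA n r c" "?\<rho> r c = \<one>\<^bsub>grp (pten s Hn A) r\<^esub>"
      using Ry unfolding R_def by blast
    have y: "y \<in> el (homology KA n) r" "kbeta r y = T" using Ry by (simp_all add: R_def)
    have \<beta>: "kbeta_rel s n K A Q e r' (smap (homology KA n) r r' y) (smap (homology HQ 1) r r' T)"
      using kbeta_smap[OF kbeta_fun(3)[OF y(1)] le] y(2) by simp
    let ?c = "smap (pten s Kn A) r r' c"
    have "?\<rho> r' ?c = \<one>\<^bsub>grp (pten s Hn A) r'\<^esub>"
      using pers_hom_smap[OF pten_map_pers_hom[OF K_mod A H_mod A \<rho> pmod_hom_id] le el[OF c(1)]] c(3)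
        hom_one[OF pten_smap_hom(1)[OF H_mod A le] pten_group[OF H_mod A] pten_group[OF H_mod A]] by simp
    moreover have "?c \<in> cycles KA n r'" using smap_cycles[OF KA le c(1)] by (simp add: complex_pten_simps)
    moreover have "smap (homology KA n) r r' y = hcls KA n r' ?c"
      unfolding c(2) using homology_smap[OF KA le c(1)] by (simp add: complex_pten_simps)
    ultimately show ?thesis using kbeta_dom[OF \<beta>] kbeta_fun(2)[OF \<beta>] unfolding R_def by blast
  qed
  define \<tau> where "\<tau> r T = (THE y. R r T y)" for r T
  have add: "\<tau> r \<in> hom (grp (homology HQ 1) r) (grp (homology KA n) r)"
      "\<And>T y. R r T y \<Longrightarrow> \<tau> r T = y"
      "\<And>T. T \<in> el (homology HQ 1) r \<Longrightarrow> R r T (\<tau> r T)" for r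
    using additive_relation[of "grp (homology HQ 1) r" "grp (homology KA n) r" "R r",
        OF HHQ HKA R_dom R_total R_mult R_unit]
    unfolding \<tau>_def[abs_def] by blast+
  have "pers_hom (homology HQ 1) (homology KA n) \<tau>"
    unfolding pers_hom_def
  proof (intro conjI allI impI ballI)
    show "\<tau> a \<in> hom (grp (homology HQ 1) a) (grp (homology KA n) a)" for a
      by (rule add(1))
    show "\<tau> b (smap (homology HQ 1) a b T) = smap (homology KA n) a b (\<tau> a T)"
      if "a \<le> b" "T \<in> el (homology HQ 1) a" for a b T
      by (rule add(2)[OF R_smap[OF add(3)[OF that(2)] that(1)]])
  qed
  moreover have "kbeta a (\<tau> a T) = T" if "T \<in> el (homology HQ 1) a" for a T
    using add(3)[OF that] by (simp add: R_def)
  ultimately show ?thesis unfolding right_split_def by blast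
qed

section \<open>Size of the universe\<close>

text \<open>A marker in front of each letter announces whether another letter follows
  (\<open>c0\<close>) or the word has ended (\<open>c1\<close>). The code can thus be read from the
  left even if the letters are themselves \<open>c0\<close> or \<open>c1\<close>.\<close>

lemma pair_lists_inject:
  assumes "c0 \<noteq> c1"
    "concat (map (\<lambda>x. [c0, x]) w) @ c1 # v = concat (map (\<lambda>x. [c0, x]) w') @ c1 # v'"
  shows "w = w' \<and> v = v'"
  using assms(2)
proof (induction w arbitrary: w')
  case Nil
  then show ?case using assms(1) by (cases w') auto
next
  case (Cons x w)
  then show ?case using assms(1) by (cases w') auto
qed

text \<open>The step that lets the universe contain finite lists of its own elements: the marked
  words are concatenated.\<close>

lemma inj_list_list:
  assumes "(c0 :: 'x) \<noteq> c1"
  shows "\<exists>f :: 'x list list \<Rightarrow> 'x list. inj f"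
proof -
  define f where "f = (\<lambda>ws. concat (map (\<lambda>w. concat (map (\<lambda>x. [c0, x]) w) @ [c1]) ws))"
  have f_Cons: "f (w # ws) = concat (map (\<lambda>x. [c0, x]) w) @ c1 # f ws" for w ws by (simp add: f_def)
  have f_Nil: "f [] = []" by (simp add: f_def)
  have "ws = ws'" if "f ws = f ws'" for ws ws'
    using that
  proof (induction ws arbitrary: ws')
    case Nil
    then show ?case by (cases ws') (simp_all add: f_Cons f_Nil)
  next
    case (Cons w ws)
    then obtain w' vs where ws': "ws' = w' # vs" by (cases ws') (simp_all add: f_Cons f_Nil)
    have "w = w' \<and> f ws = f vs"
      using Cons.prems unfolding ws' f_Cons by (rule pair_lists_inject[OF assms])
    then show ?case using Cons.IH ws' by blast
  qed
  then show ?thesis by (auto simp: inj_def)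
qed

text \<open>The finite graph over the support determines the function, and any enumeration of the
  graph determines the graph. The enumeration is chosen arbitrarily, as the types carry no
  order.\<close>

lemma inj_poly_mapping_list: "\<exists>f :: ('x \<Rightarrow>\<^sub>0 'y::zero) \<Rightarrow> ('x \<times> 'y) list. inj f"
proof -
  let ?S = "\<lambda>\<phi>. (\<lambda>k. (k, Poly_Mapping.lookup \<phi> k)) ` Poly_Mapping.keys \<phi>"
  have "\<exists>f. \<forall>\<phi> :: 'x \<Rightarrow>\<^sub>0 'y. set (f \<phi>) = ?S \<phi>"
    by (intro choice allI finite_list) simp
  then obtain f where f: "\<And>\<phi> :: 'x \<Rightarrow>\<^sub>0 'y. set (f \<phi>) = ?S \<phi>" by blast
  have "\<phi> = \<psi>" if "f \<phi> = f \<psi>" for \<phi> \<psi>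
  proof (rule poly_mapping_eqI)
    fix k
    have S: "(k, y) \<in> ?S \<chi> \<longleftrightarrow> y = Poly_Mapping.lookup \<chi> k \<and> y \<noteq> 0" for y and \<chi> :: "'x \<Rightarrow>\<^sub>0 'y"
      by (auto simp: in_keys_iff)
    have "?S \<phi> = ?S \<psi>" using f[of \<phi>] f[of \<psi>] that by simp
    then have "y = Poly_Mapping.lookup \<phi> k \<and> y \<noteq> 0 \<longleftrightarrow> y = Poly_Mapping.lookup \<psi> k \<and> y \<noteq> 0" for y
      using S[of y \<phi>] S[of y \<psi>] by simp
    then show "Poly_Mapping.lookup \<phi> k = Poly_Mapping.lookup \<psi> k" by metis
  qed
  then show ?thesis by (auto simp: inj_def)
qed

text \<open>A monomial with its coefficient becomes one list: the degree and the coefficient are put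
  in front of the label, which is already a list. Distinct markers always exist, since the summands
  for \<open>'p\<close> and \<open>'r\<close> are nonempty and disjoint.\<close>

lemma universe_encoding:
  "\<exists>enc :: ('p \<times> ('p, 'r, 'k, 'a) universe \<Rightarrow>\<^sub>0 'r::zero) \<Rightarrow> ('p, 'r, 'k, 'a) universe. inj enc"
proof -
  let ?c0 = "Inl undefined :: 'p + 'r + 'k + 'a" and ?c1 = "Inr (Inl undefined) :: 'p + 'r + 'k + 'a"
  obtain f :: "('p, 'r, 'k, 'a) universe list \<Rightarrow> ('p, 'r, 'k, 'a) universe" where f: "inj f"
    using inj_list_list[of ?c0 ?c1] by auto
  obtain g :: "('p \<times> ('p, 'r, 'k, 'a) universe \<Rightarrow>\<^sub>0 'r) \<Rightarrow> (('p \<times> ('p, 'r, 'k, 'a) universe) \<times> 'r) list"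
    where g: "inj g" using inj_poly_mapping_list by auto
  define h :: "('p \<times> ('p, 'r, 'k, 'a) universe) \<times> 'r \<Rightarrow> ('p, 'r, 'k, 'a) universe"
    where "h = (\<lambda>((p, w), r). Inl p # Inr (Inl r) # w)"
  have "inj h" by (auto simp: inj_def h_def)
  then have "inj (f \<circ> (map h \<circ> g))"
    by (intro inj_compose f g inj_mapI)
  then show ?thesis by blast
qed

section \<open>The exact sequence\<close>

lemma resolution_is_resolution:
  fixes A :: "('p::preorder, 'a, 'r::{ring, monoid_mult}) pmod" and ia :: "'a \<Rightarrow> 'u"
    and enc :: "('p \<times> 'u \<Rightarrow>\<^sub>0 'r) \<Rightarrow> 'u"
  assumes "lmod A" "inj ia" "inj enc"
  shows "projective_resolution (fst (resolution A :: ('p, 'u, 'r) pmod_complex \<times> _)) (snd (resolution A)) A"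
proof -
  obtain Q :: "('p, 'u, 'r) pmod_complex" and e where "projective_resolution Q e A"
    using projective_resolution_exists[OF assms] by blast
  then have "(\<lambda>(Q, e). projective_resolution Q e A) (Q, e)" by simp
  then have "(\<lambda>(Q, e). projective_resolution Q e A) (resolution A :: ('p, 'u, 'r) pmod_complex \<times> _)"
    unfolding resolution_def by (rule someI)
  then show ?thesis by (simp add: case_prod_beta)
qed

lemma resolution_lift_is_lift:
  fixes u :: "'u itself" and A :: "('p::preorder, 'a, 'r::{ring, monoid_mult}) pmod" and ia :: "'a \<Rightarrow> 'u"
    and A' :: "('p, 'b, 'r) pmod" and ib :: "'b \<Rightarrow> 'u" and enc :: "('p \<times> 'u \<Rightarrow>\<^sub>0 'r) \<Rightarrow> 'u"
  assumes A: "lmod A" and ia: "inj ia" and A': "lmod A'" and ib: "inj ib" and enc: "inj enc"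
    and g: "pmod_hom A A' g"
  shows "chain_map (fst (resolution A)) (fst (resolution A')) (resolution_lift u A A' g) \<and>
    (\<forall>a. \<forall>x\<in>el (obj (fst (resolution A)) 0) a.
      snd (resolution A') a (resolution_lift u A A' g 0 a x) = g a (snd (resolution A) a x))"
proof -
  note res = resolution_is_resolution[OF A ia enc] and res' = resolution_is_resolution[OF A' ib enc]
  let ?P = "\<lambda>\<phi> :: int \<Rightarrow> 'p \<Rightarrow> 'u \<Rightarrow> 'u. chain_map (fst (resolution A)) (fst (resolution A')) \<phi> \<and>
    (\<forall>a. \<forall>x\<in>el (obj (fst (resolution A)) 0) a.
      snd (resolution A') a (\<phi> 0 a x) = g a (snd (resolution A) a x))"
  have "resolution_lift u A A' g = (SOME \<phi>. ?P \<phi>)"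
    unfolding resolution_lift_def by (simp add: case_prod_beta)
  moreover have "?P (SOME \<phi>. ?P \<phi>)"
    using resolution_lift_exists[OF res res' A A' g ib] by (rule someI_ex)
  ultimately show ?thesis by simp
qed

theorem theorem8p6:
  fixes s :: tensor_kind
    and n :: nat
    and u :: "('p::preordered_ab_group_add, 'r::{ring, monoid_mult}, 'k, 'a) universe itself"
  shows "\<exists>(\<alpha> :: ('p, 'k, 'r) pmod_complex \<Rightarrow> ('p, 'a, 'r) pmod \<Rightarrow> _) \<beta>.
    (\<forall>K\<in>flat_complexes u s. \<forall>A. persistence_module Left A \<longrightarrow>
       kunneth_exact u s (int n) K A (\<alpha> K A) (\<beta> K A)) \<and>
    kunneth_natural u s (int n) (flat_complexes u s) \<alpha> \<beta> \<and>
    (right_hereditary u TYPE('p) TYPE('r) \<longrightarrow>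
      (\<forall>K\<in>projective_complexes u. \<forall>A. persistence_module Left A \<longrightarrow>
         kunneth_exact u s (int n) K A (\<alpha> K A) (\<beta> K A) \<and>
         kunneth_split u s (int n) K A (\<beta> K A)) \<and>
      kunneth_natural u s (int n) (projective_complexes u) \<alpha> \<beta>)"
proof -
  obtain enc :: "('p \<times> ('p, 'r, 'k, 'a) universe \<Rightarrow>\<^sub>0 'r) \<Rightarrow> ('p, 'r, 'k, 'a) universe" where enc: "inj enc"
    using universe_encoding by auto
  define ia :: "'a \<Rightarrow> ('p, 'r, 'k, 'a) universe" where "ia x = [Inr (Inr (Inr x))]" for x
  define ik :: "'k \<Rightarrow> ('p, 'r, 'k, 'a) universe" where "ik x = [Inr (Inr (Inl x))]" for x
  have ia: "inj ia" and ik: "inj ik" by (auto simp: inj_def ia_def ik_def)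
  let ?Q = "\<lambda>A :: ('p, 'a, 'r) pmod.
    fst (resolution A :: ('p, ('p, 'r, 'k, 'a) universe, 'r) pmod_complex \<times> _)"
  let ?e = "\<lambda>A :: ('p, 'a, 'r) pmod.
    snd (resolution A :: ('p, ('p, 'r, 'k, 'a) universe, 'r) pmod_complex \<times> _)"
  let ?N = "int n"
  \<comment> \<open>One choice of maps serves both parts of the theorem, because under heredity the
    projective complexes are among the flat ones. On flat complexes these maps coincide with
    \<open>kunneth.kalpha\<close> and \<open>kunneth.kbeta\<close>.\<close>
  define \<alpha> :: "('p, 'k, 'r) pmod_complex \<Rightarrow> ('p, 'a, 'r) pmod \<Rightarrow> _" where
    "\<alpha> = (\<lambda>K A r t. THE C. kalpha_rel s ?N K A r t C)"
  define \<beta> :: "('p, 'k, 'r) pmod_complex \<Rightarrow> ('p, 'a, 'r) pmod \<Rightarrow> _" where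
    "\<beta> = (\<lambda>K A r y. THE T. kbeta_rel s ?N K A (?Q A) (?e A) r y T)"
  have kun: "kunneth s K A (?Q A) (?e A)" if "K \<in> flat_complexes u s" "lmod A" for K :: "('p, 'k, 'r) pmod_complex" and A
    by (rule kunneth_of_flat[OF that resolution_is_resolution[OF that(2) ia enc] ia enc])
  have \<alpha>: "\<alpha> K A = kunneth.kalpha s ?N K A" and \<beta>: "\<beta> K A = kunneth.kbeta s ?N K A (?Q A) (?e A)"
    if "K \<in> flat_complexes u s" "lmod A" for K A
    using kunneth.kalpha_def[OF kun[OF that]] kunneth.kbeta_def[OF kun[OF that]]
    by (simp_all add: \<alpha>_def \<beta>_def fun_eq_iff)
  have exact: "kunneth_exact u s ?N K A (\<alpha> K A) (\<beta> K A)" if "K \<in> flat_complexes u s" "lmod A" for K A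
    using kunneth.kunneth_short_exact[OF kun[OF that], of ?N]
    by (simp add: kunneth_exact_def Tor_def \<alpha>[OF that] \<beta>[OF that])
  have natural: "kunneth_natural u s ?N (flat_complexes u s) \<alpha> \<beta>"
    unfolding kunneth_natural_def
  proof (intro ballI allI impI, elim conjE)
    fix K K' :: "('p, 'k, 'r) pmod_complex" and A A' :: "('p, 'a, 'r) pmod" and f g
    assume K: "K \<in> flat_complexes u s" and K': "K' \<in> flat_complexes u s" and A: "lmod A" and A': "lmod A'"
      and f: "chain_map K K' f" and g: "pmod_hom A A' g"
    note k = kun[OF K A] and k' = kun[OF K' A']
    note lift = resolution_lift_is_lift[OF A ia A' ia enc g, of u]
    note maps = kunneth_natural_maps[OF k k' f g conjunct1[OF lift] conjunct2[OF lift, rule_format]]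
    show "kunneth_squares u s ?N K K' A A' f g (\<alpha> K A) (\<beta> K A) (\<alpha> K' A') (\<beta> K' A')"
      unfolding kunneth_squares_def Let_def \<alpha>[OF K A] \<alpha>[OF K' A'] \<beta>[OF K A] \<beta>[OF K' A'] Tor_map_def of_nat_1
    proof (intro conjI allI ballI)
      show "homology_map (complex_pten s K' A') ?N (\<lambda>m. pten_map s (obj K' m) A' (f m) g) a (kunneth.kalpha s ?N K A a x) =
          kunneth.kalpha s ?N K' A' a (pten_map s (homology_pmod K' ?N) A' (homology_map K' ?N f) g a x)"
        if "x \<in> el (pten s (homology_pmod K ?N) A) a" for a x
        by (rule kunneth.kalpha_fun(2)[OF k' maps(1)[OF _ kunneth.kalpha_fun(3)[OF k that]], symmetric])
      show "homology_map (pten_complex s (homology_pmod K' (?N - 1)) (?Q A')) 1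
            (\<lambda>m. pten_map s (homology_pmod K' (?N - 1)) (obj (?Q A') m) (homology_map K' (?N - 1) f)
              (resolution_lift u A A' g m)) a (kunneth.kbeta s ?N K A (?Q A) (?e A) a y) =
          kunneth.kbeta s ?N K' A' (?Q A') (?e A') a
            (homology_map (complex_pten s K' A') ?N (\<lambda>m. pten_map s (obj K' m) A' (f m) g) a y)"
        if "y \<in> el (homology (complex_pten s K A) ?N) a" for a y
        by (rule kunneth.kbeta_fun(2)[OF k' maps(2)[OF _ kunneth.kbeta_fun(3)[OF k that]], symmetric])
    qed
  qed
  have split: "kunneth_split u s ?N K A (\<beta> K A)"
    if her: "right_hereditary u TYPE('p) TYPE('r)" and K: "K \<in> projective_complexes u" and A: "lmod A" for K A
  proof -
    have flat: "K \<in> flat_complexes u s" using projective_complexes_flat[OF her ik enc] K by blast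
    note k = kun[OF flat A]
    \<comment> \<open>Projectivity of the boundaries, which heredity provides, gives the extension
      of the projection from cycles to homology to all of the n-th term.\<close>
    obtain \<rho> where "pmod_hom (obj K ?N) (homology_pmod K ?N) \<rho>"
      "\<And>a x. x \<in> el (cycle_pmod K ?N) a \<Longrightarrow> \<rho> a x = hcls K ?N a x"
      using kunneth.retraction_exists[OF k boundary_projective[OF her K ik] ik, of ?N] by blast
    from kunneth.kunneth_right_split[OF k this]
    show ?thesis by (simp add: kunneth_split_def Tor_def \<beta>[OF flat A])
  qed
  have proj: "(projective_complexes u :: ('p, 'k, 'r) pmod_complex set) \<subseteq> flat_complexes u s"
    if "right_hereditary u TYPE('p) TYPE('r)"
    using projective_complexes_flat[OF that ik enc] .
  have "kunneth_natural u s ?N (projective_complexes u) \<alpha> \<beta>" if "right_hereditary u TYPE('p) TYPE('r)"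
    using natural proj[OF that] unfolding kunneth_natural_def by blast
  then show ?thesis
    using exact natural split proj by (intro exI[of _ \<alpha>] exI[of _ \<beta>]) blast
qed

end
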